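(* Let $f:X\to\Delta$ be a proper surjective holomorphic map from a Kähler manifold of dimension $n+1$ onto the unit disk, smooth over $\Delta\setminus\{0\}$, whose central fiber $Y$ is a divisor with possibly non-reduced simple normal crossings, and let $\alpha\in[0,1)\cap\mathbb Q$. The morphism $R_\alpha^r:F_\ell\,\mathrm{gr}^W_r\mathcal M_\alpha\to F_{\ell+r}\,\mathrm{gr}^W_{-r}\mathcal M_\alpha$ is an isomorphism for every $r\ge0$ and $\ell\in\mathbb Z$, and the Lefschetz decomposition of $\mathrm{gr}^W\mathcal M_\alpha$ respects the filtrations, i.e. $$F_\bullet\,\mathrm{gr}^W_r\mathcal M_\alpha=\bigoplus_{\ell\ge0,\ \ell\ge-\frac r2}R_\alpha^\ell F_{\bullet-\ell}\mathcal P_{\alpha,r+2\ell}\qquad\text{for any }r\in\mathbb Z.$$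
   Context: $t$ is the coordinate on $\Delta$, $Y=f^{-1}(0)$ as a divisor. $\Omega_{X/\Delta}(\log Y)=\Omega_X(\log Y)/f^*\Omega_\Delta(\log 0)$, $\Omega^p_{X/\Delta}(\log Y)=\bigwedge^p\Omega_{X/\Delta}(\log Y)$; $|_Y$ means $\otimes\,\mathcal O_X/t$. $\mathscr D$-modules are right modules. $\mathcal M=\mathscr H^0(\Omega^{n+\bullet}_{X/\Delta}(\log Y)|_Y\otimes_{\mathcal O_X}\mathscr D_X)$, where the relative log de Rham complex is placed in degrees $-n,\dots,0$ and the differential is (up to the shift sign) $\beta\otimes P\mapsto d\beta\otimes P+\sum_j\xi_j\wedge\beta\otimes D_jP$ ($\xi_j$, $D_j$ dual local frames of $\Omega_{X/\Delta}(\log Y)$ and its dual $\mathscr T_{X/\Delta}(\log Y)\subset\mathscr T_X$); $F_\ell\mathcal M$ is the image of $\Omega^n_{X/\Delta}(\log Y)|_Y\otimes F_{\ell+n}\mathscr D_X$. The endomorphism $R$ is $[[\beta]\otimes P]\mapsto(\frac{dt}t\wedge)^{-1}\{d(\beta\otimes P)\}$ for $\beta\in\Omega^n_X(\log Y)$, with $d(\beta\otimes P)=d\beta\otimes P+\sum_idz_i\wedge\beta\otimes\partial_iP$ and $\frac{dt}t\wedge:\Omega^n_{X/\Delta}(\log Y)\simeq\Omega^{n+1}_X(\log Y)$; its eigenvalues lie in $[0,1)\cap\mathbb Q$. $\mathcal M_{\ge\alpha}$ (resp. $\mathcal M_{>\alpha}$) is the sum of $\ker(R-\lambda)^\infty$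 over $\lambda\ge\alpha$ (resp. $\lambda>\alpha$); $\mathcal M_\alpha=\mathcal M_{\ge\alpha}/\mathcal M_{>\alpha}$ with $F_\bullet\mathcal M_\alpha=(F_\bullet\mathcal M\cap\mathcal M_{\ge\alpha})/(F_\bullet\mathcal M\cap\mathcal M_{>\alpha})$; $R_\alpha=R-\alpha$ is nilpotent on $\mathcal M_\alpha$, and $W_\bullet\mathcal M_\alpha$ is its monodromy filtration: $R_\alpha W_r\subset W_{r-2}$ and $R_\alpha^r:\mathrm{gr}^W_r\simeq\mathrm{gr}^W_{-r}$ for $r\ge0$. $F_\bullet W_r\mathcal M_\alpha=F_\bullet\mathcal M_\alpha\cap W_r\mathcal M_\alpha$, $F_\bullet\mathrm{gr}^W_r\mathcal M_\alpha=F_\bullet W_r\mathcal M_\alpha/F_\bullet W_{r-1}\mathcal M_\alpha$. For $r\ge0$ the $r$-th primitive part is $\mathcal P_{\alpha,r}=\dfrac{\ker R_\alpha^{r+1}}{\ker R_\alpha^r+R_\alpha\ker R_\alpha^{r+2}}$ (identified with $\ker R_\alpha^{r+1}\subset\mathrm{gr}^W_r\mathcal M_\alpha$), with $F_\ell\mathcal P_{\alpha,r}=\mathrm{im}(F_\ell\mathcal M_\alpha\cap\ker R_\alpha^{r+1}\to\mathcal P_{\alpha,r})$. *)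

theory Defs
  imports "HOL-Analysis.Analysis" "HOL-Algebra.Module" "HOL-Algebra.AbelCoset"
    "HOL-Algebra.Free_Abelian_Groups"
begin

section \<open>Complex and Kaehler manifolds\<close>

definition holomorphic_map :: "(complex ^ 'd::finite) set \<Rightarrow> (complex ^ 'd \<Rightarrow> complex) \<Rightarrow> bool" where
  "holomorphic_map S g \<longleftrightarrow>
     (\<forall>z\<in>S. \<exists>L. (g has_derivative L) (at z) \<and> (\<forall>c v. L (c *s v) = c * L v))"

type_synonym ('a, 'd) chart = "'a set \<times> ('a \<Rightarrow> complex ^ 'd)"

definition is_chart :: "'a topology \<Rightarrow> ('a, 'd::finite) chart \<Rightarrow> bool" where
  "is_chart X = (\<lambda>(U, \<phi>). openin X U \<and> open (\<phi> ` U) \<and>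
     homeomorphic_map (subtopology X U) (top_of_set (\<phi> ` U)) \<phi>)"

definition transition :: "('a, 'd::finite) chart \<Rightarrow> ('a, 'd::finite) chart \<Rightarrow> complex ^ 'd \<Rightarrow> complex ^ 'd" where
  "transition c c' = snd c' \<circ> inv_into (fst c) (snd c)"

definition compatible :: "('a, 'd::finite) chart \<Rightarrow> ('a, 'd::finite) chart \<Rightarrow> bool" where
  "compatible c c' \<longleftrightarrow>
     (\<forall>j. holomorphic_map (snd c ` (fst c \<inter> fst c')) (\<lambda>z. transition c c' z $ j)) \<and>
     (\<forall>j. holomorphic_map (snd c' ` (fst c \<inter> fst c')) (\<lambda>z. transition c' c z $ j))"

text \<open>The complex dimension is \<open>CARD('d)\<close>; the atlas need not be maximal.\<close>

definition complex_manifold :: "'a topology \<Rightarrow> ('a, 'd::finite) chart set \<Rightarrow> bool" where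
  "complex_manifold X A \<longleftrightarrow> Hausdorff_space X \<and> second_countable X \<and>
     (\<forall>c\<in>A. is_chart X c) \<and> (\<forall>c\<in>A. \<forall>c'\<in>A. compatible c c') \<and>
     topspace X = (\<Union>c\<in>A. fst c)"

definition holomorphic_chart :: "'a topology \<Rightarrow> ('a, 'd::finite) chart set \<Rightarrow> ('a, 'd::finite) chart \<Rightarrow> bool" where
  "holomorphic_chart X A c \<longleftrightarrow> is_chart X c \<and> (\<forall>c'\<in>A. compatible c c')"

definition holomorphic_fun ::
  "'a topology \<Rightarrow> ('a, 'd::finite) chart set \<Rightarrow> 'a set \<Rightarrow> ('a \<Rightarrow> complex) \<Rightarrow> bool" where
  "holomorphic_fun X A U g \<longleftrightarrow> openin X U \<and>
     (\<forall>(V, \<phi>)\<in>A. holomorphic_map (\<phi> ` (U \<inter> V)) (g \<circ> inv_into V \<phi>))"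

text \<open>On an open set \<open>S\<close> this is \<open>C\<^sup>\<infinity>\<close> in the real sense: all iterated directional derivatives
  exist and are (totally) differentiable.\<close>

coinductive smooth_fun ::
  "'e::real_normed_vector set \<Rightarrow> ('e \<Rightarrow> 'b::real_normed_vector) \<Rightarrow> bool" for S where
  "\<lbrakk>\<And>z. z \<in> S \<Longrightarrow> g differentiable (at z);
    \<And>v. smooth_fun S (\<lambda>z. frechet_derivative g (at z) v)\<rbrakk> \<Longrightarrow> smooth_fun S g"

text \<open>\<open>H c z v w\<close> is the value at \<open>z\<close> of the Hermitian metric in the chart \<open>c\<close>, linear in \<open>v\<close> and
  antilinear in \<open>w\<close>.\<close>

definition hermitian_metric :: "('a, 'd::finite) chart set \<Rightarrow>
    (('a, 'd::finite) chart \<Rightarrow> complex ^ 'd \<Rightarrow> complex ^ 'd \<Rightarrow> complex ^ 'd \<Rightarrow> complex) \<Rightarrow> bool" where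
  "hermitian_metric A H \<longleftrightarrow>
     (\<forall>c\<in>A.
        (\<forall>v w. smooth_fun (snd c ` fst c) (\<lambda>z. H c z v w)) \<and>
        (\<forall>z\<in>snd c ` fst c.
           (\<forall>u v w. H c z (u + v) w = H c z u w + H c z v w) \<and>
           (\<forall>a v w. H c z (a *s v) w = a * H c z v w) \<and>
           (\<forall>v w. H c z w v = cnj (H c z v w)) \<and>
           (\<forall>v. v \<noteq> 0 \<longrightarrow> 0 < Re (H c z v v)))) \<and>
     (\<forall>c\<in>A. \<forall>c'\<in>A. \<forall>z\<in>snd c ` (fst c \<inter> fst c'). \<forall>v w.
        let T = frechet_derivative (transition c c') (at z)
        in H c z v w = H c' (transition c c' z) (T v) (T w))"

text \<open>The metric is Kaehler if its fundamental 2-form, \<open>Im H\<close> up to a constant factor, is closed.\<close>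

definition kaehler_metric :: "('a, 'd::finite) chart set \<Rightarrow>
    (('a, 'd::finite) chart \<Rightarrow> complex ^ 'd \<Rightarrow> complex ^ 'd \<Rightarrow> complex ^ 'd \<Rightarrow> complex) \<Rightarrow> bool" where
  "kaehler_metric A H \<longleftrightarrow> hermitian_metric A H \<and>
     (\<forall>c\<in>A. \<forall>z\<in>snd c ` fst c. \<forall>u v w.
        frechet_derivative (\<lambda>z. Im (H c z v w)) (at z) u +
        frechet_derivative (\<lambda>z. Im (H c z w u)) (at z) v +
        frechet_derivative (\<lambda>z. Im (H c z u v)) (at z) w = 0)"

definition kaehler_manifold :: "'a topology \<Rightarrow> ('a, 'd::finite) chart set \<Rightarrow> bool" where
  "kaehler_manifold X A \<longleftrightarrow> complex_manifold X A \<and> (\<exists>H. kaehler_metric A H)"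

definition smooth_away_from_0 :: "('a, 'd::finite) chart set \<Rightarrow> ('a \<Rightarrow> complex) \<Rightarrow> bool" where
  "smooth_away_from_0 A f \<longleftrightarrow>
     (\<forall>(U, \<phi>)\<in>A. \<forall>x\<in>U. f x \<noteq> 0 \<longrightarrow>
        (\<exists>v. frechet_derivative (f \<circ> inv_into U \<phi>) (at (\<phi> x)) v \<noteq> 0))"

text \<open>The divisor of \<open>f\<close> is \<open>\<Sum>i\<in>I. e i \<cdot> Y i\<close>, where the \<open>Y i\<close> are smooth connected hypersurfaces with
  normal crossings. For \<open>p\<close> outside of all \<open>Y i\<close> the displayed condition says that \<open>f p \<noteq> 0\<close>.\<close>

definition snc_central_fiber ::
  "'a topology \<Rightarrow> ('a, 'd::finite) chart set \<Rightarrow> ('a \<Rightarrow> complex) \<Rightarrow> bool" where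
  "snc_central_fiber X A f \<longleftrightarrow>
     (\<exists>(I :: nat set) Y e. finite I \<and>
        (\<forall>i\<in>I. closedin X (Y i) \<and> connectedin X (Y i) \<and> Y i \<noteq> {} \<and> 0 < (e i :: nat)) \<and>
        (\<forall>p\<in>topspace X. \<exists>U \<phi> \<sigma> u.
           holomorphic_chart X A (U, \<phi>) \<and> p \<in> U \<and>
           inj_on \<sigma> {i\<in>I. p \<in> Y i} \<and>
           (\<forall>i\<in>I. U \<inter> Y i = (if p \<in> Y i then {x\<in>U. \<phi> x $ \<sigma> i = 0} else {})) \<and>
           holomorphic_fun X A U u \<and> (\<forall>x\<in>U. u x \<noteq> 0) \<and>
           (\<forall>x\<in>U. f x = u x * (\<Prod>i\<in>{i\<in>I. p \<in> Y i}. (\<phi> x $ \<sigma> i) ^ e i))))"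


section \<open>Germs of holomorphic functions\<close>

definition germ :: "'a topology \<Rightarrow> 'a \<Rightarrow> ('a \<Rightarrow> complex) \<Rightarrow> ('a \<Rightarrow> complex) set" where
  "germ X p g = {h. \<exists>U. openin X U \<and> p \<in> U \<and> (\<forall>x\<in>U. h x = g x)}"

definition germ_ring :: "'a topology \<Rightarrow> ('a, 'd::finite) chart set \<Rightarrow> 'a \<Rightarrow> ('a \<Rightarrow> complex) set ring" where
  "germ_ring X A p = \<lparr>
     carrier = {germ X p g | g U. p \<in> U \<and> holomorphic_fun X A U g},
     monoid.mult = (\<lambda>a b. \<Union>g\<in>a. \<Union>h\<in>b. germ X p (\<lambda>x. g x * h x)),
     one = germ X p (\<lambda>_. 1),
     ring.zero = germ X p (\<lambda>_. 0),
     ring.add = (\<lambda>a b. \<Union>g\<in>a. \<Union>h\<in>b. germ X p (\<lambda>x. g x + h x))\<rparr>"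

text \<open>The stalk at \<open>p\<close> of the ideal sheaf of the (reduced) zero set of \<open>f\<close>.\<close>

definition zero_ideal ::
  "'a topology \<Rightarrow> ('a, 'd::finite) chart set \<Rightarrow> ('a \<Rightarrow> complex) \<Rightarrow> 'a \<Rightarrow> ('a \<Rightarrow> complex) set set" where
  "zero_ideal X A f p =
     {germ X p g | g U. p \<in> U \<and> holomorphic_fun X A U g \<and> (\<forall>x\<in>U. f x = 0 \<longrightarrow> g x = 0)}"


section \<open>Quotients and tensor products of modules\<close>

text \<open>Modules are records of the HOL-Algebra type \<open>module\<close>, whose multiplicative fields are not used.\<close>

definition quotient_module :: "('s, 'v) module \<Rightarrow> 'v set \<Rightarrow> ('s, 'v set) module" where
  "quotient_module V B = \<lparr>
     carrier = a_rcosets\<^bsub>V\<^esub> B,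
     monoid.mult = undefined,
     one = undefined,
     ring.zero = B,
     ring.add = set_add V,
     smult = (\<lambda>s C. \<Union>x\<in>C. B +>\<^bsub>V\<^esub> (s \<odot>\<^bsub>V\<^esub> x))\<rparr>"

definition additive_span :: "('v, 'z) ring_scheme \<Rightarrow> 'v set \<Rightarrow> 'v set" where
  "additive_span V S = generate (add_monoid V) S"

text \<open>The map induced by \<open>h\<close> on cosets, with values in the quotient by the subgroup \<open>B\<close> of \<open>V\<close>.\<close>

definition induced_map :: "('s, 'v) module \<Rightarrow> 'v set \<Rightarrow> ('u \<Rightarrow> 'v) \<Rightarrow> 'u set \<Rightarrow> 'v set" where
  "induced_map V B h C = (\<Union>x\<in>C. B +>\<^bsub>V\<^esub> h x)"

definition restrict_scalars :: "('k \<Rightarrow> 's) \<Rightarrow> ('s, 'v) module \<Rightarrow> ('k, 'v) module" where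
  "restrict_scalars \<kappa> V = \<lparr>
     carrier = carrier V, monoid.mult = undefined, one = undefined,
     ring.zero = \<zero>\<^bsub>V\<^esub>, ring.add = ring.add V, smult = (\<lambda>c. smult V (\<kappa> c))\<rparr>"

definition tensor_free ::
  "('s, 'v) module \<Rightarrow> ('s, 'w) module \<Rightarrow> ('v \<times> 'w \<Rightarrow>\<^sub>0 int) monoid" where
  "tensor_free V W = free_Abelian_group (carrier V \<times> carrier W)"

definition tensor_relations ::
  "('s, 'z) ring_scheme \<Rightarrow> ('s, 'v) module \<Rightarrow> ('s, 'w) module \<Rightarrow> ('v \<times> 'w \<Rightarrow>\<^sub>0 int) set" where
  "tensor_relations R V W = generate (tensor_free V W)
     ({frag_of (v \<oplus>\<^bsub>V\<^esub> v', w) - frag_of (v, w) - frag_of (v', w)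
         | v v' w. v \<in> carrier V \<and> v' \<in> carrier V \<and> w \<in> carrier W} \<union>
      {frag_of (v, w \<oplus>\<^bsub>W\<^esub> w') - frag_of (v, w) - frag_of (v, w')
         | v w w'. v \<in> carrier V \<and> w \<in> carrier W \<and> w' \<in> carrier W} \<union>
      {frag_of (r \<odot>\<^bsub>V\<^esub> v, w) - frag_of (v, r \<odot>\<^bsub>W\<^esub> w)
         | r v w. r \<in> carrier R \<and> v \<in> carrier V \<and> w \<in> carrier W})"

definition tensor_class ::
  "('s, 'z) ring_scheme \<Rightarrow> ('s, 'v) module \<Rightarrow> ('s, 'w) module \<Rightarrow>
    ('v \<times> 'w \<Rightarrow>\<^sub>0 int) \<Rightarrow> ('v \<times> 'w \<Rightarrow>\<^sub>0 int) set" where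
  "tensor_class R V W u = tensor_relations R V W #>\<^bsub>tensor_free V W\<^esub> u"

definition tensor_product ::
  "('s, 'z) ring_scheme \<Rightarrow> ('s, 'v) module \<Rightarrow> ('s, 'w) module \<Rightarrow>
    ('s, ('v \<times> 'w \<Rightarrow>\<^sub>0 int) set) module" where
  "tensor_product R V W = \<lparr>
     carrier = tensor_class R V W ` carrier (tensor_free V W),
     monoid.mult = undefined,
     one = undefined,
     ring.zero = tensor_class R V W 0,
     ring.add = (\<lambda>C C'. C <#>\<^bsub>tensor_free V W\<^esub> C'),
     smult = (\<lambda>r C. \<Union>u\<in>C. tensor_class R V W
                (frag_extend (\<lambda>(v, w). frag_of (r \<odot>\<^bsub>V\<^esub> v, w)) u))\<rparr>"

text \<open>Internal direct sum \<open>T = \<Oplus>i\<in>I. S i\<close> of subgroups of \<open>V\<close>.\<close>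

definition internal_direct_sum ::
  "('v, 'z) ring_scheme \<Rightarrow> 'i set \<Rightarrow> ('i \<Rightarrow> 'v set) \<Rightarrow> 'v set \<Rightarrow> bool" where
  "internal_direct_sum V I S T \<longleftrightarrow>
     T = additive_span V (\<Union>i\<in>I. S i) \<and>
     (\<forall>J x. finite J \<and> J \<subseteq> I \<and> (\<forall>i\<in>J. x i \<in> S i) \<and> finsum V x J = \<zero>\<^bsub>V\<^esub>
        \<longrightarrow> (\<forall>i\<in>J. x i = \<zero>\<^bsub>V\<^esub>))"


section \<open>Monodromy filtrations and primitive parts\<close>

text \<open>Here \<open>V\<close> is a complex vector space, \<open>N\<close> an endomorphism of \<open>V\<close>, \<open>W\<close> an increasing filtration
  of \<open>V\<close> with \<open>N (W r) \<subseteq> W (r - 2)\<close>, and \<open>F\<close> a further filtration.\<close>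

definition kernel_pow :: "(complex, 'v) module \<Rightarrow> ('v \<Rightarrow> 'v) \<Rightarrow> nat \<Rightarrow> 'v set" where
  "kernel_pow V N k = {x \<in> carrier V. (N ^^ k) x = \<zero>\<^bsub>V\<^esub>}"

definition gr :: "(complex, 'v) module \<Rightarrow> (int \<Rightarrow> 'v set) \<Rightarrow> int \<Rightarrow> (complex, 'v set) module" where
  "gr V W r = quotient_module (V\<lparr>carrier := W r\<rparr>) (W (r - 1))"

text \<open>The map \<open>gr V W r \<rightarrow> gr V W (r - 2 * k)\<close> induced by the \<open>k\<close>-th power of \<open>N\<close>.\<close>

definition gr_pow ::
  "(complex, 'v) module \<Rightarrow> ('v \<Rightarrow> 'v) \<Rightarrow> (int \<Rightarrow> 'v set) \<Rightarrow> int \<Rightarrow> nat \<Rightarrow> 'v set \<Rightarrow> 'v set" where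
  "gr_pow V N W r k = induced_map V (W (r - 2 * int k - 1)) (N ^^ k)"

definition is_monodromy_filtration ::
  "(complex, 'v) module \<Rightarrow> ('v \<Rightarrow> 'v) \<Rightarrow> (int \<Rightarrow> 'v set) \<Rightarrow> bool" where
  "is_monodromy_filtration V N W \<longleftrightarrow>
     (\<forall>r. additive_subgroup (W r) V \<and> (\<forall>c. \<forall>x\<in>W r. c \<odot>\<^bsub>V\<^esub> x \<in> W r)) \<and>
     (\<forall>r. W r \<subseteq> W (r + 1)) \<and> (\<exists>a. W a = {\<zero>\<^bsub>V\<^esub>}) \<and> (\<exists>b. W b = carrier V) \<and>
     (\<forall>r. N ` W r \<subseteq> W (r - 2)) \<and>
     (\<forall>r::nat. gr_pow V N W (int r) r
        \<in> iso (add_monoid (gr V W (int r))) (add_monoid (gr V W (- int r))))"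

definition monodromy_filtration ::
  "(complex, 'v) module \<Rightarrow> ('v \<Rightarrow> 'v) \<Rightarrow> int \<Rightarrow> 'v set" where
  "monodromy_filtration V N = (THE W. is_monodromy_filtration V N W)"

definition F_gr ::
  "(complex, 'v) module \<Rightarrow> (int \<Rightarrow> 'v set) \<Rightarrow> (int \<Rightarrow> 'v set) \<Rightarrow> int \<Rightarrow> int \<Rightarrow> 'v set set" where
  "F_gr V F W l r = (\<lambda>x. W (r - 1) +>\<^bsub>V\<^esub> x) ` (F l \<inter> W r)"

definition primitive_relations :: "(complex, 'v) module \<Rightarrow> ('v \<Rightarrow> 'v) \<Rightarrow> nat \<Rightarrow> 'v set" where
  "primitive_relations V N r = kernel_pow V N r <+>\<^bsub>V\<^esub> N ` kernel_pow V N (r + 2)"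

definition primitive_part ::
  "(complex, 'v) module \<Rightarrow> ('v \<Rightarrow> 'v) \<Rightarrow> nat \<Rightarrow> (complex, 'v set) module" where
  "primitive_part V N r =
     quotient_module (V\<lparr>carrier := kernel_pow V N (r + 1)\<rparr>) (primitive_relations V N r)"

definition F_primitive ::
  "(complex, 'v) module \<Rightarrow> ('v \<Rightarrow> 'v) \<Rightarrow> (int \<Rightarrow> 'v set) \<Rightarrow> int \<Rightarrow> nat \<Rightarrow> 'v set set" where
  "F_primitive V N F l r =
     {C \<in> carrier (primitive_part V N r).
        \<exists>x \<in> F l \<inter> kernel_pow V N (r + 1). C = primitive_relations V N r +>\<^bsub>V\<^esub> x}"

text \<open>The identification of the primitive part with a subspace of \<open>gr V W r\<close>, induced by the inclusion
  of \<open>kernel_pow V N (r + 1)\<close> into \<open>W r\<close>.\<close>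

definition primitive_to_gr ::
  "(complex, 'v) module \<Rightarrow> (int \<Rightarrow> 'v set) \<Rightarrow> nat \<Rightarrow> 'v set \<Rightarrow> 'v set" where
  "primitive_to_gr V W r = induced_map V (W (int r - 1)) (\<lambda>x. x)"

text \<open>The image of the \<open>l\<close>-th power of \<open>N\<close> on \<open>F_primitive V N F (m - l) (r + 2 * l)\<close> inside \<open>gr V W r\<close>.\<close>

definition lefschetz_summand ::
  "(complex, 'v) module \<Rightarrow> ('v \<Rightarrow> 'v) \<Rightarrow> (int \<Rightarrow> 'v set) \<Rightarrow> (int \<Rightarrow> 'v set) \<Rightarrow>
    int \<Rightarrow> int \<Rightarrow> nat \<Rightarrow> 'v set set" where
  "lefschetz_summand V N F W m r l =
     (let k = nat (r + 2 * int l)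
      in gr_pow V N W (int k) l ` primitive_to_gr V W k ` F_primitive V N F (m - int l) k)"


section \<open>Differential operators and logarithmic forms on a local ring\<close>

text \<open>
  In the application \<open>R\<close> is the stalk of \<open>\<O>\<^sub>X\<close> at a point, \<open>\<kappa>\<close> the embedding of the constants, \<open>I\<close> the
  stalk of the ideal of \<open>Y\<^sub>r\<^sub>e\<^sub>d\<close>, \<open>t\<close> the germ of \<open>f\<close>, and \<open>n + 1\<close> the dimension of \<open>X\<close>; everything
  below is then the stalk of the sheaf in question. Vector fields are the derivations of \<open>R\<close>, and
  differential operators are endomorphisms of \<open>R\<close>.
\<close>

locale germ_family =
  fixes R :: "'r ring" (structure)
    and \<kappa> :: "complex \<Rightarrow> 'r"
    and I :: "'r set"
    and t :: 'r
    and n :: nat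
begin

definition op_add :: "('r \<Rightarrow> 'r) \<Rightarrow> ('r \<Rightarrow> 'r) \<Rightarrow> 'r \<Rightarrow> 'r" where
  "op_add P Q = (\<lambda>x\<in>carrier R. P x \<oplus> Q x)"

definition op_smult :: "'r \<Rightarrow> ('r \<Rightarrow> 'r) \<Rightarrow> 'r \<Rightarrow> 'r" where
  "op_smult a P = (\<lambda>x\<in>carrier R. a \<otimes> P x)"

definition op_comp :: "('r \<Rightarrow> 'r) \<Rightarrow> ('r \<Rightarrow> 'r) \<Rightarrow> 'r \<Rightarrow> 'r" where
  "op_comp P Q = compose (carrier R) P Q"

definition bracket :: "('r \<Rightarrow> 'r) \<Rightarrow> ('r \<Rightarrow> 'r) \<Rightarrow> 'r \<Rightarrow> 'r" where
  "bracket P Q = (\<lambda>x\<in>carrier R. P (Q x) \<ominus> Q (P x))"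

definition vector_fields :: "('r \<Rightarrow> 'r) set" where
  "vector_fields = {\<theta> \<in> carrier R \<rightarrow>\<^sub>E carrier R.
     (\<forall>a\<in>carrier R. \<forall>b\<in>carrier R. \<theta> (a \<oplus> b) = \<theta> a \<oplus> \<theta> b \<and>
                                  \<theta> (a \<otimes> b) = (a \<otimes> \<theta> b) \<oplus> (b \<otimes> \<theta> a)) \<and>
     (\<forall>c. \<theta> (\<kappa> c) = \<zero>)}"

text \<open>\<open>diff_op l P\<close>: \<open>P\<close> is a differential operator of order at most \<open>l\<close>. The algebra of differential
  operators is generated by functions and vector fields.\<close>

inductive diff_op :: "nat \<Rightarrow> ('r \<Rightarrow> 'r) \<Rightarrow> bool" where
  mult: "a \<in> carrier R \<Longrightarrow> diff_op l (\<lambda>x\<in>carrier R. a \<otimes> x)"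
| comp: "\<theta> \<in> vector_fields \<Longrightarrow> diff_op l P \<Longrightarrow> diff_op (Suc l) (op_comp \<theta> P)"
| add: "diff_op l P \<Longrightarrow> diff_op l Q \<Longrightarrow> diff_op l (op_add P Q)"

definition D :: "('r, 'r \<Rightarrow> 'r) module" where
  "D = \<lparr>carrier = {P. \<exists>l. diff_op l P}, monoid.mult = op_comp, one = (\<lambda>x\<in>carrier R. x),
        ring.zero = (\<lambda>x\<in>carrier R. \<zero>), ring.add = op_add, smult = op_smult\<rparr>"

definition F_D :: "int \<Rightarrow> ('r \<Rightarrow> 'r) set" where
  "F_D l = (if l < 0 then {\<zero>\<^bsub>D\<^esub>} else {P. diff_op (nat l) P})"

text \<open>Logarithmic vector fields are those preserving the ideal of \<open>Y\<^sub>r\<^sub>e\<^sub>d\<close>. Logarithmic forms are dual to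
  them: for \<open>Y\<^sub>r\<^sub>e\<^sub>d\<close> with normal crossings, given by \<open>z\<^sub>1 \<cdots> z\<^sub>k = 0\<close>, the fields form the free
  module on \<open>z\<^sub>i\<partial>\<^sub>i\<close> (\<open>i \<le> k\<close>) and \<open>\<partial>\<^sub>i\<close> (\<open>i > k\<close>), with dual basis \<open>dz\<^sub>i/z\<^sub>i\<close>, \<open>dz\<^sub>i\<close>; and the
  \<open>p\<close>-th exterior power of the dual of a free module of finite rank is the module of alternating
  \<open>p\<close>-linear forms. A \<open>p\<close>-form is a function on lists of vector fields of length \<open>p\<close>.\<close>

definition log_vector_fields :: "('r \<Rightarrow> 'r) set" where
  "log_vector_fields = {\<theta> \<in> vector_fields. \<theta> ` I \<subseteq> I}"

definition log_lists :: "nat \<Rightarrow> ('r \<Rightarrow> 'r) list set" where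
  "log_lists p = {\<theta>s. length \<theta>s = p \<and> set \<theta>s \<subseteq> log_vector_fields}"

definition log_form :: "nat \<Rightarrow> (('r \<Rightarrow> 'r) list \<Rightarrow> 'r) \<Rightarrow> bool" where
  "log_form p \<omega> \<longleftrightarrow> \<omega> \<in> log_lists p \<rightarrow>\<^sub>E carrier R \<and>
     (\<forall>xs \<theta> \<eta> ys. xs @ \<theta> # ys \<in> log_lists p \<and> \<eta> \<in> log_vector_fields \<longrightarrow>
        \<omega> (xs @ op_add \<theta> \<eta> # ys) = \<omega> (xs @ \<theta> # ys) \<oplus> \<omega> (xs @ \<eta> # ys)) \<and>
     (\<forall>xs \<theta> ys. \<forall>a\<in>carrier R. xs @ \<theta> # ys \<in> log_lists p \<longrightarrow>
        \<omega> (xs @ op_smult a \<theta> # ys) = a \<otimes> \<omega> (xs @ \<theta> # ys)) \<and>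
     (\<forall>\<theta>s\<in>log_lists p. \<not> distinct \<theta>s \<longrightarrow> \<omega> \<theta>s = \<zero>)"

definition \<Omega> :: "nat \<Rightarrow> ('r, ('r \<Rightarrow> 'r) list \<Rightarrow> 'r) module" where
  "\<Omega> p = \<lparr>carrier = {\<omega>. log_form p \<omega>}, monoid.mult = undefined, one = undefined,
     ring.zero = (\<lambda>\<theta>s\<in>log_lists p. \<zero>),
     ring.add = (\<lambda>\<omega> \<eta>. \<lambda>\<theta>s\<in>log_lists p. \<omega> \<theta>s \<oplus> \<eta> \<theta>s),
     smult = (\<lambda>a \<omega>. \<lambda>\<theta>s\<in>log_lists p. a \<otimes> \<omega> \<theta>s)\<rparr>"

definition delete_nth :: "nat \<Rightarrow> 'b list \<Rightarrow> 'b list" where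
  "delete_nth i xs = take i xs @ drop (Suc i) xs"

definition sign :: "nat \<Rightarrow> 'r" where
  "sign i = (\<ominus> \<one>) [^] i"

definition ext_deriv ::
  "nat \<Rightarrow> (('r \<Rightarrow> 'r) list \<Rightarrow> 'r) \<Rightarrow> ('r \<Rightarrow> 'r) list \<Rightarrow> 'r" where
  "ext_deriv p \<omega> = (\<lambda>\<theta>s\<in>log_lists (Suc p).
     (\<Oplus>i\<in>{..p}. sign i \<otimes> (\<theta>s ! i) (\<omega> (delete_nth i \<theta>s))) \<oplus>
     (\<Oplus>ij\<in>{(i, j). i < j \<and> j \<le> p}. sign (fst ij + snd ij) \<otimes>
        \<omega> (bracket (\<theta>s ! fst ij) (\<theta>s ! snd ij) # delete_nth (fst ij) (delete_nth (snd ij) \<theta>s))))"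

text \<open>\<open>wedge p \<xi> \<omega>\<close> is \<open>\<xi> \<and> \<omega>\<close> for a 1-form \<open>\<xi>\<close> and a \<open>p\<close>-form \<open>\<omega>\<close>.\<close>

definition wedge ::
  "nat \<Rightarrow> (('r \<Rightarrow> 'r) list \<Rightarrow> 'r) \<Rightarrow> (('r \<Rightarrow> 'r) list \<Rightarrow> 'r) \<Rightarrow> ('r \<Rightarrow> 'r) list \<Rightarrow> 'r" where
  "wedge p \<xi> \<omega> = (\<lambda>\<theta>s\<in>log_lists (Suc p).
     \<Oplus>i\<in>{..p}. sign i \<otimes> (\<xi> [\<theta>s ! i] \<otimes> \<omega> (delete_nth i \<theta>s)))"

definition differential :: "'r \<Rightarrow> ('r \<Rightarrow> 'r) list \<Rightarrow> 'r" where
  "differential a = (\<lambda>\<theta>s\<in>log_lists 1. hd \<theta>s a)"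

text \<open>\<open>dt/t\<close> as a logarithmic form\<close>

definition dlog_t :: "('r \<Rightarrow> 'r) list \<Rightarrow> 'r" where
  "dlog_t = (\<lambda>\<theta>s\<in>log_lists 1. THE a. a \<in> carrier R \<and> a \<otimes> t = hd \<theta>s t)"

text \<open>The module of relative logarithmic \<open>p\<close>-forms is the quotient of \<open>\<Omega> p\<close> by the multiples of \<open>dt/t\<close>;
  \<open>\<Omega>_rel_Y p\<close> is its restriction to \<open>Y\<close>.\<close>

definition dlog_t_multiples :: "nat \<Rightarrow> (('r \<Rightarrow> 'r) list \<Rightarrow> 'r) set" where
  "dlog_t_multiples p =
     additive_span (\<Omega> p) {wedge q dlog_t \<gamma> | q \<gamma>. Suc q = p \<and> \<gamma> \<in> carrier (\<Omega> q)}"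

definition \<Omega>_rel :: "nat \<Rightarrow> ('r, (('r \<Rightarrow> 'r) list \<Rightarrow> 'r) set) module" where
  "\<Omega>_rel p = quotient_module (\<Omega> p) (dlog_t_multiples p)"

definition t_multiples :: "nat \<Rightarrow> (('r \<Rightarrow> 'r) list \<Rightarrow> 'r) set set" where
  "t_multiples p = {t \<odot>\<^bsub>\<Omega>_rel p\<^esub> C | C. C \<in> carrier (\<Omega>_rel p)}"

definition \<Omega>_rel_Y :: "nat \<Rightarrow> ('r, (('r \<Rightarrow> 'r) list \<Rightarrow> 'r) set set) module" where
  "\<Omega>_rel_Y p = quotient_module (\<Omega>_rel p) (t_multiples p)"

definition form_class :: "nat \<Rightarrow> (('r \<Rightarrow> 'r) list \<Rightarrow> 'r) \<Rightarrow> (('r \<Rightarrow> 'r) list \<Rightarrow> 'r) set set" where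
  "form_class p \<beta> = t_multiples p +>\<^bsub>\<Omega>_rel p\<^esub> (dlog_t_multiples p +>\<^bsub>\<Omega> p\<^esub> \<beta>)"

text \<open>Local coordinates \<open>z\<^sub>0, \<dots>, z\<^sub>n\<close> with the dual frame \<open>E\<^sub>0, \<dots>, E\<^sub>n\<close> of the vector fields.\<close>

definition coordinate_frame :: "(nat \<Rightarrow> 'r) \<Rightarrow> (nat \<Rightarrow> 'r \<Rightarrow> 'r) \<Rightarrow> bool" where
  "coordinate_frame z E \<longleftrightarrow>
     (\<forall>i\<le>n. z i \<in> carrier R \<and> E i \<in> vector_fields) \<and>
     (\<forall>i\<le>n. \<forall>j\<le>n. E i (z j) = (if i = j then \<one> else \<zero>)) \<and>
     (\<forall>\<theta>\<in>vector_fields. \<forall>x\<in>carrier R. \<theta> x = (\<Oplus>i\<in>{..n}. \<theta> (z i) \<otimes> E i x))"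

definition rel_log_vector_fields :: "('r \<Rightarrow> 'r) set" where
  "rel_log_vector_fields = {\<theta> \<in> log_vector_fields. \<theta> t = \<zero>}"

text \<open>Dual frames of the relative logarithmic 1-forms and vector fields; the relative forms are given
  by representatives \<open>\<xi> j\<close> in \<open>\<Omega> 1\<close>, unique up to multiples of \<open>dt/t\<close>, which vanish on relative fields.\<close>

definition relative_frame ::
  "(nat \<Rightarrow> ('r \<Rightarrow> 'r) list \<Rightarrow> 'r) \<Rightarrow> (nat \<Rightarrow> 'r \<Rightarrow> 'r) \<Rightarrow> bool" where
  "relative_frame \<xi> E \<longleftrightarrow>
     (\<forall>j<n. \<xi> j \<in> carrier (\<Omega> 1) \<and> E j \<in> rel_log_vector_fields) \<and>
     (\<forall>i<n. \<forall>j<n. \<xi> i [E j] = (if i = j then \<one> else \<zero>)) \<and>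
     (\<forall>\<theta>\<in>rel_log_vector_fields. \<forall>x\<in>carrier R. \<theta> x = (\<Oplus>j\<in>{..<n}. \<xi> j [\<theta>] \<otimes> E j x))"

text \<open>A formal sum representing \<open>d\<beta> \<otimes> P + \<Sum>j\<in>J. \<xi> j \<and> \<beta> \<otimes> E j P\<close>, where \<open>\<beta>\<close> is a \<open>p\<close>-form.\<close>

definition nabla ::
  "nat set \<Rightarrow> (nat \<Rightarrow> ('r \<Rightarrow> 'r) list \<Rightarrow> 'r) \<Rightarrow> (nat \<Rightarrow> 'r \<Rightarrow> 'r) \<Rightarrow> nat \<Rightarrow>
    (('r \<Rightarrow> 'r) list \<Rightarrow> 'r) \<times> ('r \<Rightarrow> 'r) \<Rightarrow> ((('r \<Rightarrow> 'r) list \<Rightarrow> 'r) \<times> ('r \<Rightarrow> 'r) \<Rightarrow>\<^sub>0 int)" where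
  "nabla J \<xi> E p = (\<lambda>(\<beta>, P). frag_of (ext_deriv p \<beta>, P) +
     (\<Sum>j\<in>J. frag_of (wedge p (\<xi> j) \<beta>, op_comp (E j) P)))"


subsection \<open>The module \<open>M\<close>, its filtration and its endomorphism\<close>

definition rel_tensor where
  "rel_tensor = tensor_product R (\<Omega>_rel_Y n) D"

text \<open>The class in \<open>rel_tensor\<close> of a formal sum of pairs \<open>(\<beta>, P)\<close> with \<open>\<beta>\<close> in \<open>\<Omega> n\<close>.\<close>

definition rel_tensor_class where
  "rel_tensor_class u =
     tensor_class R (\<Omega>_rel_Y n) D (frag_extend (\<lambda>(\<beta>, P). frag_of (form_class n \<beta>, P)) u)"

text \<open>The image of the last differential of the relative logarithmic de Rham complex.\<close>

definition boundaries where
  "boundaries = additive_span rel_tensor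
     {rel_tensor_class (nabla {..<n} \<xi> E q (\<gamma>, P)) | \<xi> E q \<gamma> P.
        Suc q = n \<and> relative_frame \<xi> E \<and> \<gamma> \<in> carrier (\<Omega> q) \<and> P \<in> carrier D}"

text \<open>The cohomology in the top degree 0 of the complex is the cokernel of its last differential.\<close>

definition M where
  "M = quotient_module (restrict_scalars \<kappa> rel_tensor) boundaries"

definition M_class where
  "M_class u = boundaries +>\<^bsub>rel_tensor\<^esub> rel_tensor_class u"

definition F_M where
  "F_M l = additive_span M
     {M_class (frag_of (\<beta>, P)) | \<beta> P. \<beta> \<in> carrier (\<Omega> n) \<and> P \<in> F_D (l + int n)}"

text \<open>The endomorphism of \<open>M\<close> sends \<open>[u]\<close> to \<open>[v]\<close> if \<open>dt/t \<and> v = d u\<close> in the tensor product of \<open>\<Omega> (n + 1)\<close> with \<open>D\<close>.\<close>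

definition R_M where
  "R_M m = (THE m'. \<exists>u v z E.
     u \<in> carrier (tensor_free (\<Omega> n) D) \<and> v \<in> carrier (tensor_free (\<Omega> n) D) \<and>
     coordinate_frame z E \<and> m = M_class u \<and> m' = M_class v \<and>
     tensor_class R (\<Omega> (n + 1)) D (frag_extend (\<lambda>(\<gamma>, Q). frag_of (wedge n dlog_t \<gamma>, Q)) v) =
     tensor_class R (\<Omega> (n + 1)) D
       (frag_extend (nabla {..n} (\<lambda>i. differential (z i)) E n) u))"

definition R_M_minus :: "real \<Rightarrow> _" where
  "R_M_minus c m = R_M m \<ominus>\<^bsub>M\<^esub> (complex_of_real c \<odot>\<^bsub>M\<^esub> m)"

definition gen_eigenspace :: "real \<Rightarrow> _" where
  "gen_eigenspace c = (\<Union>k. kernel_pow M (R_M_minus c) k)"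

definition M_ge :: "real \<Rightarrow> _" where
  "M_ge \<alpha> = additive_span M (\<Union>c\<in>{\<alpha>..}. gen_eigenspace c)"

definition M_gt :: "real \<Rightarrow> _" where
  "M_gt \<alpha> = additive_span M (\<Union>c\<in>{\<alpha><..}. gen_eigenspace c)"

definition M_gr :: "real \<Rightarrow> _" where
  "M_gr \<alpha> = quotient_module (M\<lparr>carrier := M_ge \<alpha>\<rparr>) (M_gt \<alpha>)"

definition F_M_gr :: "real \<Rightarrow> int \<Rightarrow> _" where
  "F_M_gr \<alpha> l = (\<lambda>m. M_gt \<alpha> +>\<^bsub>M\<^esub> m) ` (F_M l \<inter> M_ge \<alpha>)"

definition R_M_gr :: "real \<Rightarrow> _" where
  "R_M_gr \<alpha> = induced_map M (M_gt \<alpha>) (R_M_minus \<alpha>)"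

end


section \<open>The stalks for a degeneration\<close>

text \<open>For \<open>f\<close> on \<open>X\<close> of dimension \<open>n + 1\<close>: the stalk at \<open>p\<close> of \<open>\<M>\<^sub>\<alpha>\<close>, of its filtration \<open>F\<close>, and of
  the nilpotent endomorphism \<open>R\<^sub>\<alpha>\<close>.\<close>

definition M_stalk where
  "M_stalk X A f n \<alpha> p =
     germ_family.M_gr (germ_ring X A p) (\<lambda>c. germ X p (\<lambda>_. c)) (zero_ideal X A f p) (germ X p f) n \<alpha>"

definition F_stalk where
  "F_stalk X A f n \<alpha> p =
     germ_family.F_M_gr (germ_ring X A p) (\<lambda>c. germ X p (\<lambda>_. c)) (zero_ideal X A f p) (germ X p f) n \<alpha>"

definition R_stalk where
  "R_stalk X A f n \<alpha> p =
     germ_family.R_M_gr (germ_ring X A p) (\<lambda>c. germ X p (\<lambda>_. c)) (zero_ideal X A f p) (germ X p f) n \<alpha>"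

definition W_stalk where
  "W_stalk X A f n \<alpha> p = monodromy_filtration (M_stalk X A f n \<alpha> p) (R_stalk X A f n \<alpha> p)"

end

theory Submission
 imports Defs "HOL-Complex_Analysis.Conformal_Mappings" "HOL-Library.Function_Algebras"
begin

text \<open>
  Near a point of \<open>Y\<close> choose coordinates with \<open>f = \<Prod> i \<in> K. z\<^sub>i ^ e\<^sub>i\<close>. In the logarithmic frame \<open>M\<close> becomes the
  quotient of the ring of differential operators by the right ideal generated by \<open>f\<close>, the differences of the
  Euler operators \<open>z\<^sub>i \<partial>\<^sub>i / e\<^sub>i\<close>, \<open>i \<in> K\<close>, and the \<open>\<partial>\<^sub>i\<close>, \<open>i \<notin> K\<close>; and \<open>R\<close> is left multiplication by one of the
  Euler operators. The monomials with exponents \<open>\<lceil>e\<^sub>i j / lcd\<rceil>\<close> generate a chain of submodules on whose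
  \<open>j\<close>-th quotient \<open>R - j / lcd\<close> is nilpotent, so these are the sums of generalized eigenspaces.

  Multiplication by such a monomial identifies \<open>M\<^sub>\<alpha>\<close>, strictly with respect to \<open>F\<close>, with the quotient of
  operators by similar relations and by \<open>\<Prod> i \<in> J. z\<^sub>i\<close>. Modulo the relations every operator is uniquely a
  polynomial in \<open>N = R - \<alpha>\<close> whose coefficients are normal: the coefficient of \<open>\<partial>\<^sup>b\<close> does not depend on \<open>z\<^sub>i\<close> if
  \<open>b\<^sub>i > 0\<close>. Applying the formal adjoint to high powers of \<open>f\<close> shows that this respects orders. Splitting
  normal operators according to how \<open>\<Prod> i \<in> J. z\<^sub>i\<close> acts on them exhibits \<open>M\<^sub>\<alpha>\<close> as a sum of Jordan blocks
  of \<open>N\<close>, along which \<open>F\<close> is shifted by one in each step, and this yields the weight filtration and the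
  Lefschetz decomposition together with \<open>F\<close>. Off \<open>Y\<close> the function \<open>f\<close> is a unit and \<open>M = 0\<close>.\<close>

text \<open>The delicate point is the filtration: a class has representatives of many orders, and
  the relations might lower the order of an operator. An order that survives them is read off from
  the monomial \<open>f^nu z^a\<close> divided by the product of the \<open>z i\<close>,
  \<open>i\<close> in \<open>K\<close>. The adjoints of all Euler operators, twisted by
  \<open>a\<close>, act on it by the same number \<open>- nu\<close>, so the adjoint of every
  relation kills it, whereas that of an operator of order \<open>m\<close> multiplies it by a
  polynomial in \<open>nu\<close> of degree at most \<open>m\<close>, with poles along the
  \<open>z i\<close>. On a normal form \<Sum> N^j y_j nothing cancels: \<open>N\<close> contributes
  a factor linear in \<open>nu\<close>, and the poles separate the terms of \<open>y_j\<close>. So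
  the degree is the maximum of \<open>j\<close> plus the order of \<open>y_j\<close>. The sizes of
  the Jordan blocks come from asking when a term \<open>g \<partial>^b\<close> can be divided on the
  left by the \<open>z i\<close>, \<open>i\<close> in \<open>J\<close>. This is immediate if
  \<open>b i = 0\<close> and \<open>z i\<close> divides \<open>g\<close>; otherwise one factor
  \<open>z i \<partial>_i\<close> has to be applied first, which is a multiple of \<open>N\<close>
  modulo the relations. The number of indices of the second kind is the length of the block.\<close>

notation (input) iff (infixr "<->" 25)

abbreviation supp :: "('a \<Rightarrow>\<^sub>0 'b::zero) => 'a set" where "supp == Poly_Mapping.keys"
abbreviation coef :: "('a \<Rightarrow>\<^sub>0 'b::zero) => 'a => 'b" where "coef == Poly_Mapping.lookup"
abbreviation mono1 :: "'a => 'b => 'a \<Rightarrow>\<^sub>0 'b::zero" where "mono1 == Poly_Mapping.single"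

subsection \<open>Differential operators in coordinates\<close>

lemma additive_zero:
 fixes F :: "'a::ab_group_add=>'b::ab_group_add" assumes "!!x y. F (x + y)=F x + F y" shows "F 0=0"
proof -
 have "F 0 + F 0=F 0 + 0" using assms[of 0 0] by simp
 thus ?thesis by(simp only:add_left_cancel)
qed

lemma additive_minus:
 fixes F :: "'a::ab_group_add=>'b::ab_group_add" assumes "!!x y. F (x + y)=F x + F y" shows "F (- x) = - F x"
proof -
 have "F (- x) + F x=0" by(simp add:assms[symmetric] additive_zero[OF assms])
 thus ?thesis by(simp add:eq_neg_iff_add_eq_0)
qed

lemma additive_diff:
 fixes F :: "'a::ab_group_add=>'b::ab_group_add" assumes "!!x y. F (x + y)=F x + F y" shows "F (x - y)=F x - F y"
 using assms[of x "- y"] additive_minus[of F y, OF assms] by simp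

lemma additive_sum:
 fixes F :: "'a::ab_group_add=>'b::ab_group_add"
 assumes "!!x y. F (x + y)=F x + F y" shows "F (sum g A)=(SUM a:A. F (g a))"
 by(induction A rule:infinite_finite_induct) (simp_all add:assms additive_zero[OF assms])

definition lin :: "('b=>'r::zero=>'m::ab_group_add)=>('b \<Rightarrow>\<^sub>0 'r)=>'m" where
 "lin f X=(SUM b:supp X. f b (coef X b))"

lemma lin_superset: assumes "finite A" "supp X<=A" "!!b. f b 0=0" shows "lin f X=(SUM b:A. f b (coef X b))"
 unfolding lin_def by(rule sum.mono_neutral_left) (insert assms, auto simp:in_keys_iff)

lemma lin_add:
 fixes f :: "'b=>'r::ab_group_add=>'m::ab_group_add" assumes "!!b x y. f b (x + y)=f b x + f b y"
 shows "lin f (X + Y)=lin f X + lin f Y"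
proof -
 have 0: "f b 0=0" for b by(rule additive_zero) (rule assms)
 let ?A = "supp X Un supp Y"
 have "lin f (X + Y)=(SUM b:?A. f b (coef (X + Y) b))"
  by(rule lin_superset) (auto simp:0 dest:subsetD[OF Poly_Mapping.keys_add])
 also have "... = (SUM b:?A. f b (coef X b)) + (SUM b:?A. f b (coef Y b))"
  by(simp add:Poly_Mapping.lookup_add assms sum.distrib)
 also have "... = lin f X + lin f Y" by(subst (1 2) lin_superset[where A = ?A]) (auto simp:0)
 finally show ?thesis .
qed

lemma lin_single: "f b 0=0 ==> lin f (mono1 b x)=f b x" by(simp add:lin_def)

lemma poly_mapping_eq_sum: "X=(SUM b:supp X. mono1 b (coef X b))"
proof(rule poly_mapping_eqI)
 fix k
 have "coef (SUM b:supp X. mono1 b (coef X b)) k=(SUM b:supp X. if b=k then coef X k else 0)"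
  unfolding lookup_sum by(rule sum.cong) (auto simp:lookup_single)
 thus "coef X k = coef (SUM b:supp X. mono1 b (coef X b)) k" by(simp add:sum.delta in_keys_iff)
qed

text \<open>Most identities between operators below are additive in the operator, so that this
  reduces them to a single term \<open>g \<partial>^b\<close>.\<close>

lemma pm_additive_eqI:
 fixes F G :: "('b \<Rightarrow>\<^sub>0 'r::ab_group_add)=>'m::ab_group_add"
 assumes "!!X Y. F (X + Y)=F X + F Y" "!!X Y. G (X + Y)=G X + G Y" and "!!b x. F (mono1 b x)=G (mono1 b x)"
 shows "F X=G X" by(subst (1 2) poly_mapping_eq_sum) (simp add:assms additive_sum[of F] additive_sum[of G])

definition inc :: "'d=>('d=>nat)=>'d=>nat" where
 "inc i b=b(i := Suc (b i))"

definition order_of :: "('d::finite=>nat)=>nat" where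
 "order_of b=(SUM i:UNIV. b i)"

lemma inc_commute: "inc i (inc j b)=inc j (inc i b)" by(auto simp:inc_def fun_eq_iff)
lemma inc_inject [simp]: "inc i b=inc i c <-> b = c" by(auto simp:inc_def fun_eq_iff split:if_splits)
lemma inc_apply: "inc i b j=(if j=i then Suc (b i) else b j)" by(simp add:inc_def)

lemma order_of_inc [simp]: "order_of (inc i b)=Suc (order_of b)"
proof -
 have "order_of (inc i b)=(SUM j:UNIV. b j + (if j=i then 1 else 0))"
  unfolding order_of_def by(rule sum.cong) (auto simp:inc_apply)
 thus ?thesis by(simp add:sum.distrib order_of_def)
qed

lemma order_of_zero [simp]: "order_of (%_. 0)=0" by(simp add:order_of_def)

lemma inc_cases:
 obtains "b=(%_. 0)" | i c where "b=inc i c" "b i > 0"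
proof(cases "b=(%_. 0)")
 case False
 then obtain i where "b i > 0" by auto
 hence "b=inc i (b(i := b i - 1))" by(auto simp:inc_def fun_eq_iff)
 thus ?thesis using that `b i > 0` by blast
qed (use that in blast)

lemma pos_imp_inc: "b i > 0 ==> EX c. b=inc i c" by(rule exI[of _ "b(i := b i - 1)"]) (auto simp:inc_def fun_eq_iff)

lemma inc_induct [case_names zero inc]:
 assumes "P (%_. 0)" "!!i b. P b ==> P (inc i b)" shows "P (b::'d::finite=>nat)"
proof(induction "order_of b" arbitrary: b rule:less_induct)
 case less
 show ?case
 proof(cases b rule:inc_cases)
  case (2 i c)
  thus ?thesis using assms(2) less[of c] by simp
 qed (use assms in simp)
qed

definition enumeration :: "'d::finite list" where
 "enumeration=(SOME xs. set xs=UNIV & distinct xs)"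

lemma enumeration: "set enumeration=(UNIV::'d::finite set)" "distinct (enumeration::'d list)"
proof -
 have "finite (UNIV::'d set)" by(rule finite)
 hence "EX xs. set xs=(UNIV::'d set) & distinct xs" by(rule finite_distinct_list)
 hence "set (enumeration::'d list)=UNIV & distinct (enumeration::'d list)" unfolding enumeration_def by(rule someI_ex)
 thus "set (enumeration::'d list)=UNIV" "distinct (enumeration::'d list)" by auto
qed

definition multi_pow :: "('d::finite=>'r=>'r)=>('d=>nat)=>'r=>'r" where
 "multi_pow D b=foldr (%i. (D i ^^ b i)) enumeration"

lemma multi_pow_zero [simp]: "multi_pow D (%_. 0) x=x"
proof -
 have "foldr (%i. (D i ^^ 0)) xs x=x" for xs by(induction xs) auto
 thus ?thesis by(simp add:multi_pow_def)
qed

lemma multi_pow_inc: assumes "!!i j x. D i (D j x)=D j (D i x)" shows "multi_pow D (inc i b) x=D i (multi_pow D b x)"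
proof -
 have c: "D i ((D j ^^ n) x)=(D j ^^ n) (D i x)" for j n x by(induction n) (simp_all, metis assms)
 have "foldr (%j. (D j ^^ inc i b j)) xs x=D i (foldr (%j. (D j ^^ b j)) xs x)"
  if "i:set xs" "distinct xs" for xs using that
 proof(induction xs)
  case (Cons j xs)
  show ?case
  proof(cases "j=i")
   case True
   have "foldr (%j. (D j ^^ inc i b j)) xs x=foldr (%j. (D j ^^ b j)) xs x"
    by(rule foldr_cong) (insert Cons.prems True, auto simp:inc_apply)
   thus ?thesis using True by(simp add:inc_apply)
  next
   case False
   thus ?thesis using Cons c by(simp add:inc_apply)
  qed
 qed simp
 thus ?thesis by(simp add:multi_pow_def enumeration)
qed

lemma multi_pow_commute: assumes "!!i j x. D i (D j x)=D j (D i x)" "!!i x. E (D i x)=D i (E x)"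
 shows "multi_pow D b (E x)=E (multi_pow D b x)"
 by(induction b rule:inc_induct) (simp_all add:multi_pow_inc[of D, OF assms(1)] assms(2))

lemma multi_pow_inc_right: assumes "!!i j x. D i (D j x)=D j (D i x)"
 shows "multi_pow D (inc i b) x=multi_pow D b (D i x)"
 unfolding multi_pow_inc[of D, OF assms] by(rule multi_pow_commute[of D, OF assms, symmetric]) (rule assms)

lemma multi_pow_add:
 fixes D :: "'d::finite=>'r::ab_group_add=>'r"
 assumes "!!i j x. D i (D j x)=D j (D i x)" "!!i x y. D i (x + y)=D i x + D i y"
 shows "multi_pow D b (x + y)=multi_pow D b x + multi_pow D b y"
 by(induction b rule:inc_induct) (simp_all add:multi_pow_inc[of D, OF assms(1)] assms(2))

section \<open>An abstract ring of functions with coordinates, and its differential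
  operators\<close>

type_synonym ('d, 'r) ops = "('d=>nat) \<Rightarrow>\<^sub>0 'r"

text \<open>The properties of the ring of convergent power series from which all the algebra is
  derived: \<open>rho i\<close> substitutes 0 for the \<open>i\<close>-th coordinate,
  \<open>rho_split\<close> is division by \<open>z i\<close>, and \<open>derivation_eq\<close> says
  that a derivation is determined by its values on the coordinates.\<close>

locale coords =
 fixes z :: "'d::finite=>'r::comm_ring_1" and pd rho :: "'d=>'r=>'r" and cst :: "complex=>'r"
 assumes cst_add: "cst (a + b) = cst a + cst b" and cst_mult: "cst (a * b) = cst a * cst b" and cst_1: "cst 1=1"
  and pd_add: "pd i (x + y) = pd i x + pd i y" and pd_mult: "pd i (x * y)=x * pd i y + y * pd i x"
  and pd_cst: "pd i (cst c)=0" and pd_z: "pd i (z j)=(if i=j then 1 else 0)"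
  and derivation_eq: "!!th x. [|!!x y. th (x + y)=th x + th y; !!x y. th (x * y)=x * th y + y * th x; !!c. th (cst
   c)=0|] ==> th x=(SUM i:UNIV. th (z i) * pd i x)"
  and rho_add: "rho i (x + y)=rho i x + rho i y" and rho_mult: "rho i (x * y)=rho i x * rho i y"
  and rho_cst: "rho i (cst c) = cst c" and rho_z: "rho i (z j)=(if i=j then 0 else z j)"
  and rho_rho: "rho i (rho j x)=rho j (rho i x)" and rho_idem: "rho i (rho i x)=rho i x"
  and pd_rho_same: "pd i (rho i x)=0" and pd_rho: "i~=j ==> pd i (rho j x)=rho j (pd i x)"
  and rho_split: "EX q. x=rho i x + z i * q" and z_regular: "z i * x=0 ==> x=0"
begin

lemma cst_0: "cst 0=0" by(rule additive_zero) (rule cst_add)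
lemma cst_minus: "cst (- c) = - cst c" by(rule additive_minus) (rule cst_add)
lemma cst_diff: "cst (c - d) = cst c - cst d" by(rule additive_diff) (rule cst_add)
lemma cst_power: "cst (c ^ k) = cst c ^ k" by(induction k) (simp_all add:cst_mult cst_1)
lemma cst_of_nat: "cst (of_nat k) = of_nat k" by(induction k) (simp_all add:cst_0 cst_add cst_1)
lemma cst_unit: "c~=0 ==> cst c * x=0 <-> x=0"
proof
 assume "c~=0" "cst c * x=0"
 hence "cst (inverse c) * (cst c * x)=0" by simp
 thus "x=0" using `c ~= 0` by(simp add:mult.assoc[symmetric] cst_mult[symmetric] cst_1)
qed simp

lemma pd_0: "pd i 0=0" by(rule additive_zero) (rule pd_add)
lemma pd_minus: "pd i (- x) = - pd i x" by(rule additive_minus) (rule pd_add)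
lemma pd_diff: "pd i (x - y) = pd i x - pd i y" by(rule additive_diff) (rule pd_add)
lemma pd_1: "pd i 1=0" using pd_cst[of i 1] by(simp add:cst_1)
lemma pd_of_nat: "pd i (of_nat k)=0" using pd_cst[of i "of_nat k"] by(simp add:cst_of_nat)
lemma pd_cst_mult: "pd i (cst c * x) = cst c * pd i x" by(simp add:pd_mult pd_cst)
lemma rho_0: "rho i 0=0" by(rule additive_zero) (rule rho_add)
lemma rho_1: "rho i 1=1" using rho_cst[of i 1] by(simp add:cst_1)

text \<open>The commutator of two coordinate derivations is a derivation that kills the coordinates.\<close>

lemma pd_commute: "pd i (pd j x) = pd j (pd i x)"
proof -
 let ?d = "%x. pd i (pd j x) - pd j (pd i x)"
 have "?d x=(SUM k:UNIV. ?d (z k) * pd k x)"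
  by(rule derivation_eq) (simp_all add:pd_add pd_mult pd_cst pd_0 algebra_simps)
 also have "... = 0" by(rule sum.neutral) (simp add:pd_z pd_0 pd_1)
 finally show ?thesis by simp
qed

lemma pd_invariant: "rho i x=x ==> pd i x=0" using pd_rho_same[of i x] by simp

definition mon :: "('d=>nat)=>'r" where "mon c=(PROD i:UNIV. z i ^ c i)"

lemma mon_zero [simp]: "mon (%_. 0)=1" by(simp add:mon_def)
lemma mon_add: "mon (%i. b i + c i)=mon b * mon c" by(simp add:mon_def power_add prod.distrib)

lemma mon_inc: "mon (inc i c)=z i * mon c"
proof -
 have "mon (inc i c)=(PROD j:UNIV. (if j=i then z i else 1) * z j ^ c j)"
  unfolding mon_def by(rule prod.cong) (auto simp:inc_apply)
 thus ?thesis by(simp add:prod.distrib mon_def)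
qed

lemma mon_regular: "mon c * x=0 ==> x=0"
proof(induction c rule:inc_induct)
 case (inc i c)
 hence "z i * (mon c * x)=0" by(simp add:mon_inc mult.assoc)
 thus ?case using inc.IH z_regular by blast
qed simp

lemma mon_cancel: "mon c * x=mon c * y <-> x=y" using mon_regular[of c "x - y"] by(auto simp:right_diff_distrib)

lemma z_pd_mon: "z i * pd i (mon c) = of_nat (c i) * mon c"
proof(induction c rule:inc_induct)
 case zero show ?case by(simp add:pd_1)
next
 case (inc j c)
 show ?case
  unfolding mon_inc using inc by(cases "i=j") (simp_all add:pd_mult pd_z inc_apply algebra_simps, metis mult.left_commute)
qed

lemma rho_mon: "rho i (mon c)=(if c i=0 then mon c else 0)"
proof(induction c rule:inc_induct)
 case zero show ?case by(simp add:rho_1)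
next
 case (inc j c)
 show ?case unfolding mon_inc using inc by(auto simp:rho_mult rho_z inc_apply)
qed

text \<open>The operator \<open>\<Sum> g\<^sub>b \<partial>\<^sup>b\<close> is represented by its coefficients \<open>g\<^sub>b\<close>; \<open>act g\<close> and \<open>der i\<close> are the left
  multiplications by \<open>g\<close> and \<open>\<partial>\<^sub>i\<close>.\<close>

definition act :: "'r=>('d, 'r) ops=>('d, 'r) ops" where
 "act g=lin (%b x. mono1 b (g * x))"

definition der :: "'d=>('d, 'r) ops=>('d, 'r) ops" where
 "der i=lin (%b x. mono1 b (pd i x) + mono1 (inc i b) x)"

definition ev :: "('d, 'r) ops=>'r=>'r" where
 "ev X x=lin (%b g. g * multi_pow pd b x) X"

lemma act_single [simp]: "act g (mono1 b x)=mono1 b (g * x)" unfolding act_def by(rule lin_single) simp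

lemma act_add: "act g (X + Y)=act g X + act g Y"
 unfolding act_def by(rule lin_add) (simp add:algebra_simps single_add)

lemma der_single [simp]: "der i (mono1 b x)=mono1 b (pd i x) + mono1 (inc i b) x"
 unfolding der_def by(rule lin_single) (simp add:pd_0)

lemma der_add: "der i (X + Y)=der i X + der i Y"
 unfolding der_def by(rule lin_add) (simp add:algebra_simps single_add pd_add)

lemmas act_0 = additive_zero[of "act g" for g, OF act_add]
lemmas act_diff = additive_diff[of "act g" for g, OF act_add]
lemmas act_sum = additive_sum[of "act g" for g, OF act_add]
lemmas der_0 = additive_zero[of "der i" for i, OF der_add]
lemma act_act: "act g (act h X)=act (g * h) X" by(rule pm_additive_eqI) (simp_all add:act_add mult.assoc)
lemma act_commute: "act g (act h X)=act h (act g X)" by(simp add:act_act mult.commute)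

lemma act_add_left: "act (g + h) X=act g X + act h X"
 by(rule pm_additive_eqI[where F = "act (g + h)"]) (simp_all add:act_add single_add algebra_simps)

lemma act_1 [simp]: "act 1 X=X" by(rule pm_additive_eqI[where F = "act 1"]) (simp_all add:act_add)
lemma act_zero_left [simp]: "act 0 X=0" by(rule pm_additive_eqI[where F = "act 0"]) (simp_all add:act_add)
lemma act_minus_left: "act (- g) X = - act g X" using act_add_left[of "- g" g X] by(simp add:eq_neg_iff_add_eq_0)

lemma lookup_act: "coef (act g X) b=g * coef X b"
proof -
 have "(%X. coef (act g X) b) X=(%X. g * coef X b) X"
  by(rule pm_additive_eqI) (simp_all add:act_add lookup_add algebra_simps lookup_single when_def)
 thus ?thesis by simp
qed

lemma der_act: "der i (act g X)=act (pd i g) X + act g (der i X)"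
 by(rule pm_additive_eqI[where F = "%X. der i (act g X)"])
  (simp_all add:act_add der_add pd_mult single_add algebra_simps)

lemma der_commute: "der i (der j X)=der j (der i X)" by(rule pm_additive_eqI[where F = "%X. der i (der j X)"])
  (simp_all add:der_add pd_commute[of i j] inc_commute[of i j])

lemma multi_pd_inc: "multi_pow pd (inc i b) x = pd i (multi_pow pd b x)" by(rule multi_pow_inc) (rule pd_commute)
lemma ev_single [simp]: "ev (mono1 b g) x=g * multi_pow pd b x" unfolding ev_def by(rule lin_single) simp
lemma ev_add: "ev (X + Y) x=ev X x + ev Y x" unfolding ev_def by(rule lin_add) (simp add:algebra_simps)
lemma ev_act: "ev (act g X) x=g * ev X x" by(rule pm_additive_eqI[where F = "%X. ev (act g X) x"])
  (simp_all add:act_add ev_add algebra_simps)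

lemma ev_der: "ev (der i X) x = pd i (ev X x)" by(rule pm_additive_eqI[where F = "%X. ev (der i X) x"])
  (simp_all add:der_add ev_add pd_add pd_mult multi_pd_inc algebra_simps)

lemmas ev_0 = additive_zero[of "%X. ev X x" for x, OF ev_add]
lemmas ev_diff = additive_diff[of "%X. ev X x" for x, OF ev_add]

text \<open>The falling factorial \<open>c (c - 1) \<cdots> (c - b + 1)\<close>, which is 0 for \<open>b > c\<close>.\<close>

definition falling :: "nat=>nat=>nat" where "falling c b=(PROD k<b. c - k)"

lemma multi_pd_mon: "multi_pow pd b (mon c) = of_nat (PROD i:UNIV. falling (c i) (b i)) * mon (%i. c i - b i)"
proof(induction b rule:inc_induct)
 case zero show ?case by(simp add:falling_def)
next
 case (inc i b)
 let ?p = "%b. PROD j:UNIV. falling (c j) (b j)" and ?c = "%b. mon (%j. c j - b j)"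
 have "?p (inc i b)=(PROD j:UNIV. (if j=i then c i - b i else 1) * falling (c j) (b j))"
  by(rule prod.cong) (auto simp:falling_def inc_apply)
 hence p: "?p (inc i b)=(c i - b i) * ?p b" by(simp add:prod.distrib)
 \<comment> \<open>For a positive exponent the formula is checked after multiplication by the
   regular element \<open>z i\<close>, where \<open>z_pd_mon\<close> applies. Otherwise truncated
   subtraction gives 0 and the monomial is free of \<open>z i\<close>.\<close>
 have "pd i (?c b) = of_nat (c i - b i) * ?c (inc i b)"
 proof(cases "c i > b i")
  case True
  hence *: "(%j. c j - b j)=inc i (%j. c j - inc i b j)" by(auto simp:fun_eq_iff inc_apply)
  have "z i * pd i (?c b)=z i * (of_nat (c i - b i) * ?c (inc i b))"
   unfolding z_pd_mon using arg_cong[OF *, of mon] by(simp add:mon_inc mult.left_commute)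
  thus ?thesis using z_regular[of i "pd i (?c b) - of_nat (c i - b i) * ?c (inc i b)"] by(simp add:right_diff_distrib)
 next
  case False
  hence "rho i (?c b)=?c b" by(simp add:rho_mon)
  thus ?thesis using False by(simp add:pd_invariant)
 qed
 thus ?case
  unfolding multi_pd_inc inc p pd_mult pd_of_nat of_nat_mult by(simp only:mult_zero_right mult_zero_left add_0_left ac_simps)
qed

text \<open>Test on \<open>z^b\<close> for \<open>b\<close> of least order in the support. Any other
  index \<open>c\<close> of the support exceeds \<open>b\<close> in some component, since otherwise
  its order would be smaller; so \<open>\<partial>^c\<close> kills \<open>z^b\<close>, and the
  coefficient at \<open>b\<close> remains, times the nonzero constant \<open>b!\<close>.\<close>

lemma ev_eq_0: assumes "!!x. ev X x=0" shows "X=0"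
proof(rule ccontr)
 assume "X~=0"
 hence ne: "supp X~={}" by simp
 define b where "b=arg_min_on order_of (supp X)"
 have b: "b:supp X" unfolding b_def by(rule arg_min_if_finite) (use ne in auto)
 have min: "order_of b <= order_of c" if "c:supp X" for c
  using arg_min_least[of "supp X" c order_of] ne that unfolding b_def by auto
 have "multi_pow pd c (mon b)=0" if c: "c:supp X - {b}" for c
 proof -
  have "EX i. b i < c i"
  proof(rule ccontr)
   assume "\<not> (EX i. b i < c i)"
   hence "c i<=b i" for i by(auto simp:not_less)
   moreover obtain j where "c j~=b j" using c by(metis DiffD2 ext singletonI)
   ultimately have "order_of c < order_of b"
    unfolding order_of_def by(intro sum_strict_mono_ex1) (auto simp:order.order_iff_strict)
   thus False using min[of c] c by simp
  qed
  then obtain i where "b i < c i" ..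
  hence "falling (b i) (c i)=0" unfolding falling_def by(intro prod_zero) auto
  hence "(PROD i:UNIV. falling (b i) (c i))=0" by(intro prod_zero) auto
  thus ?thesis unfolding multi_pd_mon by(simp only:of_nat_0 mult_zero_left)
 qed
 hence "ev X (mon b) = coef X b * multi_pow pd b (mon b)" unfolding ev_def lin_def by(subst sum.remove[OF _ b]) auto
 also have "... = cst (of_nat (PROD i:UNIV. falling (b i) (b i))) * coef X b"
  by(simp add:multi_pd_mon cst_of_nat mult.commute del:of_nat_prod)
 finally have "coef X b=0" using assms cst_unit[of "of_nat (PROD i:UNIV. falling (b i) (b i))" "coef X b"]
  by(simp add:falling_def)
 thus False using b by(simp add:in_keys_iff)
qed

end

subsection \<open>Operators modulo the Euler relations\<close>

context coords begin

definition filt :: "int=>('d, 'r) ops set" where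
 "filt m={X. ALL b:supp X. int (order_of b)<=m}"

lemma filt_0: "0:filt m" by(simp add:filt_def)
lemma filt_add: "X:filt m ==> Y:filt m ==> X + Y:filt m" using Poly_Mapping.keys_add[of X Y] by(auto simp:filt_def)
lemma filt_single: "int (order_of b)<=m ==> mono1 b g:filt m" by(simp add:filt_def)
lemma filt_minus: "X:filt m ==> - X:filt m" by(simp add:filt_def)
lemma filt_diff: "X:filt m ==> Y:filt m ==> X - Y:filt m" using filt_add[of X m "- Y"] filt_minus[of Y m] by simp

lemma filt_sum: "(!!a. a:A ==> g a:filt m) ==> sum g A:filt m"
 by(induction A rule:infinite_finite_induct) (auto simp:filt_0 filt_add)

lemma filt_mono: "m<=m' ==> filt m<=filt m'" by(auto simp:filt_def)

lemma filt_induct [consumes 1, case_names zero add single]: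
 assumes "X:filt m" "P 0" "!!X Y. P X ==> P Y ==> P (X + Y)" and "!!b g. int (order_of b)<=m ==> P (mono1 b g)"
 shows "P X"
proof -
 have "P (SUM b:B. mono1 b (coef X b))" if "B <= supp X" "finite B" for B
  using that(2,1) assms by(induction B rule:finite_induct) (auto simp:filt_def)
 from this[of "supp X"] show ?thesis by(simp add:poly_mapping_eq_sum[symmetric])
qed

lemma filt_exhaustive: "EX k. X:filt (int k)"
proof -
 have "X:filt (int (SUM b:supp X. order_of b))" unfolding filt_def by(auto intro:member_le_sum simp del:of_nat_sum)
 thus ?thesis ..
qed

lemma filt_neg: "m < 0 ==> X:filt m <-> X=0"
 unfolding filt_def by(auto simp:keys_eq_empty[symmetric] simp del:keys_eq_empty intro!:equals0I)

lemma act_filt: "X:filt m ==> act g X:filt m"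
 by(induction rule:filt_induct) (simp_all add:act_0 act_add filt_0 filt_add filt_single)

lemma der_filt: "X:filt m ==> der i X:filt (m + 1)"
 by(induction rule:filt_induct) (simp_all add:der_0 der_add filt_0 filt_add filt_single)

section \<open>Formal adjoints\<close>

definition npd :: "'d=>'r=>'r" where "npd i x = - pd i x"

text \<open>The formal adjoint \<open>\<Sum> (-\<partial>)\<^sup>b \<circ> g\<^sub>b\<close> of the operator \<open>\<Sum> g\<^sub>b \<partial>\<^sup>b\<close>, applied to \<open>h\<close>.\<close>

definition adj :: "('d, 'r) ops=>'r=>'r" where
 "adj X h=lin (%b g. multi_pow npd b (g * h)) X"

lemma npd_commute: "npd i (npd j x)=npd j (npd i x)" by(simp add:npd_def pd_minus pd_commute)
lemma npd_add: "npd i (x + y)=npd i x + npd i y" by(simp add:npd_def pd_add)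

lemma multi_npd_add: "multi_pow npd b (x + y)=multi_pow npd b x + multi_pow npd b y"
 by(rule multi_pow_add) (rule npd_commute npd_add)+

lemma multi_npd_inc: "multi_pow npd (inc i b) x = - pd i (multi_pow npd b x)"
 by(subst multi_pow_inc) (rule npd_commute, simp add:npd_def)

lemma multi_npd_inc_right: "multi_pow npd (inc i b) x=multi_pow npd b (- pd i x)"
 by(subst multi_pow_inc_right) (rule npd_commute, simp add:npd_def)

lemma multi_npd_0: "multi_pow npd b 0=0" by(rule additive_zero) (rule multi_npd_add)

lemma multi_npd_mult: assumes "!!i. b i > 0 ==> pd i g=0" shows "multi_pow npd b (g * x)=g * multi_pow npd b x"
 using assms
proof(induction b rule:inc_induct)
 case (inc i b)
 hence "multi_pow npd b (g * x)=g * multi_pow npd b x" "pd i g=0" by(auto simp:inc_apply split:if_splits)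
 thus ?case by(simp add:multi_npd_inc pd_mult)
qed simp

lemma multi_npd_mon: "multi_pow npd b (mon c) = cst ((-1) ^ order_of b * of_nat (PROD i:UNIV. falling (c i) (b i))) *
 mon (%i. c i - b i)"
proof -
 have "multi_pow npd b x=(-1) ^ order_of b * multi_pow pd b x" for x
 proof(induction b rule:inc_induct)
  case (inc i b)
  have "pd i ((-1) ^ k * y)=(-1) ^ k * pd i y" for k y by(cases "even k") (simp_all add:pd_minus)
  thus ?case using inc by(simp add:multi_npd_inc multi_pd_inc)
 qed simp
 thus ?thesis by(simp add:multi_pd_mon cst_mult cst_power cst_minus cst_1 cst_of_nat mult.assoc del:of_nat_prod)
qed

lemma adj_single [simp]: "adj (mono1 b g) h=multi_pow npd b (g * h)"
 unfolding adj_def by(rule lin_single) (simp add:multi_npd_0)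

lemma adj_add: "adj (X + Y) h=adj X h + adj Y h"
 unfolding adj_def by(rule lin_add) (simp add:distrib_right multi_npd_add)

lemma adj_add_right: "adj X (g + h)=adj X g + adj X h" by(rule pm_additive_eqI[where F = "%X. adj X (g + h)"])
  (simp_all add:adj_add distrib_left multi_npd_add)

lemmas adj_0 = additive_zero[of "%X. adj X h" for h, OF adj_add]
lemmas adj_diff = additive_diff[of "%X. adj X h" for h, OF adj_add]
lemmas adj_sum = additive_sum[of "%X. adj X h" for h, OF adj_add]
lemmas adj_minus_right = additive_minus[of "adj X" for X, OF adj_add_right]

lemma adj_act: "adj (act g X) h=adj X (g * h)" by(rule pm_additive_eqI[where F = "%X. adj (act g X) h"])
  (simp_all add:act_add adj_add ac_simps)

lemma adj_der: "adj (der i X) h=adj X (- pd i h)" by(rule pm_additive_eqI[where F = "%X. adj (der i X) h"])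
  (simp_all add:der_add adj_add multi_npd_inc_right multi_npd_add[symmetric] pd_mult algebra_simps)

lemma adj_cst: "adj X (cst c * h) = cst c * adj X h"
proof(rule pm_additive_eqI[where F = "%X. adj X (cst c * h)"])
 show "adj (mono1 b g) (cst c * h) = cst c * adj (mono1 b g) h" for b g
  using multi_npd_mult[of b "cst c" "g * h"] by(simp add:pd_cst mult.left_commute)
qed (simp_all add:adj_add algebra_simps)

end

text \<open>\<open>K\<close> indexes the local components of \<open>Y\<close> and \<open>e\<close>
  gives their multiplicities. The Euler operator of the chosen component \<open>i0\<close> will
  represent \<open>R\<close>; the other components enter through their differences from it.\<close>

locale crossing = coords z pd rho cst
 for z :: "'d::finite=>'r::comm_ring_1" and pd rho :: "'d=>'r=>'r" and cst :: "complex=>'r" +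
 fixes K :: "'d set" and e :: "'d=>nat" and i0 :: 'd assumes i0: "i0:K" and e_pos: "i:K ==> e i > 0"
begin

text \<open>Left multiplication by \<open>z\<^sub>i \<partial>\<^sub>i / e\<^sub>i + a\<^sub>i / e\<^sub>i\<close>, which is \<open>z\<^sub>i \<partial>\<^sub>i / e\<^sub>i\<close> conjugated by \<open>z\<^sup>a\<close>.\<close>

definition euler :: "('d=>nat)=>'d=>('d, 'r) ops=>('d, 'r) ops" where
 "euler a i X=act (cst (1 / of_nat (e i)) * z i) (der i X) + act (cst (of_nat (a i) / of_nat (e i))) X"

definition rel :: "('d=>nat)=>'d=>('d, 'r) ops=>('d, 'r) ops" where
 "rel a i X=(if i:K then euler a i X - euler a i0 X else der i X)"

text \<open>The \<open>X i\<close> are arbitrary right factors, so this is the right ideal generated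
  by the twisted relations. For \<open>a = 0\<close>, together with the left multiples of
  \<open>f\<close>, it is what the operators are divided by to obtain \<open>M\<close>.\<close>

definition rels :: "('d=>nat)=>('d, 'r) ops set" where
 "rels a=range (%X. SUM i:UNIV. rel a i (X i))"

lemma euler_add: "euler a i (X + Y)=euler a i X + euler a i Y" by(simp add:euler_def act_add der_add)
lemma rel_add: "rel a i (X + Y)=rel a i X + rel a i Y" by(simp add:rel_def euler_add der_add)

lemmas euler_diff = additive_diff[of "euler a i" for a i, OF euler_add]
lemmas rel_0 = additive_zero[of "rel a i" for a i, OF rel_add]
lemmas rel_minus = additive_minus[of "rel a i" for a i, OF rel_add]

lemma euler_act: "euler a i (act g X)=act (cst (1 / of_nat (e i)) * z i * pd i g) X + act g (euler a i X)"
 by(simp add:euler_def der_act act_add act_act algebra_simps)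

lemma euler_act_invariant: "pd i g=0 ==> euler a i (act g X)=act g (euler a i X)" by(simp add:euler_act)

lemma euler_der: "i~=j ==> euler a i (der j X)=der j (euler a i X)"
 by(simp add:euler_def der_act der_add der_commute[of i j] pd_mult pd_cst pd_z)

lemma euler_commute: "euler a i (euler a j X)=euler a j (euler a i X)"
proof(cases "i=j")
 case False
 have "euler a i (euler a j X)=act (cst (1 / of_nat (e j)) * z j) (der j (euler a i X)) + act (cst (of_nat (a j) /
  of_nat (e j))) (euler a i X)"
  unfolding euler_def[of a j X] using False by(simp add:euler_add euler_act_invariant pd_mult pd_cst pd_z euler_der)
 thus ?thesis by(simp add:euler_def)
qed simp

lemma euler_mon: assumes "i:K" shows "euler (%_. 0) i (act (mon a) X)=act (mon a) (euler a i X)"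
proof -
 have "cst (1 / of_nat (e i)) * z i * pd i (mon a)=mon a * cst (of_nat (a i) / of_nat (e i))"
  by(simp add:mult.assoc z_pd_mon cst_of_nat[symmetric] cst_mult[symmetric] mult.left_commute[of "cst _" "mon a"]
   mult.commute[of _ "mon a"])
 thus ?thesis by(simp add:euler_act) (simp add:euler_def act_add act_act cst_0 algebra_simps)
qed

lemma euler_filt: "X:filt m ==> euler a i X:filt (m + 1)"
 using filt_mono[of m "m + 1"] unfolding euler_def by(intro filt_add act_filt der_filt) auto

lemma rels_0: "0:rels a" unfolding rels_def by(rule image_eqI[where x = "%_. 0"]) (simp_all add:rel_0)

lemma rels_add: "X:rels a ==> Y:rels a ==> X + Y:rels a" unfolding rels_def
proof(elim imageE)
 fix F G assume "X=(SUM i:UNIV. rel a i (F i))" "Y=(SUM i:UNIV. rel a i (G i))"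
 thus "X + Y:range (%X. SUM i:UNIV. rel a i (X i))"
  by(intro image_eqI[where x = "%i. F i + G i"]) (simp_all add:rel_add sum.distrib)
qed

lemma rels_induct [consumes 1, case_names zero add rel]:
 assumes "X:rels a" "P 0" "!!X Y. P X ==> P Y ==> P (X + Y)" "!!i X. P (rel a i X)" shows "P X"
proof -
 from assms(1) obtain F where "X=(SUM i:UNIV. rel a i (F i))" by(auto simp:rels_def)
 moreover have "P (SUM i:A. rel a i (F i))" for A by(induction A rule:infinite_finite_induct) (simp_all add:assms)
 ultimately show ?thesis by simp
qed

lemma rel_in_rels: "rel a i X:rels a" unfolding rels_def
 by(rule image_eqI[where x = "%j. if j=i then X else 0"]) (simp_all add:rel_0 if_distrib[of "rel a _"] cong: if_cong)

lemma rels_closed: assumes "!!X Y. F (X + Y)=F X + F Y" "!!i X. F (rel a i X)=rel a' i (F' i X)" "X:rels a"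
 shows "F X:rels a'" using assms(3)
 by(induction rule:rels_induct) (simp_all add:assms additive_zero[of F] rels_0 rels_add rel_in_rels)

lemma rels_minus: "X:rels a ==> - X:rels a" by(rule rels_closed[where F' = "%i X. - X"]) (simp_all add:rel_minus)
lemma rels_diff: "X:rels a ==> Y:rels a ==> X - Y:rels a" using rels_add[of X a "- Y"] rels_minus[of Y a] by simp
lemma rels_act_cst: "X:rels a ==> act (cst c) X:rels a" by(rule rels_closed[where F' = "%i X. act (cst c) X"])
  (simp_all add:act_add rel_def euler_act_invariant der_act pd_cst act_diff)

text \<open>Left multiplication by an operator need not preserve a right ideal. The Euler operators
  of \<open>K\<close> commute with one another and with \<open>\<partial>_j\<close> for
  \<open>j\<close> outside \<open>K\<close>, hence with all relations, and this lets
  \<open>R\<close> act on the quotient.\<close>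

lemma euler_rel: "i:K ==> euler a i (rel a j X)=rel a j (euler a i X)"
 by(cases "j:K", simp_all add:rel_def euler_diff euler_commute[of a i]) (metis euler_der)

lemma rels_euler: "i:K ==> X:rels a ==> euler a i X:rels a"
 by(rule rels_closed[where F = "euler a i" and F' = "%j X. euler a i X"]) (simp_all add:euler_add euler_rel)

lemma rels_mon: assumes "!!i. i ~: K ==> a i=0" "X:rels a" shows "act (mon a) X:rels (%_. 0)"
proof(rule rels_closed[where F = "act (mon a)" and F' = "%i X. act (mon a) X"])
 show "act (mon a) (rel a i X)=rel (%_. 0) i (act (mon a) X)" for i X using assms(1)[of i] i0
  by(auto simp:rel_def euler_mon act_diff der_act pd_invariant rho_mon)
qed (insert assms, simp_all add:act_add)

definition invariant :: "('d=>nat)=>'r set" where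
 "invariant b={g. ALL i. b i > 0 --> rho i g=g}"

lemma invariant_0: "0:invariant b" by(simp add:invariant_def rho_0)
lemma invariant_add: "g:invariant b ==> h:invariant b ==> g + h:invariant b" by(simp add:invariant_def rho_add)
lemma invariant_mult: "g:invariant b ==> h:invariant b ==> g * h:invariant b" by(simp add:invariant_def rho_mult)
lemma invariant_cst: "cst c:invariant b" by(simp add:invariant_def rho_cst)
lemma invariant_sum: "(!!x. x:A ==> g x:invariant b) ==> sum g A:invariant b"
 by(induction A rule:infinite_finite_induct) (auto simp:invariant_0 invariant_add)

text \<open>Compare the coefficients of the lowest power of a variable \<open>z\<^sub>i\<close> whose exponents \<open>b\<^sub>i\<close> differ.\<close>

lemma monomial_independence: assumes "finite B" "!!b. b:B ==> h b:invariant b" "!!b i. b:B ==> b i<=bt i"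
  and "(SUM b:B. mon (%i. bt i - b i) * h b)=0" "b:B" shows "h b=0"
proof -
 have "(ALL b:B. h b:invariant b) ==> (ALL b:B. ALL i. b i<=bt i) ==> (SUM b:B. mon (%i. bt i - b i) * h b)=0 ==>
  (ALL b:B. h b=0)"
  using assms(1)
 proof(induction B rule:finite_psubset_induct)
 case (psubset B)
 note inv = psubset.prems(1)[rule_format] and le = psubset.prems(2)[rule_format]
 show ?case
 proof(cases "EX b:B. EX c:B. c~=b")
  case False
  hence "B={} | (EX b. B={b})" by blast
  thus ?thesis using psubset.prems(3) mon_regular by auto
 next
  case True
  then obtain b c where c0: "b:B" "c:B" "c~=b" by blast
  then obtain i where "c i~=b i" by(meson ext)
  note c = c0(1,2) this
  define m where "m=Max ((%b. b i) ` B)"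
  have m: "b' i<=m" if "b':B" for b' unfolding m_def using that psubset.hyps(1) by auto
  have "m:(%b. b i) ` B" unfolding m_def using psubset.hyps(1) c by(intro Max_in) auto
  then obtain bm where bm: "bm:B" "bm i=m" by auto
  have "m > 0" using m[OF c(1)] m[OF c(2)] c(3) by linarith
  define B1 where "B1={b':B. b' i=m}"
  have B1: "B1<=B" "B1~=B" "B - B1~=B"
  proof -
   have "b ~: B1 | c ~: B1" "bm:B1" using c(3) bm by(auto simp:B1_def)
   thus "B1~=B" "B - B1~=B" using c bm by blast+
   show "B1<=B" by(auto simp:B1_def)
  qed
  let ?t = "%b. mon (%j. bt j - b j) * h b"
  define bt' where "bt' b=(%j. if j=i then m - b i else bt j - b j)" for b :: "'d=>nat"
  have split:"mon (%j. bt j - b j)=mon (%j. if j=i then bt i - m else 0) * mon (bt' b)" if "b:B" for b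
  proof -
   have "(%j. bt j - b j)=(%j. (if j=i then bt i - m else 0) + bt' b j)"
    using m[OF that] le[OF bm(1), of i] le[OF that, of i] bm(2) by(auto simp:bt'_def fun_eq_iff)
   thus ?thesis by(simp add:mon_add)
  qed
  have "mon (%j. if j=i then bt i - m else 0) * (SUM b:B. mon (bt' b) * h b)=(SUM b:B. ?t b)"
   by(simp add:sum_distrib_left split mult.assoc)
  hence "(SUM b:B. mon (bt' b) * h b)=0" using psubset.prems(3) mon_regular by simp
  \<comment> \<open>After the common power of \<open>z i\<close> is cancelled, substituting 0 for
    \<open>z i\<close> keeps exactly the terms of \<open>B1\<close>; their coefficients are
    unchanged because \<open>m > 0\<close> makes them independent of \<open>z i\<close>.\<close>
  hence "rho i (SUM b:B. mon (bt' b) * h b)=0" by(simp add:rho_0)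
  moreover have "rho i (mon (bt' b) * h b)=(if b:B1 then mon (bt' b) * h b else 0)" if "b:B" for b
  proof(cases "b:B1")
   case True
   hence "rho i (h b)=h b" using inv[OF that] `m > 0` by(auto simp:B1_def invariant_def)
   thus ?thesis using True by(simp add:rho_mult rho_mon bt'_def B1_def)
  next
   case False
   hence "bt' b i > 0" using m[OF that] that by(auto simp:B1_def bt'_def)
   thus ?thesis using False by(simp add:rho_mult rho_mon)
  qed
  ultimately have "(SUM b:B1. mon (bt' b) * h b)=0"
   using psubset.hyps(1) B1(1) by(simp add:additive_sum[of "rho i", OF rho_add] sum.inter_restrict[symmetric] inf.absorb2)
  moreover have "(SUM b:B1. ?t b)=mon (%j. if j=i then bt i - m else 0) * (SUM b:B1. mon (bt' b) * h b)"
   unfolding sum_distrib_left by(rule sum.cong) (insert B1(1) split, auto simp:mult.assoc)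
  ultimately have 1: "(SUM b:B1. ?t b)=0" by simp
  hence 2: "(SUM b:B - B1. ?t b)=0" using psubset.hyps(1) psubset.prems(3) B1(1) by(simp add:sum_diff)
  have "ALL b:B1. h b=0" "ALL b:B - B1. h b=0"
   by(rule psubset.IH[OF _ _ _ 1], use B1 inv le in blast, use B1 inv le in blast, use B1 inv le in blast)
    (rule psubset.IH[OF _ _ _ 2], use B1 inv le in blast, use B1 inv le in blast, use B1 inv le in blast)
  thus ?thesis by blast
 qed
 qed
 thus ?thesis using assms by blast
qed

text \<open>Operators \<open>\<Sum> g\<^sub>b \<partial>\<^sup>b\<close>, with \<open>b\<close> supported in \<open>K\<close>, such that \<open>g\<^sub>b\<close> does not depend on \<open>z\<^sub>i\<close> if \<open>b\<^sub>i > 0\<close>.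
  They are a complement of the span of all \<open>rel a i X\<close> over polynomials in \<open>euler a i0\<close>.\<close>

definition normal :: "('d, 'r) ops set" where
 "normal={X. ALL b:supp X. (ALL i. i ~: K --> b i=0) & coef X b:invariant b}"

lemma normal_0: "0:normal" by(simp add:normal_def)

lemma normal_lookup: "X:normal ==> coef X b:invariant b"
 by(cases "b:supp X") (auto simp:normal_def in_keys_iff invariant_0)

lemma normal_add: "X:normal ==> Y:normal ==> X + Y:normal"
 using Poly_Mapping.keys_add[of X Y] normal_lookup[of X] normal_lookup[of Y]
 by(auto simp:normal_def lookup_add intro!:invariant_add)

lemma normal_single: "(!!i. i ~: K ==> b i=0) ==> g:invariant b ==> mono1 b g:normal" by(auto simp:normal_def)

definition shifted :: "('d=>nat)=>complex=>('d, 'r) ops=>('d, 'r) ops" where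
 "shifted a c X=euler a i0 X - act (cst c) X"

lemma shifted_add: "shifted a c (X + Y) = shifted a c X + shifted a c Y" by(simp add:shifted_def euler_add act_add)

lemma shifted_pow_add: "(shifted a c ^^ j) (X + Y)=(shifted a c ^^ j) X + (shifted a c ^^ j) Y"
 by(induction j) (simp_all add:shifted_add)

lemmas shifted_pow_0 = additive_zero[of "shifted a c ^^ j" for a c j, OF shifted_pow_add]
lemmas shifted_pow_diff = additive_diff[of "shifted a c ^^ j" for a c j, OF shifted_pow_add]
lemmas shifted_pow_sum = additive_sum[of "shifted a c ^^ j" for a c j, OF shifted_pow_add]

lemma rels_shifted: "X:rels a ==> shifted a c X:rels a" by(simp add:shifted_def rels_diff rels_euler i0 rels_act_cst)
lemma rels_shifted_pow: "X:rels a ==> (shifted a c ^^ j) X:rels a" by(induction j) (simp_all add:rels_shifted)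

lemma shifted_filt: "X:filt m ==> shifted a c X:filt (m + 1)"
 using filt_mono[of m "m + 1"] unfolding shifted_def by(intro filt_diff euler_filt act_filt) auto

lemma shifted_pow_filt: "X:filt m ==> (shifted a c ^^ j) X:filt (m + int j)"
 using shifted_filt[of _ "m + int j" for j] by(induction j) (auto simp:algebra_simps dest!:shifted_filt)

text \<open>The index \<open>m\<close> charges every factor \<open>shifted a c\<close> with order
  one. That \<open>filt m\<close> lies in \<open>normal_span a c m\<close> thus means that the
  expansion can be chosen without raising the order.\<close>

inductive_set normal_span :: "('d=>nat)=>complex=>int=>('d, 'r) ops set" for a c m where
 rels: "X:rels a ==> X:normal_span a c m"
| add:"X:normal_span a c m ==> Y:normal_span a c m ==> X + Y:normal_span a c m"
| gen: "X:normal ==> X:filt (m - int j) ==> (shifted a c ^^ j) X:normal_span a c m"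

lemma normal_span_mono: "X:normal_span a c m ==> m<=m' ==> X:normal_span a c m'"
proof(induction rule:normal_span.induct)
 case (gen X j)
 thus ?case using filt_mono[of "m - int j" "m' - int j"] by(intro normal_span.gen) auto
qed (auto intro:normal_span.intros)

lemma normal_span_shifted: "X:normal_span a c m ==> shifted a c X:normal_span a c (m + 1)"
proof(induction rule:normal_span.induct)
 case (gen X j)
 hence "(shifted a c ^^ Suc j) X:normal_span a c (m + 1)" by(intro normal_span.gen) auto
 thus ?case by simp
qed (auto simp:shifted_add rels_shifted intro:normal_span.intros)

lemma normal_act_cst: assumes "X:normal" shows "act (cst c) X:normal"
proof -
 have "supp (act (cst c) X) <= supp X" by(auto simp:in_keys_iff lookup_act)
 thus ?thesis using assms by(auto simp:normal_def lookup_act invariant_cst intro!:invariant_mult)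
qed

lemma act_cst_shifted: "act (cst c) (shifted a c' X) = shifted a c' (act (cst c) X)"
 by(simp add:shifted_def act_diff euler_act_invariant pd_cst act_commute[of "cst c"])

lemma act_cst_shifted_pow: "act (cst c) ((shifted a c' ^^ j) X)=(shifted a c' ^^ j) (act (cst c) X)"
 by(induction j) (simp_all add:act_cst_shifted)

lemma normal_span_act_cst: "X:normal_span a c m ==> act (cst k) X:normal_span a c m"
proof(induction rule:normal_span.induct)
 case (gen X j)
 thus ?case unfolding act_cst_shifted_pow by(intro normal_span.gen normal_act_cst act_filt)
qed (simp_all add:act_add rels_act_cst normal_span.rels normal_span.add)

lemma normal_span_diff: assumes "X:normal_span a c m" "Y:normal_span a c m" shows "X - Y:normal_span a c m"
proof -
 have "act (cst (-1)) Y = - Y" by(simp add:cst_minus cst_1 act_minus_left)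
 thus ?thesis using normal_span.add[OF assms(1) normal_span_act_cst[OF assms(2), of "-1"]] by simp
qed

text \<open>A derivative outside \<open>K\<close> is a relation up to lower order. Otherwise let
  \<open>b i > 0\<close> while \<open>g\<close> depends on \<open>z i\<close>, and write
  \<open>g = rho i g + z i * q\<close>. The first summand depends on one such variable less; in the
  second a factor \<open>z i \<partial>_i\<close> can be moved to the left, where modulo the
  relations it is a combination of \<open>shifted a c\<close> and a constant. Hence the double
  induction, on the order and on the number of such \<open>i\<close>.\<close>

lemma single_normal_span: "mono1 b g:normal_span a c (int (order_of b))"
proof(induction "order_of b" arbitrary: b g rule:less_induct)
 case less
 note IH = less
 show ?case
 proof(cases "EX i. i ~: K & b i > 0")
  case True
  then obtain i b' where i: "i ~: K" and b: "b=inc i b'" using pos_imp_inc by metis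
  have eq: "mono1 b g=rel a i (mono1 b' g) - mono1 b' (pd i g)" by(simp add:b rel_def i)
  have "mono1 b' (pd i g):normal_span a c (int (order_of b))" by(rule normal_span_mono[OF less]) (simp_all add:b)
  thus ?thesis unfolding eq by(intro normal_span_diff normal_span.rels[OF rel_in_rels])
 next
  case False
  define bad where "bad g={i. b i > 0 & rho i g~=g}" for g
  show ?thesis
  proof(induction "card (bad g)" arbitrary: g rule:less_induct)
   case less
   show ?case
   proof(cases "bad g={}")
    case True
    hence "g:invariant b" unfolding bad_def invariant_def by blast
    hence "mono1 b g:normal" using False by(intro normal_single) auto
    thus ?thesis using normal_span.gen[of "mono1 b g" _ 0] by(simp add:filt_single)
   next
    case ne: False
    then obtain i where i: "b i > 0" "rho i g~=g" by(auto simp:bad_def)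
    hence K: "i:K" using False by auto
    obtain q where q: "g=rho i g + z i * q" using rho_split[of g i] by(elim exE)
    obtain b' where b: "b=inc i b'" using pos_imp_inc[of b i] i(1) by auto
    let ?Y = "mono1 b' q" and ?m = "int (order_of b)"
    have e: "of_nat (e i)~=(0::complex)" using e_pos[OF K] by simp
    have "rho j g=g ==> rho j (rho i g)=rho i g" for j by(subst rho_rho) simp
    hence "bad (rho i g)<=bad g - {i}" by(auto simp:bad_def rho_idem)
    hence "card (bad (rho i g)) < card (bad g)" using i by(intro psubset_card_mono) (auto simp:bad_def)
    hence 1: "mono1 b (rho i g):normal_span a c ?m" by(rule less)
    have Y0: "mono1 b' h:normal_span a c (?m - 1)" for h using IH[of b' h] by(simp add:b)
    hence Y: "mono1 b' h:normal_span a c ?m" for h by(rule normal_span_mono) simp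
    have s: "shifted a c ?Y:normal_span a c ?m" using normal_span_shifted[OF Y0] by simp
    \<comment> \<open>The Euler operator of \<open>i\<close> is solved for
      \<open>z i \<partial>_i\<close> and then replaced by that of \<open>i0\<close>, at the cost of
      a relation.\<close>
    have "act (z i) (der i ?Y)=act (cst (of_nat (e i))) (euler a i ?Y - act (cst (of_nat (a i) / of_nat (e i))) ?Y)"
     using e by(simp add:euler_def act_add act_act cst_mult[symmetric] mult.assoc[symmetric] cst_1 del:act_single der_single)
    also have "... = act (cst (of_nat (e i))) (shifted a c ?Y + act (cst c) ?Y + rel a i ?Y - act (cst (of_nat (a i)
     / of_nat (e i))) ?Y)"
     by(simp add:K rel_def shifted_def del:act_single der_single)
    finally have "act (z i) (der i ?Y):normal_span a c ?m"
     by(simp only:) (intro normal_span_act_cst normal_span_diff normal_span.add s Y normal_span.rels[OF rel_in_rels])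
    hence "act (z i) (der i ?Y) - mono1 b' (z i * pd i q):normal_span a c ?m" by(rule normal_span_diff) (rule Y)
    hence 2: "mono1 b (z i * q):normal_span a c ?m" by(simp add:b act_add)
    show ?thesis using normal_span.add[OF 1 2] q by(simp add:single_add[symmetric])
   qed
  qed
 qed
qed

lemma filt_normal_span: "X:filt m ==> X:normal_span a c m" by(induction rule:filt_induct)
  (rule normal_span.rels[OF rels_0], erule (1) normal_span.add, erule normal_span_mono[OF single_normal_span])

lemma normal_span_sum: assumes "X:normal_span a c m"
 obtains y J where "!!j. y j:normal" "!!j. y j:filt (m - int j)" "!!j. j>=J ==> y j=0"
  "X - (SUM j<J. (shifted a c ^^ j) (y j)):rels a"
proof -
 have "EX y J. (ALL j. y j:normal & y j:filt (m - int j)) & (ALL j>=J. y j=0) & X - (SUM j<J. (shifted a c ^^ j) (y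
  j)):rels a"
  using assms
 proof(induction rule:normal_span.induct)
  case (rels X)
  thus ?case by(intro exI[of _ "%_. 0"] exI[of _ 0]) (simp add:normal_0 filt_0)
 next
  case (add X Y)
  let ?P = "%X x I. (ALL j. x j:normal & x j:filt (m - int j)) & (ALL j>=I. x j=0) & X - (SUM j<I. (shifted a c ^^ j)
   (x j)):rels a"
  obtain x I where x: "?P X x I" using add.IH(1) by(elim exE)
  obtain y J where y: "?P Y y J" using add.IH(2) by(elim exE)
  have ext: "(SUM j<I'. (shifted a c ^^ j) (x j))=(SUM j<max I' J'. (shifted a c ^^ j) (x j))"
   "(SUM j<I'. (shifted a c ^^ j) (x j))=(SUM j<max J' I'. (shifted a c ^^ j) (x j))"
   if "!!j. j>=I' ==> x j=0" for I' J' x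
   by(rule sum.mono_neutral_left; use that in \<open>auto simp:shifted_pow_0\<close>)+
  have eq: "X + Y - (SUM j<max I J. (shifted a c ^^ j) (x j + y j))=(X - (SUM j<I. (shifted a c ^^ j) (x j))) + (Y -
   (SUM j<J. (shifted a c ^^ j) (y j)))"
   by(simp add:shifted_pow_add sum.distrib ext(1)[of I x J] ext(2)[of J y I] x y)
  have "X + Y - (SUM j<max I J. (shifted a c ^^ j) (x j + y j)):rels a"
   unfolding eq using x y by(blast intro:rels_add)
  thus ?case using x y by(intro exI[of _ "%j. x j + y j"] exI[of _ "max I J"]) (simp add:normal_add filt_add)
 next
  case (gen X j)
  let ?y = "%k. if k=j then X else 0"
  have "(SUM k<Suc j. (shifted a c ^^ k) (?y k))=(SUM k<Suc j. if k=j then (shifted a c ^^ j) X else 0)"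
   by(rule sum.cong) (auto simp:shifted_pow_0)
  also have "... = (shifted a c ^^ j) X" by(subst sum.delta) auto
  finally have "(shifted a c ^^ j) X - (SUM k<Suc j. (shifted a c ^^ k) (?y k)):rels a" by(simp only:diff_self rels_0)
  moreover have "ALL k. ?y k:normal & ?y k:filt (m - int k)" "ALL k>=Suc j. ?y k=0"
   using gen by(auto simp:normal_0 filt_0)
  ultimately show ?case by(intro exI[of _ ?y] exI[of _ "Suc j"] conjI)
 qed
 then obtain y J where *: "(ALL j. y j:normal & y j:filt (m - int j)) & (ALL j>=J. y j=0) & X - (SUM j<J. (shifted a
  c ^^ j) (y j)):rels a" by(elim exE)
 from * have 1: "ALL j. y j:normal" and 2: "ALL j. y j:filt (m - int j)" and 3: "ALL j>=J. y j=0"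
  and 4: "X - (SUM j<J. (shifted a c ^^ j) (y j)):rels a" by blast+
 show ?thesis by(rule that[OF spec[OF 1] spec[OF 2] mp[OF spec[OF 3]] 4])
qed

end

text \<open>The ring is not assumed to be a domain, so degrees of products may drop. Recording the
  coefficient at an upper bound \<open>n\<close> of the degree, where \<open>u\<close> may be 0,
  gives an exact product rule.\<close>

definition top_coeff :: "'r::comm_ring_1 poly=>nat=>'r=>bool" where
 "top_coeff p n u <-> (ALL d>n. poly.coeff p d=0) & poly.coeff p n=u"

lemma top_coeff_mult: assumes "top_coeff p n u" "top_coeff q m v" shows "top_coeff (p * q) (n + m) (u * v)"
proof -
 have *: "poly.coeff p i * poly.coeff q j=0" if "i > n | j > m" for i j using assms that by(auto simp:top_coeff_def)
 have "poly.coeff (p * q) d=0" if "d > n + m" for d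
  unfolding coeff_mult by(rule sum.neutral) (insert that, auto intro!:*)
 moreover have "poly.coeff (p * q) (n + m)=(SUM i<=n + m. if i=n then u * v else 0)"
  unfolding coeff_mult by(rule sum.cong) (insert assms, auto simp:top_coeff_def intro!:*)
 ultimately show ?thesis by(simp add:top_coeff_def)
qed

lemma top_coeff_1: "top_coeff 1 0 1" by(simp add:top_coeff_def)
lemma top_coeff_const: "top_coeff [:c:] 0 c" by(simp add:top_coeff_def coeff_pCons split:nat.splits)
lemma top_coeff_linear: "top_coeff [:c, d:] 1 d" by(auto simp:top_coeff_def coeff_pCons split:nat.splits)

lemma top_coeff_power: "top_coeff p n u ==> top_coeff (p ^ k) (n * k) (u ^ k)"
 using top_coeff_mult[of p n u "p ^ k" "n * k" "u ^ k" for k] by(induction k) (simp_all add:top_coeff_1 algebra_simps)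

lemma top_coeff_prod:
 "finite A ==> (!!i. i:A ==> top_coeff (p i) (n i) (u i)) ==> top_coeff (prod p A) (sum n A) (prod u A)"
 by(induction A rule:finite_induct) (auto simp:top_coeff_1 intro:top_coeff_mult)

context coords begin

text \<open>Splitting off the linear factor of one root leaves a polynomial that vanishes at all
  larger integers, because differences of distinct integers are invertible constants.\<close>

lemma poly_eq_0_of_nat: assumes "!!nu. nu>=nu0 ==> poly P (of_nat nu::'r)=0" shows "P=0" using assms
proof(induction "degree P" arbitrary: P nu0 rule:less_induct)
 case less
 let ?x = "of_nat nu0::'r"
 let ?Q = "synthetic_div P ?x"
 have P: "P=[:- ?x, 1:] * ?Q" using synthetic_div_correct'[of ?x P] less.prems[of nu0] by simp
 show ?case
 proof(cases "degree P=0")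
  case True
  then obtain p where "P=[:p:]" by(metis degree_eq_zeroE)
  thus ?thesis using less.prems[of nu0] by simp
 next
  case False
  have "poly ?Q (of_nat nu)=0" if "nu>=Suc nu0" for nu
  proof -
   have "(of_nat nu - ?x) * poly ?Q (of_nat nu) = poly P (of_nat nu)" by(subst (2) P) (simp add:algebra_simps)
   hence "cst (of_nat nu - of_nat nu0) * poly ?Q (of_nat nu)=0"
    using less.prems[of nu] that by(simp add:cst_diff cst_of_nat)
   thus ?thesis using that by(subst (asm) cst_unit) auto
  qed
  hence "?Q=0" using False by(intro less.hyps[of ?Q "Suc nu0"]) (simp_all add:degree_synthetic_div)
  thus ?thesis using P by simp
 qed
qed

end

section \<open>Adjoints at monomials as polynomials in the exponent, and strictness\<close>

context crossing begin

text \<open>This is the exponent of \<open>f^nu z^a\<close> divided by the product of the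
  \<open>z i\<close>, \<open>i\<close> in \<open>K\<close>. The adjoint of
  \<open>z i \<partial>_i\<close> is \<open>- z i \<partial>_i - 1\<close>; lowering the exponent by
  one absorbs the -1, so that the adjoints of all \<open>euler a i\<close> have the same eigenvalue
  \<open>- nu\<close>.\<close>

definition weight :: "('d=>nat)=>nat=>'d=>nat" where
 "weight a nu i=(if i:K then e i * nu + a i - 1 else 0)"

lemma of_nat_weight: assumes "nu>=1" "i:K"
 shows "(of_nat (weight a nu i)::'b::comm_ring_1) = of_nat (e i) * of_nat nu + of_nat (a i) - 1"
proof -
 have "e i * nu + a i>=1" using assms e_pos[of i] by(simp add:Suc_le_eq)
 thus ?thesis using assms by(simp add:weight_def of_nat_diff)
qed

lemma minus_diff_commute: "- x - y = - y - (x::'r)" by simp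

lemma adj_euler: assumes "i:K" "nu>=1"
 shows "adj (euler a i X) (mon (weight a nu)) = cst (- of_nat nu) * adj X (mon (weight a nu))"
proof -
 let ?w = "mon (weight a nu)" and ?e = "of_nat (e i)::complex"
 have e: "?e~=0" using e_pos[OF assms(1)] by simp
 have "pd i (cst (1 / ?e) * z i * ?w) = cst (1 / ?e) * (?w + z i * pd i ?w)"
  unfolding mult.assoc pd_cst_mult by(simp add:pd_mult pd_z algebra_simps)
 also have "... = cst ((1 + of_nat (weight a nu i)) / ?e) * ?w"
  by(simp add:z_pd_mon cst_mult[symmetric] cst_of_nat[symmetric] distrib_left mult.assoc[symmetric]
   add_divide_distrib cst_add)
   (simp add:distrib_right)
 finally have "adj (euler a i X) ?w=adj X (- (cst ((1 + of_nat (weight a nu i)) / ?e) * ?w)) + adj X (cst (of_nat (a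
  i) / ?e) * ?w)"
  by(simp add:euler_def adj_add adj_act adj_der)
 also have "... = cst (- ((1 + of_nat (weight a nu i)) / ?e) + of_nat (a i) / ?e) * adj X ?w"
  by(simp add:adj_minus_right adj_cst cst_add cst_minus cst_diff left_diff_distrib)
 also have "- ((1 + of_nat (weight a nu i)) / ?e) + of_nat (a i) / ?e = - of_nat nu"
  using e assms by(simp add:of_nat_weight field_simps)
 finally show ?thesis .
qed

text \<open>The equal eigenvalues cancel in the differences. So for each \<open>nu\<close> the
  adjoint at this monomial depends on an operator only modulo the relations.\<close>

lemma adj_rels: assumes "X:rels a" "nu>=1" shows "adj X (mon (weight a nu))=0" using assms(1)
proof(induction rule:rels_induct)
 case (rel i X)
 show ?case
 proof(cases "i:K")
  case False
  hence "pd i (mon (weight a nu))=0" by(simp add:pd_invariant rho_mon weight_def)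
  thus ?thesis using False by(simp add:rel_def adj_der additive_zero[of "adj X", OF adj_add_right])
 qed (simp add:rel_def adj_diff adj_euler[OF _ assms(2)] i0)
qed (simp_all add:adj_0 adj_add)

lemma adj_shifted_pow: assumes "nu>=1"
 shows "adj ((shifted a c ^^ j) X) (mon (weight a nu)) = cst ((- of_nat nu - c) ^ j) * adj X (mon (weight a nu))"
proof(induction j)
 case (Suc j)
 have "adj ((shifted a c ^^ Suc j) X) (mon (weight a nu)) = cst (- of_nat nu - c) * adj ((shifted a c ^^ j) X) (mon
  (weight a nu))"
  by(simp add:shifted_def adj_diff adj_euler[OF i0 assms] adj_act adj_cst cst_diff algebra_simps)
 thus ?case by(simp add:Suc cst_mult mult.assoc)
qed (simp add:cst_1)

text \<open>The factor that \<open>(-\<partial>)^b\<close> produces at the weight, as a polynomial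
  in \<open>nu\<close>. Its degree is the order of \<open>b\<close>, with an invertible leading
  coefficient if \<open>b\<close> is supported in \<open>K\<close>.\<close>

definition pfac :: "('d=>nat)=>('d=>nat)=>'r poly" where
 "pfac a b=[:cst ((-1) ^ order_of b):] * (PROD i:UNIV. PROD k<b i. [:cst (of_nat (a i) - 1 - of_nat k), cst (of_nat
  (e i)):])"

lemma poly_pfac: assumes "nu>=1" "!!i. i ~: K ==> b i=0" "!!i. b i<=weight a nu i"
 shows "poly (pfac a b) (of_nat nu) = cst ((-1) ^ order_of b * of_nat (PROD i:UNIV. falling (weight a nu i) (b i)))"
proof -
 have *: "(PROD k<b i. cst (of_nat (a i) - 1 - of_nat k) + of_nat nu * of_nat (e i)) = of_nat (falling (weight a nu
  i) (b i))" for i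
  unfolding falling_def of_nat_prod
 proof(rule prod.cong)
  fix k assume k: "k:{..<b i}"
  hence "i:K" using assms(2) by fastforce
  have "of_nat (weight a nu i - k) = cst (of_nat (weight a nu i) - of_nat k)"
   using k assms(3)[of i] by(simp add:of_nat_diff cst_diff cst_of_nat)
  thus "cst (of_nat (a i) - 1 - of_nat k) + of_nat nu * of_nat (e i) = of_nat (weight a nu i - k)"
   by(simp add:of_nat_weight[OF assms(1) `i : K`] cst_diff cst_add cst_mult cst_of_nat cst_1 algebra_simps)
 qed simp
 show ?thesis unfolding pfac_def poly_mult poly_prod cst_mult cst_of_nat unfolding of_nat_prod by(simp add:*)
qed

lemma top_coeff_pfac: "top_coeff (pfac a b) (order_of b) (cst ((-1) ^ order_of b * (PROD i:UNIV. of_nat (e i) ^ b i)))"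
proof -
 have "top_coeff (PROD i:UNIV. PROD k<b i. [:cst (of_nat (a i) - 1 - of_nat k), cst (of_nat (e i)):]) (SUM i:UNIV.
  SUM k<b i. 1) (PROD i:UNIV. PROD k<b i. cst (of_nat (e i)))"
  by(intro top_coeff_prod top_coeff_linear) auto
 hence "top_coeff (pfac a b) (0 + (SUM i:UNIV. SUM k<b i. 1)) (cst ((-1) ^ order_of b) * (PROD i:UNIV. PROD k<b i.
  cst (of_nat (e i))))"
  unfolding pfac_def by(intro top_coeff_mult top_coeff_const)
 moreover have "cst (PROD i:A. of_nat (e i) ^ b i)=(PROD i:A. PROD k<b i. cst (of_nat (e i)))" for A
  by(induction A rule:infinite_finite_induct) (simp_all add:cst_1 cst_mult cst_power)
 ultimately show ?thesis by(simp add:order_of_def cst_mult)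
qed

text \<open>The coefficients pass through the derivatives because \<open>X\<close> is normal, and
  \<open>mon bt\<close> clears the denominators \<open>z^b\<close>.\<close>

lemma adj_normal: assumes "X:normal" "nu>=1" "finite B" "supp X<=B"
  and "!!b i. b:B ==> b i<=weight a nu i" "!!b i. b:B ==> b i<=bt i" "!!b i. b:B ==> i ~: K ==> b i=0"
 shows "mon bt * adj X (mon (weight a nu))=mon (weight a nu) * (SUM b:B. mon (%i. bt i - b i) * poly (pfac a b)
  (of_nat nu) * coef X b)"
proof -
 let ?w = "weight a nu"
 have "mon bt * multi_pow npd b (coef X b * mon ?w)=mon ?w * (mon (%i. bt i - b i) * poly (pfac a b) (of_nat nu) *
  coef X b)" if b: "b:B" for b
 proof -
  let ?c = "cst ((-1) ^ order_of b * of_nat (PROD i:UNIV. falling (?w i) (b i)))"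
  have "multi_pow npd b (coef X b * mon ?w) = coef X b * multi_pow npd b (mon ?w)"
   using normal_lookup[OF assms(1), of b] by(intro multi_npd_mult pd_invariant) (auto simp:invariant_def)
  hence "mon bt * multi_pow npd b (coef X b * mon ?w)=?c * coef X b * (mon bt * mon (%i. ?w i - b i))"
   by(simp only:multi_npd_mon ac_simps)
  also have "mon bt * mon (%i. ?w i - b i)=mon (%i. bt i - b i) * mon ?w"
   unfolding mon_add[symmetric] using assms(5,6)[OF b] by(intro arg_cong[of _ _ mon]) (auto simp:fun_eq_iff)
  also have "?c = poly (pfac a b) (of_nat nu)" using assms(5,7) b by(intro poly_pfac[OF assms(2), symmetric]) auto
  finally show ?thesis by(simp only:ac_simps)
 qed
 moreover have "adj X (mon ?w)=(SUM b:B. multi_pow npd b (coef X b * mon ?w))"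
  unfolding adj_def by(rule lin_superset) (insert assms, auto simp:multi_npd_0)
 ultimately show ?thesis by(simp add:sum_distrib_left)
qed

lemma coeff_invariant_mult: assumes "!!d. poly.coeff p d:invariant b" "!!d. poly.coeff q d:invariant b"
 shows "poly.coeff (p * q) d:invariant b" unfolding coeff_mult by(intro invariant_sum invariant_mult assms)

lemma coeff_invariant_const: "c:invariant b ==> poly.coeff [:c:] d:invariant b" by(cases d) (auto simp:invariant_0)

lemma coeff_invariant_linear: "poly.coeff [:cst c, cst c':] d:invariant b"
 by(auto simp:coeff_pCons invariant_0 invariant_cst split:nat.split)

lemma coeff_invariant_1: "poly.coeff 1 d:invariant b" using invariant_cst[of 1 b] by(simp add:cst_1 invariant_0)

lemma coeff_invariant_prod: "(!!i d. i:A ==> poly.coeff (p i) d:invariant b) ==> poly.coeff (prod p A) d:invariant b"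
proof(induction A arbitrary: d rule:infinite_finite_induct)
 case (insert x A)
 thus ?case by(simp add:coeff_invariant_mult)
qed (metis prod.infinite coeff_invariant_1, metis prod.empty coeff_invariant_1)

lemma coeff_invariant_power: "(!!d. poly.coeff p d:invariant b) ==> poly.coeff (p ^ k) d:invariant b"
 by(induction k arbitrary: d) (simp_all only:power_0 power_Suc coeff_invariant_mult coeff_invariant_1)

lemma coeff_invariant_pfac: "poly.coeff (pfac a b') d:invariant b" unfolding pfac_def
 by(intro coeff_invariant_mult coeff_invariant_const invariant_cst coeff_invariant_prod coeff_invariant_linear)

text \<open>The adjoint detects the order of a combination of normal operators.\<close>

lemma normal_order: assumes y: "!!j. y j:normal" "!!j. j>=J ==> y j=0" and G: "!!d. d>=m ==> poly.coeff G d=0"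
  and eq: "!!nu. nu>=nu0 ==> mon bt * adj (SUM j<J. (shifted a c ^^ j) (y j)) (mon (weight a nu))=mon (weight a nu) *
   poly G (of_nat nu)"
 shows "y j:filt (int m - 1 - int j)"
proof -
 define B where "B=(\<Union>j<J. supp (y j))"
 have fin: "finite B" by(simp add:B_def)
 have suppB: "b i=0" if "b:B" "i ~: K" for b i using y(1) that unfolding B_def normal_def by blast
 have keysB: "supp (y j)<=B" for j using y(2)[of j] by(cases "j < J") (auto simp:B_def)
 define bt0 where "bt0 i=(SUM b:B. b i)" for i
 have bt0: "b i<=bt0 i" if "b:B" for b i unfolding bt0_def using that fin by(intro member_le_sum) auto
 let ?bt = "%i. bt i + bt0 i"
 \<comment> \<open>The factor by which the adjoint of \<open>shifted a c\<close> acts, as a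
   polynomial in \<open>nu\<close>; \<open>r b\<close> collects the coefficients of
   \<open>\<partial>^b\<close> over all powers.\<close>
 define q where "q=[:cst (- c), cst (-1):]"
 define r where "r b=(SUM j<J. q ^ j * [:coef (y j) b:])" for b
 define L where "L=(SUM b:B. [:mon (%i. ?bt i - b i):] * (pfac a b * r b))"
 \<comment> \<open>From here on the weight dominates every \<open>b\<close> in \<open>B\<close>, so
   that the truncated subtraction of exponents is exact.\<close>
 define nu1 where "nu1=Suc (nu0 + (SUM i:UNIV. bt0 i))"
 have "poly (L - [:mon bt0:] * G) (of_nat nu)=0" if nu: "nu>=nu1" for nu
 proof -
  let ?w = "mon (weight a nu)"
  have 1: "nu>=1" "nu>=nu0" using nu by(simp_all add:nu1_def)
  have le: "b i<=weight a nu i" if "b:B" for b i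
  proof(cases "i:K")
   case True
   have "bt0 i<=(SUM i:UNIV. bt0 i)" by(intro member_le_sum) auto
   hence "b i + 1<=1 * nu" using bt0[OF that, of i] nu by(simp add:nu1_def)
   also have "... <= e i * nu" using e_pos[OF True] by(intro mult_right_mono) auto
   finally show ?thesis using True by(simp add:weight_def)
  qed (simp add:suppB[OF that])
  have "poly r' (of_nat nu)=(SUM j<J. cst ((- of_nat nu - c) ^ j) * coef (y j) b)"
   if "r'=r b" for b r' unfolding that r_def q_def
   by(simp add:minus_diff_commute[of "cst c"] mult.commute poly_sum cst_power cst_diff cst_minus cst_of_nat cst_1)
  hence r: "poly (r b) (of_nat nu)=(SUM j<J. cst ((- of_nat nu - c) ^ j) * coef (y j) b)" for b by simp
  have "?w * poly L (of_nat nu)=?w * (SUM b:B. SUM j<J. cst ((- of_nat nu - c) ^ j) * (mon (%i. ?bt i - b i) * poly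
   (pfac a b) (of_nat nu) * coef (y j) b))"
   unfolding L_def by(simp add:poly_sum r sum_distrib_left ac_simps)
  also have "... = (SUM j<J. cst ((- of_nat nu - c) ^ j) * (?w * (SUM b:B. mon (%i. ?bt i - b i) * poly (pfac a b)
   (of_nat nu) * coef (y j) b)))"
   by(subst sum.swap) (simp add:sum_distrib_left ac_simps)
  also have "... = (SUM j<J. cst ((- of_nat nu - c) ^ j) * (mon ?bt * adj (y j) ?w))"
   by(rule sum.cong[OF refl], subst adj_normal[OF y(1) 1(1) fin keysB]) (simp_all add:le suppB bt0 trans_le_add2)
  also have "... = mon bt0 * (mon bt * adj (SUM j<J. (shifted a c ^^ j) (y j)) ?w)"
   by(simp add:adj_sum adj_shifted_pow[OF 1(1)] sum_distrib_left mon_add ac_simps)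
  also have "... = ?w * (mon bt0 * poly G (of_nat nu))" by(simp add:eq 1 ac_simps)
  finally show ?thesis by(simp add:mon_cancel)
 qed
 hence "L - [:mon bt0:] * G=0" by(rule poly_eq_0_of_nat)
 hence L: "L=[:mon bt0:] * G" by simp
 have cr: "poly.coeff (pfac a b * r b) d:invariant b" if "b:B" for b d
 proof(rule coeff_invariant_mult[OF coeff_invariant_pfac])
  have "poly.coeff (q ^ j * [:coef (y j) b:]) d:invariant b" for j d
   unfolding q_def by(intro coeff_invariant_mult coeff_invariant_power coeff_invariant_linear coeff_invariant_const
    normal_lookup y)
  thus "poly.coeff (r b) d:invariant b" for d by(simp add:r_def coeff_sum invariant_sum)
 qed
 \<comment> \<open>At each power of \<open>nu\<close> there is a vanishing sum of monomials with
   invariant coefficients, so each \<open>b\<close> vanishes separately.\<close>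
 have zero: "poly.coeff (pfac a b * r b) d=0" if "d>=m" "b:B" for b d
 proof(rule monomial_independence[OF fin cr _ _ that(2), where bt = ?bt])
  have "(SUM b:B. mon (%i. ?bt i - b i) * poly.coeff (pfac a b * r b) d) = poly.coeff L d"
   unfolding L_def by(simp add:coeff_sum)
  thus "(SUM b:B. mon (%i. ?bt i - b i) * poly.coeff (pfac a b * r b) d)=0" using G[OF that(1)] by(simp add:L)
 qed (insert bt0, auto intro:trans_le_add2)
 have "coef (y j) b=0" if b: "b:B" and j: "j + order_of b>=m" for b j
 proof(rule ccontr)
  assume ne: "coef (y j) b~=0"
  \<comment> \<open>The largest power of \<open>shifted a c\<close> in which
    \<open>\<partial>^b\<close> occurs supplies the top coefficient of
    \<open>pfac a b * r b\<close>, at index \<open>order_of b + j0\<close>. This index is at least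
    \<open>m\<close>, so the coefficient would have to vanish.\<close>
  define j0 where "j0=Max {j. coef (y j) b~=0}"
  have f: "finite {j. coef (y j) b~=0}"
  proof(rule finite_subset)
   show "{j. coef (y j) b~=0}<={..<J}"
   proof
    fix x assume "x:{j. coef (y j) b~=0}"
    thus "x:{..<J}" using y(2)[of x] by(cases "x < J") auto
   qed
  qed simp
  have "{j. coef (y j) b~=0}~={}" using ne by blast
  hence j0: "coef (y j0) b~=0" using Max_in[OF f] unfolding j0_def by simp
  have le: "k<=j0" if "coef (y k) b~=0" for k unfolding j0_def using f that by(intro Max_ge) auto
  have gt: "coef (y k) b=0" if "k > j0" for k using le[of k] that by(cases "coef (y k) b=0") auto
  have j0J: "j0 < J" using j0 y(2)[of j0] by(cases "j0 < J") auto
  have qk: "top_coeff (q ^ k * [:coef (y k) b:]) k (cst ((-1) ^ k) * coef (y k) b)" for k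
   using top_coeff_mult[OF top_coeff_power[OF top_coeff_linear, of "cst (- c)" "cst (-1)" k] top_coeff_const]
   by(simp add:q_def cst_power)
  have "top_coeff (r b) j0 (cst ((-1) ^ j0) * coef (y j0) b)" unfolding top_coeff_def
  proof(intro conjI allI impI)
   fix d assume "j0 < d"
   show "poly.coeff (r b) d=0" unfolding r_def coeff_sum
   proof(rule sum.neutral, rule ballI)
    fix k show "poly.coeff (q ^ k * [:coef (y k) b:]) d=0"
     using qk[of k] gt[of k] `j0 < d` by(cases "k<=j0") (auto simp:top_coeff_def)
   qed
  next
   have "poly.coeff (r b) j0=(SUM k<J. if k=j0 then cst ((-1) ^ j0) * coef (y j0) b else 0)" unfolding r_def coeff_sum
   proof(rule sum.cong)
    fix k show "poly.coeff (q ^ k * [:coef (y k) b:]) j0=(if k=j0 then cst ((-1) ^ j0) * coef (y j0) b else 0)"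
     using qk[of k] gt[of k] by(cases k j0 rule:linorder_cases) (auto simp:top_coeff_def)
   qed simp
   thus "poly.coeff (r b) j0 = cst ((-1) ^ j0) * coef (y j0) b" using j0J by simp
  qed
  from top_coeff_mult[OF top_coeff_pfac[of a b] this]
  have "cst ((-1) ^ order_of b * (PROD i:UNIV. of_nat (e i) ^ b i)) * (cst ((-1) ^ j0) * coef (y j0) b)=0"
   using zero[of "order_of b + j0" b] b j le[OF ne] by(simp add:top_coeff_def)
  moreover have "(PROD i:UNIV. of_nat (e i) ^ b i)~=(0::complex)"
  proof -
   have "of_nat (e i) ^ b i~=(0::complex)" for i using suppB[OF b, of i] e_pos[of i] by(cases "i:K") auto
   thus ?thesis by simp
  qed
  ultimately show False using j0 by(subst (asm) cst_unit, simp) (subst (asm) cst_unit, simp_all)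
 qed
 hence "order_of b + j < m" if "b:supp (y j)" for b
  using that keysB[of j] by(metis add.commute in_keys_iff not_le subsetD)
 thus ?thesis unfolding filt_def by fastforce
qed

lemma pd_poly: "pd i (poly P (of_nat nu)) = poly (map_poly (pd i) P) (of_nat nu)"
proof(induction P)
 case (pCons p P)
 thus ?case by(subst map_poly_pCons) (simp_all add:pd_0 pd_add pd_mult pd_of_nat)
qed (simp add:pd_0)

text \<open>A derivative that falls on the monomial produces a factor linear in \<open>nu\<close>,
  so the degree grows by at most one per derivative; \<open>bt\<close> clears the powers of the
  \<open>z i\<close> that appear in denominators.\<close>

lemma filt_adj_poly: assumes "X:filt m"
 obtains bt G where "!!d. int d > m ==> poly.coeff G d=0"
  "!!nu. nu>=1 ==> mon bt * adj X (mon (weight a nu))=mon (weight a nu) * poly G (of_nat nu)"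
proof -
 have mono: "EX G. (ALL d > order_of b. poly.coeff G d=0) & (ALL nu>=1. mon b * multi_pow npd b (g * mon (weight a
  nu))=mon (weight a nu) * poly G (of_nat nu))" for b g
 proof(induction b rule:inc_induct)
  case zero
  show ?case by(rule exI[of _ "[:g:]"]) (auto simp:coeff_pCons mult.commute split:nat.split)
 next
  case (inc i b)
  then obtain G where G: "!!d. d > order_of b ==> poly.coeff G d=0"
   and eq: "!!nu. nu>=1 ==> mon b * multi_pow npd b (g * mon (weight a nu))=mon (weight a nu) * poly G (of_nat nu)" by blast
  \<comment> \<open>\<open>C\<close> is the exponent of \<open>z i\<close> in the weight as a
    polynomial in \<open>nu\<close>. \<open>G'\<close> is what the product rule gives for
    \<open>- z i \<partial>_i\<close>, with \<open>b i\<close> correcting for the derivative of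
    \<open>mon b\<close>.\<close>
  define C :: "'r poly" where "C=(if i:K then [:of_nat (a i) - 1, of_nat (e i):] else 0)"
  define G' where "G'=Polynomial.smult (of_nat (b i)) G - C * G - Polynomial.smult (z i) (map_poly (pd i) G)"
  have top: "top_coeff C 1 (poly.coeff C 1)" "top_coeff G (order_of b) (poly.coeff G (order_of b))"
   using G by(auto simp:C_def top_coeff_def coeff_pCons split:nat.split)
  have "poly.coeff G' d=0" if "d > order_of (inc i b)" for d
   using top_coeff_mult[OF top] that G[of d] by(auto simp:G'_def top_coeff_def coeff_map_poly pd_0)
  moreover have "mon (inc i b) * multi_pow npd (inc i b) (g * mon (weight a nu))=mon (weight a nu) * poly G' (of_nat
   nu)" if nu: "nu>=1" for nu
  proof -
   let ?w = "mon (weight a nu)" and ?g = "poly G (of_nat nu)"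
   let ?u = "multi_pow npd b (g * ?w)"
   have C: "poly C (of_nat nu) = of_nat (weight a nu i)"
    using nu by(cases "i:K") (simp_all add:C_def of_nat_weight algebra_simps, simp add:weight_def)
   have "z i * pd i (mon b * ?u)=mon b * (z i * pd i ?u) + ?u * (z i * pd i (mon b))"
    by(simp add:pd_mult algebra_simps)
   hence "mon (inc i b) * multi_pow npd (inc i b) (g * ?w) = of_nat (b i) * (mon b * ?u) - z i * pd i (mon b * ?u)"
    by(simp add:mon_inc multi_npd_inc z_pd_mon algebra_simps)
   also have "... = of_nat (b i) * (?w * ?g) - (?w * (z i * pd i ?g) + ?g * (z i * pd i ?w))"
    unfolding eq[OF nu] by(simp add:pd_mult algebra_simps)
   also have "... = ?w * poly G' (of_nat nu)" unfolding z_pd_mon pd_poly by(simp add:G'_def C algebra_simps)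
   finally show ?thesis .
  qed
  ultimately show ?case by blast
 qed
 have "EX bt G. (ALL d. int d > m --> poly.coeff G d=0) & (ALL nu>=1. mon bt * adj X (mon (weight a nu))=mon (weight
  a nu) * poly G (of_nat nu))"
  using assms
 proof(induction rule:filt_induct)
  case zero
  show ?case by(intro exI[of _ "%_. 0"] exI[of _ 0]) (simp add:adj_0)
 next
  case (add X Y)
  then obtain bt G where G: "ALL d. int d > m --> poly.coeff G d=0"
   "ALL nu>=1. mon bt * adj X (mon (weight a nu))=mon (weight a nu) * poly G (of_nat nu)" by blast
  from add obtain ga H where H: "ALL d. int d > m --> poly.coeff H d=0"
   "ALL nu>=1. mon ga * adj Y (mon (weight a nu))=mon (weight a nu) * poly H (of_nat nu)" by blast
  have "mon (%i. bt i + ga i) * adj (X + Y) (mon (weight a nu))=mon (weight a nu) * poly (Polynomial.smult (mon ga) G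
   + Polynomial.smult (mon bt) H) (of_nat nu)" if "nu>=1" for nu
  proof -
   have "mon (%i. bt i + ga i) * adj (X + Y) (mon (weight a nu))=mon ga * (mon bt * adj X (mon (weight a nu))) + mon
    bt * (mon ga * adj Y (mon (weight a nu)))"
    by(simp add:adj_add mon_add algebra_simps)
   also have "... = mon (weight a nu) * poly (Polynomial.smult (mon ga) G + Polynomial.smult (mon bt) H) (of_nat nu)"
    using G(2) H(2) that by(simp add:algebra_simps)
   finally show ?thesis .
  qed
  thus ?case using G(1) H(1)
   by(intro exI[of _ "%i. bt i + ga i"] exI[of _ "Polynomial.smult (mon ga) G + Polynomial.smult (mon bt) H"]) simp
 next
  case (single b g)
  obtain G where "ALL d > order_of b. poly.coeff G d=0" "ALL nu>=1. mon b * multi_pow npd b (g * mon (weight a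
   nu))=mon (weight a nu) * poly G (of_nat nu)" using mono[of b g] by blast
  thus ?case using single by(intro exI[of _ b] exI[of _ G]) auto
 qed
 thus ?thesis using that by blast
qed

text \<open>Expand \<open>X\<close> in normal operators. The adjoint of \<open>z^a X\<close> at the
  weight for 0 is that of \<open>X\<close> at the weight for \<open>a\<close>, as the two monomials
  differ by \<open>z^a\<close>. It is also the adjoint of \<open>P\<close>, which has degree at most
  \<open>m\<close> in \<open>nu\<close>; so by \<open>normal_order\<close> every term of the
  expansion has order at most \<open>m\<close>, and the expansion itself serves as
  \<open>Y\<close>.\<close>

lemma strictness: assumes P: "P:filt m" and a: "!!i. i ~: K ==> a i=0" and X: "P - act (mon a) X:rels (%_. 0)"
 obtains Y where "Y:filt m" "X - Y:rels a"
proof -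
 obtain k where "X:filt (int k)" using filt_exhaustive by blast
 hence "X:normal_span a 0 (int k)" by(rule filt_normal_span)
 then obtain y J where y: "!!j. y j:normal" "!!j. y j:filt (int k - int j)" "!!j. j>=J ==> y j=0"
  and Xy: "X - (SUM j<J. (shifted a 0 ^^ j) (y j)):rels a" by(rule normal_span_sum) blast
 let ?Y = "SUM j<J. (shifted a 0 ^^ j) (y j)"
 obtain bt G where G: "!!d. int d > m ==> poly.coeff G d=0"
  and eq: "!!nu. nu>=1 ==> mon bt * adj P (mon (weight (%_. 0) nu))=mon (weight (%_. 0) nu) * poly G (of_nat nu)"
  using filt_adj_poly[OF P] by blast
 have "mon (%i. a i + bt i) * adj ?Y (mon (weight a nu))=mon (weight a nu) * poly G (of_nat nu)" if nu: "nu>=1" for nu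
 proof -
  have "weight a nu i=a i + weight (%_. 0) nu i" for i
  proof(cases "i:K")
   case True
   hence "e i * nu>=1" using e_pos[OF True] nu by(simp add:Suc_le_eq)
   thus ?thesis using True by(simp add:weight_def)
  qed (simp add:weight_def a)
  hence w: "mon (weight a nu)=mon a * mon (weight (%_. 0) nu)"
   unfolding mon_add[symmetric] by(intro arg_cong[of _ _ mon]) auto
  have "adj ?Y (mon (weight a nu))=adj X (mon (weight a nu))" using adj_rels[OF Xy nu] by(simp add:adj_diff)
  also have "... = adj (act (mon a) X) (mon (weight (%_. 0) nu))" by(simp add:w adj_act)
  also have "... = adj P (mon (weight (%_. 0) nu))" using adj_rels[OF X nu] by(simp add:adj_diff)
  finally have "mon (%i. a i + bt i) * adj ?Y (mon (weight a nu))=mon a * (mon bt * adj P (mon (weight (%_. 0) nu)))"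
   by(simp add:mon_add mult.assoc)
  thus ?thesis unfolding eq[OF nu] w by(simp add:mult.assoc)
 qed
 \<comment> \<open>The detour through \<open>nat\<close> covers negative \<open>m\<close>, for which
   both filtration steps are 0.\<close>
 hence "y j:filt (int (nat (m + 1)) - 1 - int j)" for j
  by(intro normal_order[OF y(1,3), where G = G and ?nu0.0 = 1 and bt = "%i. a i + bt i" and a = a and c = 0])
   (use G in auto)
 hence yj: "y j:filt (m - int j)" for j
  by(cases "m >= -1") (auto simp:filt_neg dest:meta_spec[of _ j] elim!:order.trans)
 have "?Y:filt m"
 proof(rule filt_sum)
  fix j show "(shifted a 0 ^^ j) (y j):filt m"
   using shifted_pow_filt[OF yj[of j], where a = a and c = 0 and j = j] by simp
 qed
 thus ?thesis using Xy that by blast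
qed

end

subsection \<open>Jordan blocks on a graded piece\<close>

definition ind :: "'d set=>'d=>nat" where "ind I i=(if i:I then 1 else 0)"

lemma ind_insert: "i ~: I ==> ind (insert i I)=inc i (ind I)" by(auto simp:ind_def inc_apply fun_eq_iff)
lemma ind_empty: "ind {}=(%_. 0)" by(simp add:ind_def fun_eq_iff)

section \<open>Splitting coefficients by their dependence on the variables of a list\<close>

context coords begin

text \<open>For a term \<open>g \<partial>^b\<close> the eigenvalue 0 means that
  \<open>b i = 0\<close> and \<open>z i\<close> divides \<open>g\<close>. The eigenvalue 1 means
  that \<open>b i > 0\<close> or \<open>g\<close> is free of \<open>z i\<close>; then
  \<open>z i\<close> can be split off on the left only after applying
  \<open>z i \<partial>_i\<close>.\<close>

definition rho_if :: "('d=>nat)=>'d=>'r=>'r" where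
 "rho_if b i g=(if b i > 0 then g else rho i g)"

text \<open>The commuting projections \<open>rho_if b i\<close>, for \<open>i\<close> in a list, split the ring into simultaneous
  eigenspaces; \<open>part b is q\<close> projects to those with exactly \<open>q\<close> eigenvalues 1.\<close>

primrec part :: "('d=>nat)=>'d list=>nat=>'r=>'r" where
 "part b [] q g=(if q=0 then g else 0)"
| "part b (i # is) q g=(if q=0 then 0 else rho_if b i (part b is (q - 1) g)) + (part b is q g - rho_if b i (part b is q g))"

lemma rho_if_add: "rho_if b i (g + h)=rho_if b i g + rho_if b i h" by(simp add:rho_if_def rho_add)

lemmas rho_if_0 = additive_zero[of "rho_if b i" for b i, OF rho_if_add]
lemmas rho_if_diff = additive_diff[of "rho_if b i" for b i, OF rho_if_add]

lemma rho_if_idem: "rho_if b i (rho_if b i g)=rho_if b i g" by(simp add:rho_if_def rho_idem)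

lemma part_add: "part b is q (g + h) = part b is q g + part b is q h"
 by(induction "is" arbitrary: q) (simp_all add:rho_if_add)

lemmas part_0 = additive_zero[of "part b is q" for b "is" q, OF part_add]
lemmas part_diff = additive_diff[of "part b is q" for b "is" q, OF part_add]
lemma part_commute: assumes "!!g h. F (g + h)=F g + F h" "!!i g. i:set is ==> F (rho_if b i g)=rho_if b i (F g)"
 shows "F (part b is q g) = part b is q (F g)" using assms(2)
 by(induction "is" arbitrary: q) (simp_all add:assms(1) additive_zero[of F] additive_diff[of F])

lemma part_rho_if: "rho_if b i (part b is q g) = part b is q (rho_if b i g)"
 by(rule part_commute) (simp add:rho_if_add, auto simp:rho_if_def intro:rho_rho)

lemma part_rho: "rho i (part b is q g) = part b is q (rho i g)"
 by(rule part_commute) (auto simp:rho_add rho_if_def intro:rho_rho)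

lemma part_cst: "cst c * part b is q g = part b is q (cst c * g)"
 by(rule part_commute) (auto simp:distrib_left rho_if_def rho_mult rho_cst)

lemma part_z: "i ~: set is ==> z i * part b is q g = part b is q (z i * g)"
 by(rule part_commute) (auto simp:distrib_left rho_if_def rho_mult rho_z)

lemma part_beyond: "q > length is ==> part b is q g=0" by(induction "is" arbitrary: q) (auto simp:rho_if_0)

lemma part_total: "(SUM q<=length is. part b is q g)=g"
proof(induction "is")
 case (Cons i "is")
 let ?n = "length is"
 have 1: "(SUM q<=Suc ?n. if q=0 then 0 else rho_if b i (part b is (q - 1) g))=rho_if b i g"
  by(subst sum.atMost_Suc_shift) (simp add:additive_sum[of "rho_if b i", OF rho_if_add, symmetric] Cons)
 have "(SUM q<=Suc ?n. part b is q g)=g" by(simp add:Cons part_beyond)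
 thus ?case using 1 by(simp add:sum.distrib sum_subtractf additive_sum[of "rho_if b i", OF rho_if_add, symmetric]
    del:sum.atMost_Suc)
qed simp

lemma part_part: "part b is q (part b is q' g)=(if q=q' then part b is q g else 0)"
proof(induction "is" arbitrary: q q' g)
 case (Cons i "is")
 show ?case
  by(cases q; cases q') (simp_all add:part_add part_diff part_0 rho_if_add rho_if_diff rho_if_0 part_rho_if Cons rho_if_idem)
qed simp

lemma part_eigen: assumes "!!i. i:set is ==> rho_if b i g=(if i:J then g else 0)" "distinct is"
 shows "part b is q g=(if q = card (set is Int J) then g else 0)" using assms
proof(induction "is" arbitrary: q)
 case (Cons i "is")
 have *: "part b is q g=(if q = card (set is Int J) then g else 0)" for q using Cons by simp
 have "rho_if b i g=(if i:J then g else 0)" using Cons.prems by simp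
 moreover have "card (set (i # is) Int J)=(if i:J then Suc (card (set is Int J)) else card (set is Int J))"
  using Cons.prems by(simp add:Int_insert_left)
 ultimately show ?case by(auto simp:* rho_if_0)
qed simp

lemma mon_ind_insert: "i ~: I ==> mon (ind (insert i I))=z i * mon (ind I)" by(simp add:ind_insert mon_inc)
lemma pd_mon_ind: "i ~: I ==> pd i (mon (ind I))=0" by(rule pd_invariant) (simp add:rho_mon ind_def)

definition proj :: "'d list=>nat=>('d, 'r) ops=>('d, 'r) ops" where
 "proj is q=lin (%b g. mono1 b (part b is q g))"

lemma proj_add: "proj is q (X + Y) = proj is q X + proj is q Y"
 unfolding proj_def by(rule lin_add) (simp add:part_add single_add)

lemmas proj_0 = additive_zero[of "proj is q" for "is" q, OF proj_add]
lemmas proj_sum = additive_sum[of "proj is q" for "is" q, OF proj_add]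

lemma proj_single [simp]: "proj is q (mono1 b g)=mono1 b (part b is q g)"
 unfolding proj_def by(rule lin_single) (simp add:part_0)

lemma lookup_proj: "coef (proj is q X) b = part b is q (coef X b)"
 by(rule pm_additive_eqI[where F = "%X. coef (proj is q X) b"])
  (auto simp:proj_add lookup_add part_add lookup_single when_def part_0)

lemma proj_filt: "X:filt m ==> proj is q X:filt m"
 by(induction rule:filt_induct) (simp_all add:proj_0 proj_add filt_0 filt_add filt_single)

lemma proj_proj: "proj is q (proj is q' X)=(if q=q' then proj is q X else 0)"
 by(rule poly_mapping_eqI) (simp add:lookup_proj part_part)

lemma proj_act_cst: "act (cst c) (proj is q X) = proj is q (act (cst c) X)"
 by(rule poly_mapping_eqI) (simp add:lookup_proj lookup_act part_cst)

lemma proj_total: "(SUM q<=length is. proj is q X)=X"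
 by(rule poly_mapping_eqI) (simp add:lookup_sum lookup_proj part_total)

end

context crossing begin

lemma normal_proj: assumes "X:normal" shows "proj is q X:normal"
proof -
 have "part b is q g:invariant b" if "g:invariant b" for b g using that by(auto simp:invariant_def part_rho)
 moreover have "supp (proj is q X) <= supp X" by(auto simp:in_keys_iff lookup_proj part_0)
 ultimately show ?thesis using assms by(auto simp:normal_def lookup_proj)
qed

lemma normal_sum: "(!!x. x:A ==> g x:normal) ==> sum g A:normal"
 by(induction A rule:infinite_finite_induct) (auto simp:normal_0 intro:normal_add)

lemma euler_mon_add: assumes "i:K" shows "euler a i (act (mon b) X)=act (mon b) (euler (%i. a i + b i) i X)"
proof -
 have "euler a i Y=euler (%_. 0) i Y + act (cst (of_nat (a i) / of_nat (e i))) Y" for a Y by(simp add:euler_def cst_0)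
 from this[of a "act (mon b) X"] this[of b X] this[of "%i. a i + b i" X] show ?thesis
  using assms by(simp add:euler_mon act_add act_commute[of "cst _" "mon b"] add_divide_distrib cst_add act_add_left)
qed

end

text \<open>\<open>II\<close> lists components with \<open>a i / e i = c\<close>. For these the
  untwisted Euler operator \<open>T i\<close> agrees with \<open>N\<close> modulo
  \<open>rels a\<close>. A list is used because \<open>part\<close> and the products of the
  \<open>T i\<close> recurse along it. The quotient by \<open>null\<close> will be a graded piece of
  \<open>M\<close>.\<close>

locale crossing_eigenvalue = crossing z pd rho cst K e i0
 for z :: "'d::finite=>'r::comm_ring_1" and pd rho cst K e i0 +
 fixes a :: "'d=>nat" and c :: complex and II :: "'d list" assumes dist: "distinct II" and II_K: "set II<=K"
  and a_II: "i:set II ==> of_nat (a i) / of_nat (e i) = c" and a_0: "i ~: K ==> a i=0"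
begin

abbreviation N where "N == shifted a c"
abbreviation T where "T == euler (%_. 0)"
abbreviation zI where "zI == mon (ind (set II))"

definition null :: "('d, 'r) ops set" where
 "null={X. EX Q. X - act zI Q:rels a}"

text \<open>These are the generators of the Jordan blocks of length \<open>q\<close>.\<close>

definition comp :: "nat=>('d, 'r) ops set" where
 "comp q={X:normal. proj II q X=X}"

lemma null_rels: "X:rels a ==> X:null" unfolding null_def by(rule CollectI, rule exI[of _ 0]) (simp add:act_0)
lemma null_act: "act zI X:null" unfolding null_def by(rule CollectI, rule exI[of _ X]) (simp add:rels_0)
lemma null_0: "0:null" by(rule null_rels) (rule rels_0)

lemma null_add: "X:null ==> Y:null ==> X + Y:null" unfolding null_def
proof safe
 fix Q Q' assume "X - act zI Q:rels a" "Y - act zI Q':rels a"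
 from rels_add[OF this] show "EX Q. X + Y - act zI Q:rels a"
  by(intro exI[of _ "Q + Q'"]) (simp add:act_add algebra_simps)
qed

lemma null_act_cst: "X:null ==> act (cst k) X:null" unfolding null_def
proof safe
 fix Q assume "X - act zI Q:rels a"
 from rels_act_cst[OF this, of k] show "EX Q. act (cst k) X - act zI Q:rels a"
  by(intro exI[of _ "act (cst k) Q"]) (simp add:act_diff act_commute[of "cst k"])
qed

lemma null_minus: "X:null ==> - X:null" using null_act_cst[of X "-1"] by(simp add:cst_minus cst_1 act_minus_left)
lemma null_diff: "X:null ==> Y:null ==> X - Y:null" using null_add[of X "- Y"] null_minus[of Y] by simp

lemma null_sum: "(!!x. x:A ==> g x:null) ==> sum g A:null"
 by(induction A rule:infinite_finite_induct) (auto simp:null_0 null_add)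

lemma zI_shifted: "N (act zI X)=act zI (shifted (%i. a i + ind (set II) i) c X)"
 by(simp add:shifted_def euler_mon_add i0 act_diff act_commute[of "cst c"])

lemma zI_shifted_pow: "(N ^^ j) (act zI X)=act zI ((shifted (%i. a i + ind (set II) i) c ^^ j) X)"
 by(induction j) (simp_all add:zI_shifted)

lemma zI_rels: "X:rels (%i. a i + ind (set II) i) ==> act zI X:rels a"
proof(rule rels_closed[where F = "act zI" and F' = "%i X. act zI X"])
 show "act zI (rel (%i. a i + ind (set II) i) i X)=rel a i (act zI X)" for i X
 proof(cases "i:K")
  case False
  hence "i ~: set II" using II_K by blast
  thus ?thesis using False by(simp add:rel_def der_act pd_mon_ind)
 qed (simp add:rel_def euler_mon_add act_diff i0)
qed (simp_all add:act_add)

lemma null_N: "X:null ==> N X:null" unfolding null_def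
proof safe
 fix Q assume "X - act zI Q:rels a"
 from rels_shifted[OF this, of c] show "EX Q. N X - act zI Q:rels a"
  using additive_diff[of N X "act zI Q", OF shifted_add] zI_shifted[of Q]
  by(intro exI[of _ "shifted (%i. a i + ind (set II) i) c Q"]) simp
qed

lemma null_N_pow: "X:null ==> (N ^^ j) X:null" by(induction j) (simp_all add:null_N)

lemma T_N: "i:set II ==> T i X - N X:rels a"
proof -
 assume i: "i:set II"
 hence "T i X - N X=rel a i X" using II_K a_II[OF i] by(auto simp:rel_def shifted_def) (simp add:euler_def cst_0)
 thus ?thesis by(simp add:rel_in_rels)
qed

lemma T_pow_N: assumes "set js <= set II" shows "foldr T js X - (N ^^ length js) X:rels a" using assms
proof(induction js)
 case (Cons j js)
 let ?X = "foldr T js X"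
 have "foldr T (j # js) X - (N ^^ length (j # js)) X=(T j ?X - N ?X) + N (?X - (N ^^ length js) X)"
  by(simp add:additive_diff[of N, OF shifted_add])
 also have "... : rels a" using Cons by(intro rels_add T_N rels_shifted) auto
 finally show ?case .
qed (simp add:rels_0)

lemma T_pow_act: "(!!i. i:set js ==> pd i g=0) ==> foldr T js (act g X)=act g (foldr T js X)"
 by(induction js) (simp_all add:euler_act_invariant)

text \<open>\<open>q\<close> counts the Euler operators that have to be applied before the product
  of the variables in \<open>is\<close> splits off on the left. For \<open>II\<close> each of them
  is \<open>N\<close> modulo the relations, so \<open>q\<close> bounds the nilpotency of
  \<open>N\<close>.\<close>

inductive_set good :: "'d list=>nat=>('d, 'r) ops set" for "is" q where
 zero: "0:good is q"
| add:"X:good is q ==> Y:good is q ==> X + Y:good is q"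
| gen: "set js <= set is ==> length js=q ==> foldr T js X=act (mon (ind (set is))) Y ==> X:good is q"

lemma good_Cons_T: assumes "X:good is q" "i ~: set is" shows "X:good (i # is) (Suc q)" using assms(1)
proof(induction rule:good.induct)
 case (gen js X Y)
 have "foldr T (i # js) X=act (mon (ind (set is))) (T i Y)"
  using gen by(simp add:euler_act_invariant pd_mon_ind assms(2))
 also have "... = act (mon (ind (set (i # is)))) (act (cst (1 / of_nat (e i))) (der i Y))"
  by(simp add:euler_def cst_0 act_act mon_ind_insert assms(2) ac_simps)
 finally show ?case using gen by(intro good.gen[of "i # js"]) auto
qed (auto intro:good.zero good.add)

lemma good_Cons_z: assumes "X:good is q" "i ~: set is" shows "act (z i) X:good (i # is) q" using assms(1)
proof(induction rule:good.induct)
 case (gen js X Y)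
 have "foldr T js (act (z i) X)=act (z i) (foldr T js X)" by(rule T_pow_act) (insert gen assms(2), auto simp:pd_z)
 also have "... = act (mon (ind (set (i # is)))) Y" using gen by(simp add:act_act mon_ind_insert assms(2))
 finally show ?case using gen by(intro good.gen[of js]) auto
qed (auto simp:act_0 act_add intro:good.zero good.add)

text \<open>An eigenvalue 1 is paid for by \<open>T i\<close>, which brings its own factor
  \<open>z i\<close>; an eigenvalue 0 already has this factor in the coefficient.\<close>

lemma part_good: assumes "distinct is" shows "mono1 b (part b is q g):good is q" using assms
proof(induction "is" arbitrary: q g)
 case Nil
 show ?case by(cases "q=0") (auto simp:good.zero ind_empty intro:good.gen[of "[]" _ _ _ "mono1 b g"])
next
 case (Cons i "is")
 hence i: "i ~: set is" and IH: "mono1 b (part b is q g):good is q" for q g by auto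
 have 1: "mono1 b (if q=0 then 0 else rho_if b i (part b is (q - 1) g)):good (i # is) q"
  using good_Cons_T[OF IH[of "q - 1" "rho_if b i g"] i] by(cases q) (simp_all add:part_rho_if good.zero)
 have "EX h. g - rho_if b i g=z i * h"
 proof(cases "b i > 0")
  case False
  obtain h where "g=rho i g + z i * h" using rho_split[of g i] by(elim exE)
  hence "g - rho i g=z i * h" by(metis add_diff_cancel_left')
  thus ?thesis using False by(auto simp:rho_if_def)
 qed (auto simp:rho_if_def intro:exI[of _ 0])
 then obtain h where h: "g - rho_if b i g=z i * h" by blast
 have "part b is q g - rho_if b i (part b is q g)=z i * part b is q h"
  by(simp add:part_rho_if part_diff[symmetric] h part_z i)
 hence 2: "mono1 b (part b is q g - rho_if b i (part b is q g)):good (i # is) q"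
  using good_Cons_z[OF IH[of q h] i] by simp
 show ?case using good.add[OF 1 2] by(simp add:single_add)
qed

lemma good_null: "X:good II q ==> (N ^^ q) X:null"
proof(induction rule:good.induct)
 case (gen js X Y)
 have "foldr T js X:null" using null_act[of Y] gen by simp
 moreover have "foldr T js X - (N ^^ q) X:null" using T_pow_N[of js X] gen by(intro null_rels) auto
 ultimately have "foldr T js X - (foldr T js X - (N ^^ q) X):null" by(rule null_diff)
 thus ?case by simp
qed (simp_all add:shifted_pow_0 shifted_pow_add null_0 null_add)

lemma comp_null: assumes "X:comp q" shows "(N ^^ q) X:null"
proof -
 have "(N ^^ q) (proj II q X):null" for X
 proof -
  have "X:filt (int (SUM b:supp X. order_of b))" unfolding filt_def by(auto intro:member_le_sum simp del:of_nat_sum)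
  thus ?thesis by(induction rule:filt_induct)
    (simp_all add:proj_0 proj_add shifted_pow_0 shifted_pow_add null_0 null_add good_null part_good dist)
 qed
 from this[of X] show ?thesis using assms by(simp add:comp_def)
qed

lemma comp_0: "0:comp q" by(simp add:comp_def normal_0 proj_0)
lemma comp_add: "X:comp q ==> Y:comp q ==> X + Y:comp q" by(simp add:comp_def normal_add proj_add)
lemma comp_act_cst: "X:comp q ==> act (cst k) X:comp q" by(simp add:comp_def normal_act_cst proj_act_cst[symmetric])

text \<open>A converse of \<open>part_good\<close> on normal terms. If the exponent at
  \<open>i\<close> is 0, the factor \<open>z i\<close> is absorbed into the coefficient, which then
  has eigenvalue 0. If it is positive, the coefficient is free of \<open>z i\<close>, and
  multiplication by \<open>z i\<close> amounts to \<open>T i\<close> on the term with exponent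
  lowered by one, scaled by \<open>e i\<close>; this term has eigenvalue 1. So \<open>js\<close>
  lists the eigenvalues 1.\<close>

lemma zI_single: assumes "distinct is" "set is<=K" "g:invariant b"
 shows "EX js b' g'. set js <= set is & distinct js & act (mon (ind (set is))) (mono1 b g)=foldr T js (mono1 b' g') &
  g':invariant b' & (ALL i. i ~: set is --> b' i=b i) & (ALL i:set is. rho_if b' i g'=(if i:set js then g' else 0))"
 using assms
proof(induction "is")
 case Nil
 thus ?case by(intro exI[of _ "[]"] exI[of _ b] exI[of _ g]) (simp add:ind_empty)
next
 case (Cons i "is")
 then obtain js b' g' where js: "set js <= set is" "distinct js" and
  eq: "act (mon (ind (set is))) (mono1 b g)=foldr T js (mono1 b' g')" and
  g': "g':invariant b'" and b': "!!i. i ~: set is ==> b' i=b i" and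
  ev: "!!i. i:set is ==> rho_if b' i g'=(if i:set js then g' else 0)" by auto
 have i: "i ~: set is" "i:K" using Cons.prems by auto
 have "act (mon (ind (set (i # is)))) (mono1 b g)=act (z i) (foldr T js (mono1 b' g'))"
  by(simp add:eq[symmetric] i mon_ind_insert act_act del:act_single) 
 also have "... = foldr T js (act (z i) (mono1 b' g'))" by(rule T_pow_act[symmetric]) (insert js i, auto simp:pd_z)
 finally have eq2: "act (mon (ind (set (i # is)))) (mono1 b g)=foldr T js (act (z i) (mono1 b' g'))" .
 show ?case
 proof(cases "b' i > 0")
  case False
  have "z i * g':invariant b'" using g' False by(auto simp:invariant_def rho_mult rho_z)
  moreover have "rho_if b' k (z i * g')=(if k:set js then z i * g' else 0)" if "k:set (i # is)" for k
  proof(cases "k=i")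
   case True
   thus ?thesis using False js i by(auto simp:rho_if_def rho_mult rho_z)
  next
   case False
   hence "rho_if b' k (z i * g')=z i * rho_if b' k g'" by(simp add:rho_if_def rho_mult rho_z)
   thus ?thesis using ev[of k] that False by simp
  qed
  ultimately show ?thesis using js b' eq2 by(intro exI[of _ js] exI[of _ b'] exI[of _ "z i * g'"]) auto
 next
  case True
  obtain b'' where b'': "b'=inc i b''" using pos_imp_inc[of b' i] True by auto
  let ?g = "cst (of_nat (e i)) * g'"
  have r: "rho i g'=g'" using g' True by(auto simp:invariant_def)
  have inv: "rho k g'=g'" if "b'' k > 0" for k using g' that by(auto simp:invariant_def b'' inc_apply split:if_splits)
  have "T i (mono1 b'' ?g)=act (z i) (mono1 b' g')" using r e_pos[OF i(2)]
   by(simp add:euler_def cst_0 pd_cst_mult pd_invariant b'' mult.assoc mult.left_commute[of "z i"])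
    (simp add:mult.assoc[symmetric] cst_mult[symmetric] cst_1)
  hence "act (mon (ind (set (i # is)))) (mono1 b g)=foldr T (js @ [i]) (mono1 b'' ?g)"
   by(simp only:eq2 foldr_append foldr.simps o_def id_def)
  moreover have "rho_if b'' k ?g=(if k:set (js @ [i]) then ?g else 0)" if "k:set (i # is)" for k
  proof(cases "k=i")
   case True
   thus ?thesis using r by(auto simp:rho_if_def rho_mult rho_cst)
  next
   case False
   hence "rho_if b'' k ?g = cst (of_nat (e i)) * rho_if b' k g'"
    by(simp add:rho_if_def rho_mult rho_cst b'' inc_apply)
   thus ?thesis using ev[of k] that False by simp
  qed
  moreover have "?g:invariant b''" using inv by(auto simp:invariant_def rho_mult rho_cst)
  moreover have "b'' k=b k" if "k ~: set (i # is)" for k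
   using b'[of k] that by(auto simp:b'' inc_apply split:if_splits)
  ultimately show ?thesis using js i by(intro exI[of _ "js @ [i]"] exI[of _ b''] exI[of _ ?g]) auto
 qed
qed

lemma zI_normal: assumes "X:normal"
 shows "EX d. (ALL q. d q:comp q) & act zI X - (SUM q<=length II. (N ^^ q) (d q)):rels a"
proof -
 let ?P = "%X d. (ALL q. d q:comp q) & act zI X - (SUM q<=length II. (N ^^ q) (d q)):rels a"
 have "EX d. ?P (mono1 b g) d" if g: "g:invariant b" and b: "!!i. i ~: K ==> b i=0" for b g
 proof -
  obtain js b' g' where js: "set js <= set II" "distinct js" and
   eq: "act zI (mono1 b g)=foldr T js (mono1 b' g')" and
   g': "g':invariant b'" and b': "!!i. i ~: set II ==> b' i=b i" and
   ev: "!!i. i:set II ==> rho_if b' i g'=(if i:set js then g' else 0)" using zI_single[OF dist II_K g] by auto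
  let ?X = "mono1 b' g'"
  have "set II Int set js = set js" using js by auto
  hence part: "part b' II q g'=(if q=length js then g' else 0)" for q
   using part_eigen[OF ev dist, of q] js by(simp add:distinct_card)
  hence X: "?X:comp (length js)"
  proof -
   have "b' i=0" if "i ~: K" for i using b'[of i] b[OF that] that II_K by auto
   thus ?thesis using part g' by(auto simp:comp_def intro!:normal_single)
  qed
  have len: "length js<=length II" using js dist by(metis card_mono distinct_card finite_set)
  have "(SUM q<=length II. (N ^^ q) (if q=length js then ?X else 0))=(SUM q<=length II. if q=length js then (N ^^
   length js) ?X else 0)"
   by(rule sum.cong) (auto simp:shifted_pow_0)
  also have "... = (N ^^ length js) ?X" using len by simp
  finally have "(SUM q<=length II. (N ^^ q) (if q=length js then ?X else 0))=(N ^^ length js) ?X" .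
  hence "?P (mono1 b g) (%q. if q=length js then ?X else 0)"
   using X T_pow_N[OF js(1), of ?X] by(simp add:eq comp_0 del:act_single)
  thus ?thesis by(rule exI[of _ "%q. if q=length js then ?X else 0"])
 qed
 note single = this
 have "EX d. ?P (SUM b:B. mono1 b (coef X b)) d"
  if "finite B" "B <= supp X" for B using that
 proof(induction B rule:finite_induct)
  case empty
  show ?case by(rule exI[of _ "%_. 0"]) (simp add:act_0 shifted_pow_0 rels_0 comp_0)
 next
  case (insert b B)
  then obtain d where d: "?P (SUM b:B. mono1 b (coef X b)) d" by auto
  have "coef X b:invariant b" "!!i. i ~: K ==> b i=0" using assms insert.prems by(auto simp:normal_def)
  from single[OF this] obtain d' where d': "?P (mono1 b (coef X b)) d'" by auto
  let ?S = "SUM b:B. mono1 b (coef X b)"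
  let ?s = "mono1 b (coef X b)"
  have "act zI (?s + ?S) - (SUM q<=length II. (N ^^ q) (d' q + d q))=(act zI ?s - (SUM q<=length II. (N ^^ q) (d'
   q))) + (act zI ?S - (SUM q<=length II. (N ^^ q) (d q)))"
   by(simp add:act_add shifted_pow_add sum.distrib del:act_single)
  also have "... : rels a" using d d' by(intro rels_add) auto
  finally have "?P (?s + ?S) (%q. d' q + d q)" using d d' by(auto intro:comp_add)
  thus ?case using insert.hyps by auto
 qed
 from this[of "supp X"] show ?thesis by(simp add:poly_mapping_eq_sum[symmetric])
qed

lemma decomposition_exists: assumes "X:filt m"
 obtains y where "!!q j. y q j:comp q" "!!q j. y q j:filt (m - int j)"
  "X - (SUM q<=length II. SUM j<q. (N ^^ j) (y q j)):null"
proof -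
 from filt_normal_span[OF assms] have "X:normal_span a c m" .
 then obtain y J where y: "!!j. y j:normal" "!!j. y j:filt (m - int j)" "!!j. j>=J ==> y j=0"
  and X: "X - (SUM j<J. (N ^^ j) (y j)):rels a" by(rule normal_span_sum) blast
 let ?Y = "%q j. (N ^^ j) (proj II q (y j))"
 define J' where "J'=max J (Suc (length II))"
 have "(SUM j<J. (N ^^ j) (y j))=(SUM j<J'. (N ^^ j) (y j))"
  by(rule sum.mono_neutral_left) (auto simp:J'_def y shifted_pow_0)
 also have "... = (SUM j<J'. SUM q<=length II. ?Y q j)" by(simp add:shifted_pow_sum[symmetric] proj_total)
 also have "... = (SUM q<=length II. SUM j<J'. ?Y q j)" by(rule sum.swap)
 also have "... = (SUM q<=length II. (SUM j<q. ?Y q j) + (SUM j=q..<J'. ?Y q j))"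
 proof(rule sum.cong)
  fix q assume "q:{..length II}"
  hence eq: "{..<J'}={..<q} Un {q..<J'}" by(auto simp:J'_def)
  show "(SUM j<J'. ?Y q j)=(SUM j<q. ?Y q j) + (SUM j=q..<J'. ?Y q j)" by(subst eq, rule sum.union_disjoint) auto
 qed simp
 finally have sum: "(SUM j<J. (N ^^ j) (y j))=(SUM q<=length II. SUM j<q. ?Y q j) + (SUM q<=length II. SUM j=q..<J'.
  ?Y q j)" by(simp add:sum.distrib)
 have comp: "proj II q (y j):comp q" for q j by(simp add:comp_def normal_proj y proj_proj)
 have "?Y q j:null" if "q<=j" for q j
 proof -
  have "?Y q j=(N ^^ (j - q)) ((N ^^ q) (proj II q (y j)))"
   using that by(simp add:funpow_add[symmetric, unfolded o_def fun_eq_iff, rule_format])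
  thus ?thesis using comp_null[OF comp] null_N_pow by simp
 qed
 hence "(SUM q<=length II. SUM j=q..<J'. ?Y q j):null" by(intro null_sum) auto
 from null_add[OF null_rels[OF X] this]
 have "X - (SUM q<=length II. SUM j<q. ?Y q j):null" unfolding sum by(simp add:algebra_simps)
 thus ?thesis by(rule that[of "%q j. proj II q (y j)", OF comp proj_filt[OF y(2)]])
qed

text \<open>Write the null element as \<open>zI\<close> times \<open>Q\<close> modulo relations,
  expand \<open>Q\<close> in normal operators and apply \<open>zI_normal\<close>. In part
  \<open>q\<close> this produces only powers \<open>N^k\<close> with \<open>k >= q\<close>, while
  the given sum has only \<open>k < q\<close> there. So in the normal expansion of the difference
  the two cannot interfere; \<open>w k\<close> is its coefficient at \<open>N^k\<close>.\<close>

lemma decomposition_unique: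
 assumes x: "!!q j. x q j:comp q" and null: "(SUM q<=length II. SUM j<q. (N ^^ j) (x q j)):null"
  and qj: "q<=length II" "j < q" shows "x q j=0"
proof -
 let ?a = "%i. a i + ind (set II) i" and ?r = "length II"
 obtain Q where Q: "(SUM q<=?r. SUM j<q. (N ^^ j) (x q j)) - act zI Q:rels a" using null by(auto simp:null_def)
 obtain k where "Q:filt (int k)" using filt_exhaustive by blast
 hence "Q:normal_span ?a c (int k)" by(rule filt_normal_span)
 then obtain y J where y: "!!j. y j:normal" "!!j. j>=J ==> y j=0"
  and yQ: "Q - (SUM j<J. (shifted ?a c ^^ j) (y j)):rels ?a" by(rule normal_span_sum) blast
 have "EX d. (ALL q. d q:comp q) & act zI (y j) - (SUM q<=?r. (N ^^ q) (d q)):rels a & (j>=J --> d=(%_. 0))" for j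
 proof(cases "j>=J")
  case True
  thus ?thesis by(intro exI[of _ "%_. 0"]) (simp add:y comp_0 shifted_pow_0 act_0 rels_0)
 next
  case False
  thus ?thesis using zI_normal[OF y(1)[of j]] by auto
 qed
 hence "EX d. ALL j. (ALL q. d j q:comp q) & act zI (y j) - (SUM q<=?r. (N ^^ q) (d j q)):rels a & (j>=J --> d j=(%_.
  0))" by(intro choice allI)
 then obtain d where "ALL j. (ALL q. d j q:comp q) & act zI (y j) - (SUM q<=?r. (N ^^ q) (d j q)):rels a & (j>=J -->
  d j=(%_. 0))" by(elim exE)
 hence d: "!!j q. d j q:comp q" "!!j. act zI (y j) - (SUM q<=?r. (N ^^ q) (d j q)):rels a"
  "!!j q. j>=J ==> d j q=0" by auto
 have "act zI Q - (SUM j<J. (N ^^ j) (act zI (y j))):rels a"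
  using zI_rels[OF yQ] by(simp add:act_diff act_sum zI_shifted_pow)
 moreover have "(SUM j<J. (N ^^ j) (act zI (y j) - (SUM q<=?r. (N ^^ q) (d j q)))):rels a"
 proof -
  have "(SUM j:A. (N ^^ j) (act zI (y j) - (SUM q<=?r. (N ^^ q) (d j q)))):rels a" for A
   by(induction A rule:infinite_finite_induct) (simp_all add:rels_0 rels_add rels_shifted_pow d)
  thus ?thesis .
 qed
 ultimately have "act zI Q - (SUM j<J. (N ^^ j) (act zI (y j))) + (SUM j<J. (N ^^ j) (act zI (y j) - (SUM q<=?r. (N
  ^^ q) (d j q)))):rels a" by(rule rels_add)
 hence zQ: "act zI Q - (SUM j<J. SUM q<=?r. (N ^^ j) ((N ^^ q) (d j q))):rels a"
  by(simp add:shifted_pow_diff shifted_pow_sum sum_subtractf)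
 define M where "M=J + Suc ?r"
 define w where "w k=(SUM q<=?r. if k < q then x q k else - d (k - q) q)" for k
 have minus: "(N ^^ k) (- X) = - (N ^^ k) X" for k X by(rule additive_minus) (rule shifted_pow_add)
 have "(SUM q<=?r. SUM j<q. (N ^^ j) (x q j)) - (SUM j<J. SUM q<=?r. (N ^^ j) ((N ^^ q) (d j q)))=(SUM k<M. (N ^^ k) (w k))"
 proof -
  have A: "(SUM k<M. if k < q then (N ^^ k) (x q k) else 0)=(SUM j<q. (N ^^ j) (x q j))" if "q<=?r" for q
  proof -
   have "{..<M} Int {k. k < q}={..<q}" using that by(auto simp:M_def)
   thus ?thesis by(simp add:sum.If_cases)
  qed
  have B: "(SUM k<M. if k < q then 0 else (N ^^ k) (d (k - q) q))=(SUM j<J. (N ^^ j) ((N ^^ q) (d j q)))" if "q<=?r" for q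
  proof -
   have "(SUM k<M. if k < q then 0 else (N ^^ k) (d (k - q) q))=(SUM k=q..<J + q. (N ^^ k) (d (k - q) q))"
    by(rule sum.mono_neutral_cong_right) (insert that, auto simp:M_def d(3) shifted_pow_0)
   also have "... = (SUM j=0..<J. (N ^^ (j + q)) (d j q))"
    using sum.shift_bounds_nat_ivl[of "%k. (N ^^ k) (d (k - q) q)" 0 q J] by simp
   finally show ?thesis by(simp add:funpow_add atLeast0LessThan)
  qed
  have "(SUM k<M. (N ^^ k) (w k))=(SUM k<M. SUM q<=?r. (if k < q then (N ^^ k) (x q k) else 0) - (if k < q then 0
   else (N ^^ k) (d (k - q) q)))"
   unfolding w_def shifted_pow_sum by(intro sum.cong refl) (simp add:minus)
  also have "... = (SUM q<=?r. (SUM k<M. if k < q then (N ^^ k) (x q k) else 0) - (SUM k<M. if k < q then 0 else (N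
   ^^ k) (d (k - q) q)))"
   by(subst sum.swap) (simp add:sum_subtractf)
  also have "... = (SUM q<=?r. (SUM j<q. (N ^^ j) (x q j)) - (SUM j<J. (N ^^ j) ((N ^^ q) (d j q))))"
   by(intro sum.cong refl) (simp add:A B)
  finally show ?thesis by(simp add:sum_subtractf sum.swap[of _ "{..<J}"])
 qed
 with rels_add[OF Q zQ] have wr: "(SUM k<M. (N ^^ k) (w k)):rels a" by simp
 have minus_comp: "- X:comp q" if "X:comp q" for X q
  using comp_act_cst[OF that, of "-1"] by(simp add:cst_minus cst_1 act_minus_left)
 have wn: "w k:normal" for k
 proof -
  have "(if k < q then x q k else - d (k - q) q):normal" for q
   using x[of q k] minus_comp[OF d(1)[of "k - q" q]] by(simp add:comp_def)
  hence "(SUM q:A. if k < q then x q k else - d (k - q) q):normal" for A by(rule normal_sum)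
  thus ?thesis by(simp add:w_def)
 qed
 have w0: "w k=0" if "k>=M" for k
 proof -
  have "(if k < q then x q k else - d (k - q) q)=0" if "q<=?r" for q using that `k >= M` by(auto simp:M_def d(3))
  thus ?thesis by(simp add:w_def)
 qed
 \<comment> \<open>For \<open>m = 0\<close> and \<open>G = 0\<close>, \<open>normal_order\<close> is
   the uniqueness of the normal expansion, as negative filtration steps are 0.\<close>
 have "w j:filt (int 0 - 1 - int j)"
  by(rule normal_order[OF wn w0, where G = 0 and ?nu0.0 = 1 and bt = "%_. 0"]) (use adj_rels[OF wr] in auto)
 hence "w j=0" by(simp add:filt_neg)
 hence "0 = proj II q (w j)" by(simp add:proj_0)
 also have "... = (SUM q'<=?r. if q'=q then x q j else 0)" unfolding w_def proj_sum
 proof(rule sum.cong)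
  fix q'
  have "proj II q X=(if q'=q then X else 0)" if "X:comp q'" for X
   using proj_proj[of II q q' X] that by(auto simp:comp_def)
  thus "proj II q (if j < q' then x q' j else - d (j - q') q')=(if q'=q then x q j else 0)"
   using x[of q' j] minus_comp[OF d(1)[of "j - q'" q']] qj(2) by auto
 qed simp
 also have "... = x q j" using qj(1) by simp
 finally show ?thesis by simp
qed

end

subsection \<open>Cosets and monodromy filtrations\<close>

definition subgrp :: "'k::ab_group_add set=>bool" where
 "subgrp A <-> 0:A & (ALL x:A. ALL y:A. x - y:A)"

lemma subgrpI: "0:A ==> (!!x y. x:A ==> y:A ==> x - y:A) ==> subgrp A" by(simp add:subgrp_def)
lemma subgrp_0: "subgrp A ==> 0:A" by(simp add:subgrp_def)
lemma subgrp_diff: "subgrp A ==> x:A ==> y:A ==> x - y:A" by(simp add:subgrp_def)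
lemma subgrp_minus: "subgrp A ==> x:A ==> - x:A" using subgrp_diff[of A 0 x] subgrp_0[of A] by simp
lemma subgrp_add: "subgrp A ==> x:A ==> y:A ==> x + y:A" using subgrp_diff[of A x "- y"] subgrp_minus[of A y] by simp

lemma subgrp_sum: "subgrp A ==> (!!i. i:J ==> g i:A) ==> sum g J:A"
 by(induction J rule:infinite_finite_induct) (auto simp:subgrp_0 subgrp_add)

lemma subgrp_cong: "subgrp A ==> x - y:A ==> x:A <-> y:A"
 using subgrp_add[of A "x - y" y] subgrp_diff[of A x "x - y"] by auto

lemma subgrp_diff_cong: "subgrp A ==> x - x':A ==> y - y':A ==> x - y:A <-> x' - y':A"
 using subgrp_cong[of A "x - y" "x' - y'"] subgrp_diff[of A "x - x'" "y - y'"] by(simp add:algebra_simps)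

text \<open>A module with scalars \<open>S\<close> whose elements are parametrized, through \<open>ups\<close>, by a subgroup
  \<open>A\<close> of an abelian group in the sense of type classes. This turns cosets into congruences in that
   group.\<close>

locale presented =
 fixes V :: "('c, 'v) module" and ups :: "'k::ab_group_add=>'v" and sc :: "'c=>'k=>'k"
  and A :: "'k set" and S :: "'c set" assumes A: "subgrp A" and sc_A: "k:S ==> x:A ==> sc k x:A"
  and carrier: "carrier V=ups ` A" and add:"x:A ==> y:A ==> ups x \<oplus>\<^bsub>V\<^esub> ups y=ups (x + y)"
  and zero: "\<zero>\<^bsub>V\<^esub>=ups 0"
  and smult: "k:S ==> x:A ==> k \<odot>\<^bsub>V\<^esub> ups x=ups (sc k x)"
begin

lemmas A_closed = subgrp_0[OF A] subgrp_diff[OF A] subgrp_minus[OF A] subgrp_add[OF A]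

definition ker :: "'k set" where "ker={x:A. ups x=ups 0}"

lemma group: "abelian_group V"
proof(rule abelian_groupI)
 fix x assume "x:carrier V"
 then obtain u where u: "u:A" "x=ups u" by(auto simp:carrier)
 thus "EX y:carrier V. y \<oplus>\<^bsub>V\<^esub> x=\<zero>\<^bsub>V\<^esub>"
  using A_closed by(intro bexI[of _ "ups (- u)"]) (auto simp:carrier zero add)
qed (insert A_closed, auto simp:carrier zero add add_ac)

sublocale V: abelian_group V by(rule group)

lemma minus: "x:A ==> \<ominus>\<^bsub>V\<^esub> ups x=ups (- x)"
 using A_closed by(intro V.minus_equality) (auto simp:carrier zero add)

lemma eq_iff: assumes "x:A" "y:A" shows "ups x=ups y <-> x - y:ker"
proof -
 have "ups (x - y)=ups x \<oplus>\<^bsub>V\<^esub> ups (- y)" using assms A_closed by(simp add:add)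
 moreover have "ups y \<oplus>\<^bsub>V\<^esub> ups (- y)=\<zero>\<^bsub>V\<^esub>" "ups (- y):carrier V" "ups
  x:carrier V" "ups y:carrier V"
  using assms A_closed by(auto simp:add zero carrier)
 ultimately show ?thesis using assms A_closed unfolding ker_def zero[symmetric] by(auto) (metis V.add.right_cancel)
qed

lemma ker: "subgrp ker"
proof(rule subgrpI)
 show "0:ker" using A_closed by(simp add:ker_def)
 fix x y assume "x:ker" "y:ker"
 hence "ups x=ups y" "x:A" "y:A" by(auto simp:ker_def)
 thus "x - y:ker" using eq_iff by simp
qed

lemma image_mem_iff: assumes "subgrp B" "ker<=B" "B<=A" "x:A" shows "ups x:ups ` B <-> x:B"
proof
 assume "ups x:ups ` B"
 then obtain y where "y:B" "x - y:ker" using assms eq_iff by auto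
 thus "x:B" using subgrp_cong[of B x y] assms by auto
qed simp

lemma additive_subgroup_image: assumes "subgrp B" "B<=A" shows "additive_subgroup (ups ` B) V"
proof(rule additive_subgroup.intro, rule subgroup.intro)
 show "ups ` B <= carrier (add_monoid V)" using assms by(auto simp:carrier)
 show "\<one>\<^bsub>add_monoid V\<^esub>:ups ` B" using subgrp_0[OF assms(1)] by(auto simp:zero)
 fix x y assume "x:ups ` B" "y:ups ` B"
 then obtain u w where u: "u:B" "x=ups u" "w:B" "y=ups w" by auto
 thus "x \<otimes>\<^bsub>add_monoid V\<^esub> y:ups ` B"
  using subgrp_add[OF assms(1), of u w] assms(2) by(auto simp:add subset_iff)
 show "inv\<^bsub>add_monoid V\<^esub> x:ups ` B"
  using minus[of u] subgrp_minus[OF assms(1), of u] assms(2) u by(auto simp:a_inv_def)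
qed

definition coset :: "'k set=>'k=>'v set" where "coset B x=ups ` {u:A. u - x:B}"

lemma a_r_coset_image: assumes "subgrp B" "B<=A" "x:A" shows "ups ` B +>\<^bsub>V\<^esub> ups x = coset B x"
proof -
 have "ups ` B +>\<^bsub>V\<^esub> ups x=(%h. ups (h + x)) ` B"
  unfolding a_r_coset_def' using assms add by auto (metis imageI subsetD)+
 also have "... = coset B x" unfolding coset_def
 proof(intro equalityI subsetI)
  fix v assume "v:ups ` {u:A. u - x:B}"
  then obtain u where "v=ups u" "u:A" "u - x:B" by auto
  thus "v:(%h. ups (h + x)) ` B" by(intro image_eqI[of _ _ "u - x"]) auto
 qed (use assms A_closed in auto)
 finally show ?thesis .
qed

lemma coset_zero: "subgrp B ==> B<=A ==> coset B 0=ups ` B" by(auto simp:coset_def)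

lemma coset_eq_iff: assumes "subgrp B" "ker<=B" "B<=A" "x:A" "y:A" shows "coset B x = coset B y <-> x - y:B"
proof
 assume eq: "coset B x = coset B y"
 have "ups x:coset B x" unfolding coset_def using assms(4) subgrp_0[OF assms(1)] by(intro image_eqI[of _ _ x]) auto
 hence "ups x:coset B y" using eq by simp
 then obtain u where u: "u:A" "ups x=ups u" "u - y:B" by(auto simp:coset_def)
 hence xu: "x - u:B" using assms eq_iff by auto
 show "x - y:B" using subgrp_add[OF assms(1) xu u(3)] by simp
next
 assume *: "x - y:B"
 have "u - x:B <-> u - y:B" for u using subgrp_diff_cong[OF assms(1), of u u x y] * subgrp_0[OF assms(1)] by simp
 thus "coset B x = coset B y" by(simp add:coset_def)
qed

lemma coset_add: assumes "subgrp B" "B<=A" "x:A" "y:A"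
 shows "coset B x <+>\<^bsub>V\<^esub> coset B y = coset B (x + y)" unfolding set_add_def' coset_def
proof(intro equalityI subsetI)
 fix v assume "v:(UN h:ups ` {u:A. u - x:B}. UN k:ups ` {u:A. u - y:B}. {h \<oplus>\<^bsub>V\<^esub> k})"
 then obtain u w where "u:A" "w:A" "u - x:B" "w - y:B" "v=ups (u + w)" by(auto simp:add)
 thus "v:ups ` {u:A. u - (x + y):B}"
  using A_closed subgrp_add[OF assms(1), of "u - x" "w - y"] by(auto simp:algebra_simps)
next
 fix v assume "v:ups ` {u:A. u - (x + y):B}"
 then obtain u where u: "u:A" "v=ups u" "u - (x + y):B" by auto
 have "v=ups (u - y) \<oplus>\<^bsub>V\<^esub> ups y" using u assms A_closed by(simp add:add)
 moreover have "u - y - x:B" "y - y:B" "u - y:A" using u assms A_closed subgrp_0 by(auto simp:algebra_simps)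
 ultimately show "v:(UN h:ups ` {u:A. u - x:B}. UN k:ups ` {u:A. u - y:B}. {h \<oplus>\<^bsub>V\<^esub> k})"
  using assms(4) by blast
qed

lemma induced_coset: assumes B: "subgrp B" and B': "subgrp B'" "ker<=B'" "B'<=A" and x: "x:A"
  and h: "!!u. u:A ==> h (ups u)=ups (g u)" "!!u. u:A ==> g u:A" and g: "!!u. u:A ==> u - x:B ==> g u - g x:B'"
 shows "induced_map V (ups ` B') h (coset B x) = coset B' (g x)"
proof -
 have "ups ` B' +>\<^bsub>V\<^esub> h (ups u) = coset B' (g x)" if "u:A" "u - x:B" for u
  using that h g B' x coset_eq_iff[of B' "g u" "g x"] by(simp add:a_r_coset_image)
 moreover have "x:{u:A. u - x:B}" using x subgrp_0[OF B] by simp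
 ultimately show ?thesis unfolding induced_map_def coset_def[of B] by blast
qed

text \<open>The quotient is parametrized by elements of the same group, now with kernel
  \<open>B\<close>. Iterating this, the stacked quotients that define \<open>M\<close>,
  \<open>M_gr\<close> and \<open>gr\<close> are handled by representatives throughout.\<close>

lemma quotient: assumes A': "subgrp A'" "A'<=A" "!!k x. k:S ==> x:A' ==> sc k x:A'"
  and B: "subgrp B" "ker<=B" "B<=A'" "!!k x. k:S ==> x:B ==> sc k x:B"
  and sc: "!!k x y. k:S ==> sc k (x - y) = sc k x - sc k y"
 shows "presented (quotient_module (V\<lparr>carrier := ups ` A'\<rparr>) (ups ` B)) (coset B) sc A' S"
proof
 have BA: "B<=A" using assms by blast
 have c: "ups ` B +>\<^bsub>V\<lparr>carrier := ups ` A'\<rparr>\<^esub> x=ups ` B +>\<^bsub>V\<^esub> x" for x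
  by(simp add:a_r_coset_def')
 show "carrier (quotient_module (V\<lparr>carrier := ups ` A'\<rparr>) (ups ` B)) = coset B ` A'"
  using A' a_r_coset_image[OF B(1) BA] by(auto simp:quotient_module_def A_RCOSETS_def' c image_UN subset_iff)
 fix x y assume xy: "x:A'" "y:A'"
 have "C <+>\<^bsub>V\<lparr>carrier := ups ` A'\<rparr>\<^esub> C'=C <+>\<^bsub>V\<^esub> C'" for C C'
  by(simp add:set_add_def')
 thus "coset B x \<oplus>\<^bsub>quotient_module (V\<lparr>carrier := ups ` A'\<rparr>) (ups ` B)\<^esub> coset B y =
  coset B (x + y)"
  using coset_add[OF B(1) BA] A' xy by(auto simp:quotient_module_def subset_iff)
next
 fix x k assume k: "k:S" and x: "x:A'"
 hence xA: "x:A" using A' by blast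
 have BA: "B<=A" using assms by blast
 have "induced_map V (ups ` B) (%v. k \<odot>\<^bsub>V\<^esub> v) (coset B x) = coset B (sc k x)"
  by(rule induced_coset[OF B(1) B(1,2) BA xA]) (insert k, auto simp:smult sc_A sc[symmetric] B)
 thus "k \<odot>\<^bsub>quotient_module (V\<lparr>carrier := ups ` A'\<rparr>) (ups ` B)\<^esub> coset B x = coset B
  (sc k x)"
  by(simp add:quotient_module_def induced_map_def a_r_coset_def')
next
 show "\<zero>\<^bsub>quotient_module (V\<lparr>carrier := ups ` A'\<rparr>) (ups ` B)\<^esub> = coset B 0"
  using assms by(simp add:quotient_module_def coset_zero[OF B(1)] order.trans[OF B(3) A'(2)])
qed (use A' in auto)

end

text \<open>Serves to parametrize a graded piece by all operators, through multiplication by a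
  monomial, instead of by the operators of one level.\<close>

lemma presented_reparametrize: assumes "presented V ups sc A S" "subgrp A'" "!!x k. k:S ==> x:A' ==> sc' k x:A'"
  and si: "!!x. x:A' ==> si x:A" "!!x y. x:A' ==> y:A' ==> si (x + y) = si x + si y"
  "!!x k. k:S ==> x:A' ==> ups (si (sc' k x))=ups (sc k (si x))" and surj: "ups ` A=(%x. ups (si x)) ` A'"
 shows "presented V (%x. ups (si x)) sc' A' S"
proof -
 interpret presented V ups sc A S by fact
 have "si 0 + si 0 = si 0 + 0" using si(2)[of 0 0] subgrp_0[OF assms(2)] by simp
 hence "si 0=0" by(simp only:add_left_cancel)
 thus ?thesis using assms by unfold_locales (auto simp:carrier add zero smult)
qed

section \<open>Uniqueness of the monodromy filtration, and its description by
  representatives\<close>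

locale presented_endo = presented V ups sc UNIV UNIV
 for V :: "(complex, 'v) module" and ups :: "'k::ab_group_add=>'v" and sc :: "complex=>'k=>'k" +
 fixes N :: "'v=>'v" and T :: "'k=>'k" assumes N: "N (ups x)=ups (T x)" and T_diff: "T (x - y)=T x - T y"
  and sc_diff: "sc k (x - y) = sc k x - sc k y"
begin

lemma T_pow_diff: "(T ^^ j) (x - y)=(T ^^ j) x - (T ^^ j) y" by(induction j) (simp_all add:T_diff)
lemma T_pow_0: "(T ^^ j) 0=0" using T_pow_diff[of j 0 0] by simp

lemma T_pow_add: "(T ^^ j) (x + y)=(T ^^ j) x + (T ^^ j) y"
 using T_pow_diff[of j x "- y"] T_pow_diff[of j 0 y] by(simp add:T_pow_0)

lemma T_pow_sum: "(T ^^ j) (sum g J)=(SUM i:J. (T ^^ j) (g i))"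
 by(induction J rule:infinite_finite_induct) (simp_all add:T_pow_0 T_pow_add)

lemma N_pow: "(N ^^ j) (ups x)=ups ((T ^^ j) x)" by(induction j) (simp_all add:N)
lemma T_pow_comp: "(T ^^ i) ((T ^^ j) x)=(T ^^ (i + j)) x" by(simp add:funpow_add)

lemma T_ker: "x:ker ==> T x:ker"
proof -
 assume "x:ker"
 hence "ups (T x)=ups (T 0)" unfolding N[symmetric] by(simp add:ker_def)
 thus "T x:ker" using T_diff[of 0 0] by(simp add:ker_def)
qed

lemma T_pow_ker: "x:ker ==> (T ^^ j) x:ker" by(induction j) (simp_all add:T_ker)

text \<open>The pullback of a monodromy filtration along \<open>ups\<close>.\<close>

definition lifted_mono :: "(int=>'k set)=>bool" where
 "lifted_mono W <-> (ALL r. subgrp (W r)) & (ALL r. ker<=W r) & (ALL r. W r<=W (r + 1)) & (EX a. W a=ker) & (EX b. W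
  b=UNIV) & (ALL r. T ` W r<=W (r - 2)) & (ALL r::nat. ALL x:W (int r). (T ^^ r) x:W (- int r - 1) --> x:W (int r -
  1)) & (ALL r::nat. ALL y:W (- int r). EX x:W (int r). y - (T ^^ r) x:W (- int r - 1))"

lemma lifted_monoD: assumes "lifted_mono W" shows "subgrp (W r)" "ker<=W r" "W r<=W (r + 1)" "x:W r ==> T x:W (r - 2)"
  "x:W (int k) ==> (T ^^ k) x:W (- int k - 1) ==> x:W (int k - 1)"
  "y:W (- int k) ==> EX x:W (int k). y - (T ^^ k) x:W (- int k - 1)" using assms unfolding lifted_mono_def by blast+

lemma lifted_mono: assumes "lifted_mono W" "r <= s" shows "W r<=W s"
proof -
 have "W r<=W (r + int k)" for k
 proof(induction k)
  case (Suc k)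
  have "W (r + int k)<=W (r + int k + 1)" using assms(1) by(simp add:lifted_mono_def)
  thus ?case using Suc by(simp add:algebra_simps)
 qed simp
 from this[of "nat (s - r)"] show ?thesis using assms(2) by simp
qed

lemma lifted_T_pow: assumes "lifted_mono W" "x:W r" shows "(T ^^ k) x:W (r - 2 * int k)"
proof(induction k)
 case (Suc k)
 have "T ((T ^^ k) x):W (r - 2 * int k - 2)" using lifted_monoD(4)[OF assms(1) Suc] .
 thus ?case by(simp add:algebra_simps)
qed (use assms in simp)

text \<open>For the converse, descend from a step that is everything: for \<open>x\<close> in
  \<open>W (k + d)\<close> with \<open>d > 0\<close> the assumption puts
  \<open>(T ^^ (k + d)) x\<close> into \<open>W (- (k + d) - 1)\<close>, so injectivity on the
  graded piece lowers \<open>x\<close> by one step.\<close>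

lemma lifted_nonneg: assumes W: "lifted_mono W" shows "x:W (int k) <-> (T ^^ (k + 1)) x:W (- int k - 2)"
proof
 assume "x:W (int k)"
 from lifted_T_pow[OF W this, of "k + 1"] show "(T ^^ (k + 1)) x:W (- int k - 2)" by(simp add:algebra_simps)
next
 assume *: "(T ^^ (k + 1)) x:W (- int k - 2)"
 obtain b where b: "W b=UNIV" using W by(auto simp:lifted_mono_def)
 have "b<=int k + int (nat (b - int k))" by simp
 from lifted_mono[OF W this] have "x:W (int k + int (nat (b - int k)))" unfolding b by blast
 moreover have "x:W (int k + int d) ==> x:W (int k)" for d
 proof(induction d)
  case (Suc d)
  have "(T ^^ (k + Suc d)) x=(T ^^ (d + (k + 1))) x" by(rule arg_cong[of _ _ "%n. (T ^^ n) x"]) simp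
  hence "(T ^^ (k + Suc d)) x=(T ^^ d) ((T ^^ (k + 1)) x)" by(simp only:funpow_add o_apply)
  hence "(T ^^ (k + Suc d)) x:W (- int k - 2 - 2 * int d)" using lifted_T_pow[OF W *] by simp
  hence "(T ^^ (k + Suc d)) x:W (- int (k + Suc d) - 1)"
   using lifted_mono[OF W, of "- int k - 2 - 2 * int d" "- int (k + Suc d) - 1"] by auto
  moreover have "x:W (int (k + Suc d))" using Suc.prems unfolding of_nat_add .
  ultimately have "x:W (int (k + Suc d) - 1)" by(intro lifted_monoD(5)[OF W])
  thus ?case using Suc.IH by simp
 qed simp
 ultimately show "x:W (int k)" by blast
qed

text \<open>Surjectivity on the graded pieces, iterated down to a step that is
  \<open>ker\<close>.\<close>

lemma lifted_nonpos: assumes W: "lifted_mono W" and y: "y:W (- int k)" shows "EX x:W (int k). y - (T ^^ k) x:ker"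
proof -
 obtain a where a: "W a=ker" using W by(auto simp:lifted_mono_def)
 have sg: "subgrp (W r)" for r using W by(simp add:lifted_mono_def)
 have "- int k<=a + int m ==> y:W (- int k) ==> EX x:W (int k). y - (T ^^ k) x:ker" for m
 proof(induction m arbitrary: k y)
  case 0
  hence "y:ker" using lifted_mono[OF W, of "- int k" a] a by auto
  thus ?case using subgrp_0[OF sg] by(intro bexI[of _ 0]) (simp_all add:T_pow_0)
 next
  case (Suc m)
  obtain x where x: "x:W (int k)" "y - (T ^^ k) x:W (- int k - 1)" using lifted_monoD(6)[OF W Suc.prems(2)] by blast
  moreover have "- int (Suc k) = - int k - 1" by simp
  ultimately have "y - (T ^^ k) x:W (- int (Suc k))" by metis
  then obtain x' where x': "x':W (int (Suc k))" "y - (T ^^ k) x - (T ^^ Suc k) x':ker"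
   using Suc.IH[of "Suc k"] Suc.prems by auto
  have "T x':W (int k - 1)" using lifted_T_pow[OF W x'(1), of 1] by simp
  hence "x + T x':W (int k)" using lifted_mono[OF W, of "int k - 1" "int k"] x(1) by(auto intro:subgrp_add[OF sg])
  moreover have "y - (T ^^ k) (x + T x')=y - (T ^^ k) x - (T ^^ Suc k) x'" by(simp add:T_pow_add funpow_swap1)
  ultimately show ?case using x'(2) by metis
 qed
 from this[of "nat (- int k - a)"] show ?thesis using y by simp
qed

text \<open>\<open>W (- k)\<close> is determined by \<open>W k\<close> through
  \<open>lifted_nonpos\<close>, and \<open>W k\<close> by \<open>W (- k - 2)\<close> through
  \<open>lifted_nonneg\<close>. Hence agreement at \<open>k + 2\<close> gives agreement at
  \<open>k\<close>, starting where both filtrations are everything.\<close>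

lemma lifted_unique: assumes W: "lifted_mono W" and W': "lifted_mono W'" shows "W=W'"
proof -
 obtain b b' where b: "W b=UNIV" "W' b'=UNIV" using W W' by(auto simp:lifted_mono_def)
 let ?P = "%k::nat. W (int k)=W' (int k) & W (- int k)=W' (- int k)"
 have neg: "W (- int k)=W' (- int k)" if "W (int k)=W' (int k)" for k
 proof -
  have *: "V (- int k)={y. EX x:V (int k). y - (T ^^ k) x:ker}" if V: "lifted_mono V" for V
  proof(intro equalityI subsetI)
   fix y assume "y:{y. EX x:V (int k). y - (T ^^ k) x:ker}"
   then obtain x where x: "x:V (int k)" "y - (T ^^ k) x:ker" by auto
   have "(T ^^ k) x:V (- int k)" using lifted_T_pow[OF V x(1), of k] by(simp add:algebra_simps)
   thus "y:V (- int k)" using subgrp_cong[OF lifted_monoD(1)[OF V], of y "(T ^^ k) x" "- int k"] x(2)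
     lifted_monoD(2)[OF V, of "- int k"] by auto
  qed (use lifted_nonpos[OF V] in auto)
  show ?thesis using *[OF W] *[OF W'] that by simp
 qed
 have "max b b'<=int k + int m ==> ?P k" for m k
 proof(induction m arbitrary: k rule:less_induct)
  case (less m)
  show ?case
  proof(cases "max b b'<=int k")
   case True
   hence "W (int k)=UNIV" "W' (int k)=UNIV"
    using lifted_mono[OF W, of b "int k"] lifted_mono[OF W', of b' "int k"] b by auto
   thus ?thesis using neg by simp
  next
   case False
   hence "m > 0" using less.prems by(cases m) auto
   hence "?P (k + 2)" using less.prems by(intro less.IH[of "m - 1"]) auto
   hence "W (- int k - 2)=W' (- int k - 2)" by(simp add:algebra_simps)
   hence "W (int k)=W' (int k)" using lifted_nonneg[OF W] lifted_nonneg[OF W'] by blast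
   thus ?thesis using neg by simp
  qed
 qed
 note main = this
 have P: "?P k" for k
 proof(rule main)
  show "max b b'<=int k + int (nat (max b b'))" by linarith
 qed
 show ?thesis
 proof
  fix r show "W r=W' r"
  proof(cases "r>=0")
   case True
   thus ?thesis using P[of "nat r"] by simp
  next
   case False
   thus ?thesis using P[of "nat (- r)"] by simp
  qed
 qed
qed

lemma presented_gr: assumes "subgrp A" "!!k x. x:A ==> sc k x:A" "subgrp B" "ker<=B" "B<=A" "!!k x. x:B ==> sc k x:B"
 shows "presented (quotient_module (V\<lparr>carrier := ups ` A\<rparr>) (ups ` B)) (coset B) sc A UNIV"
 by(rule quotient) (use assms sc_diff in auto)

lemma induced_pow_coset: assumes "subgrp B" "subgrp B'" "ker<=B'" "!!x. x:B ==> (T ^^ k) x:B'"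
 shows "induced_map V (ups ` B') (N ^^ k) (coset B x) = coset B' ((T ^^ k) x)"
 by(rule induced_coset) (insert assms, auto simp:N_pow T_pow_diff[symmetric])

context
 fixes W :: "int=>'k set"
 assumes sg: "!!r. subgrp (W r)" and ker_W: "!!r. ker<=W r" and sc_W: "!!r k x. x:W r ==> sc k x:W r"
  and W_Suc: "!!r. W r<=W (r + 1)" and T_W: "!!r. T ` W r<=W (r - 2)"
begin

lemma T_pow_W: "x:W r ==> (T ^^ k) x:W (r - 2 * int k)"
proof(induction k)
 case (Suc k)
 hence "T ((T ^^ k) x):W (r - 2 * int k - 2)" using T_W by blast
 thus ?case by(simp add:algebra_simps)
qed simp

lemma W_pred: "W (r - 1)<=W r" using W_Suc[of "r - 1"] by simp

lemma gr_presented: "presented (gr V (%r. ups ` W r) r) (coset (W (r - 1))) sc (W r) UNIV"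
 unfolding gr_def by(rule presented_gr) (use sg ker_W sc_W W_pred in auto)

lemma gr_pow_coset: "gr_pow V N (%r. ups ` W r) r k (coset (W (r - 1)) x) = coset (W (r - 2 * int k - 1)) ((T ^^ k) x)"
 unfolding gr_pow_def
proof(rule induced_pow_coset[OF sg sg ker_W])
 fix x assume "x:W (r - 1)"
 hence "(T ^^ k) x:W (r - 1 - 2 * int k)" by(rule T_pow_W)
 thus "(T ^^ k) x:W (r - 2 * int k - 1)" by(simp add:algebra_simps)
qed

lemma coset_W_eq: "coset (W r) x = coset (W r) y <-> x - y:W r" by(rule coset_eq_iff) (use sg ker_W in auto)

text \<open>Stated for parts \<open>X\<close> and \<open>Y\<close> of the two steps, so that it
  serves for the graded pieces themselves and for the filtration that \<open>F\<close> induces on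
  them.\<close>

lemma gr_pow_iso_restrict: assumes X: "subgrp X" "X<=W (int r)" and Y: "Y<=W (- int r)"
  and XY: "!!x. x:X ==> (T ^^ r) x:Y" and inj: "!!x. x:X ==> (T ^^ r) x:W (- int r - 1) ==> x:W (int r - 1)"
  and surj: "!!y. y:Y ==> EX x:X. y - (T ^^ r) x:W (- int r - 1)"
 shows "gr_pow V N (%r. ups ` W r) (int r) r:iso ((add_monoid (gr V (%r. ups ` W r) (int r)))\<lparr>carrier := coset
  (W (int r - 1)) ` X\<rparr>) ((add_monoid (gr V (%r. ups ` W r) (- int r)))\<lparr>carrier := coset (W (- int r -
  1)) ` Y\<rparr>)"
  (is "?g:iso ?A ?B")
proof -
 interpret G: presented "gr V (%r. ups ` W r) (int r)" "coset (W (int r - 1))" sc "W (int r)" UNIV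
  by(rule gr_presented)
 interpret H: presented "gr V (%r. ups ` W r) (- int r)" "coset (W (- int r - 1))" sc "W (- int r)" UNIV
  by(rule gr_presented)
 have g: "?g (coset (W (int r - 1)) x) = coset (W (- int r - 1)) ((T ^^ r) x)" for x
  using gr_pow_coset[of "int r" r x] by simp
 have "?g:hom ?A ?B"
 proof(rule homI)
  fix x y
  assume "x:carrier ?A" "y:carrier ?A"
  then obtain u w where u: "x = coset (W (int r - 1)) u" "y = coset (W (int r - 1)) w" "u:X" "w:X" by auto
  hence "u:W (int r)" "w:W (int r)" "(T ^^ r) u:W (- int r)" "(T ^^ r) w:W (- int r)" using X Y XY by auto
  thus "?g (x \<otimes>\<^bsub>?A\<^esub> y)=?g x \<otimes>\<^bsub>?B\<^esub> ?g y"
   using u by(simp add:G.add H.add g T_pow_add)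
 qed (auto simp:g XY)
 moreover have "bij_betw ?g (coset (W (int r - 1)) ` X) (coset (W (- int r - 1)) ` Y)" unfolding bij_betw_def
 proof
  show "inj_on ?g (coset (W (int r - 1)) ` X)"
  proof(rule inj_onI)
   fix x y assume "x:coset (W (int r - 1)) ` X" "y:coset (W (int r - 1)) ` X" and eq: "?g x=?g y"
   then obtain u w where u: "x = coset (W (int r - 1)) u" "y = coset (W (int r - 1)) w" "u:X" "w:X" by auto
   hence "(T ^^ r) (u - w):W (- int r - 1)" using eq by(simp add:g coset_W_eq T_pow_diff)
   thus "x=y" using inj[of "u - w"] subgrp_diff[OF X(1)] u by(simp add:coset_W_eq)
  qed
  show "?g ` coset (W (int r - 1)) ` X = coset (W (- int r - 1)) ` Y"
  proof(intro equalityI subsetI)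
   fix v assume "v:coset (W (- int r - 1)) ` Y"
   then obtain y where "v = coset (W (- int r - 1)) y" "y:Y" by auto
   moreover then obtain x where "x:X" "y - (T ^^ r) x:W (- int r - 1)" using surj by blast
   ultimately have "v=?g (coset (W (int r - 1)) x)" "x:X" by(simp_all add:g coset_W_eq)
   thus "v:?g ` coset (W (int r - 1)) ` X" by blast
  qed (auto simp:g XY)
 qed
 ultimately show ?thesis by(simp add:iso_def)
qed

end

lemma lifted_imp_monodromy: assumes W: "lifted_mono W" and sc: "!!r k x. x:W r ==> sc k x:W r"
 shows "is_monodromy_filtration V N (%r. ups ` W r)" unfolding is_monodromy_filtration_def
proof(intro conjI allI)
 have sg: "subgrp (W r)" and kW: "ker<=W r" and Suc: "W r<=W (r + 1)" and T_W: "T ` W r<=W (r - 2)" for r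
  using W by(simp_all add:lifted_mono_def)
 show "additive_subgroup (ups ` W r) V" for r by(rule additive_subgroup_image) (use sg in auto)
 show "ALL x:ups ` W r. k \<odot>\<^bsub>V\<^esub> x:ups ` W r" for r k using sc by(auto simp:smult)
 show "ups ` W r<=ups ` W (r + 1)" for r using Suc by blast
 obtain a where "W a=ker" using W by(auto simp:lifted_mono_def)
 hence "ups ` W a={\<zero>\<^bsub>V\<^esub>}" using subgrp_0[OF ker] by(auto simp:zero ker_def)
 thus "EX a. ups ` W a={\<zero>\<^bsub>V\<^esub>}" ..
 obtain b where "W b=UNIV" using W by(auto simp:lifted_mono_def)
 hence "ups ` W b = carrier V" by(simp add:carrier)
 thus "EX b. ups ` W b = carrier V" ..
 show "N ` ups ` W r<=ups ` W (r - 2)" for r using T_W[of r] by(auto simp:N)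
 fix r :: nat
 have c: "carrier (gr V (%r. ups ` W r) s) = coset (W (s - 1)) ` W s" for s
  by(rule presented.carrier[OF gr_presented]) (use sg kW sc Suc T_W in auto)
 have "gr_pow V N (%r. ups ` W r) (int r) r:iso ((add_monoid (gr V (%r. ups ` W r) (int r)))\<lparr>carrier := coset
  (W (int r - 1)) ` W (int r)\<rparr>) ((add_monoid (gr V (%r. ups ` W r) (- int r)))\<lparr>carrier := coset (W (-
  int r - 1)) ` W (- int r)\<rparr>)"
  by(rule gr_pow_iso_restrict)
   (insert sg kW sc Suc T_W W lifted_T_pow[OF W, of _ "int r" r], auto simp:lifted_mono_def algebra_simps)
 thus "gr_pow V N (%r. ups ` W r) (int r) r:iso (add_monoid (gr V (%r. ups ` W r) (int r))) (add_monoid (gr V (%r.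
  ups ` W r) (- int r)))"
  by(simp add:c[symmetric])
qed

text \<open>This direction serves the uniqueness under \<open>THE\<close>: every competitor lifts,
  and lifts are unique.\<close>

lemma monodromy_imp_lifted: assumes W: "is_monodromy_filtration V N W"
 shows "lifted_mono (%r. ups -` W r)" "W r=ups ` (ups -` W r)" 
proof -
 have as: "additive_subgroup (W r) V" and Wsc: "!!x c. x:W r ==> c \<odot>\<^bsub>V\<^esub> x:W r" and
  WSuc: "W r<=W (r + 1)" and WN: "N ` W r<=W (r - 2)" for r using W unfolding is_monodromy_filtration_def by blast+
 have Wa: "EX a. W a={\<zero>\<^bsub>V\<^esub>}" and Wb: "EX b. W b = carrier V" and
  Wiso: "!!r::nat. gr_pow V N W (int r) r:iso (add_monoid (gr V W (int r))) (add_monoid (gr V W (- int r)))"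
  using W unfolding is_monodromy_filtration_def by blast+
 have sub: "W r<=range ups" for r using additive_subgroup.a_subset[OF as] by(simp add:carrier)
 thus im: "W r=ups ` (ups -` W r)" for r by blast
 have z: "ups 0:W r" for r using additive_subgroup.zero_closed[OF as] by(simp add:zero)
 have sg: "subgrp (ups -` W r)" for r
 proof(rule subgrpI)
  fix x y assume "x:ups -` W r" "y:ups -` W r"
  hence "ups x \<oplus>\<^bsub>V\<^esub> \<ominus>\<^bsub>V\<^esub> ups y:W r"
   using additive_subgroup.a_closed[OF as] additive_subgroup.a_inv_closed[OF as] V.abelian_group_axioms by auto
  thus "x - y:ups -` W r" by(simp add:minus add)
 qed (use z in simp)
 have kW: "ker<=ups -` W r" for r using z by(auto simp:ker_def)
 have sc: "x:ups -` W r ==> sc k x:ups -` W r" for r k x using Wsc[of "ups x" r k] by(simp add:smult)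
 have Suc: "ups -` W r<=ups -` W (r + 1)" for r using WSuc by blast
 have T_W: "T ` (ups -` W r)<=ups -` W (r - 2)" for r using WN[of r] N by(metis image_subset_iff vimageE vimageI2)
 obtain a where "W a={\<zero>\<^bsub>V\<^esub>}" using Wa ..
 hence a: "ups -` W a=ker" by(auto simp:zero ker_def)
 obtain b where "W b = carrier V" using Wb ..
 hence b: "ups -` W b=UNIV" by(auto simp:carrier)
 let ?L = "%r. ups -` W r"
 have c: "carrier (gr V W s) = coset (?L (s - 1)) ` ?L s" for s
  using presented.carrier[OF gr_presented[of ?L s]] sg kW sc Suc T_W im by simp
 have g: "gr_pow V N W s k (coset (?L (s - 1)) x) = coset (?L (s - 2 * int k - 1)) ((T ^^ k) x)" for s k x
  using gr_pow_coset[of ?L s k x] sg kW sc Suc T_W im by simp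
 have eq: "coset (?L r) x = coset (?L r) y <-> x - y:?L r" for r x y by(rule coset_eq_iff) (use sg kW in auto)
 have bij: "bij_betw (gr_pow V N W (int r) r) (coset (?L (int r - 1)) ` ?L (int r)) (coset (?L (- int r - 1)) ` ?L (-
  int r))" for r
  using Wiso[of r] by(simp add:iso_def c)
 have inj: "x:?L (int r - 1)" if x: "x:?L (int r)" "(T ^^ r) x:?L (- int r - 1)" for x and r :: nat
 proof -
  have "gr_pow V N W (int r) r (coset (?L (int r - 1)) x)=gr_pow V N W (int r) r (coset (?L (int r - 1)) 0)"
   using x(2) by(simp only:g eq) (simp add:T_pow_0)
  from this have "coset (?L (int r - 1)) x = coset (?L (int r - 1)) 0"
   by(rule inj_onD[OF bij_betw_imp_inj_on[OF bij[of r]]]) (rule imageI, rule x(1), rule imageI, rule subgrp_0[OF sg])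
  thus ?thesis by(simp only:eq) simp
 qed
 have surj: "EX x:?L (int r). y - (T ^^ r) x:?L (- int r - 1)" if y: "y:?L (- int r)" for y and r :: nat
 proof -
  have "coset (?L (- int r - 1)) y:gr_pow V N W (int r) r ` coset (?L (int r - 1)) ` ?L (int r)"
   unfolding bij_betw_imp_surj_on[OF bij[of r]] using y by(rule imageI)
  then obtain x where x: "x:?L (int r)" "coset (?L (- int r - 1)) y=gr_pow V N W (int r) r (coset (?L (int r - 1))
   x)" by blast
  have r: "int r - 2 * int r - 1 = - int r - 1" by simp
  have "y - (T ^^ r) x:?L (- int r - 1)" using x(2) unfolding g r eq .
  thus ?thesis using x(1) by(rule bexI)
 qed
 show "lifted_mono ?L" unfolding lifted_mono_def
 proof(intro conjI allI)
  show "EX a. ?L a=ker" by(rule exI[of _ a]) (rule a)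
  show "EX b. ?L b=UNIV" by(rule exI[of _ b]) (rule b)
  show "ALL x:?L (int r). (T ^^ r) x:?L (- int r - 1) --> x:?L (int r - 1)" for r by(intro ballI impI) (rule inj)
  show "ALL y:?L (- int r). EX x:?L (int r). y - (T ^^ r) x:?L (- int r - 1)" for r by(intro ballI) (rule surj)
 qed (rule sg kW Suc T_W)+
qed

lemma monodromy_filtration_eq: assumes W: "lifted_mono W" and sc: "!!r k x. x:W r ==> sc k x:W r"
 shows "monodromy_filtration V N=(%r. ups ` W r)" unfolding monodromy_filtration_def
proof(rule the_equality)
 show "is_monodromy_filtration V N (%r. ups ` W r)" using lifted_imp_monodromy assms by blast
 fix W' assume W': "is_monodromy_filtration V N W'"
 have "(%r. ups -` W' r)=W" using lifted_unique[OF monodromy_imp_lifted(1)[OF W'] W] .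
 thus "W'=(%r. ups ` W r)" using monodromy_imp_lifted(2)[OF W'] by metis
qed

end

subsection \<open>Filtered Jordan decompositions\<close>

text \<open>A filtered Jordan decomposition \<open>V = \<Oplus> q \<le> ro. \<Oplus> j < q. N\<^sup>j (C q)\<close>: the filtration \<open>F\<close> is the
  direct sum of its intersections with the summands, where \<open>N\<^sup>j\<close> shifts it by \<open>j\<close>.\<close>

locale filtered_jordan = presented_endo V ups sc N T
 for V :: "(complex, 'v) module" and ups :: "'k::ab_group_add=>'v" and sc N T +
 fixes F :: "int=>'v set" and Fk :: "int=>'k set" and C :: "nat=>'k set" and ro :: nat
 assumes F: "F l=ups ` Fk l" and Fk: "subgrp (Fk l)" and T_Fk: "x:Fk l ==> T x:Fk (l + 1)"
  and exhaustive: "EX l. x:Fk l"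
  and C: "subgrp (C q)" and sc_C: "x:C q ==> sc k x:C q" and sc_T: "sc k (T x)=T (sc k x)"
  and C_ker: "x:C q ==> (T ^^ q) x:ker"
  and decompose: "x:Fk l ==> EX c. (ALL q j. c q j:C q & c q j:Fk (l - int j)) & x - (SUM q<=ro. SUM j<q. (T ^^ j) (c
   q j)):ker"
  and unique: "!!c q j. (!!q j. c q j:C q) ==> (SUM q<=ro. SUM j<q. (T ^^ j) (c q j)):ker ==> q<=ro ==> j < q ==> c q j=0"
begin

definition adm :: "(nat=>nat=>'k)=>bool" where "adm c <-> (ALL q j. c q j:C q)"

definition S :: "(nat=>nat=>'k)=>'k" where "S c=(SUM q<=ro. SUM j<q. (T ^^ j) (c q j))"

lemma adm_diff: "adm c ==> adm d ==> adm (%q j. c q j - d q j)" by(simp add:adm_def subgrp_diff[OF C])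
lemma adm_sum: "(!!i. i:J ==> adm (c i)) ==> adm (%q j. SUM i:J. c i q j)" by(simp add:adm_def subgrp_sum[OF C])
lemma S_diff: "S (%q j. c q j - d q j)=S c - S d" by(simp add:S_def T_pow_diff sum_subtractf)

lemma S_sum: "S (%q j. SUM i:J. c i q j)=(SUM i:J. S (c i))"
 by(induction J rule:infinite_finite_induct) (simp_all add:S_def T_pow_0 T_pow_add sum.distrib)

lemma S_unique: assumes "adm c" "adm d" "S c - S d:ker" "q<=ro" "j < q" shows "c q j=d q j"
 using unique[of "%q j. c q j - d q j" q j] assms adm_diff[OF assms(1,2)]
 by(simp add:adm_def S_diff[symmetric]) (simp add:S_def)

lemma expand: "EX c. adm c & x - S c:ker" using exhaustive[of x] decompose[of x] unfolding adm_def S_def by blast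

text \<open>The coefficients of \<open>(T ^^ k) (S c)\<close>. Entries pushed beyond
  \<open>j < q\<close> are dropped, rightly so because \<open>T ^^ q\<close> kills
  \<open>C q\<close>.\<close>

definition shift :: "nat=>(nat=>nat=>'k)=>nat=>nat=>'k" where
 "shift k c q j=(if j < k then 0 else c q (j - k))"

lemma adm_shift: "adm c ==> adm (shift k c)" by(simp add:adm_def shift_def subgrp_0[OF C])
lemma T_pow_C: "x:C q ==> q<=j ==> (T ^^ j) x:ker" using T_pow_ker[OF C_ker, of x q "j - q"] by(simp add:T_pow_comp)

lemma T_pow_S: assumes "adm c" shows "(T ^^ k) (S c) - S (shift k c):ker"
proof -
 have "(SUM j<q. (T ^^ (k + j)) (c q j)) - (SUM j<q. (T ^^ j) (shift k c q j)):ker" for q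
 proof -
  have "(SUM j<q. (T ^^ j) (shift k c q j))=(SUM j:{..<q} Int {k..}. (T ^^ j) (c q (j - k)))"
   by(rule sum.mono_neutral_cong_right) (auto simp:shift_def T_pow_0)
  also have "... = (SUM j<q - k. (T ^^ (k + j)) (c q j))"
   by(rule sum.reindex_bij_witness[of _ "%j. j + k" "%j. j - k"]) auto
  finally have eq: "(SUM j<q. (T ^^ j) (shift k c q j))=(SUM j<q - k. (T ^^ (k + j)) (c q j))" .
  have "(SUM j<q. (T ^^ (k + j)) (c q j))=(SUM j:{..<q} - {..<q - k}. (T ^^ (k + j)) (c q j)) + (SUM j<q - k. (T ^^
   (k + j)) (c q j))"
   by(rule sum.subset_diff) auto
  hence "(SUM j<q. (T ^^ (k + j)) (c q j)) - (SUM j<q. (T ^^ j) (shift k c q j))=(SUM j:{..<q} - {..<q - k}. (T ^^ (k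
   + j)) (c q j))"
   by(simp only:eq add_diff_cancel_right')
  also have "... : ker" by(rule subgrp_sum[OF ker]) (insert assms, auto simp:adm_def intro!:T_pow_C)
  finally show ?thesis .
 qed
 hence "(SUM q<=ro. (SUM j<q. (T ^^ (k + j)) (c q j)) - (SUM j<q. (T ^^ j) (shift k c q j))):ker"
  by(intro subgrp_sum[OF ker])
 thus ?thesis by(simp add:S_def T_pow_sum T_pow_comp sum_subtractf)
qed

lemma T_pow_expand: assumes "adm c" "x - S c:ker" shows "(T ^^ k) x - S (shift k c):ker"
proof -
 have "(T ^^ k) (x - S c) + ((T ^^ k) (S c) - S (shift k c)):ker" by(intro subgrp_add[OF ker] T_pow_ker T_pow_S assms)
 thus ?thesis by(simp add:T_pow_diff)
qed

text \<open>The string \<open>C q\<close>, \<open>T (C q)\<close>, ... of length \<open>q\<close>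
  gets the weights q - 1, q - 3, ..., 1 - q, symmetric about 0. Entries of weight above
  \<open>w\<close> are required to vanish.\<close>

definition wt0 :: "int=>(nat=>nat=>'k)=>bool" where
 "wt0 w c <-> (ALL q<=ro. ALL j<q. w < int q - 1 - 2 * int j --> c q j=0)"

definition W :: "int=>'k set" where
 "W w={x. EX c. adm c & x - S c:ker & wt0 w c}"

lemma W_iff: assumes "adm c" "x - S c:ker" shows "x:W w <-> wt0 w c"
proof
 assume "x:W w"
 then obtain d where d: "adm d" "x - S d:ker" "wt0 w d" by(auto simp:W_def)
 have "S c - S d:ker" using subgrp_diff[OF ker d(2) assms(2)] by simp
 hence "c q j=d q j" if "q<=ro" "j < q" for q j using S_unique assms(1) d(1) that by blast
 thus "wt0 w c" using d(3) by(simp add:wt0_def)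
qed (insert assms, auto simp:W_def)

lemma W_subgroup: "subgrp (W w)"
proof(rule subgrpI)
 have "adm (%q j. 0)" "S (%q j. 0)=0" by(simp_all add:adm_def S_def T_pow_0 subgrp_0[OF C])
 thus "0:W w" unfolding W_def wt0_def using subgrp_0[OF ker] by(intro CollectI exI[of _ "%q j. 0"]) simp
 fix x y assume "x:W w" "y:W w"
 then obtain c d where c: "adm c" "x - S c:ker" "wt0 w c" and d: "adm d" "y - S d:ker" "wt0 w d"
  unfolding W_def by blast
 have "(x - S c) - (y - S d):ker" by(rule subgrp_diff[OF ker c(2) d(2)])
 hence "x - y - S (%q j. c q j - d q j):ker" by(simp add:S_diff algebra_simps)
 from W_iff[OF adm_diff[OF c(1) d(1)] this] show "x - y:W w" using c(3) d(3) by(simp add:wt0_def)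
qed

lemma ker_W: "ker<=W w"
proof
 fix x assume "x:ker"
 thus "x:W w" unfolding W_def wt0_def
  by(intro CollectI exI[of _ "%q j. 0"]) (simp add:adm_def S_def T_pow_0 subgrp_0[OF C])
qed

lemma W_mono: "w<=w' ==> W w<=W w'" unfolding W_def wt0_def by force

lemma sc_ker: "x:ker ==> sc k x:ker"
proof -
 assume "x:ker"
 hence "ups (sc k x)=ups (sc k 0)" by(simp add:ker_def smult[symmetric])
 thus ?thesis using sc_diff[of k 0 0] by(simp add:ker_def)
qed

lemma sc_S: "sc k (S c)=S (%q j. sc k (c q j))"
proof -
 have 0: "sc k 0=0" using sc_diff[of k 0 0] by simp
 have a: "sc k (x + y) = sc k x + sc k y" for x y using sc_diff[of k x "- y"] sc_diff[of k 0 y] 0 by simp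
 have s: "sc k (sum g J)=(SUM i:J. sc k (g i))" for g :: "nat=>'k" and J
  by(induction J rule:infinite_finite_induct) (simp_all add:0 a)
 have t: "sc k ((T ^^ j) x)=(T ^^ j) (sc k x)" for j x by(induction j) (simp_all add:sc_T)
 show ?thesis by(simp add:S_def s t)
qed

lemma sc_W: "x:W w ==> sc k x:W w"
proof -
 assume "x:W w"
 then obtain c where c: "adm c" "x - S c:ker" "wt0 w c" unfolding W_def by blast
 have "sc k x - S (%q j. sc k (c q j)):ker" using sc_ker[OF c(2), of k] by(simp add:sc_diff sc_S)
 moreover have "adm (%q j. sc k (c q j))" using c(1) sc_C by(simp add:adm_def)
 moreover have "wt0 w (%q j. sc k (c q j))" using c(3) sc_diff[of k 0 0] by(simp add:wt0_def)
 ultimately show ?thesis unfolding W_def by blast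
qed

lemma W_lifted: "lifted_mono W" unfolding lifted_mono_def
proof(intro conjI allI)
 show "subgrp (W r)" for r by(rule W_subgroup)
 show "ker<=W r" for r by(rule ker_W)
 show "W r<=W (r + 1)" for r by(rule W_mono) simp
 have "W (- int ro - 1)<=ker"
 proof
  fix x assume "x:W (- int ro - 1)"
  then obtain c where c: "adm c" "x - S c:ker" "wt0 (- int ro - 1) c" unfolding W_def by blast
  have "S c=0" unfolding S_def
  proof(intro sum.neutral ballI)
   fix q j assume "q:{..ro}" "j:{..<q}"
   hence "c q j=0" using c(3) unfolding wt0_def by auto
   thus "(T ^^ j) (c q j)=0" by(simp add:T_pow_0)
  qed
  thus "x:ker" using c(2) by simp
 qed
 hence "W (- int ro - 1)=ker" using ker_W by blast
 thus "EX a. W a=ker" by(rule exI[of _ "- int ro - 1"])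
 have "x:W (int ro)" for x
 proof -
  obtain c where "adm c" "x - S c:ker" using expand by blast
  thus ?thesis unfolding W_iff[OF `adm c` `x - S c : ker`] by(auto simp:wt0_def)
 qed
 hence "W (int ro)=UNIV" by blast
 thus "EX b. W b=UNIV" by(rule exI[of _ "int ro"])
 show "T ` W r<=W (r - 2)" for r
 proof safe
  fix x assume "x:W r"
  then obtain c where c: "adm c" "x - S c:ker" "wt0 r c" unfolding W_def by blast
  have "T x - S (shift 1 c):ker" using T_pow_expand[OF c(1,2), of 1] by simp
  moreover have "wt0 (r - 2) (shift 1 c)" using c(3) by(auto simp:wt0_def shift_def)
  ultimately show "T x:W (r - 2)" using W_iff[OF adm_shift[OF c(1)]] by blast
 qed
 fix r :: nat
 show "ALL x:W (int r). (T ^^ r) x:W (- int r - 1) --> x:W (int r - 1)"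
 proof(intro ballI impI)
  fix x assume x: "x:W (int r)" "(T ^^ r) x:W (- int r - 1)"
  then obtain c where c: "adm c" "x - S c:ker" "wt0 (int r) c" unfolding W_def by blast
  have s: "wt0 (- int r - 1) (shift r c)" using x(2) W_iff[OF adm_shift[OF c(1)] T_pow_expand[OF c(1,2)]] by blast
  have "wt0 (int r - 1) c" unfolding wt0_def
  proof(intro allI impI)
   fix q j assume q: "q<=ro" "j < q" "int r - 1 < int q - 1 - 2 * int j"
   show "c q j=0"
   proof(cases "int r < int q - 1 - 2 * int j")
    case True
    thus ?thesis using c(3) q unfolding wt0_def by blast
   next
    case False
    \<comment> \<open>The weight is exactly \<open>r\<close> here, so \<open>T ^^ r\<close> moves
      the entry to the place \<open>j + r\<close> of its string, of weight \<open>- r\<close>, where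
      it has to vanish.\<close>
    hence "j + r < q" "- int r - 1 < int q - 1 - 2 * int (j + r)" using q by auto
    hence "shift r c q (j + r)=0" using s q(1) unfolding wt0_def by blast
    thus ?thesis by(simp add:shift_def)
   qed
  qed
  thus "x:W (int r - 1)" using W_iff[OF c(1,2)] by blast
 qed
 show "ALL y:W (- int r). EX x:W (int r). y - (T ^^ r) x:W (- int r - 1)"
 proof
  fix y assume "y:W (- int r)"
  then obtain d where d: "adm d" "y - S d:ker" "wt0 (- int r) d" unfolding W_def by blast
  \<comment> \<open>The entries of \<open>d\<close> of weight \<open>- r\<close> are moved back by
    \<open>r\<close> places along their strings, to weight \<open>r\<close>.\<close>
  define c where "c q j=(if int q - 1 - 2 * int j=int r then d q (j + r) else 0)" for q j
  have c: "adm c" using d(1) by(simp add:adm_def c_def subgrp_0[OF C])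
  have ker0: "S c - S c:ker" using subgrp_0[OF ker] by simp
  have Sc: "S c:W (int r)" unfolding W_iff[OF c ker0] by(auto simp:wt0_def c_def)
  have "y - (T ^^ r) (S c) - S (%q j. d q j - shift r c q j):ker"
   using subgrp_diff[OF ker d(2) T_pow_expand[OF c ker0, of r]] by(simp add:S_diff algebra_simps)
  moreover have "wt0 (- int r - 1) (%q j. d q j - shift r c q j)" unfolding wt0_def
   proof(intro allI impI)
    fix q j assume q: "q<=ro" "j < q" "- int r - 1 < int q - 1 - 2 * int j"
    show "d q j - shift r c q j=0"
    proof(cases "- int r < int q - 1 - 2 * int j")
     case True
     hence "d q j=0" using d(3) q unfolding wt0_def by blast
     moreover have "shift r c q j=0" using True by(auto simp:shift_def c_def)
     ultimately show ?thesis by simp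
    next
     case False
     hence "j>=r" "int q - 1 - 2 * int (j - r)=int r" using q by auto
     thus ?thesis by(simp add:shift_def c_def)
    qed
   qed
  ultimately have "y - (T ^^ r) (S c):W (- int r - 1)" using W_iff[OF adm_diff[OF d(1) adm_shift[OF c]]] by blast
  thus "EX x:W (int r). y - (T ^^ r) x:W (- int r - 1)" using Sc by blast
 qed
qed

lemma monodromy: "monodromy_filtration V N=(%r. ups ` W r)" by(rule monodromy_filtration_eq[OF W_lifted]) (rule sc_W)

lemma T_pow_Fk: "x:Fk l ==> (T ^^ k) x:Fk (l + int k)"
proof(induction k)
 case (Suc k)
 hence "T ((T ^^ k) x):Fk (l + int k + 1)" by(intro T_Fk)
 thus ?case by(simp add:algebra_simps)
qed simp

text \<open>By uniqueness the expansion adapted to \<open>F\<close> is adapted to \<open>W\<close>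
  as well. So the two filtrations split simultaneously, which is the source of all compatibility
  statements below.\<close>

lemma Fk_W_decompose: assumes "x:Fk l" "x:W w"
 obtains c where "adm c" "!!q j. c q j:Fk (l - int j)" "x - S c:ker" "wt0 w c"
proof -
 obtain c where "ALL q j. c q j:C q & c q j:Fk (l - int j)" "x - S c:ker"
  using decompose[OF assms(1)] unfolding S_def by blast
 hence "adm c" "!!q j. c q j:Fk (l - int j)" by(auto simp:adm_def)
 thus ?thesis using that `x - S c : ker` assms(2) W_iff by blast
qed

lemma F_gr_eq: "F_gr V F (%r. ups ` W r) l r = coset (W (r - 1)) ` (Fk l Int W r)"
proof -
 have "F l Int ups ` W r=ups ` (Fk l Int W r)" using image_mem_iff[OF W_subgroup ker_W, of r] by(auto simp:F)
 thus ?thesis unfolding F_gr_def by(simp add:image_image a_r_coset_image[OF W_subgroup])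
qed

lemma top_weight: assumes "adm c" "x - S c:ker" "wt0 w c"
 shows "x - (SUM q<=ro. SUM j | j < q & int q - 1 - 2 * int j=w. (T ^^ j) (c q j)):W (w - 1)"
proof -
 let ?T = "%q. SUM j | j < q & int q - 1 - 2 * int j=w. (T ^^ j) (c q j)"
 define d where "d q j=(if int q - 1 - 2 * int j=w then 0 else c q j)" for q j
 have d: "adm d" using assms(1) by(simp add:adm_def d_def subgrp_0[OF C])
 have "(SUM j<q. (T ^^ j) (c q j)) - ?T q=(SUM j<q. (T ^^ j) (d q j))" for q
 proof -
  have "?T q=(SUM j<q. if int q - 1 - 2 * int j=w then (T ^^ j) (c q j) else 0)"
   by(simp add:sum.If_cases Int_def lessThan_def)
  thus ?thesis by(simp add:sum_subtractf[symmetric] del:sum_subtractf) (intro sum.cong refl, auto simp:d_def T_pow_0)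
 qed
 hence "S c - (SUM q<=ro. ?T q)=S d" unfolding S_def by(simp add:sum_subtractf[symmetric] del:sum_subtractf)
 hence "x - (SUM q<=ro. ?T q) - S d:ker" using assms(2) by(simp add:algebra_simps)
 moreover have "wt0 (w - 1) d" using assms(3) by(auto simp:wt0_def d_def)
 ultimately show ?thesis using W_iff[OF d] by blast
qed

text \<open>\<open>T ^^ k\<close> moves each entry by \<open>k\<close> places, so an element of its
  kernel only has entries in the last \<open>k\<close> places of each string.\<close>

lemma ker_pow_shift: assumes "adm c" "x - S c:ker" "(T ^^ k) x:ker" "q<=ro" "j + k < q" shows "c q j=0"
proof -
 have "S (shift k c) - S (%q j. 0):ker"
  using subgrp_diff[OF ker assms(3) T_pow_expand[OF assms(1,2), of k]] by(simp add:S_def T_pow_0)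
 from S_unique[OF adm_shift[OF assms(1)] _ this assms(4,5)] show ?thesis by(simp add:adm_def subgrp_0[OF C] shift_def)
qed

lemma ker_pow_W: "(T ^^ k) x:ker ==> x:W (int k - 1)"
proof -
 assume *: "(T ^^ k) x:ker"
 obtain c where c: "adm c" "x - S c:ker" using expand by blast
 show ?thesis unfolding W_iff[OF c] wt0_def using ker_pow_shift[OF c *] by auto
qed

lemma filtered_iso:
 "gr_pow V N (%r. ups ` W r) (int r) r:iso ((add_monoid (gr V (%r. ups ` W r) (int r)))\<lparr>carrier := F_gr V F
  (%r. ups ` W r) l (int r)\<rparr>) ((add_monoid (gr V (%r. ups ` W r) (- int r)))\<lparr>carrier := F_gr V F (%r.
  ups ` W r) (l + int r) (- int r)\<rparr>)"
 unfolding F_gr_eq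
proof(rule gr_pow_iso_restrict[OF W_subgroup ker_W sc_W])
 show "W r<=W (r + 1)" for r by(rule W_mono) simp
 show "T ` W r<=W (r - 2)" for r using lifted_monoD(4)[OF W_lifted] by blast
 show "subgrp (Fk l Int W (int r))" using Fk W_subgroup by(simp add:subgrp_def)
 show "(T ^^ r) x:Fk (l + int r) Int W (- int r)" if "x:Fk l Int W (int r)" for x
  using that T_pow_Fk[of x l r] lifted_T_pow[OF W_lifted, of x "int r" r] by(auto simp:algebra_simps)
 show "x:W (int r - 1)" if "x:Fk l Int W (int r)" "(T ^^ r) x:W (- int r - 1)" for x
  using that lifted_monoD(5)[OF W_lifted, of x r] by blast
 show "EX x:Fk l Int W (int r). y - (T ^^ r) x:W (- int r - 1)" if y: "y:Fk (l + int r) Int W (- int r)" for y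
 proof -
  obtain c where c: "adm c" "!!q j. c q j:Fk (l + int r - int j)" "y - S c:ker" "wt0 (- int r) c"
   using Fk_W_decompose y by blast
  let ?I = "%q. {j. j < q & int q - 1 - 2 * int j = - int r}"
  \<comment> \<open>In weight \<open>- r\<close> the place satisfies \<open>j >= r\<close>, because
    \<open>j < q\<close>. So each term can be divided by \<open>T ^^ r\<close>, which lowers its
    step in \<open>F\<close> by \<open>r\<close>.\<close>
  define x where "x=(SUM q<=ro. SUM j:?I q. (T ^^ (j - r)) (c q j))"
  have "(T ^^ r) x=(SUM q<=ro. SUM j:?I q. (T ^^ j) (c q j))"
   unfolding x_def T_pow_sum T_pow_comp by(intro sum.cong refl) auto
  hence "y - (T ^^ r) x:W (- int r - 1)" using top_weight[OF c(1,3,4)] by simp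
  moreover have "x:Fk l" unfolding x_def
  proof(intro subgrp_sum[OF Fk])
   fix q j assume "j:?I q"
   hence "l + int r - int j + int (j - r)=l" by auto
   thus "(T ^^ (j - r)) (c q j):Fk l" using T_pow_Fk[OF c(2)[of q j], of "j - r"] by simp
  qed
  moreover have "x:W (int r)" unfolding x_def
  proof(intro subgrp_sum[OF W_subgroup])
   fix q j assume "q:{..ro}" and j: "j:?I q"
   have "(T ^^ q) (c q j):ker" using c(1) C_ker by(simp add:adm_def)
   hence "c q j:W (int q - 1)" by(rule ker_pow_W)
   hence "(T ^^ (j - r)) (c q j):W (int q - 1 - 2 * int (j - r))" by(rule lifted_T_pow[OF W_lifted])
   moreover have "int q - 1 - 2 * int (j - r)=int r" using j by auto
   ultimately show "(T ^^ (j - r)) (c q j):W (int r)" by metis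
  qed
  ultimately show ?thesis by blast
 qed
qed auto

lemma gr_W: "presented (gr V (%r. ups ` W r) r) (coset (W (r - 1))) sc (W r) UNIV"
 by(rule gr_presented[OF W_subgroup ker_W sc_W]) (simp_all add:W_mono image_subset_iff lifted_monoD(4)[OF W_lifted])

lemma kernel_pow_eq: "kernel_pow V N k=ups ` {x. (T ^^ k) x:ker}"
proof -
 have "(N ^^ k) (ups x)=\<zero>\<^bsub>V\<^esub> <-> (T ^^ k) x:ker" for x by(simp add:N_pow zero ker_def)
 thus ?thesis unfolding kernel_pow_def carrier by blast
qed

lemma ker_pow_subgroup: "subgrp {x. (T ^^ k) x:ker}" using ker by(auto simp:subgrp_def T_pow_0 T_pow_diff)

definition prim_rel :: "nat=>'k set" where
 "prim_rel k={x + T y | x y. (T ^^ k) x:ker & (T ^^ (k + 2)) y:ker}"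

lemma prim_rel_subgroup: "subgrp (prim_rel k)"
proof(rule subgrpI)
 show "0:prim_rel k" unfolding prim_rel_def using T_diff[of 0 0] subgrp_0[OF ker]
  by(intro CollectI exI[of _ 0]) (simp add:T_pow_0)
 fix x y assume "x:prim_rel k" "y:prim_rel k"
 then obtain u w u' w' where "x=u + T w" "(T ^^ k) u:ker" "(T ^^ (k + 2)) w:ker"
  "y=u' + T w'" "(T ^^ k) u':ker" "(T ^^ (k + 2)) w':ker" unfolding prim_rel_def by blast
 hence "x - y=(u - u') + T (w - w')" "(T ^^ k) (u - u'):ker" "(T ^^ (k + 2)) (w - w'):ker"
  unfolding T_pow_diff T_diff by(auto intro:subgrp_diff[OF ker])
 thus "x - y:prim_rel k" unfolding prim_rel_def by blast
qed

lemma ker_prim_rel: "ker <= prim_rel k"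
proof
 fix x assume "x:ker"
 thus "x:prim_rel k" unfolding prim_rel_def using T_pow_ker[of x k] T_diff[of 0 0] subgrp_0[OF ker]
  by(intro CollectI exI[of _ x] exI[of _ 0]) (simp add:T_pow_0)
qed

lemma primitive_relations_eq: "primitive_relations V N k=ups ` prim_rel k"
proof -
 have "ups x \<oplus>\<^bsub>V\<^esub> N (ups y)=ups (x + T y)" for x y by(simp add:N add)
 thus ?thesis unfolding primitive_relations_def set_add_def' kernel_pow_eq prim_rel_def by auto
qed

lemma prim_rel_W: "prim_rel k<=W (int k - 1)"
proof
 fix x assume "x:prim_rel k"
 then obtain u w where u: "x=u + T w" "(T ^^ k) u:ker" "(T ^^ (k + 2)) w:ker" unfolding prim_rel_def by blast
 have "w:W (int (k + 2) - 1)" using u(3) by(rule ker_pow_W)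
 hence "T w:W (int (k + 2) - 1 - 2)" by(rule lifted_monoD(4)[OF W_lifted])
 hence "T w:W (int k - 1)" by(simp add:algebra_simps)
 thus "x:W (int k - 1)" unfolding u(1) by(intro subgrp_add[OF W_subgroup ker_pow_W[OF u(2)]])
qed

lemma primitive_to_gr_coset: "primitive_to_gr V (%r. ups ` W r) k (coset (prim_rel k) x) = coset (W (int k - 1)) x"
 unfolding primitive_to_gr_def by(rule induced_coset[OF prim_rel_subgroup W_subgroup ker_W]) (use prim_rel_W in auto)

lemma F_primitive_eq: "F_primitive V N F l k = coset (prim_rel k) ` (Fk l Int {x. (T ^^ (k + 1)) x:ker})"
proof -
 have kp: "prim_rel k<={x. (T ^^ (k + 1)) x:ker}"
 proof
  fix x assume "x:prim_rel k"
  then obtain u w where u: "x=u + T w" "(T ^^ k) u:ker" "(T ^^ (k + 2)) w:ker" unfolding prim_rel_def by blast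
  have "(T ^^ (k + 1)) u:ker" using T_ker[OF u(2)] by simp
  moreover have "(T ^^ (k + 1)) (T w):ker" using u(3) by(simp add:funpow_swap1)
  ultimately show "x:{x. (T ^^ (k + 1)) x:ker}" unfolding u(1) mem_Collect_eq T_pow_add by(rule subgrp_add[OF ker])
 qed
 have t: "(T ^^ j) (sc c x) = sc c ((T ^^ j) x)" for j c x by(induction j) (simp_all add:sc_T)
 have "sc c x:prim_rel k" if "x:prim_rel k" for c x
 proof -
  from that obtain u w where u: "x=u + T w" "(T ^^ k) u:ker" "(T ^^ (k + 2)) w:ker" unfolding prim_rel_def by blast
  have "sc c x = sc c u + T (sc c w)"
   using sc_diff[of c u "- T w"] sc_diff[of c 0 "T w"] sc_diff[of c 0 0] by(simp add:u(1) sc_T)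
  thus ?thesis unfolding prim_rel_def using sc_ker[OF u(2), of c] sc_ker[OF u(3), of c]
   by(intro CollectI exI[of _ "sc c u"] exI[of _ "sc c w"] conjI) (simp_all only:t)
 qed
 hence "presented (primitive_part V N k) (coset (prim_rel k)) sc {x. (T ^^ (k + 1)) x:ker} UNIV"
  unfolding primitive_part_def kernel_pow_eq primitive_relations_eq
  by(intro presented_gr) (insert ker_pow_subgroup prim_rel_subgroup ker_prim_rel kp sc_ker t, auto simp del:funpow.simps)
 hence c: "carrier (primitive_part V N k) = coset (prim_rel k) ` {x. (T ^^ (k + 1)) x:ker}" by(rule presented.carrier)
 have i: "F l Int kernel_pow V N (k + 1)=ups ` (Fk l Int {x. (T ^^ (k + 1)) x:ker})"
 proof -
  have "ker<={x. (T ^^ (k + 1)) x:ker}" using T_pow_ker by blast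
  thus ?thesis unfolding F kernel_pow_eq using image_mem_iff[OF ker_pow_subgroup, of "k + 1"] by auto
 qed
 have r: "ups ` prim_rel k +>\<^bsub>V\<^esub> ups x = coset (prim_rel k) x" for x
  by(simp add:a_r_coset_image[OF prim_rel_subgroup])
 show ?thesis unfolding F_primitive_def i c primitive_relations_eq bex_simps r by blast
qed

lemma lefschetz_summand_eq: assumes "- real_of_int r / 2<=real l"
 shows "lefschetz_summand V N F (%r. ups ` W r) m r l=(%x. coset (W (r - 1)) ((T ^^ l) x)) ` (Fk (m - int l) Int {x.
  (T ^^ (nat (r + 2 * int l) + 1)) x:ker})"
proof -
 have "0<=r + 2 * int l" using assms by linarith
 hence k: "int (nat (r + 2 * int l))=r + 2 * int l" by simp
 have g: "gr_pow V N (%r. ups ` W r) (r + 2 * int l) l (coset (W (r + 2 * int l - 1)) x) = coset (W (r - 1)) ((T ^^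
  l) x)" for x
 proof -
  have "gr_pow V N (%r. ups ` W r) (r + 2 * int l) l (coset (W (r + 2 * int l - 1)) x) = coset (W (r + 2 * int l - 2
   * int l - 1)) ((T ^^ l) x)"
   by(rule gr_pow_coset[OF W_subgroup ker_W sc_W]) (simp_all add:W_mono image_subset_iff lifted_monoD(4)[OF W_lifted])
  thus ?thesis by simp
 qed
 show ?thesis unfolding lefschetz_summand_def Let_def F_primitive_eq image_image primitive_to_gr_coset k g ..
qed

lemma summand_mem: assumes "- real_of_int r / 2<=real l" "y:Fk (m - int l)" "(T ^^ (nat (r + 2 * int l) + 1)) y:ker"
 shows "(T ^^ l) y:Fk m Int W r"
proof
 show "(T ^^ l) y:Fk m" using T_pow_Fk[OF assms(2), of l] by simp
 have "0<=r + 2 * int l" using assms by linarith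
 hence "int (nat (r + 2 * int l) + 1) - 1=r + 2 * int l" by simp
 hence "y:W (r + 2 * int l)" using ker_pow_W[OF assms(3)] by metis
 thus "(T ^^ l) y:W r" using lifted_T_pow[OF W_lifted, of y "r + 2 * int l" l] by simp
qed

text \<open>Modulo lower weight, an element of weight \<open>r\<close> is a sum of terms
  \<open>(T ^^ j) (c q j)\<close> with \<open>q = r + 2 j + 1\<close>, and there
  \<open>c q j\<close> is primitive of weight \<open>r + 2 j\<close>. For directness,
  \<open>y l\<close> is killed by \<open>T ^^ (r + 2 l + 1)\<close>, so the entries of weight
  \<open>r\<close> in \<open>(T ^^ l) (y l)\<close> sit at the place \<open>l\<close> of their
  strings; different \<open>l\<close> cannot cancel.\<close>

lemma filtered_lefschetz:
 "internal_direct_sum (gr V (%r. ups ` W r) r) {l::nat. - real_of_int r / 2<=real l} (lefschetz_summand V N F (%r.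
  ups ` W r) m r) (F_gr V F (%r. ups ` W r) m r)"
proof -
 let ?L = "{l::nat. - real_of_int r / 2<=real l}"
 let ?S = "lefschetz_summand V N F (%r. ups ` W r) m r"
 let ?G = "gr V (%r. ups ` W r) r"
 let ?c = "coset (W (r - 1))"
 interpret G: presented ?G ?c sc "W r" UNIV by(rule gr_W)
 show ?thesis unfolding internal_direct_sum_def
 proof(intro conjI allI impI ballI)
 have S: "?S l=(%x. ?c ((T ^^ l) x)) ` (Fk (m - int l) Int {x. (T ^^ (nat (r + 2 * int l) + 1)) x:ker})"
  if "l:?L" for l using that by(intro lefschetz_summand_eq) simp
 let ?U = "UN l:?L. ?S l"
 show "F_gr V F (%r. ups ` W r) m r=additive_span ?G ?U" unfolding F_gr_eq additive_span_def
 proof(intro equalityI subsetI)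
  fix v assume "v:?c ` (Fk m Int W r)"
  then obtain x where x: "v=?c x" "x:Fk m" "x:W r" by auto
  obtain c where c: "adm c" "!!q j. c q j:Fk (m - int j)" "x - S c:ker" "wt0 r c"
   using Fk_W_decompose[OF x(2,3)] by blast
  let ?I = "%q. {j. j < q & int q - 1 - 2 * int j=r}"
  have summand: "(T ^^ j) (c q j):W r & ?c ((T ^^ j) (c q j)):?U" if "j:?I q" for q j
  proof -
   have j: "j:?L" and q: "nat (r + 2 * int j) + 1=q" using that by auto
   have k: "(T ^^ (nat (r + 2 * int j) + 1)) (c q j):ker" unfolding q using c(1) C_ker by(simp add:adm_def)
   hence "?c ((T ^^ j) (c q j)):?S j" unfolding S[OF j] using c(2) by blast
   thus ?thesis using j summand_mem[OF _ c(2) k] by blast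
  qed
  have sums: "(SUM i:J. g i):W r & ?c (SUM i:J. g i):generate (add_monoid ?G) ?U"
   if "finite J" "!!i. i:J ==> g i:W r & ?c (g i):generate (add_monoid ?G) ?U" for J and g :: "nat=>'k" using that
  proof(induction J rule:finite_induct)
   case empty
   show ?case using generate.one[of "add_monoid ?G" ?U] subgrp_0[OF W_subgroup] by(simp add:G.zero)
  next
   case (insert i J)
   hence "?c (g i) \<otimes>\<^bsub>add_monoid ?G\<^esub> ?c (SUM i:J. g i):generate (add_monoid ?G) ?U"
    by(intro generate.eng) auto
   thus ?case using insert subgrp_add[OF W_subgroup] by(simp add:G.add)
  qed
  let ?x = "SUM q<=ro. SUM j:?I q. (T ^^ j) (c q j)"
  have "?x:W r & ?c ?x:generate (add_monoid ?G) ?U" using summand by(intro sums) (auto intro:generate.incl)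
  moreover have "?c x=?c ?x" using top_weight[OF c(1,3,4)] coset_eq_iff[OF W_subgroup ker_W] by simp
  ultimately show "v:generate (add_monoid ?G) ?U" using x(1) by simp
 next
  fix v assume "v:generate (add_monoid ?G) ?U"
  thus "v:?c ` (Fk m Int W r)"
  proof(induction rule:generate.induct)
   case one
   show ?case using subgrp_0[OF Fk] subgrp_0[OF W_subgroup] by(intro image_eqI[of _ _ 0]) (simp_all add:G.zero)
  next
   case (incl h)
   then obtain l where l: "l:?L" "h:?S l" by blast
   thus ?case using summand_mem[of r l] S[OF l(1)] by auto
  next
   case (inv h)
   then obtain l where l: "l:?L" "h:?S l" by blast
   then obtain y where y: "y:Fk m Int W r" "h=?c y" using summand_mem[of r l] S[OF l(1)] by auto
   hence "inv\<^bsub>add_monoid ?G\<^esub> h=?c (- y)" using G.minus[of y] by(simp add:a_inv_def)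
   thus ?case using y subgrp_minus[OF Fk] subgrp_minus[OF W_subgroup] by auto
  next
   case (eng h1 h2)
   then obtain y1 y2 where "y1:Fk m Int W r" "h1=?c y1" "y2:Fk m Int W r" "h2=?c y2" by blast
   thus ?case using subgrp_add[OF Fk] subgrp_add[OF W_subgroup]
    by(intro image_eqI[of _ _ "y1 + y2"]) (auto simp:G.add)
  qed
 qed
next
 fix J x
 assume *: "finite J & J<=?L & (ALL i:J. x i:?S i) & finsum ?G x J=\<zero>\<^bsub>?G\<^esub>"
 have "EX y. y:Fk (m - int l) & (T ^^ (nat (r + 2 * int l) + 1)) y:ker & x l=?c ((T ^^ l) y)" if "l:J" for l
 proof -
  have "- real_of_int r / 2<=real l" "x l:?S l" using * that by auto
  thus ?thesis unfolding lefschetz_summand_eq[OF `- real_of_int r / 2 <= real l`] by blast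
 qed
 then obtain y where y: "!!l. l:J ==> y l:Fk (m - int l)"
  "!!l. l:J ==> (T ^^ (nat (r + 2 * int l) + 1)) (y l):ker" "!!l. l:J ==> x l=?c ((T ^^ l) (y l))" by metis
 have L: "- real_of_int r / 2<=real l" if "l:J" for l using * that by auto
 have yW: "(T ^^ l) (y l):W r" if "l:J" for l using summand_mem[OF L y(1,2)] that by blast
 have fin: "finsum ?G x J'=?c (SUM l:J'. (T ^^ l) (y l)) & (SUM l:J'. (T ^^ l) (y l)):W r" if "finite J'" "J'<=J" for J'
  using that
 proof(induction J' rule:finite_induct)
  case empty
  show ?case using subgrp_0[OF W_subgroup] by(simp add:G.zero)
 next
  case (insert l J')
  hence "x l=?c ((T ^^ l) (y l))" "x:J' \<rightarrow> carrier ?G" "x l:carrier ?G" "(T ^^ l) (y l):W r"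
   using y(3) yW by(auto simp:G.carrier)
  thus ?case using insert subgrp_add[OF W_subgroup] by(simp add:G.add)
 qed
 have "?c (SUM l:J. (T ^^ l) (y l))=?c 0" using * fin[of J] by(simp add:G.zero)
 hence sumW: "(SUM l:J. (T ^^ l) (y l)):W (r - 1)" using coset_eq_iff[OF W_subgroup ker_W, of "r - 1"] by simp
 have "EX c. ALL l. adm (c l) & y l - S (c l):ker" using expand by(intro choice) blast
 then obtain c where c: "!!l. adm (c l)" "!!l. y l - S (c l):ker" by blast
 have c0: "c l q j=0" if "l:J" "q<=ro" "j + nat (r + 2 * int l) + 1 < q" for l q j
  using ker_pow_shift[OF c y(2)[OF that(1)] that(2), of j] that(3) by simp
 have adm: "adm (%q j. SUM l:J. shift l (c l) q j)" by(intro adm_sum adm_shift c)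
 have "(SUM l:J. (T ^^ l) (y l)) - S (%q j. SUM l:J. shift l (c l) q j):ker"
  unfolding S_sum sum_subtractf[symmetric] by(intro subgrp_sum[OF ker] T_pow_expand c)
 hence wz: "wt0 (r - 1) (%q j. SUM l:J. shift l (c l) q j)" using sumW W_iff[OF adm] by blast
 have k: "int (nat (r + 2 * int l))=r + 2 * int l" if "l:J" for l
 proof -
  have "0<=r + 2 * int l" using L[OF that] by linarith
  thus ?thesis by simp
 qed
 fix l assume l: "l:J"
 \<comment> \<open>For \<open>j < i\<close> the shift has left the place empty; for
   \<open>j > i\<close> the kernel condition excludes weights of at least \<open>r\<close>.\<close>
 have sh: "shift i (c i) q j=0" if "i:J" "i~=j" "q<=ro" "j < q" "r - 1 < int q - 1 - 2 * int j" for i q j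
 proof(cases "j < i")
  case False
  hence "j - i + nat (r + 2 * int i) + 1 < q" using k[OF that(1)] that by linarith
  thus ?thesis using c0[OF that(1,3)] False by(simp add:shift_def)
 qed (simp add:shift_def)
 have "wt0 (r - 1) (shift l (c l))" unfolding wt0_def
 proof(intro allI impI)
  fix q j assume q: "q<=ro" "j < q" "r - 1 < int q - 1 - 2 * int j"
  show "shift l (c l) q j=0"
  proof(cases "l=j")
   case True
   have "(SUM i:J. shift i (c i) q j)=(SUM i:J. if i=l then shift l (c l) q j else 0)"
    using sh q True by(intro sum.cong) auto
   also have "... = shift l (c l) q j" using l * by simp
   finally show ?thesis using wz q unfolding wt0_def by simp
  qed (use sh l q in blast)
 qed
 hence "(T ^^ l) (y l):W (r - 1)" using W_iff[OF adm_shift[OF c(1)] T_pow_expand[OF c]] by blast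
 hence "?c ((T ^^ l) (y l))=?c 0" using coset_eq_iff[OF W_subgroup ker_W, of "r - 1"] by simp
 thus "x l=\<zero>\<^bsub>?G\<^esub>" using y(3)[OF l] by(simp add:G.zero)
 qed
qed

theorem filtered_decomposition:
 "let W=monodromy_filtration V N in (ALL (r::nat) (l::int). gr_pow V N W (int r) r:iso ((add_monoid (gr V W (int
  r)))\<lparr>carrier := F_gr V F W l (int r)\<rparr>) ((add_monoid (gr V W (- int r)))\<lparr>carrier := F_gr V F W
  (l + int r) (- int r)\<rparr>)) & (ALL (r::int) (m::int). internal_direct_sum (gr V W r) {l::nat. - real_of_int r /
  2<=real l} (lefschetz_summand V N F W m r) (F_gr V F W m r))"
 unfolding monodromy Let_def using filtered_iso filtered_lefschetz by blast

end

subsection \<open>Generalized eigenspaces\<close>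

text \<open>A decreasing chain of submodules such that a power of \<open>T - j/e\<close> maps \<open>G j\<close> to \<open>G (j + 1)\<close> is
  the chain of sums of generalized eigenspaces.\<close>

locale spectral_chain = presented_endo V ups sc N T
 for V :: "(complex, 'v) module" and ups :: "'k::ab_group_add=>'v" and sc N T +
 fixes G :: "nat=>'k set" and e :: nat assumes sc_sc: "sc k (sc l x) = sc (k * l) x" and sc_1: "sc 1 x=x"
  and sc_add_left: "sc (k + l) x = sc k x + sc l x" and sc_T: "sc k (T x)=T (sc k x)"
  and G: "subgrp (G j)" and G_ker: "ker<=G j" and G_sc: "x:G j ==> sc k x:G j"
  and G_T: "x:G j ==> T x:G j" and G_0: "G 0=UNIV" and G_e: "G e=ker"
  and G_step: "j < e ==> EX r. ALL x:G j. ((%x. T x - sc (of_real (real j / real e)) x) ^^ r) x:G (Suc j)"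
begin

definition S :: "real=>'k=>'k" where "S c x=T x - sc (of_real c) x"

definition E :: "real=>'k set" where "E c={x. EX k. (S c ^^ k) x:ker}"

lemma sc_commute: "sc k (sc l x) = sc l (sc k x)" by(simp add:sc_sc mult.commute)
lemma S_diff: "S c (x - y)=S c x - S c y" by(simp add:S_def T_diff sc_diff)

lemma S_commute: "S c (S d x)=S d (S c x)"
 by(simp add:S_def T_diff sc_diff sc_T[symmetric] sc_commute[of "of_real c" "of_real d"])

lemma S_sc: "S c (sc k x) = sc k (S c x)" by(simp add:S_def sc_diff sc_T sc_commute[of k])
lemma S_pow_diff: "(S c ^^ k) (x - y)=(S c ^^ k) x - (S c ^^ k) y" by(induction k) (simp_all add:S_diff)
lemma S_pow_sc: "(S c ^^ k) (sc l x) = sc l ((S c ^^ k) x)" by(induction k) (simp_all add:S_sc)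
lemma S_pow_commute: "(S c ^^ k) (S d x)=S d ((S c ^^ k) x)" by(induction k) (simp_all add:S_commute[of c d])

lemma S_sub: "S c x - S d x = sc (of_real (d - c)) x"
 using sc_add_left[of "of_real (d - c)" "of_real c" x] by(simp add:S_def algebra_simps)

lemma sc_cancel: "c~=0 ==> sc (inverse c) (sc c x)=x" by(simp add:sc_sc sc_1)

lemma sc_ker: "x:ker ==> sc k x:ker"
proof -
 assume "x:ker"
 hence "ups (sc k x)=ups (sc k 0)" by(simp add:ker_def smult[symmetric])
 thus ?thesis using sc_diff[of k 0 0] by(simp add:ker_def)
qed

lemma S_ker: "x:ker ==> S c x:ker" unfolding S_def by(intro subgrp_diff[OF ker] T_ker sc_ker)
lemma S_pow_ker: "x:ker ==> (S c ^^ k) x:ker" by(induction k) (simp_all add:S_ker)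

lemma E_subgroup: "subgrp (E c)"
proof(rule subgrpI)
 show "0:E c" unfolding E_def using subgrp_0[OF ker] by(auto intro:exI[of _ 0])
 fix x y assume "x:E c" "y:E c"
 then obtain k l where "(S c ^^ k) x:ker" "(S c ^^ l) y:ker" by(auto simp:E_def)
 hence "(S c ^^ (l + k)) x:ker" "(S c ^^ (k + l)) y:ker" unfolding funpow_add o_apply by(auto intro:S_pow_ker)
 hence "(S c ^^ (k + l)) (x - y):ker" unfolding S_pow_diff by(intro subgrp_diff[OF ker]) (simp_all add:add.commute)
 thus "x - y:E c" unfolding E_def by blast
qed

lemma E_sc: "x:E c ==> sc k x:E c" unfolding E_def using sc_ker by(auto simp:S_pow_sc)

text \<open>\<open>S d - S c\<close> is a nonzero scalar, so \<open>x\<close> lies in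
  \<open>H\<close> as soon as \<open>S c x\<close> and \<open>S d x\<close> do. Two inductions
  reduce the powers to this case.\<close>

lemma separate: assumes H: "subgrp H" "ker<=H" "!!x k. x:H ==> sc k x:H" "!!x. x:H ==> T x:H"
  and cd: "c~=d" and x: "(S c ^^ k) x:H" "(S d ^^ r) x:H" shows "x:H"
proof -
 have S_H: "S b y:H" if "y:H" for b y unfolding S_def using that H by(intro subgrp_diff[OF H(1)])
 have one: "x:H" if "(S c ^^ k) x:H" "S d x:H" for x k using that
 proof(induction k arbitrary: x)
  case (Suc k)
  have "S c x:H" using Suc.IH[of "S c x"] Suc.prems S_H[of "S d x" c] by(simp add:S_commute[of d] funpow_swap1)
  hence "S d x - S c x:H" using Suc.prems by(intro subgrp_diff[OF H(1)])
  hence *: "sc (inverse (of_real (c - d))) (sc (of_real (c - d)) x):H" unfolding S_sub by(rule H(3))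
  have "sc (inverse (of_real (c - d))) (sc (of_real (c - d)) x)=x" by(rule sc_cancel) (use cd in simp)
  thus ?case using * by metis
 qed simp
 have "(S c ^^ k) x:H ==> (S d ^^ r) x:H ==> x:H" for x
 proof(induction r arbitrary: x)
  case (Suc r)
  have "(S c ^^ k) (S d x):H" unfolding S_pow_commute using Suc.prems(1) by(rule S_H)
  moreover have "(S d ^^ r) (S d x):H" using Suc.prems(2) by(simp add:funpow_Suc_right del:funpow.simps)
  ultimately have "S d x:H" by(rule Suc.IH)
  thus ?case using one Suc.prems by blast
 qed simp
 thus ?thesis using x by blast
qed

text \<open>On \<open>E c\<close> the operator \<open>S d\<close> is the locally nilpotent
  \<open>S c\<close> plus the nonzero scalar \<open>c - d\<close>, hence invertible modulo
  \<open>ker\<close>.\<close>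

lemma E_invert: assumes "c~=d" "u:E c" shows "EX v:E c. (S d ^^ r) v - u:ker"
proof -
 have one: "EX v:E c. S d v - u:ker" if "(S c ^^ k) u:ker" for k u using that
 proof(induction k arbitrary: u)
  case 0
  hence "u:ker" "S d 0=0" using S_diff[of d 0 0] by simp_all
  thus ?case using subgrp_0[OF E_subgroup] subgrp_minus[OF ker] by(intro bexI[of _ 0]) simp_all
 next
  case (Suc k)
  then obtain v where v: "v:E c" "S d v - S c u:ker" by(auto simp:funpow_swap1)
  have u: "u:E c" using Suc.prems unfolding E_def by blast
  let ?k = "inverse (of_real (c - d))::complex"
  have "S d (u - v) - sc (of_real (c - d)) u = - (S d v - S c u)"
   using S_sub[of d u c] by(simp add:S_diff algebra_simps)
  hence "S d (u - v) - sc (of_real (c - d)) u:ker" using subgrp_minus[OF ker v(2)] by simp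
  hence "sc ?k (S d (u - v) - sc (of_real (c - d)) u):ker" by(rule sc_ker)
  also have "sc ?k (S d (u - v) - sc (of_real (c - d)) u)=S d (sc ?k (u - v)) - u"
   using assms(1) by(subst sc_diff, subst sc_cancel) (auto simp:S_sc)
  finally show ?case using E_sc subgrp_diff[OF E_subgroup u v(1)] by blast
 qed
 show ?thesis
 proof(induction r)
  case 0
  show ?case using assms(2) subgrp_0[OF ker] by(intro bexI[of _ u]) simp_all
 next
  case (Suc r)
  then obtain v where v: "v:E c" "(S d ^^ r) v - u:ker" by blast
  then obtain k where "(S c ^^ k) v:ker" by(auto simp:E_def)
  then obtain w where w: "w:E c" "S d w - v:ker" using one by blast
  have "(S d ^^ r) (S d w - v) + ((S d ^^ r) v - u):ker" by(intro subgrp_add[OF ker] S_pow_ker w v)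
  hence "(S d ^^ Suc r) w - u:ker" by(simp add:S_pow_diff funpow_swap1)
  thus ?case using w(1) by blast
 qed
qed

lemma E_G: assumes "x:E c" "!!j. j < m ==> c~=real j / real e" "m<=e" shows "x:G m" using assms(2,3)
proof(induction m)
 case (Suc j)
 hence xj: "x:G j" and j: "j < e" by auto
 obtain r where "ALL x:G j. ((%x. T x - sc (of_real (real j / real e)) x) ^^ r) x:G (Suc j)"
  using G_step[OF j] by blast
 moreover have "(%x. T x - sc (of_real (real j / real e)) x)=S (real j / real e)" by(simp add:S_def fun_eq_iff)
 ultimately have "(S (real j / real e) ^^ r) x:G (Suc j)" using xj by simp
 moreover obtain k where "(S c ^^ k) x:G (Suc j)" using assms(1) G_ker by(auto simp:E_def)
 moreover have "c~=real j / real e" using Suc.prems by auto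
 ultimately show ?case using separate[OF G G_ker G_sc G_T] by blast
qed (simp add:G_0)

text \<open>Descending induction on \<open>j\<close>. A power of \<open>S (j / e)\<close> moves
  \<open>x\<close> into the next step, where it splits into generalized eigenvectors. These have
  preimages under that power by \<open>E_invert\<close>, and \<open>x\<close> minus the preimages is
  killed by it modulo \<open>ker\<close>, so it lies in \<open>E (j / e)\<close>.\<close>

lemma G_E: assumes "j<=e" "x:G j" shows "EX y. (ALL i. y i:E (real i / real e)) & x - (SUM i=j..<e. y i):ker"
 using assms
proof(induction "e - j" arbitrary: j x)
 case 0
 hence "j=e" by simp
 hence "x:ker" using 0 G_e by simp
 thus ?case using 0 subgrp_0[OF E_subgroup] by(intro exI[of _ "%_. 0"]) simp
next
 case (Suc m)
 hence j: "j < e" by simp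
 let ?c = "real j / real e"
 obtain r where "ALL x:G j. ((%x. T x - sc (of_real ?c) x) ^^ r) x:G (Suc j)" using G_step[OF j] by blast
 moreover have "(%x. T x - sc (of_real ?c) x)=S ?c" by(simp add:S_def fun_eq_iff)
 ultimately have x': "(S ?c ^^ r) x:G (Suc j)" using Suc.prems by simp
 have "m=e - Suc j" using Suc.hyps(2) by simp
 from Suc.hyps(1)[OF this _ x'] obtain y
  where y: "!!i. y i:E (real i / real e)" "(S ?c ^^ r) x - (SUM i=Suc j..<e. y i):ker" using j by auto
 have "EX v. v:E (real i / real e) & (i~=j --> (S ?c ^^ r) v - y i:ker)" for i
 proof(cases "i=j")
  case False
  hence "real i / real e~=?c" using j by(simp add:divide_eq_eq)
  thus ?thesis using E_invert y(1) by blast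
 qed (use y in blast)
 then obtain v where v: "!!i. v i:E (real i / real e)" "!!i. i~=j ==> (S ?c ^^ r) (v i) - y i:ker" by metis
 let ?v = "SUM i=Suc j..<e. v i"
 have S0: "(S ?c ^^ r) 0=0" using S_pow_diff[where c = ?c and k = r and x = 0 and y = 0] by simp
 have Sadd: "(S ?c ^^ r) (a + b)=(S ?c ^^ r) a + (S ?c ^^ r) b" for a b
  using S_pow_diff[where c = ?c and k = r and x = a and y = "- b"] S_pow_diff[where c = ?c and k = r and x = 0 and y
   = b] S0 by simp
 have Ssum: "(S ?c ^^ r) (SUM i:A. v i)=(SUM i:A. (S ?c ^^ r) (v i))" for A
  by(induction A rule:infinite_finite_induct) (simp_all add:S0 Sadd)
 have "(SUM i=Suc j..<e. (S ?c ^^ r) (v i) - y i):ker" by(intro subgrp_sum[OF ker] v) auto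
 from subgrp_diff[OF ker y(2) this] have "(S ?c ^^ r) (x - ?v):ker" by(simp add:S_pow_diff Ssum sum_subtractf)
 hence xv: "x - ?v:E ?c" unfolding E_def by blast
 have "(SUM i=j..<e. if i=j then x - ?v else v i)=(x - ?v) + ?v" using j by(simp add:sum.atLeast_Suc_lessThan)
 thus ?case using xv v(1) subgrp_0[OF ker] by(intro exI[of _ "%i. if i=j then x - ?v else v i"]) auto
qed

lemma gen_eigenspace_eq: assumes "!!x. Nc (ups x)=ups (S c x)" shows "(\<Union>k. kernel_pow V Nc k)=ups ` E c"
proof -
 have "(Nc ^^ k) (ups x)=ups ((S c ^^ k) x)" for k x by(induction k) (simp_all add:assms)
 hence "x:kernel_pow V Nc k <-> (EX y. x=ups y & (S c ^^ k) y:ker)" for x k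
  unfolding kernel_pow_def carrier ker_def zero by auto
 thus ?thesis unfolding E_def by blast
qed

text \<open>\<open>G_E\<close> writes elements of \<open>G m\<close> by the \<open>E (j / e)\<close>
  with \<open>j >= m\<close>. Conversely, every real number of \<open>A\<close> differs from the
  \<open>j / e\<close> with \<open>j < m\<close>, so its \<open>E\<close> lies in \<open>G m\<close>
  by \<open>E_G\<close>.\<close>

lemma eigenspan: assumes m: "m<=e" and A: "!!j. j < e ==> real j / real e:A <-> m<=j"
 shows "additive_span V (UN c:A. ups ` E c)=ups ` G m" unfolding additive_span_def
proof
 let ?g = "generate (add_monoid V) (UN c:A. ups ` E c)"
 have "subgroup (ups ` G m) (add_monoid V)" using additive_subgroup_image[OF G] by(simp add:additive_subgroup_def)
 moreover have "E c<=G m" if "c:A" for c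
 proof
  fix x assume x: "x:E c"
  have "c~=real j / real e" if "j < m" for j using A[of j] that m `c : A` by auto
  thus "x:G m" using E_G[OF x _ m] by blast
 qed
 ultimately show "?g<=ups ` G m" by(intro group.generate_subgroup_incl[OF V.a_group]) blast+
 show "ups ` G m<=?g"
 proof
  fix v assume "v:ups ` G m"
  then obtain x where x: "v=ups x" "x:G m" by blast
  obtain y where y: "!!i. y i:E (real i / real e)" "x - (SUM i=m..<e. y i):ker" using G_E[OF m x(2)] by blast
  have "ups (SUM i:J. y i):?g" if "finite J" "J<={m..<e}" for J using that
  proof(induction J rule:finite_induct)
   case empty
   show ?case using generate.one[of "add_monoid V"] by(simp add:zero)
  next
   case (insert i J)
   hence "real i / real e:A" using A[of i] by auto
   hence "ups (y i):?g" using y(1) by(intro generate.incl) blast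
   hence "ups (y i) \<otimes>\<^bsub>add_monoid V\<^esub> ups (SUM i:J. y i):?g"
    using insert by(intro generate.eng) auto
   thus ?case using insert by(simp add:add)
  qed
  from this[of "{m..<e}"] show "v:?g" using y(2) x(1) eq_iff[of x "SUM i=m..<e. y i"] by simp
 qed
qed

end

section \<open>The graded pieces of \<open>M\<close> for the eigenvalue filtration\<close>

context germ_family begin

definition graded_decomp :: "real=>bool" where
 "graded_decomp al <-> (let W=monodromy_filtration (M_gr al) (R_M_gr al) in (ALL (r::nat) (l::int). gr_pow (M_gr al)
  (R_M_gr al) W (int r) r:iso ((add_monoid (gr (M_gr al) W (int r)))\<lparr>carrier := F_gr (M_gr al) (F_M_gr al) W l
  (int r)\<rparr>) ((add_monoid (gr (M_gr al) W (- int r)))\<lparr>carrier := F_gr (M_gr al) (F_M_gr al) W (l + int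
  r) (- int r)\<rparr>)) & (ALL (r::int) (m::int). internal_direct_sum (gr (M_gr al) W r) {l::nat. - real_of_int r /
  2<=real l} (lefschetz_summand (M_gr al) (R_M_gr al) (F_M_gr al) W m r) (F_gr (M_gr al) (F_M_gr al) W m r)))"

end

locale germ_spectral = germ_family R \<kappa> I t n + spectral_chain M ps sc R_M T G e
 for R :: "'s ring" (structure) and \<kappa> I t n and ps :: "'k::ab_group_add=>_" and sc T G e
begin

lemma R_M_minus_eq: "R_M_minus c (ps x) = ps (S c x)" by(simp add:R_M_minus_def N smult a_minus_def minus add S_def)

lemma gen_eigenspace_image: "gen_eigenspace c = ps ` E c"
 unfolding gen_eigenspace_def by(rule gen_eigenspace_eq) (rule R_M_minus_eq)

lemma M_ge_eq: assumes "m<=e" "!!j. j < e ==> al<=real j / real e <-> m<=j" shows "M_ge al = ps ` G m"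
 unfolding M_ge_def gen_eigenspace_image by(rule eigenspan) (use assms in auto)

lemma M_gt_eq: assumes "m<=e" "!!j. j < e ==> al < real j / real e <-> m<=j" shows "M_gt al = ps ` G m"
 unfolding M_gt_def gen_eigenspace_image by(rule eigenspan) (use assms in auto)

lemma G_S: "x:G j ==> S c x:G j" unfolding S_def by(intro subgrp_diff[OF G] G_T G_sc)

lemma M_gr_presented: assumes "M_ge al = ps ` G m" "M_gt al = ps ` G m'" "G m'<=G m"
 shows "presented (M_gr al) (coset (G m')) sc (G m) UNIV"
 unfolding M_gr_def assms(1,2) by(rule quotient) (use G G_ker G_sc sc_diff assms(3) in auto)

lemma R_M_gr_coset: assumes "M_gt al = ps ` G m'" shows "R_M_gr al (coset (G m') x) = coset (G m') (S al x)"
 unfolding R_M_gr_def assms by(rule induced_coset) (insert G G_ker R_M_minus_eq G_S, auto simp:S_diff[symmetric])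

lemma F_M_gr_coset: assumes "M_ge al = ps ` G m" "M_gt al = ps ` G m'" "F_M l = ps ` Fk"
 shows "F_M_gr al l = coset (G m') ` (Fk Int G m)"
proof -
 have "F_M l Int M_ge al = ps ` (Fk Int G m)" unfolding assms using image_mem_iff[OF G G_ker, of m] by auto
 thus ?thesis unfolding F_M_gr_def assms(2) by(simp add:image_image a_r_coset_image[OF G])
qed

end

text \<open>The zero module, as it occurs off \<open>Y\<close>. To pass it through the general
  argument its element is parametrized by a constant map on the complex numbers, so that
  \<open>ker\<close> is everything and the Jordan decomposition with \<open>ro = 0\<close> is an
  empty sum.\<close>

lemma (in germ_family) trivial_decomposition:
 assumes M: "presented M (%_::complex. m0) (*) UNIV UNIV" and R: "R_M m0=m0" and F: "!!l. F_M l={m0}"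
 shows "graded_decomp al"
proof -
 interpret M: presented M "%_::complex. m0" "(*)" UNIV UNIV by fact
 have ker: "M.ker=UNIV" by(simp add:M.ker_def)
 interpret germ_spectral R \<kappa> I t n "%_. m0" "(*)" "%x. x" "%_. UNIV" 1
  by unfold_locales (auto simp:R ker algebra_simps subgrp_def)
 have eq: "additive_span M (UN c:A. (%_. m0) ` E c)=(%_. m0) ` (UNIV::complex set)" for A :: "real set"
 proof(cases "0:A")
  case True
  thus ?thesis by(intro eigenspan[of 0]) auto
 next
  case False
  thus ?thesis by(intro eigenspan[of 1]) auto
 qed
 have ge: "M_ge al=(%_. m0) ` (UNIV::complex set)" unfolding M_ge_def gen_eigenspace_image by(rule eq)
 have gt: "M_gt al=(%_. m0) ` (UNIV::complex set)" unfolding M_gt_def gen_eigenspace_image by(rule eq)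
 have pr: "presented (M_gr al) (M.coset UNIV) (*) UNIV UNIV" by(rule M_gr_presented[OF ge gt]) simp
 then interpret V: presented "M_gr al" "M.coset UNIV" "(*)" UNIV UNIV .
 have c: "M.coset UNIV x=M.coset UNIV 0" for x by(simp add:M.coset_def)
 have kerV: "V.ker=UNIV" using c by(auto simp:V.ker_def)
 interpret V: filtered_jordan "M_gr al" "M.coset UNIV" "(*)" "R_M_gr al" "%x. x" "F_M_gr al" "%_. UNIV" "%_. UNIV" 0
 proof unfold_locales
  show "R_M_gr al (M.coset UNIV x)=M.coset UNIV x" for x using R_M_gr_coset[OF gt, of x] c by metis
  show "F_M_gr al l=M.coset UNIV ` UNIV" for l using F_M_gr_coset[OF ge gt, of l UNIV] by(simp add:F)
 qed (auto simp:kerV algebra_simps subgrp_def)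
 show ?thesis using V.filtered_decomposition unfolding graded_decomp_def .
qed

lemma div_ceil_mult: "q > 0 ==> (k * q + q - Suc 0) div q=(k::nat)"
proof -
 assume "q > 0"
 hence eq: "k * q + q - Suc 0=(q - Suc 0) + k * q" by simp
 show ?thesis unfolding eq using `q > 0` by(subst div_mult_self1) auto
qed

section \<open>The chain of submodules at a crossing\<close>

context crossing begin

text \<open>A common denominator of the fractions \<open>b / e i\<close>, so that the eigenvalues
  are among the numbers \<open>j / lcd\<close>.\<close>

definition lcd :: nat where "lcd=(PROD i:K. e i)"

definition jump :: "'d=>nat" where "jump i=lcd div e i"

lemma lcd_pos: "lcd > 0" unfolding lcd_def using e_pos by(simp add:prod_pos)

lemma lcd_eq: assumes "i:K" shows "lcd=jump i * e i"
proof -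
 have "e i dvd lcd" unfolding lcd_def using assms by(intro dvd_prodI) auto
 thus ?thesis by(simp add:jump_def)
qed

lemma jump_pos: "i:K ==> jump i > 0" using lcd_eq lcd_pos by(metis gr0I mult_is_0 not_gr_zero)

text \<open>The exponents \<open>\<lceil>e\<^sub>i j / lcd\<rceil>\<close>.\<close>

definition ceil_exp :: "nat=>'d=>nat" where
 "ceil_exp j i=(if i:K then (j + jump i - 1) div jump i else 0)"

text \<open>The components for which \<open>e i * j / lcd\<close> is an integer. Exactly there the
  rounded exponent grows by one from \<open>j\<close> to \<open>j + 1\<close>, and divided by
  \<open>e i\<close> it is the eigenvalue \<open>j / lcd\<close>.\<close>

definition crit :: "nat=>'d set" where "crit j={i:K. jump i dvd j}"

lemma ceil_exp_0: "ceil_exp 0=(%_. 0)" using jump_pos by(auto simp:ceil_exp_def fun_eq_iff)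

lemma ceil_exp_lcd: "ceil_exp lcd i=(if i:K then e i else 0)"
proof(cases "i:K")
 case True
 have "lcd + jump i - 1=e i * jump i + (jump i - 1)" using lcd_eq[OF True] jump_pos[OF True] by(simp add:mult.commute)
 hence "(lcd + jump i - 1) div jump i=e i" using jump_pos[OF True] by(simp add:div_ceil_mult)
 thus ?thesis using True by(simp add:ceil_exp_def)
qed (simp add:ceil_exp_def)

lemma ceil_exp_mono: "j<=k ==> ceil_exp j i <= ceil_exp k i" by(simp add:ceil_exp_def div_le_mono)

lemma ceil_exp_crit: assumes "i:crit j" shows "ceil_exp j i=j div jump i"
proof -
 have i: "i:K" "jump i dvd j" using assms by(auto simp:crit_def)
 then obtain k where k: "j=jump i * k" by auto
 have "j + jump i - 1=k * jump i + (jump i - 1)" using jump_pos[OF i(1)] by(simp add:k mult.commute)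
 thus ?thesis using jump_pos[OF i(1)] i(1) by(simp add:ceil_exp_def k div_ceil_mult)
qed

lemma ceil_exp_Suc: "ceil_exp (Suc j)=(%i. ceil_exp j i + ind (crit j) i)"
proof
 fix i
 show "ceil_exp (Suc j) i = ceil_exp j i + ind (crit j) i"
 proof(cases "i:K")
  case True
  let ?q = "jump i"
  have q: "?q > 0" by(rule jump_pos[OF True])
  have S: "ceil_exp (Suc j) i=j div ?q + 1" using True q by(simp add:ceil_exp_def)
  show ?thesis
  proof(cases "?q dvd j")
   case d: True
   hence "i:crit j" using True by(simp add:crit_def)
   thus ?thesis using ceil_exp_crit S by(simp add:ind_def)
  next
   case False
   hence m: "j mod ?q > 0" by(metis mod_eq_0_iff_dvd neq0_conv)
   have eq: "j + ?q - 1=(j mod ?q - 1) + (j div ?q + 1) * ?q"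
    unfolding add_mult_distrib using m div_mult_mod_eq[of j ?q] q by linarith
   have "j mod ?q - 1 < ?q" using mod_less_divisor[OF q, of j] by linarith
   hence "(j + ?q - 1) div ?q=j div ?q + 1" unfolding eq using q by(subst div_mult_self1) auto
   thus ?thesis using S True False by(simp add:ceil_exp_def ind_def crit_def)
  qed
 qed (simp add:ceil_exp_def ind_def crit_def)
qed

lemma ceil_exp_crit_div:
 assumes "i:crit j" shows "of_nat (ceil_exp j i) / of_nat (e i)=(of_real (real j / real lcd)::complex)"
proof -
 have i: "i:K" "jump i dvd j" using assms by(auto simp:crit_def)
 then obtain k where k: "j=jump i * k" by auto
 have "real (ceil_exp j i) / real (e i)=real j / real lcd"
  using ceil_exp_crit[OF assms] jump_pos[OF i(1)] e_pos[OF i(1)] lcd_eq[OF i(1)] by(simp add:k)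
 thus ?thesis by(metis of_real_divide of_real_of_nat_eq)
qed

text \<open>The chain descends from everything at \<open>j = 0\<close> to the left multiples of
  \<open>f\<close>, modulo relations, at \<open>j = lcd\<close>, where \<open>ceil_exp\<close> is
  the exponent of \<open>f\<close>.\<close>

definition level :: "nat=>('d, 'r) ops set" where
 "level j={X. EX Y. X - act (mon (ceil_exp j)) Y:rels (%_. 0)}"

lemma rels_level: "X:rels (%_. 0) ==> X:level j" unfolding level_def by(intro CollectI exI[of _ 0]) (simp add:act_0)

lemma act_level: "act (mon (ceil_exp j)) Y:level j"
 unfolding level_def by(intro CollectI exI[of _ Y]) (simp add:rels_0)

lemma level_subgroup: "subgrp (level j)"
proof(rule subgrpI)
 show "0:level j" by(rule rels_level[OF rels_0])
 fix X Y assume "X:level j" "Y:level j"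
 then obtain X' Y' where "X - act (mon (ceil_exp j)) X':rels (%_. 0)" "Y - act (mon (ceil_exp j)) Y':rels (%_. 0)"
  by(auto simp:level_def)
 from rels_diff[OF this] show "X - Y:level j"
  unfolding level_def by(intro CollectI exI[of _ "X' - Y'"]) (simp add:act_diff algebra_simps)
qed

lemma level_act_cst: "X:level j ==> act (cst c) X:level j" unfolding level_def
proof safe
 fix Y assume "X - act (mon (ceil_exp j)) Y:rels (%_. 0)"
 from rels_act_cst[OF this, of c] show "EX Y. act (cst c) X - act (mon (ceil_exp j)) Y:rels (%_. 0)"
  by(intro exI[of _ "act (cst c) Y"]) (simp add:act_diff act_commute[of "cst c"])
qed

lemma level_euler: "X:level j ==> euler (%_. 0) i0 X:level j" unfolding level_def
proof safe
 fix Y assume "X - act (mon (ceil_exp j)) Y:rels (%_. 0)"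
 from rels_euler[OF i0 this] show "EX Y. euler (%_. 0) i0 X - act (mon (ceil_exp j)) Y:rels (%_. 0)"
  by(intro exI[of _ "euler (ceil_exp j) i0 Y"]) (simp add:euler_diff euler_mon i0)
qed

lemma level_mono: assumes "j<=k" shows "level k<=level j"
proof
 fix X assume "X:level k"
 then obtain Y where Y: "X - act (mon (ceil_exp k)) Y:rels (%_. 0)" by(auto simp:level_def)
 have "mon (ceil_exp k)=mon (ceil_exp j) * mon (%i. ceil_exp k i - ceil_exp j i)"
  unfolding mon_add[symmetric] using ceil_exp_mono[OF assms] by simp
 hence "act (mon (ceil_exp k)) Y=act (mon (ceil_exp j)) (act (mon (%i. ceil_exp k i - ceil_exp j i)) Y)"
  by(simp add:act_act)
 thus "X:level j" using Y unfolding level_def by auto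
qed

lemma level_0: "level 0=UNIV"
proof -
 have "X:level 0" for X unfolding level_def ceil_exp_0 by(intro CollectI exI[of _ X]) (simp add:rels_0)
 thus ?thesis by blast
qed

lemma shifted_mon: "(shifted (%_. 0) c ^^ k) (act (mon a) X)=act (mon a) ((shifted a c ^^ k) X)"
 by(induction k) (simp_all add:shifted_def euler_mon i0 act_diff act_commute[of "cst c"])

lemma crossing_eigenvalue_level: assumes "set II = crit j" "distinct II"
 shows "crossing_eigenvalue z pd rho cst K e i0 (ceil_exp j) (of_real (real j / real lcd)) II"
proof unfold_locales
 show "of_nat (ceil_exp j i) / of_nat (e i)=(of_real (real j / real lcd)::complex)" if "i:set II" for i
  by(rule ceil_exp_crit_div) (use that assms in simp)
qed (insert assms, auto simp:crit_def ceil_exp_def)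

end

context crossing_eigenvalue begin

lemma T_pow_monomial: assumes "distinct js" "set js<=K" shows "EX Y. foldr T js X=act (mon (ind (set js))) Y"
 using assms
proof(induction js)
 case Nil
 show ?case by(rule exI[of _ X]) (simp add:ind_empty)
next
 case (Cons i js)
 then obtain Y where Y: "foldr T js X=act (mon (ind (set js))) Y" by auto
 have i: "i ~: set js" using Cons.prems by simp
 have "foldr T (i # js) X=act (mon (ind (set js))) (T i Y)" using Y i by(simp add:euler_act_invariant pd_mon_ind)
 also have "... = act (mon (ind (set (i # js)))) (act (cst (1 / of_nat (e i))) (der i Y))"
  using i by(simp add:euler_def cst_0 act_act mon_ind_insert ac_simps)
 finally show ?case by blast
qed

text \<open>The product of the \<open>T i\<close>, \<open>i\<close> in \<open>II\<close>, is
  divisible by \<open>zI\<close> on the left, and each factor is \<open>N\<close> modulo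
  \<open>rels a\<close>.\<close>

lemma N_pow_null: "(N ^^ length II) X:null"
proof -
 obtain Y where "foldr T II X=act zI Y" using T_pow_monomial[OF dist II_K] by blast
 hence "foldr T II X:null" using null_act by simp
 from null_diff[OF this null_rels[OF T_pow_N[of II X]]] show ?thesis by simp
qed

text \<open>Left multiplication by \<open>z^a\<close> is injective modulo the relations: this is
  \<open>strictness\<close> for \<open>P = 0\<close> and order -1. So \<open>null\<close> is the
  preimage of the next member of the chain under this multiplication.\<close>

lemma null_iff: "X:null <-> (EX Q. act (mon a) X - act (mon (%i. a i + ind (set II) i)) Q:rels (%_. 0))"
proof -
 have eq: "act (mon a) X - act (mon (%i. a i + ind (set II) i)) Q=act (mon a) (X - act zI Q)" for Q
  by(simp add:act_diff act_act mon_add)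
 have "Y:rels a <-> act (mon a) Y:rels (%_. 0)" for Y
 proof
  assume "act (mon a) Y:rels (%_. 0)"
  hence "0 - act (mon a) Y:rels (%_. 0)" using rels_minus by fastforce
  then obtain Y' where "Y':filt (-1)" "Y - Y':rels a"
   using strictness[where P = 0 and m = "-1" and a = a and X = Y] a_0 filt_0 by blast
  thus "Y:rels a" by(simp add:filt_neg)
 qed (erule rels_mon[rotated], rule a_0)
 thus ?thesis unfolding null_def eq by blast
qed

end

locale germ_crossing = germ_family R \<kappa> I t n + crossing z pd rho cst K e i0
 for R :: "'s ring" (structure) and \<kappa> I t n
  and z :: "'d::finite=>'r::comm_ring_1" and pd rho :: "'d=>'r=>'r" and cst :: "complex=>'r" and K e i0 +
 fixes ps :: "('d, 'r) ops=>_" assumes M: "presented M ps (%c. act (cst c)) UNIV UNIV"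
  and psi_ker: "ps X = ps 0 <-> (EX Q. X - act (mon (%i. if i:K then e i else 0)) Q:rels (%_. 0))"
  and F_psi: "F_M l = ps ` filt (l + int n)" and R_psi: "R_M (ps X) = ps (euler (%_. 0) i0 X)"
begin

theorem graded_decomp: assumes al: "0<=al" "al < 1" shows "graded_decomp al"
proof -
 interpret M: presented M ps "%c. act (cst c)" UNIV UNIV by(rule M)
 \<comment> \<open>Capped at \<open>lcd\<close>, since every member of a
   \<open>spectral_chain\<close> contains \<open>ker\<close>, and the levels beyond
   \<open>lcd\<close> would be too small.\<close>
 let ?G = "%j. level (min j lcd)"
 have "ceil_exp lcd=(%i. if i:K then e i else 0)" by(simp add:ceil_exp_lcd fun_eq_iff)
 hence ker: "M.ker=level lcd" by(auto simp:M.ker_def psi_ker level_def)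
 interpret germ_spectral R \<kappa> I t n ps "%c. act (cst c)" "euler (%_. 0) i0" ?G lcd
 proof unfold_locales
  fix j assume j: "j < lcd"
  obtain II where II: "set II = crit j" "distinct II" using finite_distinct_list[of "crit j"] by auto
  let ?c = "of_real (real j / real lcd)::complex"
  interpret E: crossing_eigenvalue z pd rho cst K e i0 "ceil_exp j" ?c II by(rule crossing_eigenvalue_level[OF II])
  have "(shifted (%_. 0) ?c ^^ length II) X:level (Suc j)" if "X:level j" for X
  proof -
   let ?N = "shifted (%_. 0) ?c ^^ length II"
   from that obtain Y where "X - act (mon (ceil_exp j)) Y:rels (%_. 0)" by(auto simp:level_def)
   hence 1: "?N X - ?N (act (mon (ceil_exp j)) Y):rels (%_. 0)"
    unfolding shifted_pow_diff[symmetric] by(rule rels_shifted_pow)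
   obtain Q where "act (mon (ceil_exp j)) ((E.N ^^ length II) Y) - act (mon (ceil_exp (Suc j))) Q:rels (%_. 0)"
    using E.N_pow_null[of Y] unfolding E.null_iff ceil_exp_Suc II by blast
   hence "?N (act (mon (ceil_exp j)) Y) - act (mon (ceil_exp (Suc j))) Q:rels (%_. 0)" unfolding shifted_mon .
   from rels_add[OF 1 this] have "?N X - act (mon (ceil_exp (Suc j))) Q:rels (%_. 0)" by simp
   thus ?thesis unfolding level_def by blast
  qed
  moreover have "(%X. euler (%_. 0) i0 X - act (cst ?c) X) = shifted (%_. 0) ?c" by(simp add:shifted_def fun_eq_iff)
  ultimately show "EX r. ALL X:?G j. ((%X. euler (%_. 0) i0 X - act (cst (of_real (real j / real lcd))) X) ^^ r) X:?G
   (Suc j)"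
   using j by(intro exI[of _ "length II"]) auto
 next
  show "M.ker<=?G j" for j unfolding ker by(rule level_mono) simp
 qed (auto simp:R_psi euler_diff act_diff act_act cst_mult cst_1 act_add_left[symmetric] cst_add
   euler_act_invariant pd_cst level_subgroup level_act_cst level_euler level_0 ker)
 \<comment> \<open>\<open>m\<close> is the first \<open>j\<close> with \<open>j / lcd\<close> at
   least \<open>al\<close>, and \<open>m'\<close> the first with \<open>j / lcd\<close> above
   \<open>al\<close>.\<close>
 define m where "m=nat \<lceil>al * real lcd\<rceil>"
 define m' where "m'=nat (\<lfloor>al * real lcd\<rfloor> + 1)"
 have "al * real lcd < 1 * real lcd" using al lcd_pos by(intro mult_strict_right_mono) auto
 hence lt: "al * real lcd < real lcd" by simp
 have nn: "0<=al * real lcd" using al by simp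
 have m: "m<=lcd" "m'<=lcd" "m<=m'" unfolding m_def m'_def using lt nn by linarith+
 have div: "al<=real j / real lcd <-> al * real lcd<=real j" "al < real j / real lcd <-> al * real lcd < real j" for j
  using lcd_pos by(simp_all add:pos_le_divide_eq pos_less_divide_eq)
 have ge: "M_ge al = ps ` ?G m" by(rule M_ge_eq) (use m in \<open>simp\<close>, unfold div m_def, linarith)
 have gt: "M_gt al = ps ` ?G m'" by(rule M_gt_eq) (use m in \<open>simp\<close>, unfold div m'_def, linarith)
 \<comment> \<open>If \<open>al * lcd\<close> is not an integer, the graded piece is 0. The empty
   list covers this case, because then \<open>zI\<close> is 1 and \<open>null\<close> is
   everything.\<close>
 define J where "J=(if al * real lcd=real m then crit m else {})"
 obtain II where II: "set II=J" "distinct II" using finite_distinct_list[of J] by auto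
 interpret E: crossing_eigenvalue z pd rho cst K e i0 "ceil_exp m" "of_real al" II
 proof unfold_locales
  show "of_nat (ceil_exp m i) / of_nat (e i)=(of_real al::complex)" if "i:set II" for i
  proof -
   have "i:crit m" "al * real lcd=real m" using that II by(auto simp:J_def split:if_splits)
   moreover hence "al=real m / real lcd" using lcd_pos by(simp add:field_simps)
   ultimately show ?thesis using ceil_exp_crit_div by metis
  qed
 qed (insert II, auto simp:J_def crit_def ceil_exp_def split:if_splits)
 have exp: "ceil_exp m'=(%i. ceil_exp m i + ind (set II) i)"
 proof(cases "al * real lcd=real m")
  case True
  hence "m'=Suc m" unfolding m'_def by simp
  thus ?thesis using True by(simp add:ceil_exp_Suc II J_def)
 next
  case False
  have "m'=m"
  proof -
   have "real_of_int \<lfloor>al * real lcd\<rfloor>~=al * real lcd"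
   proof
    assume h: "real_of_int \<lfloor>al * real lcd\<rfloor>=al * real lcd"
    hence "\<lceil>al * real lcd\<rceil>=\<lfloor>al * real lcd\<rfloor>" by(metis ceiling_of_int)
    hence "real m=al * real lcd" unfolding m_def using h nn by simp
    thus False using False by simp
   qed
   hence "\<lceil>al * real lcd\<rceil>=\<lfloor>al * real lcd\<rfloor> + 1" by(simp add:ceiling_altdef)
   thus ?thesis by(simp add:m_def m'_def)
  qed
  thus ?thesis using False by(simp add:II J_def ind_empty)
 qed
 \<comment> \<open>All operators parametrize the graded piece through left multiplication by
   \<open>z^a\<close>, which carries \<open>N\<close> to \<open>R\<close> minus
   \<open>al\<close>.\<close>
 let ?a = "ceil_exp m"
 let ?si = "act (mon ?a)" and ?c = "M.coset (level m')"
 let ?v = "%X. ?c (?si X)"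
 have Gm: "?G m=level m" "?G m'=level m'" using m by(simp_all add:min_absorb1)
 have sub: "level m'<=level m" by(rule level_mono) (rule m)
 interpret Q: presented "M_gr al" ?c "%c. act (cst c)" "level m" UNIV using M_gr_presented[OF ge gt] Gm sub by simp
 have cs: "?c x=?c y <-> x - y:level m'" for x y using M.coset_eq_iff[OF G G_ker, of m' x y] Gm by simp
 have pr: "presented (M_gr al) ?v (%c. act (cst c)) UNIV UNIV"
 proof(rule presented_reparametrize[OF Q.presented_axioms])
  show "?c ` level m=?v ` UNIV"
  proof(intro equalityI subsetI)
   fix v assume "v:?c ` level m"
   then obtain X Y where "v=?c X" "X - ?si Y:rels (%_. 0)" by(auto simp:level_def)
   hence "v=?v Y" using cs rels_level by simp
   thus "v:?v ` UNIV" by blast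
  qed (use act_level in auto)
 qed (auto simp:act_level act_add act_commute[of "mon ?a"] subgrp_def)
 then interpret V: presented "M_gr al" ?v "%c. act (cst c)" UNIV UNIV .
 have null: "V.ker=E.null"
 proof -
  have "X:V.ker <-> ?si X:level m'" for X by(simp add:V.ker_def cs act_0)
  moreover have "?si X:level m' <-> X:E.null" for X unfolding E.null_iff level_def exp by blast
  ultimately show ?thesis by blast
 qed
 have S: "S al (?si X)=?si (E.N X)" for X
  using shifted_mon[where c = "of_real al" and k = 1 and a = ?a and X = X] by(simp add:S_def shifted_def)
 interpret V: filtered_jordan "M_gr al" ?v "%c. act (cst c)" "R_M_gr al" E.N
  "F_M_gr al" "%l. filt (l + int n)" E.comp "length II"
 proof unfold_locales
  show "R_M_gr al (?v X)=?v (E.N X)" for X using R_M_gr_coset[OF gt, of "?si X"] by(simp add:Gm S)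
  show "F_M_gr al l=?v ` filt (l + int n)" for l
  proof -
   have "F_M_gr al l=?c ` (filt (l + int n) Int level m)" using F_M_gr_coset[OF ge gt F_psi[of l]] by(simp add:Gm)
   \<comment> \<open>Strictness is decisive here: an operator of bounded order in the level is,
     modulo relations, \<open>z^a\<close> times one of the same order.\<close>
   also have "... = ?v ` filt (l + int n)"
   proof(intro equalityI subsetI)
    fix v assume "v:?c ` (filt (l + int n) Int level m)"
    then obtain P X where P: "v=?c P" "P:filt (l + int n)" "P - ?si X:rels (%_. 0)" by(auto simp:level_def)
    then obtain Y where Y: "Y:filt (l + int n)" "X - Y:rels ?a" using strictness[OF P(2) E.a_0 P(3)] by blast
    have "?si (X - Y):rels (%_. 0)" by(rule rels_mon[OF E.a_0 Y(2)])
    from rels_add[OF P(3) this] have "P - ?si Y:rels (%_. 0)" by(simp add:act_diff)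
    hence "v=?v Y" using P(1) cs rels_level by simp
    thus "v:?v ` filt (l + int n)" using Y(1) by blast
   qed (use act_level act_filt in auto)
   finally show ?thesis .
  qed
  show "subgrp (filt (l + int n))" for l by(simp add:subgrp_def filt_0 filt_diff)
  show "E.N X:filt (l + 1 + int n)" if "X:filt (l + int n)" for X l
   using shifted_filt[OF that] by(simp add:algebra_simps)
  show "EX l. X:filt (l + int n)" for X using filt_exhaustive[of X] by(metis diff_add_cancel)
  show "subgrp (E.comp q)" for q
  proof(rule subgrpI[OF E.comp_0])
   fix X Y assume XY: "X:E.comp q" "Y:E.comp q"
   have "act (cst (-1)) Y = - Y" by(simp add:cst_minus cst_1 act_minus_left)
   thus "X - Y:E.comp q" using E.comp_add[OF XY(1) E.comp_act_cst[OF XY(2), of "-1"]] by simp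
  qed
  show "EX y. (ALL q j. y q j:E.comp q & y q j:filt (l - int j + int n)) & X - (SUM q<=length II. SUM j<q. (E.N ^^ j)
   (y q j)):V.ker" if X: "X:filt (l + int n)" for X l
  proof -
   obtain y where y: "!!q j. y q j:E.comp q" "!!q j. y q j:filt (l + int n - int j)"
    "X - (SUM q<=length II. SUM j<q. (E.N ^^ j) (y q j)):E.null" using E.decomposition_exists[OF X] by blast
   thus ?thesis unfolding null by(intro exI[of _ y]) (simp add:algebra_simps)
  qed
  show "E.N (X - Y)=E.N X - E.N Y" for X Y using shifted_pow_diff[where j = 1] by simp
  show "act (cst k) (E.N X)=E.N (act (cst k) X)" for k X by(rule act_cst_shifted)
  show "(E.N ^^ q) X:V.ker" if "X:E.comp q" for X q unfolding null by(rule E.comp_null[OF that])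
  show "y q j=0" if "!!q j. y q j:E.comp q" "(SUM q<=length II. SUM j<q. (E.N ^^ j) (y q j)):V.ker"
   "q<=length II" "j < q" for y q j using E.decomposition_unique[OF that(1) that(2)[unfolded null] that(3,4)] .
 qed (auto simp:act_diff E.comp_act_cst)
 show ?thesis using V.filtered_decomposition unfolding graded_decomp_def .
qed

end

subsection \<open>Alternating forms on logarithmic vector fields\<close>

definition del_at :: "nat=>'b list=>'b list" where
 "del_at i xs=take i xs @ drop (Suc i) xs"

lemma del_at_0 [simp]: "del_at 0 (x # xs)=xs" by(simp add:del_at_def)
lemma del_at_Suc [simp]: "del_at (Suc i) (x # xs)=x # del_at i xs" by(simp add:del_at_def)
lemma length_del_at: "i < length xs ==> length (del_at i xs)=length xs - 1" by(simp add:del_at_def)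
lemma set_del_at: "set (del_at i xs) <= set xs" by(auto simp:del_at_def dest:in_set_takeD in_set_dropD)

definition fadd :: "('r=>'r)=>('r=>'r)=>'r=>'r::comm_ring_1" where "fadd th et=(%x. th x + et x)"
definition fscale :: "'r=>('r=>'r)=>'r=>'r::comm_ring_1" where "fscale a th=(%x. a * th x)"
definition fbracket :: "('r=>'r)=>('r=>'r)=>'r=>'r::comm_ring_1" where
 "fbracket th et=(%x. th (et x) - et (th x))"

text \<open>The fields \<open>m i \<partial>_i\<close> span the logarithmic fields and are scaled so
  as to multiply \<open>t\<close> by 1 or 0. At a crossing \<open>m i\<close> is
  \<open>z i / e i\<close> for \<open>i\<close> in \<open>K\<close> and 1 otherwise; off
  \<open>Y\<close> it is the unit \<open>t\<close> for one index and 1 otherwise.\<close>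

locale log_frame = coords z pd rho cst
 for z :: "'d::finite=>'r::comm_ring_1" and pd rho :: "'d=>'r=>'r" and cst :: "complex=>'r" +
 fixes m eps :: "'d=>'r" and i0 :: 'd and t :: 'r
 assumes pd_m: "j~=i ==> pd j (m i)=0" and m_regular: "m i * x=0 ==> x=0"
  and m_pd_t: "m i * pd i t=eps i * t" and eps: "eps i=0 | eps i=1" and eps_i0: "eps i0=1"
  and t_regular: "t * x=0 ==> x=0"
begin

definition derivation :: "('r=>'r)=>bool" where
 "derivation th <-> (ALL x y. th (x + y)=th x + th y) & (ALL x y. th (x * y)=x * th y + y * th x) & (ALL c. th (cst c)=0)"

definition LV :: "('r=>'r) set" where "LV={th. derivation th & (ALL i. m i dvd th (z i))}"

definition LL :: "nat=>('r=>'r) list set" where "LL p={xs. length xs = p & set xs<=LV}"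

lemma LL_Nil [simp]: "[]:LL p <-> p=0" by(auto simp:LL_def)
lemma LL_Cons [simp]: "x # xs:LL (Suc p) <-> x:LV & xs:LL p" by(auto simp:LL_def)
lemma LL_0 [simp]: "xs:LL 0 <-> xs=[]" by(auto simp:LL_def)
lemma LL_SucE: assumes "xs:LL (Suc p)" obtains x ys where "xs=x # ys" "x:LV" "ys:LL p"
 using assms by(cases xs) (auto simp:LL_def)

lemma derivation_eq': "derivation th ==> th x=(SUM i:UNIV. th (z i) * pd i x)"
 by(rule derivation_eq) (auto simp:derivation_def)

lemma derivation_add: "derivation th ==> th (x + y)=th x + th y" by(simp add:derivation_def)
lemma derivation_mult: "derivation th ==> th (x * y)=x * th y + y * th x" by(simp add:derivation_def)
lemma derivation_0: "derivation th ==> th 0=0" by(rule additive_zero) (rule derivation_add)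
lemma derivation_cst: "derivation th ==> th (cst c)=0" by(simp add:derivation_def)
lemma LV_derivation: "th:LV ==> derivation th" by(simp add:LV_def)

lemma derivation_fbracket: "derivation th ==> derivation et ==> derivation (fbracket th et)"
 unfolding derivation_def[of "fbracket th et"]
 by(simp add:fbracket_def derivation_add derivation_mult derivation_cst derivation_0 algebra_simps)

lemma LV_fadd: "th:LV ==> et:LV ==> fadd th et:LV" by(auto simp:LV_def fadd_def derivation_def algebra_simps)
lemma LV_fscale: "th:LV ==> fscale a th:LV" by(auto simp:LV_def fscale_def derivation_def algebra_simps)

lemma dvd_LV_m: assumes "th:LV" shows "m i dvd th (m i)"
proof -
 have "th (m i)=(SUM j:UNIV. th (z j) * pd j (m i))" using assms by(intro derivation_eq' LV_derivation)
 also have "... = (SUM j:UNIV. if j=i then th (z i) * pd i (m i) else 0)" by(rule sum.cong) (auto simp:pd_m)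
 finally show ?thesis using assms by(auto simp:LV_def)
qed

lemma LV_fbracket: assumes "th:LV" "et:LV" shows "fbracket th et:LV"
proof -
 have *: "m i dvd th (et (z i))" if L: "th:LV" "et:LV" for th et i
 proof -
  obtain q where "et (z i)=m i * q" using L(2) by(auto simp:LV_def elim:dvdE)
  thus ?thesis using dvd_LV_m[OF L(1), of i] LV_derivation[OF L(1)] by(simp add:derivation_mult)
 qed
 show ?thesis unfolding LV_def using *[OF assms] *[OF assms(2,1)] derivation_fbracket[of th et] assms
  by(auto simp:LV_def fbracket_def)
qed

text \<open>Linearity is demanded in the first slot, and vanishing if the first two arguments agree;
  all else is inherited from the forms with fixed first argument. Contraction then removes the head
  of a list, which suits the recursive operations below. \<open>aformI\<close> and
  \<open>aform_not_distinct\<close> link this to the usual conditions.\<close>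

primrec aform :: "nat=>(('r=>'r) list=>'r)=>bool" where
 "aform 0 om <-> True"
| "aform (Suc p) om <-> (ALL th:LV. aform p (%xs. om (th # xs))) & (ALL th:LV. ALL et:LV. ALL xs:LL p. om (fadd th et
 # xs) = om (th # xs) + om (et # xs)) & (ALL a. ALL th:LV. ALL xs:LL p. om (fscale a th # xs)=a * om (th # xs)) &
 (ALL th:LV. ALL xs. th # xs:LL p --> om (th # th # xs)=0)"

lemma aform_SucI: assumes "!!th. th:LV ==> aform p (%xs. om (th # xs))"
  and "!!th et xs. th:LV ==> et:LV ==> xs:LL p ==> om (fadd th et # xs) = om (th # xs) + om (et # xs)"
  and "!!a th xs. th:LV ==> xs:LL p ==> om (fscale a th # xs)=a * om (th # xs)"
  and "!!th xs p'. p=Suc p' ==> th:LV ==> xs:LL p' ==> om (th # th # xs)=0" shows "aform (Suc p) om"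
 using assms by(cases p) auto

lemma aform_SucD: assumes "aform (Suc p) om" shows "th:LV ==> aform p (%xs. om (th # xs))"
  and "th:LV ==> et:LV ==> xs:LL p ==> om (fadd th et # xs) = om (th # xs) + om (et # xs)"
  and "th:LV ==> xs:LL p ==> om (fscale a th # xs)=a * om (th # xs)"
  and "p=Suc p' ==> th:LV ==> xs:LL p' ==> om (th # th # xs)=0" using assms by auto

lemma aform_add: "aform p om ==> aform p om' ==> aform p (%xs. om xs + om' xs)"
proof(induction p arbitrary: om om')
 case (Suc p)
 show ?case by(rule aform_SucI)
   (insert aform_SucD[OF Suc.prems(1)] aform_SucD[OF Suc.prems(2)] Suc.IH, simp_all add:algebra_simps)
qed simp

lemma aform_scale: "aform p om ==> aform p (%xs. a * om xs)"
proof(induction p arbitrary: om)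
 case (Suc p)
 show ?case by(rule aform_SucI) (insert aform_SucD[OF Suc.prems] Suc.IH, simp_all add:algebra_simps)
qed simp

lemma aform_diff: "aform p om ==> aform p om' ==> aform p (%xs. om xs - om' xs)"
 using aform_add[of p om "%xs. -1 * om' xs"] aform_scale[of p om' "-1"] by simp

lemma aform_zero: "aform p (%xs. 0)" by(induction p) (auto intro:aform_SucI simp del:aform.simps(2))

lemma aform_swap: assumes "aform (Suc (Suc p)) om" "th:LV" "et:LV" "xs:LL p"
 shows "om (th # et # xs) = - om (et # th # xs)"
proof -
 note D = aform_SucD[OF assms(1)]
 have f: "fadd th et:LV" using assms LV_fadd by blast
 have "0 = om (fadd th et # fadd th et # xs)" by(rule D(4)[OF refl f assms(4), symmetric])
 also have "... = om (th # fadd th et # xs) + om (et # fadd th et # xs)" by(rule D(2)) (use assms f in auto)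
 also have "... = om (th # et # xs) + om (et # th # xs)"
  unfolding aform_SucD(2)[OF D(1)[OF assms(2)] assms(2,3,4)] aform_SucD(2)[OF D(1)[OF assms(3)] assms(2,3,4)]
   D(4)[OF refl assms(2,4)] D(4)[OF refl assms(3,4)] by simp
 finally show ?thesis by(simp add:eq_neg_iff_add_eq_0)
qed

lemma aform_front: assumes "aform (Suc p) om" "th:LV" "ys @ zs:LL p"
 shows "om (ys @ th # zs)=(-1) ^ length ys * om (th # ys @ zs)" using assms
proof(induction ys arbitrary: p om)
 case (Cons y ys)
 then obtain p' where p: "p=Suc p'" "y:LV" "ys @ zs:LL p'" by(cases p) auto
 have "om (y # ys @ th # zs)=(-1) ^ length ys * om (y # th # ys @ zs)"
  using Cons.IH[OF aform_SucD(1)[OF Cons.prems(1) p(2), unfolded p(1)]] Cons.prems(2) p by simp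
 also have "om (y # th # ys @ zs) = - om (th # y # ys @ zs)"
  using aform_swap[OF Cons.prems(1)[unfolded p(1)]] Cons.prems p by blast
 finally show ?case by simp
qed simp

lemma aform_repeat: assumes "aform p om" "xs @ th # ys @ th # zs:LL p" shows "om (xs @ th # ys @ th # zs)=0"
 using assms
proof(induction xs arbitrary: p om)
 case Nil
 then obtain p' where p: "p=Suc (Suc p')" "th:LV" "ys @ zs:LL p'" by(cases p; cases "p - 1") (auto simp:LL_def)
 have "om (th # ys @ th # zs)=(-1) ^ length ys * om (th # th # ys @ zs)"
  using aform_front[OF aform_SucD(1)[OF Nil.prems(1)[unfolded p(1)] p(2)]] p by simp
 thus ?case using aform_SucD(4)[OF Nil.prems(1)[unfolded p(1)]] p by simp
next
 case (Cons x xs)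
 then obtain p' where p: "p=Suc p'" by(cases p) (auto simp:LL_def)
 show ?case using Cons.IH[OF aform_SucD(1)[OF Cons.prems(1)[unfolded p]]] Cons.prems(2) p by simp
qed

lemma aform_not_distinct: "aform p om ==> xs:LL p ==> \<not> distinct xs ==> om xs=0"
 using aform_repeat not_distinct_decomp[of xs] by fastforce

lemma aform_fadd: assumes "aform p om" "xs @ th # ys:LL p" "et:LV"
 shows "om (xs @ fadd th et # ys) = om (xs @ th # ys) + om (xs @ et # ys)" using assms
proof(induction xs arbitrary: p om)
 case Nil
 then obtain p' where "p=Suc p'" by(cases p) (auto simp:LL_def)
 thus ?case using Nil by simp
next
 case (Cons x xs)
 then obtain p' where p: "p=Suc p'" by(cases p) (auto simp:LL_def)
 show ?case using Cons.IH[OF aform_SucD(1)[OF Cons.prems(1)[unfolded p]]] Cons.prems p by simp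
qed

lemma aform_fscale: assumes "aform p om" "xs @ th # ys:LL p" shows "om (xs @ fscale a th # ys)=a * om (xs @ th # ys)"
 using assms
proof(induction xs arbitrary: p om)
 case Nil
 then obtain p' where "p=Suc p'" by(cases p) (auto simp:LL_def)
 thus ?case using Nil by simp
next
 case (Cons x xs)
 then obtain p' where p: "p=Suc p'" by(cases p) (auto simp:LL_def)
 show ?case using Cons.IH[OF aform_SucD(1)[OF Cons.prems(1)[unfolded p]]] Cons.prems p by simp
qed

lemma aformI:
 assumes "!!xs th ys et. xs @ th # ys:LL p ==> et:LV ==> om (xs @ fadd th et # ys) = om (xs @ th # ys) + om (xs @ et # ys)"
  and "!!xs th ys a. xs @ th # ys:LL p ==> om (xs @ fscale a th # ys)=a * om (xs @ th # ys)"
  and "!!xs. xs:LL p ==> \<not> distinct xs ==> om xs=0" shows "aform p om" using assms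
proof(induction p arbitrary: om)
 case (Suc p)
 show ?case
 proof(rule aform_SucI)
  show "aform p (%xs. om (th # xs))" if "th:LV" for th
   by(rule Suc.IH) (use Suc.prems(1)[of "th # _"] Suc.prems(2)[of "th # _"] Suc.prems(3) that in auto)
 qed (use Suc.prems(1)[of "[]"] Suc.prems(2)[of "[]"] Suc.prems(3) in auto)
qed simp

text \<open>The wedge product of \<open>xi\<close> with \<open>bt\<close>, by the rule that
  contraction with \<open>th\<close> is an antiderivation.\<close>

primrec ww :: "('r=>'r) list=>(('r=>'r)=>'r)=>(('r=>'r) list=>'r)=>'r" where
 "ww [] xi bt=0"
| "ww (th # xs) xi bt=xi th * bt xs - ww xs xi (%ys. bt (th # ys))"

text \<open>The Lie derivative of \<open>bt\<close> along \<open>th\<close>, by the Leibniz rule in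
  the arguments.\<close>

primrec lie :: "('r=>'r) list=>('r=>'r)=>(('r=>'r) list=>'r)=>'r" where
 "lie [] th bt=th (bt [])"
| "lie (et # xs) th bt=lie xs th (%ys. bt (et # ys)) - bt (fbracket th et # xs)"

text \<open>The exterior derivative by Cartan's formula: contracting it with \<open>th\<close> gives
  the Lie derivative of \<open>bt\<close> along \<open>th\<close> minus the exterior derivative of
  the contraction. Linearity and alternation then follow slot by slot.\<close>

primrec dd :: "('r=>'r) list=>(('r=>'r) list=>'r)=>'r" where
 "dd [] bt=0"
| "dd (th # xs) bt=lie xs th bt - dd xs (%ys. bt (th # ys))"

definition linear_form :: "(('r=>'r)=>'r)=>bool" where
 "linear_form xi <-> (ALL th:LV. ALL et:LV. xi (fadd th et)=xi th + xi et) & (ALL a. ALL th:LV. xi (fscale a th)=a * xi th)"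

lemma ww_cong: "xs:LL (Suc p) ==> (!!ys. ys:LL p ==> bt ys=bt' ys) ==> ww xs xi bt=ww xs xi bt'"
proof(induction xs arbitrary: p bt bt')
 case (Cons x xs)
 show ?case
 proof(cases p)
  case 0
  thus ?thesis using Cons.prems by simp
 next
  case (Suc p')
  thus ?thesis using Cons.prems Cons.IH[of p' "%ys. bt (x # ys)" "%ys. bt' (x # ys)"] by simp
 qed
qed simp

lemma ww_add: "ww xs xi (%ys. bt ys + bt' ys)=ww xs xi bt + ww xs xi bt'"
 by(induction xs arbitrary: bt bt') (simp_all add:algebra_simps)

lemma ww_scale: "ww xs xi (%ys. a * bt ys)=a * ww xs xi bt"
 by(induction xs arbitrary: bt) (simp_all add:algebra_simps)

lemma ww_zero: "xs:LL (Suc p) ==> (!!ys. ys:LL p ==> bt ys=0) ==> ww xs xi bt=0"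
 using ww_cong[of xs p bt "%ys. 0 * bt ys" xi] ww_scale[of xs xi 0 bt] by simp

lemma aform_ww: assumes xi: "linear_form xi" and "aform p bt" shows "aform (Suc p) (%xs. ww xs xi bt)" using assms(2)
proof(induction p arbitrary: bt)
 case 0
 thus ?case using xi by(intro aform_SucI) (auto simp:linear_form_def algebra_simps)
next
 case (Suc p)
 note D = aform_SucD[OF Suc.prems]
 have xi1: "xi (fadd th et)=xi th + xi et" if "th:LV" "et:LV" for th et using xi that by(simp add:linear_form_def)
 have xi2: "xi (fscale a th)=a * xi th" if "th:LV" for a th using xi that by(simp add:linear_form_def)
 show ?case
 proof(rule aform_SucI)
  fix th assume th: "th:LV"
  show "aform (Suc p) (%xs. ww (th # xs) xi bt)"
   unfolding ww.simps(2) by(intro aform_diff aform_scale Suc.prems Suc.IH D(1) th)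
 next
  fix th et xs assume *: "th:LV" "et:LV" "xs:LL (Suc p)"
  have "ww xs xi (%ys. bt (fadd th et # ys))=ww xs xi (%ys. bt (th # ys) + bt (et # ys))"
   by(rule ww_cong[OF *(3)]) (use D(2) * in blast)
  thus "ww (fadd th et # xs) xi bt=ww (th # xs) xi bt + ww (et # xs) xi bt"
   using * by(simp add:ww_add xi1 algebra_simps)
 next
  fix a th xs assume *: "th:LV" "xs:LL (Suc p)"
  have "ww xs xi (%ys. bt (fscale a th # ys))=ww xs xi (%ys. a * bt (th # ys))"
   by(rule ww_cong[OF *(2)]) (use D(3) * in blast)
  thus "ww (fscale a th # xs) xi bt=a * ww (th # xs) xi bt" using * by(simp add:ww_scale xi2 algebra_simps)
 next
  fix th xs p' assume *: "Suc p=Suc p'" "th:LV" "xs:LL p'"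
  have "ww xs xi (%ys. bt (th # th # ys))=0"
  proof(cases p)
   case (Suc q)
   show ?thesis by(rule ww_zero[of _ q]) (use * Suc D(4) in auto)
  qed (use * in simp)
  thus "ww (th # th # xs) xi bt=0" by simp
 qed
qed

lemma lie_cong: "xs:LL p ==> th:LV ==> (!!ys. ys:LL p ==> bt ys=bt' ys) ==> lie xs th bt=lie xs th bt'"
proof(induction xs arbitrary: p bt bt')
 case (Cons x xs)
 then obtain p' where p: "p=Suc p'" by(cases p) (auto simp:LL_def)
 show ?case using Cons.IH[of p' "%ys. bt (x # ys)" "%ys. bt' (x # ys)"] Cons.prems p LV_fbracket by simp
qed simp

lemma lie_add: "th:LV ==> lie xs th (%ys. bt ys + bt' ys)=lie xs th bt + lie xs th bt'"
 by(induction xs arbitrary: bt bt') (simp_all add:derivation_add[OF LV_derivation])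

lemma lie_scale: "th:LV ==> lie xs th (%ys. a * bt ys)=a * lie xs th bt + th a * bt xs"
 by(induction xs arbitrary: bt) (simp_all add:derivation_mult[OF LV_derivation] algebra_simps)

lemma lie_zero: "xs:LL p ==> th:LV ==> (!!ys. ys:LL p ==> bt ys=0) ==> lie xs th bt=0"
 using lie_cong[of xs p th bt "%ys. 0 * bt ys"] lie_scale[of th xs 0 bt] derivation_0[OF LV_derivation, of th] by simp

lemma fbracket_fadd_right: "th:LV ==> fbracket th (fadd et ze)=fadd (fbracket th et) (fbracket th ze)"
 by(simp add:fbracket_def fadd_def fun_eq_iff derivation_add[OF LV_derivation] algebra_simps)

lemma fbracket_fscale_right: "th:LV ==> fbracket th (fscale a et)=fadd (fscale a (fbracket th et)) (fscale (th a) et)"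
 by(simp add:fbracket_def fadd_def fscale_def fun_eq_iff derivation_mult[OF LV_derivation] algebra_simps)

lemma fbracket_fadd_left: "ze:LV ==> fbracket (fadd th et) ze=fadd (fbracket th ze) (fbracket et ze)"
 by(simp add:fbracket_def fadd_def fun_eq_iff derivation_add[OF LV_derivation] algebra_simps)

lemma fbracket_fscale_left: "ze:LV ==> fbracket (fscale a th) ze=fadd (fscale a (fbracket th ze)) (fscale (- ze a) th)"
 by(simp add:fbracket_def fadd_def fscale_def fun_eq_iff derivation_mult[OF LV_derivation] algebra_simps)

lemma aform_lie: assumes th: "th:LV" and "aform p bt" shows "aform p (%xs. lie xs th bt)" using assms(2)
proof(induction p arbitrary: bt)
 case (Suc p)
 note D = aform_SucD[OF Suc.prems]
 show ?case
 proof(rule aform_SucI)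
  fix et assume "et:LV"
  thus "aform p (%xs. lie (et # xs) th bt)" unfolding lie.simps(2) by(intro aform_diff Suc.IH D(1) LV_fbracket th)
 next
  fix et ze xs assume *: "et:LV" "ze:LV" "xs:LL p"
  have "lie xs th (%ys. bt (fadd et ze # ys))=lie xs th (%ys. bt (et # ys) + bt (ze # ys))"
   by(rule lie_cong[OF *(3) th]) (use D(2) * in blast)
  thus "lie (fadd et ze # xs) th bt=lie (et # xs) th bt + lie (ze # xs) th bt"
   using * th by(simp add:lie_add fbracket_fadd_right D(2) LV_fbracket)
 next
  fix a et xs assume *: "et:LV" "xs:LL p"
  have "lie xs th (%ys. bt (fscale a et # ys))=lie xs th (%ys. a * bt (et # ys))"
   by(rule lie_cong[OF *(2) th]) (use D(3) * in blast)
  thus "lie (fscale a et # xs) th bt=a * lie (et # xs) th bt"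
   using * th by(simp add:lie_scale fbracket_fscale_right D(2,3) LV_fbracket LV_fscale algebra_simps)
 next
  fix et xs p' assume *: "p=Suc p'" "et:LV" "xs:LL p'"
  have "lie xs th (%ys. bt (et # et # ys))=0" by(rule lie_zero[OF *(3) th]) (use D(4) * in blast)
  moreover have "bt (et # fbracket th et # xs) = - bt (fbracket th et # et # xs)"
   by(rule aform_swap[OF Suc.prems[unfolded *(1)]]) (use * th LV_fbracket in auto)
  ultimately show "lie (et # et # xs) th bt=0" by simp
 qed
qed simp

lemma dd_cong: "xs:LL (Suc p) ==> (!!ys. ys:LL p ==> bt ys=bt' ys) ==> dd xs bt=dd xs bt'"
proof(induction xs arbitrary: p bt bt')
 case (Cons x xs)
 have l: "lie xs x bt=lie xs x bt'" by(rule lie_cong[of _ p]) (use Cons.prems in auto)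
 show ?case
 proof(cases p)
  case 0
  thus ?thesis using Cons.prems l by simp
 next
  case (Suc p')
  thus ?thesis using Cons.prems Cons.IH[of p' "%ys. bt (x # ys)" "%ys. bt' (x # ys)"] l by simp
 qed
qed simp

lemma dd_add: "xs:LL p ==> dd xs (%ys. bt ys + bt' ys)=dd xs bt + dd xs bt'"
proof(induction xs arbitrary: p bt bt')
 case (Cons x xs)
 then obtain p' where p: "p=Suc p'" by(cases p) (auto simp:LL_def)
 show ?case using Cons.IH[of p'] Cons.prems p lie_add by simp
qed simp

lemma dd_scale: "xs:LL p ==> dd xs (%ys. a * bt ys)=a * dd xs bt + ww xs (%th. th a) bt"
proof(induction xs arbitrary: p bt)
 case (Cons x xs)
 then obtain p' where p: "p=Suc p'" by(cases p) (auto simp:LL_def)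
 show ?case using Cons.IH[of p'] Cons.prems p lie_scale by(simp add:algebra_simps)
qed simp

lemma dd_zero: "xs:LL (Suc p) ==> (!!ys. ys:LL p ==> bt ys=0) ==> dd xs bt=0"
 using dd_cong[of xs p bt "%ys. 0 * bt ys"] dd_scale[of xs "Suc p" 0 bt] ww_zero[of xs p bt] by simp

lemma lie_fadd: assumes "aform p bt" "th:LV" "et:LV" "xs:LL p"
 shows "lie xs (fadd th et) bt=lie xs th bt + lie xs et bt" using assms
proof(induction xs arbitrary: p bt)
 case (Cons x xs)
 then obtain p' where p: "p=Suc p'" by(cases p) (auto simp:LL_def)
 note D = aform_SucD[OF Cons.prems(1)[unfolded p]]
 show ?case using Cons.IH[OF D(1)] Cons.prems p D(2) by(simp add:fbracket_fadd_left LV_fbracket)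
qed (simp add:fadd_def)

text \<open>The correction term cancels the one in \<open>dd_scale\<close>, and so makes
  \<open>dd\<close> linear over functions.\<close>

lemma lie_fscale: assumes "aform p bt" "th:LV" "xs:LL p"
 shows "lie xs (fscale a th) bt=a * lie xs th bt + ww xs (%ze. ze a) (%ys. bt (th # ys))" using assms
proof(induction xs arbitrary: p bt)
 case (Cons x xs)
 then obtain p' where p: "p=Suc p'" by(cases p) (auto simp:LL_def)
 note D = aform_SucD[OF Cons.prems(1)[unfolded p]]
 have x: "x:LV" "xs:LL p'" using Cons.prems p by auto
 have "ww xs (%ze. ze a) (%ys. bt (x # th # ys)) = - ww xs (%ze. ze a) (%ys. bt (th # x # ys))"
 proof(cases p')
  case (Suc q)
  have "ww xs (%ze. ze a) (%ys. bt (x # th # ys))=ww xs (%ze. ze a) (%ys. -1 * bt (th # x # ys))"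
  proof(rule ww_cong)
   show "xs:LL (Suc q)" using x Suc by simp
   fix ys assume "ys:LL q"
   from aform_swap[OF Cons.prems(1)[unfolded p Suc] x(1) Cons.prems(2) this]
   show "bt (x # th # ys) = -1 * bt (th # x # ys)" by simp
  qed
  thus ?thesis by(simp only:ww_scale) simp
 qed (use x in simp)
 thus ?case using Cons.IH[OF D(1)[OF x(1)] Cons.prems(2) x(2)] x Cons.prems(2) D(2,3)
  by(simp add:fbracket_fscale_left LV_fbracket LV_fscale algebra_simps)
qed (simp add:fscale_def)

lemma aform_dd: assumes "aform p bt" shows "aform (Suc p) (%xs. dd xs bt)" using assms
proof(induction p arbitrary: bt)
 case 0
 thus ?case by(intro aform_SucI) (auto simp:fadd_def fscale_def)
next
 case (Suc p)
 note D = aform_SucD[OF Suc.prems]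
 show ?case
 proof(rule aform_SucI)
  fix th assume "th:LV"
  thus "aform (Suc p) (%xs. dd (th # xs) bt)"
   unfolding dd.simps(2) by(intro aform_diff aform_lie Suc.IH Suc.prems D(1))
 next
  fix th et xs assume *: "th:LV" "et:LV" "xs:LL (Suc p)"
  have "dd xs (%ys. bt (fadd th et # ys))=dd xs (%ys. bt (th # ys) + bt (et # ys))"
   by(rule dd_cong[OF *(3)]) (use D(2) * in blast)
  thus "dd (fadd th et # xs) bt=dd (th # xs) bt + dd (et # xs) bt"
   using * by(simp add:dd_add[OF *(3)] lie_fadd[OF Suc.prems])
 next
  fix a th xs assume *: "th:LV" "xs:LL (Suc p)"
  have "dd xs (%ys. bt (fscale a th # ys))=dd xs (%ys. a * bt (th # ys))"
   by(rule dd_cong[OF *(2)]) (use D(3) * in blast)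
  thus "dd (fscale a th # xs) bt=a * dd (th # xs) bt"
   using * by(simp add:dd_scale[OF *(2)] lie_fscale[OF Suc.prems] algebra_simps)
 next
  fix th xs p' assume *: "Suc p=Suc p'" "th:LV" "xs:LL p'"
  have "dd xs (%ys. bt (th # th # ys))=0"
  proof(cases p)
   case (Suc q)
   show ?thesis by(rule dd_zero[of _ q]) (use * Suc D(4) in auto)
  qed (use * in simp)
  moreover have "bt (fbracket th th # xs)=0"
  proof -
   have "fbracket th th=fscale 0 th" by(simp add:fbracket_def fscale_def)
   thus ?thesis using D(3)[of th xs 0] * by simp
  qed
  ultimately show "dd (th # th # xs) bt=0" by simp
 qed
qed

lemma ww_sum: "xs:LL (Suc p) ==> ww xs xi bt=(SUM i<=p. (-1) ^ i * (xi (xs ! i) * bt (del_at i xs)))"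
proof(induction p arbitrary: xs bt)
 case 0
 thus ?case by(auto elim!:LL_SucE)
next
 case (Suc p)
 then obtain x ys where xs: "xs=x # ys" "ys:LL (Suc p)" by(auto elim:LL_SucE)
 show ?case unfolding xs(1) ww.simps Suc.IH[OF xs(2)] sum.atMost_Suc_shift by(simp add:sum_negf)
qed

lemma lie_sum: assumes "aform p bt" "th:LV" "xs:LL p"
 shows "lie xs th bt=th (bt xs) - (SUM j<p. (-1) ^ j * bt (fbracket th (xs ! j) # del_at j xs))" using assms
proof(induction p arbitrary: xs bt)
 case (Suc p)
 then obtain x ys where xs: "xs=x # ys" "x:LV" "ys:LL p" by(auto elim:LL_SucE)
 note D = aform_SucD[OF Suc.prems(1)]
 have sw: "bt (x # fbracket th (ys ! j) # del_at j ys) = - bt (fbracket th (ys ! j) # x # del_at j ys)"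
  if j: "j < p" for j
 proof -
  obtain p' where p: "p=Suc p'" using j by(cases p) auto
  have "del_at j ys:LL p'" "ys ! j:LV"
   using xs(3) j p length_del_at[of j ys] set_del_at[of j ys] by(auto simp:LL_def subset_iff)
  thus ?thesis using aform_swap[OF Suc.prems(1)[unfolded p]] xs(2) Suc.prems(2) LV_fbracket by blast
 qed
 have "(SUM j<p. (-1) ^ j * bt (x # fbracket th (ys ! j) # del_at j ys))=(SUM j<p. (-1) ^ Suc j * bt (fbracket th (ys
  ! j) # x # del_at j ys))"
  by(rule sum.cong) (simp_all add:sw)
 thus ?case unfolding xs(1) lie.simps Suc.IH[OF D(1)[OF xs(2)] Suc.prems(2) xs(3)] sum.lessThan_Suc_shift
  by(simp add:sum_negf)
qed simp

lemma pairs_Suc: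
 "{(i, j). i < j & j<=Suc p}=(%j. (0, Suc j)) ` {..p} Un (%(i, j). (Suc i, Suc j)) ` {(i, j). i < j & j <= p}"
proof(intro equalityI subsetI)
 fix x assume "x:{(i, j). i < j & j<=Suc p}"
 then obtain i j where x: "x=(i, Suc j)" "i < Suc j" "j <= p" by(cases x; cases "snd x") auto
 thus "x:(%j. (0, Suc j)) ` {..p} Un (%(i, j). (Suc i, Suc j)) ` {(i, j). i < j & j <= p}" by(cases i) force+
qed auto

lemma finite_pairs: "finite {(i, j). i < j & j<=(p::nat)}" by(rule finite_subset[of _ "{..p} \<times> {..p}"]) auto

lemma sum_pairs_Suc:
 fixes f :: "nat=>nat=>'b::comm_monoid_add"
 shows "(SUM (i, j):{(i, j). i < j & j<=Suc p}. f i j)=(SUM j<=p. f 0 (Suc j)) + (SUM (i, j):{(i, j). i < j & j <=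
  p}. f (Suc i) (Suc j))"
 unfolding pairs_Suc by(subst sum.union_disjoint)
  (auto simp:sum.reindex inj_on_def case_prod_unfold intro!:finite_imageI finite_pairs[unfolded case_prod_unfold])

text \<open>The link to \<open>ext_deriv\<close>: in its double sum the pairs with first index 0
  come from the Lie derivative, the others from the recursion.\<close>

lemma dd_sum: assumes "aform p bt" "xs:LL (Suc p)"
 shows "dd xs bt=(SUM i<=p. (-1) ^ i * (xs ! i) (bt (del_at i xs))) + (SUM (i, j):{(i, j). i < j & j <= p}. (-1) ^ (i
  + j) * bt (fbracket (xs ! i) (xs ! j) # del_at i (del_at j xs)))"
 using assms
proof(induction p arbitrary: xs bt)
 case 0
 have E: "{(i, j). i < j & j<=(0::nat)}={}" by auto
 show ?case using 0 unfolding E by(auto elim!:LL_SucE)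
next
 case (Suc p)
 then obtain x ys where xs: "xs=x # ys" "x:LV" "ys:LL (Suc p)" by(auto elim:LL_SucE)
 note D = aform_SucD[OF Suc.prems(1)]
 let ?P = "{(i, j). i < j & j <= p}"
 have sw: "bt (x # fbracket (ys ! i) (ys ! j) # del_at i (del_at j ys)) = - bt (fbracket (ys ! i) (ys ! j) # x #
  del_at i (del_at j ys))" if ij: "i < j" "j <= p" for i j
 proof -
  obtain p' where p: "p=Suc p'" using ij by(cases p) auto
  have "length (del_at j ys) = p" "set (del_at j ys)<=LV"
   using xs(3) ij length_del_at[of j ys] set_del_at[of j ys] by(auto simp:LL_def)
  hence "del_at i (del_at j ys):LL p'" "ys ! i:LV" "ys ! j:LV"
   using xs(3) ij p length_del_at[of i "del_at j ys"] set_del_at[of i "del_at j ys"] by(auto simp:LL_def subset_iff)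
  thus ?thesis using aform_swap[OF Suc.prems(1)[unfolded p]] xs(2) LV_fbracket by blast
 qed
 have P: "(SUM (i, j):?P. (-1) ^ (i + j) * bt (x # fbracket (ys ! i) (ys ! j) # del_at i (del_at j ys))) = - (SUM (i,
  j):?P. (-1) ^ (i + j) * bt (fbracket (ys ! i) (ys ! j) # x # del_at i (del_at j ys)))"
  unfolding sum_negf[symmetric] by(rule sum.cong) (auto simp:sw)
 have "dd xs bt=x (bt ys) - (SUM j<=p. (-1) ^ j * bt (fbracket x (ys ! j) # del_at j ys)) - ((SUM i<=p. (-1) ^ i *
  (ys ! i) (bt (x # del_at i ys))) - (SUM (i, j):?P. (-1) ^ (i + j) * bt (fbracket (ys ! i) (ys ! j) # x # del_at i
  (del_at j ys))))"
  unfolding xs(1) dd.simps Suc.IH[OF D(1)[OF xs(2)] xs(3)] lie_sum[OF Suc.prems(1) xs(2,3)]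
  by(simp add:P lessThan_Suc_atMost)
 thus ?case unfolding sum_pairs_Suc sum.atMost_Suc_shift[of _ p] by(simp add:xs(1) sum_negf)
qed

end

section \<open>A frame adapted to \<open>t\<close>\<close>

context log_frame
begin

text \<open>\<open>fr i0\<close> sends \<open>t\<close> to \<open>t\<close>, and the other fields
  are corrected by a multiple of it so as to kill \<open>t\<close>. They therefore form a frame of
  the relative fields, and in the dual basis \<open>eta\<close> the form \<open>eta i0\<close> is
  dt/t.\<close>

definition fr :: "'d=>'r=>'r" where
 "fr i=(%x. m i * pd i x - (if i=i0 then 0 else eps i * (m i0 * pd i0 x)))"

definition quot :: "('r=>'r)=>'d=>'r" where "quot th i=(THE q. th (z i)=m i * q)"

definition eta :: "'d=>('r=>'r)=>'r" where
 "eta i th=(if i=i0 then SUM j:UNIV. eps j * quot th j else quot th i)"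

lemma m_cancel: "m i * x=m i * y ==> x=y" using m_regular[of i "x - y"] by(simp add:right_diff_distrib)
lemma t_cancel: "t * x=t * y ==> x=y" using t_regular[of "x - y"] by(simp add:right_diff_distrib)
lemma quot_eqI: "th (z i)=m i * q ==> quot th i=q" unfolding quot_def by(rule the_equality) (auto dest:m_cancel)

lemma quot: "th:LV ==> th (z i)=m i * quot th i"
 using quot_eqI[of th i] by(force simp:LV_def elim!:dvdE dest:spec[of _ i])

lemma linear_form_quot: "linear_form (%th. quot th i)" unfolding linear_form_def
 by(auto intro!:quot_eqI simp:fadd_def fscale_def quot algebra_simps)

lemma linear_form_eta: "linear_form (eta i)" using linear_form_quot
 by(auto simp:linear_form_def eta_def sum.distrib sum_distrib_left algebra_simps)

lemma sum_remove_i0: "(SUM i:UNIV. f i)=f i0 + (SUM i:UNIV - {i0}. f i)" for f :: "'d=>'b::comm_monoid_add"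
 by(rule sum.remove) auto

lemma LV_expansion: assumes "th:LV" shows "th x=(SUM i:UNIV. eta i th * fr i x)"
proof -
 have "th x=(SUM i:UNIV. m i * quot th i * pd i x)"
  using derivation_eq'[OF LV_derivation[OF assms], of x] by(simp add:quot[OF assms])
 also have "... = (SUM i:UNIV. eta i th * fr i x)" unfolding sum_remove_i0
  by(simp add:fr_def eta_def sum_remove_i0 eps_i0 sum_subtractf sum_distrib_right sum_distrib_left algebra_simps)
 finally show ?thesis .
qed

lemma derivation_fr: "derivation (fr i)" by(auto simp:derivation_def fr_def pd_add pd_mult pd_cst algebra_simps)
lemma fr_z: "fr i (z j)=(if j=i then m i else if j=i0 then - (eps i * m i0) else 0)" by(auto simp:fr_def pd_z)
lemma fr_LV: "fr i:LV" by(auto simp:LV_def derivation_fr fr_z)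

lemma quot_fr: "quot (fr i) j=(if j=i then 1 else if j=i0 then - eps i else 0)"
 by(rule quot_eqI) (simp add:fr_z mult.commute)

lemma eta_fr: "eta i (fr j)=(if i=j then 1 else 0)"
proof(cases "i=i0")
 case True
 have "(SUM k:UNIV - {i0}. eps k * quot (fr j) k)=(SUM k:UNIV - {i0}. if k=j then eps j else 0)"
  by(rule sum.cong) (auto simp:quot_fr)
 thus ?thesis using True by(auto simp:eta_def sum_remove_i0 eps_i0 quot_fr)
qed (auto simp:eta_def quot_fr)

lemma pd_eps: "pd i (eps j)=0" using eps[of j] by(auto simp:pd_0 pd_1)
lemma fr_t: "fr i t=(if i=i0 then t else 0)" by(simp add:fr_def m_pd_t eps_i0)
lemma LV_t: "th:LV ==> th t=eta i0 th * t" by(simp add:LV_expansion fr_t if_distrib[of "(*) _"] cong: if_cong)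

lemma fr_commute: "fr i (fr j x)=fr j (fr i x)"
proof -
 have T: "m i * pd i (m j * pd j x)=m j * pd j (m i * pd i x)" for i j x
  by(cases "i=j") (auto simp:pd_mult pd_m pd_commute[of i j] algebra_simps)
 have E: "m i * pd i (eps j * x)=eps j * (m i * pd i x)" for i j x by(simp add:pd_mult pd_eps algebra_simps)
 show ?thesis unfolding fr_def
  by(auto simp:pd_0 pd_diff pd_mult[of _ "eps _"] pd_eps T[of i j] right_diff_distrib T[of i0 i] T[of i0 j]
   mult.left_commute[of "m _" "eps _"])
qed

lemma fbracket_fr: "fbracket (fr i) (fr j)=fscale 0 (fr i)"
 by(simp add:fbracket_def fscale_def fr_commute[of i j] fun_eq_iff)

lemma aform_expand: assumes "aform (Suc p) om" "th:LV" "xs:LL p"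
 shows "om (th # xs)=(SUM i:UNIV. eta i th * om (fr i # xs))"
proof -
 note D = aform_SucD[OF assms(1)]
 let ?f = "%S x. SUM i:S. eta i th * fr i x"
 have "?f S:LV & om (?f S # xs)=(SUM i:S. eta i th * om (fr i # xs))" if "finite S" for S using that
 proof(induction S rule:finite_induct)
  case empty
  have "?f {}=fscale 0 th" by(simp add:fscale_def)
  thus ?case using D(3)[OF assms(2,3), of 0] LV_fscale[OF assms(2)] by simp
 next
  case (insert i S)
  have "?f (insert i S)=fadd (fscale (eta i th) (fr i)) (?f S)" using insert by(simp add:fadd_def fscale_def)
  thus ?case using insert D(2,3) assms(3) fr_LV LV_fscale LV_fadd by simp
 qed
 from this[of UNIV] show ?thesis by(simp add:LV_expansion[OF assms(2), symmetric])
qed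

lemma LL_map_fr [simp]: "map fr is:LL p <-> length is = p" by(auto simp:LL_def fr_LV)

lemma aform_frame_eq_0: assumes "aform p om" "!!is. length is = p ==> om (map fr is)=0" "xs:LL p" shows "om xs=0"
 using assms
proof(induction p arbitrary: om xs)
 case 0
 thus ?case using "0.prems"(2)[of "[]"] by simp
next
 case (Suc p)
 obtain x ys where xs: "xs=x # ys" "x:LV" "ys:LL p" using Suc.prems(3) by(auto elim:LL_SucE)
 show ?case unfolding xs(1)
 proof(rule Suc.IH[OF _ _ xs(3)])
  show "aform p (%ys. om (x # ys))" by(rule aform_SucD(1)[OF Suc.prems(1) xs(2)])
  fix "is" :: "'d list" assume "length is = p"
  thus "om (x # map fr is)=0"
   using aform_expand[OF Suc.prems(1) xs(2), of "map fr is"] Suc.prems(2)[of "_ # is"] by simp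
 qed
qed

lemma aform_mset_eq_0: assumes "aform p om" "xs:LL p" "mset xs=mset ys" "om ys=0" shows "om xs=0" using assms
proof(induction xs arbitrary: p om ys)
 case (Cons x xs)
 obtain q where p: "p=Suc q" using Cons.prems(2) by(cases p) auto
 have "x:set ys" using Cons.prems(3) by(metis list.set_intros(1) mset_eq_setD)
 then obtain us vs where ys: "ys=us @ x # vs" by(auto simp:in_set_conv_decomp)
 have s: "set ys = set (x # xs)" "length ys=length (x # xs)"
  using Cons.prems(3) by(metis mset_eq_setD, metis mset_eq_length)
 have L: "us @ vs:LL q" using s ys Cons.prems(2) p unfolding LL_def by auto
 have x: "x:LV" "xs:LL q" using Cons.prems(2) p by auto
 have "(-1) ^ length us * om (x # us @ vs)=0"
  using aform_front[OF Cons.prems(1)[unfolded p] x(1) L] Cons.prems(4) ys by simp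
 hence "(-1) ^ length us * ((-1) ^ length us * om (x # us @ vs))=0" by simp
 hence "om (x # us @ vs)=0" by(simp add:mult.assoc[symmetric] power_add[symmetric])
 thus ?case
  using Cons.IH[OF aform_SucD(1)[OF Cons.prems(1)[unfolded p] x(1)] x(2), of "us @ vs"] Cons.prems(3) ys by simp
qed simp

lemma mset_eq_distinct: "distinct xs ==> distinct ys ==> set xs = set ys ==> mset xs=mset ys"
 by(simp add:set_eq_iff_mset_eq_distinct)

text \<open>With \<open>i0\<close> in front of \<open>rest\<close>, as in \<open>FL\<close>, wedging
  with dt/t from the left turns values on \<open>rest\<close> into values on \<open>FL\<close>
  without a sign.\<close>

definition rest :: "'d list" where "rest=filter (%i. i~=i0) enumeration"

abbreviation FL :: "'d list" where "FL == i0 # rest"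

lemma rest: "set rest=UNIV - {i0}" "distinct rest" using enumeration[where ?'d = 'd] by(auto simp:rest_def)
lemma length_FL: "length FL=CARD('d)" using distinct_card[of FL] rest by(simp add:insert_absorb)

lemma full_list: assumes "length is=CARD('d)" "distinct (is::'d list)" shows "mset is=mset FL"
proof(rule mset_eq_distinct)
 have "card (set is)=CARD('d)" using assms distinct_card by metis
 hence "set is=UNIV" by(simp add:card_eq_UNIV_imp_eq_UNIV)
 thus "set is = set FL" using rest by auto
qed (use assms rest in auto)

lemma top_form_eq_0: assumes "aform CARD('d) om" "om (map fr FL)=0" "xs:LL CARD('d)" shows "om xs=0"
proof(rule aform_frame_eq_0[OF assms(1) _ assms(3)])
 fix "is" :: "'d list" assume l: "length is=CARD('d)"
 show "om (map fr is)=0"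
 proof(cases "distinct is")
  case True
  hence "mset (map fr is)=mset (map fr FL)" using full_list[OF l] by simp
  thus ?thesis using aform_mset_eq_0[OF assms(1) _ _ assms(2)] l by simp
 next
  case False
  thus ?thesis using aform_not_distinct[OF assms(1), of "map fr is"] l by(auto simp:distinct_map)
 qed
qed

lemma ww_vanishing: "(!!th. th:set xs ==> xi th=0) ==> ww xs xi bt=0" by(induction xs arbitrary: bt) auto

lemma ww_eta_fr: "i ~: set is ==> ww (fr i # map fr is) (eta i) bt=bt (map fr is)"
proof -
 assume "i ~: set is"
 hence "ww (map fr is) (eta i) (%ys. bt (fr i # ys))=0" by(intro ww_vanishing) (auto simp:eta_fr)
 thus ?thesis by(simp add:eta_fr)
qed

text \<open>A form is determined by its values on distinct frame fields. Up to order
  \<open>rest\<close> is the only choice without \<open>fr i0\<close>, and on choices containing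
  \<open>fr i0\<close> the form agrees with dt/t wedged with its contraction by
  \<open>fr i0\<close>.\<close>

lemma form_vanishing_on_rest:
 assumes bt: "aform (Suc q) bt" "bt (map fr rest)=0" and q: "length rest=Suc q" and xs: "xs:LL (Suc q)"
 shows "bt xs=ww xs (eta i0) (%ys. bt (fr i0 # ys))"
proof -
 let ?dl = "%xs. bt xs - ww xs (eta i0) (%ys. bt (fr i0 # ys))"
 note D = aform_SucD[OF bt(1)]
 have dl: "aform (Suc q) ?dl" by(intro aform_diff bt(1) aform_ww linear_form_eta D(1) fr_LV)
 have "?dl xs=0"
 proof(rule aform_frame_eq_0[OF dl _ xs])
  fix "is" :: "'d list" assume l: "length is=Suc q"
  have front: "?dl (fr i0 # map fr js)=0" if js: "length js=q" for js
  proof(cases q)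
   case (Suc p)
   have "ww (map fr js) (eta i0) (%ys. bt (fr i0 # fr i0 # ys))=0"
    by(rule ww_zero[of _ p]) (use js Suc D(4) fr_LV in auto)
   thus ?thesis by(simp add:eta_fr)
  qed (insert js, simp add:eta_fr)
  consider "\<not> distinct is" | "distinct is" "i0:set is" | "distinct is" "i0 ~: set is" by blast
  thus "?dl (map fr is)=0"
  proof cases
   case 1
   thus ?thesis using aform_not_distinct[OF dl, of "map fr is"] l by(auto simp:distinct_map)
  next
   case 2
   hence "mset is=mset (i0 # remove1 i0 is)" by simp
   hence "mset (map fr is)=mset (fr i0 # map fr (remove1 i0 is))" by(metis list.simps(9) mset_map)
   thus ?thesis
    using aform_mset_eq_0[OF dl _ _ front[of "remove1 i0 is"], of "map fr is"] l 2 by(simp add:length_remove1)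
  next
   case 3
   have "set is=UNIV - {i0}"
    by(rule card_subset_eq) (use 3 l q rest distinct_card[of "is"] distinct_card[of rest] in auto)
   hence "mset is=mset rest" using rest 3 by(intro mset_eq_distinct) auto
   hence "mset (map fr is)=mset (map fr rest)" by simp
   hence "bt (map fr is)=0" by(rule aform_mset_eq_0[OF bt(1), rotated]) (use l bt in auto)
   moreover have "ww (map fr is) (eta i0) (%ys. bt (fr i0 # ys))=0" by(rule ww_vanishing) (insert 3, auto simp:eta_fr)
   ultimately show ?thesis by simp
  qed
 qed
 thus ?thesis by simp
qed

primrec vol :: "'d list=>('r=>'r) list=>'r" where
 "vol []=(%xs. 1)"
| "vol (i # is)=(%xs. ww xs (eta i) (vol is))"

lemma aform_vol: "length is = p ==> aform p (vol is)"
 by(induction "is" arbitrary: p) (auto intro:aform_ww linear_form_eta simp del:aform.simps(2))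

lemma vol_eq_1: "distinct is ==> vol is (map fr is)=1"
proof(induction "is")
 case (Cons i "is")
 thus ?case using ww_eta_fr[of i "is" "vol is"] by simp
qed simp

text \<open>The fields of the frame commute, so that only the first sum of Cartan's formula is left.\<close>

lemma dd_frame: assumes bt: "aform p bt" and l: "length is=Suc p"
 shows "dd (map fr is) bt=(SUM k<=p. (-1) ^ k * fr (is ! k) (bt (del_at k (map fr is))))"
proof -
 have "bt (fbracket (map fr is ! i) (map fr is ! j) # del_at i (del_at j (map fr is)))=0" if ij: "i < j" "j <= p" for i j
 proof -
  obtain q where p: "p=Suc q" using ij by(cases p) auto
  have l1: "length (del_at j (map fr is)) = p" "set (del_at j (map fr is))<=LV"
   using l ij length_del_at[of j "map fr is"] set_del_at[of j "map fr is"] fr_LV by auto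
  hence "del_at i (del_at j (map fr is)):LL q"
   using ij p length_del_at[of i "del_at j (map fr is)"] set_del_at[of i "del_at j (map fr is)"] by(auto simp:LL_def)
  thus ?thesis using aform_SucD(3)[OF bt[unfolded p] fr_LV, of _ 0] ij l by(simp add:fbracket_fr)
 qed
 hence "(SUM (i, j):{(i, j). i < j & j <= p}. (-1) ^ (i + j) * bt (fbracket (map fr is ! i) (map fr is ! j) # del_at
  i (del_at j (map fr is))))=0"
  by(intro sum.neutral) auto
 thus ?thesis using dd_sum[OF bt, of "map fr is"] l by simp
qed

definition vf :: "('r=>'r)=>('d, 'r) ops=>('d, 'r) ops" where
 "vf th X=(SUM i:UNIV. act (th (z i)) (der i X))"

lemma ev_sum: "ev (sum g S) x=(SUM i:S. ev (g i) x)" by(rule additive_sum) (rule ev_add)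

lemma ev_vf: "derivation th ==> ev (vf th X) x=th (ev X x)"
 by(simp add:vf_def ev_sum ev_act ev_der derivation_eq'[of th "ev X x"])

lemma ev_eqI: "(!!x. ev X x=ev Y x) ==> X=Y" using ev_eq_0[of "X - Y"] by(simp add:ev_diff)
lemma vf_add: "vf th (X + Y) = vf th X + vf th Y" by(simp add:vf_def der_add act_add sum.distrib)

lemmas vf_0 = additive_zero[of "vf th" for th, OF vf_add]
lemmas vf_minus = additive_minus[of "vf th" for th, OF vf_add]
lemmas vf_diff = additive_diff[of "vf th" for th, OF vf_add]
lemmas vf_sum = additive_sum[of "vf th" for th, OF vf_add]

lemma vf_act: "derivation th ==> vf th (act a X)=act a (vf th X) + act (th a) X"
 by(rule ev_eqI) (simp add:ev_vf ev_act ev_add derivation_mult algebra_simps)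

lemma vf_fr_commute: "vf (fr i) (vf (fr j) X) = vf (fr j) (vf (fr i) X)"
 by(rule ev_eqI) (simp add:ev_vf derivation_fr fr_commute[of i j])

lemma vf_lincomb:
 fixes g :: "'b=>'r" shows "vf (%x. SUM j:J. g j * th j x) X=(SUM j:J. act (g j) (vf (th j) X))"
proof -
 have a: "act (SUM j:J. h j) Y=(SUM j:J. act (h j) Y)" for h :: "'b=>'r" and Y :: "('d, 'r) ops"
  by(rule additive_sum[of "%g. act g Y"]) (rule act_add_left)
 show ?thesis unfolding vf_def a act_sum act_act by(rule sum.swap)
qed

lemma conn_frame:
 fixes J :: "nat set" assumes bt: "aform p bt" and l: "length is=Suc p"
  and fr: "!!i x. i:set is ==> fr i x=(SUM j:J. xi j (fr i) * E j x)"
 shows "act (dd (map fr is) bt) X + (SUM j:J. act (ww (map fr is) (xi j) bt) (vf (E j) X))=(SUM k<=p. act ((-1) ^ k)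
  (vf (fr (is ! k)) (act (bt (del_at k (map fr is))) X)))"
proof -
 have a: "act (SUM j:J. h j) Y=(SUM j:J. act (h j) Y)" for J :: "nat set" and h :: "nat=>'r" and Y :: "('d, 'r) ops"
  by(rule additive_sum[of "%g. act g Y"]) (rule act_add_left)
 let ?g = "%k. bt (del_at k (map fr is))"
 have f: "vf (fr (is ! k)) X=(SUM j:J. act (xi j (fr (is ! k))) (vf (E j) X))" if "k <= p" for k
 proof -
  have "fr (is ! k)=(%x. SUM j:J. xi j (fr (is ! k)) * E j x)" using fr[of "is ! k"] l that by auto
  thus ?thesis using vf_lincomb[where J = J and g = "%j. xi j (fr (is ! k))" and th = E and X = X] by metis
 qed
 have "(SUM j:J. act (ww (map fr is) (xi j) bt) (vf (E j) X))=(SUM j:J. SUM k<=p. act ((-1) ^ k) (act (?g k) (act (xi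
  j (fr (is ! k))) (vf (E j) X))))"
  using l by(simp add:ww_sum[of _ p] a act_act mult.assoc mult.commute[of "?g _"])
 also have "... = (SUM k<=p. act ((-1) ^ k) (act (?g k) (vf (fr (is ! k)) X)))"
  by(subst sum.swap) (simp add:f act_sum)
 finally show ?thesis unfolding dd_frame[OF bt l] a
  by(simp add:vf_act derivation_fr act_add act_act[symmetric] sum.distrib)
qed

end

subsection \<open>Tensor products with a cyclic module\<close>

lemma generate_subgrp:
 fixes A :: "('k \<Rightarrow>\<^sub>0 int) set"
 assumes "B <= carrier (free_Abelian_group A')" shows "subgrp (generate (free_Abelian_group A') B)"
proof(rule subgrpI)
 let ?G = "free_Abelian_group A'"
 interpret G: Group.group ?G by simp
 show "0:generate ?G B" using generate.one[of ?G B] by simp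
 have sub: "subgroup (generate ?G B) ?G" by(rule G.generate_is_subgroup[OF assms])
 fix x y assume xy: "x:generate ?G B" "y:generate ?G B"
 hence y: "supp y<=A'" using subgroup.mem_carrier[OF sub] by simp
 hence "- y:generate ?G B" using subgroup.m_inv_closed[OF sub xy(2)] by simp
 from subgroup.m_closed[OF sub xy(1) this] show "x - y:generate ?G B" by simp
qed

lemma generate_subset_subgrp: assumes "subgrp C" "B <= carrier (free_Abelian_group A')" "B<=C"
 shows "generate (free_Abelian_group A') B<=C"
proof
 fix x assume "x:generate (free_Abelian_group A') B"
 thus "x:C"
 proof induction
  case one thus ?case using subgrp_0[OF assms(1)] by simp
 next
  case (inv h)
  hence "h:C" "h:carrier (free_Abelian_group A')" using assms by blast+
  thus ?case using subgrp_minus[OF assms(1)] by simp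
 next
  case (eng h1 h2) thus ?case using subgrp_add[OF assms(1)] by simp
 qed (use assms in auto)
qed

lemma keys_frag_extend_subset: assumes "supp u<=A" "!!x. x:A ==> supp (f x)<=B" shows "supp (frag_extend f u)<=B"
 using keys_frag_extend[of f u] assms by blast

text \<open>Tensor product over \<open>R\<close> of the cyclic module \<open>R / a0\<close> with a module \<open>W\<close>, which is \<open>W / a0 W\<close>.\<close>

locale cyclic_tensor =
 fixes R :: "('s, 'z) ring_scheme" and ga :: "'r::comm_ring_1=>'s"
  and V :: "('s, 'v) module" and ups :: "'r=>'v" and W :: "('s, 'w) module" and dl :: "'k::ab_group_add=>'w"
  and ac :: "'r=>'k=>'k" and a0 :: 'r assumes R: "carrier R=range ga"
  and V: "carrier V=range ups" "ups x \<oplus>\<^bsub>V\<^esub> ups y=ups (x + y)" "ga a \<odot>\<^bsub>V\<^esub> ups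
   x=ups (a * x)"
  and V_eq: "ups x=ups y <-> a0 dvd x - y"
  and W: "carrier W=range dl" "dl X \<oplus>\<^bsub>W\<^esub> dl Y=dl (X + Y)" "ga a \<odot>\<^bsub>W\<^esub> dl X=dl
   (ac a X)"
  and W_inj: "inj dl" and ac_add: "ac a (X + Y)=ac a X + ac a Y" and ac_add_left: "ac (a + b) X=ac a X + ac b X"
  and ac_mult: "ac a (ac b X)=ac (a * b) X" and ac_1: "ac 1 X=X"
begin

lemmas ac_0 = additive_zero[of "ac a" for a, OF ac_add]
lemmas ac_diff = additive_diff[of "ac a" for a, OF ac_add]
lemmas ac_0_left = additive_zero[of "%a. ac a X" for X, OF ac_add_left]
lemmas ac_diff_left = additive_diff[of "%a. ac a X" for X, OF ac_add_left]

definition val :: "'v=>'r" where "val v=(SOME a. ups a = v)"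

lemma val: "v:carrier V ==> ups (val v) = v" unfolding val_def V(1) by(rule someI_ex) auto
lemma val_ups: "a0 dvd val (ups a) - a" using val[of "ups a"] V(1) V_eq by auto

text \<open>On formal sums, \<open>v \<otimes> w\<close> is sent to \<open>val v\<close> times
  \<open>w\<close>. The representative \<open>val v\<close> is only determined up to multiples of
  \<open>a0\<close>, so this is inverse to \<open>ta\<close> modulo \<open>Z\<close>.\<close>

definition fs :: "('v \<times> 'w \<Rightarrow>\<^sub>0 int)=>'k" where
 "fs=lin (%(v, w) k. ac (of_int k * val v) (inv_into UNIV dl w))"

lemma fs_add: "fs (u + u')=fs u + fs u'" unfolding fs_def by(rule lin_add) (auto simp:algebra_simps ac_add_left)

lemmas fs_0 = additive_zero[of fs, OF fs_add]
lemmas fs_diff = additive_diff[of fs, OF fs_add]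
lemma fs_frag_of: "fs (frag_of (v, w))=ac (val v) (inv_into UNIV dl w)"
 unfolding fs_def by(subst lin_single) (auto simp:ac_0_left)

definition Z :: "'k set" where "Z=range (ac a0)"

lemma Z: "subgrp Z"
proof(rule subgrpI)
 show "0:Z" using ac_0[of a0] by(auto simp:Z_def intro:range_eqI[of _ _ 0])
 fix x y assume "x:Z" "y:Z"
 thus "x - y:Z" by(auto simp:Z_def ac_diff[symmetric])
qed

lemma Z_ac: "X:Z ==> ac a X:Z" by(auto simp:Z_def ac_mult mult.commute[of a]) (metis ac_mult rangeI)
lemma dvd_Z: "a0 dvd a ==> ac a X:Z" by(auto simp:Z_def dvd_def ac_mult[symmetric])

lemma fs_frag_of_Z: "fs (frag_of (ups a, dl X)) - ac a X:Z"
 by(simp add:fs_frag_of W_inj ac_diff_left[symmetric] dvd_Z val_ups)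

abbreviation "G == tensor_free V W"
abbreviation "rr == tensor_relations R V W"

lemma carrier_G: "u:carrier G <-> supp u <= carrier V \<times> carrier W" by(simp add:tensor_free_def)

definition gens :: "('v \<times> 'w \<Rightarrow>\<^sub>0 int) set" where
 "gens={frag_of (v \<oplus>\<^bsub>V\<^esub> v', w) - frag_of (v, w) - frag_of (v', w) | v v' w. v:carrier V &
  v':carrier V & w:carrier W} Un {frag_of (v, w \<oplus>\<^bsub>W\<^esub> w') - frag_of (v, w) - frag_of (v, w') | v
  w w'. v:carrier V & w:carrier W & w':carrier W} Un {frag_of (r \<odot>\<^bsub>V\<^esub> v, w) - frag_of (v, r
  \<odot>\<^bsub>W\<^esub> w) | r v w. r:carrier R & v:carrier V & w:carrier W}"

lemma rr_eq: "rr=generate G gens" by(simp add:tensor_relations_def gens_def)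

lemma gens_cases: assumes "u:gens"
 obtains x y X where "u=frag_of (ups (x + y), dl X) - frag_of (ups x, dl X) - frag_of (ups y, dl X)"
 | x X Y where "u=frag_of (ups x, dl (X + Y)) - frag_of (ups x, dl X) - frag_of (ups x, dl Y)"
 | a x X where "u=frag_of (ups (a * x), dl X) - frag_of (ups x, dl (ac a X))"
 using assms unfolding gens_def by(elim UnE CollectE exE conjE) (auto simp:V W R)

lemma keys_diff_subset: "supp u<=A ==> supp u'<=A ==> supp (u - u')<=A"
 for u u' :: "'b \<Rightarrow>\<^sub>0 int" using keys_diff[of u u'] by blast

lemma gens_carrier: "gens <= carrier G"
proof
 fix u assume "u:gens"
 thus "u:carrier G" unfolding carrier_G
  by(cases rule:gens_cases; hypsubst; intro keys_diff_subset; simp add:V(1) W(1))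
qed

lemma rr: "subgrp rr" unfolding rr_eq tensor_free_def
 by(rule generate_subgrp) (rule gens_carrier[unfolded tensor_free_def])

lemma rr_carrier: "rr <= carrier G"
proof -
 interpret G: Group.group G by(simp add:tensor_free_def)
 show ?thesis unfolding rr_eq by(rule G.generate_incl) (rule gens_carrier)
qed

lemma rr_I: "frag_of (ups (x + y), dl X) - frag_of (ups x, dl X) - frag_of (ups y, dl X):rr"
 "frag_of (ups x, dl (X + Y)) - frag_of (ups x, dl X) - frag_of (ups x, dl Y):rr"
 "frag_of (ups (a * x), dl X) - frag_of (ups x, dl (ac a X)):rr"
proof -
 show "frag_of (ups (x + y), dl X) - frag_of (ups x, dl X) - frag_of (ups y, dl X):rr"
  unfolding V(2)[symmetric] rr_eq gens_def
  by(rule generate.incl, rule UnI1, rule UnI1, rule CollectI, rule exI[of _ "ups x"], rule exI[of _ "ups y"],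
    rule exI[of _ "dl X"]) (simp add:V(1) W(1))
 show "frag_of (ups x, dl (X + Y)) - frag_of (ups x, dl X) - frag_of (ups x, dl Y):rr"
  unfolding W(2)[symmetric] rr_eq gens_def
  by(rule generate.incl, rule UnI1, rule UnI2, rule CollectI, rule exI[of _ "ups x"], rule exI[of _ "dl X"],
    rule exI[of _ "dl Y"]) (simp add:V(1) W(1))
 show "frag_of (ups (a * x), dl X) - frag_of (ups x, dl (ac a X)):rr"
  unfolding V(3)[symmetric] W(3)[symmetric] rr_eq gens_def
  by(rule generate.incl, rule UnI2, rule CollectI, rule exI[of _ "ga a"], rule exI[of _ "ups x"],
    rule exI[of _ "dl X"]) (simp add:V(1) W(1) R)
qed

lemma fs_rr: "rr<={u. fs u:Z}" unfolding rr_eq tensor_free_def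
proof(rule generate_subset_subgrp)
 show "subgrp {u. fs u:Z}" using Z by(auto simp:subgrp_def fs_diff fs_0)
next
 let ?B = "%x X. fs (frag_of (ups x, dl X)) - ac x X"
 have 1: "fs (frag_of (ups (x + y), dl X) - frag_of (ups x, dl X) - frag_of (ups y, dl X)):Z" for x y X
  using subgrp_diff[OF Z subgrp_diff[OF Z fs_frag_of_Z[of "x + y" X] fs_frag_of_Z[of x X]] fs_frag_of_Z[of y X]]
  by(simp add:fs_diff fs_add ac_add_left algebra_simps)
 have 2: "fs (frag_of (ups x, dl (X + Y)) - frag_of (ups x, dl X) - frag_of (ups x, dl Y)):Z" for x X Y
  using subgrp_diff[OF Z subgrp_diff[OF Z fs_frag_of_Z[of x "X + Y"] fs_frag_of_Z[of x X]] fs_frag_of_Z[of x Y]]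
  by(simp add:fs_diff fs_add ac_add algebra_simps)
 have 3: "fs (frag_of (ups (a * x), dl X) - frag_of (ups x, dl (ac a X))):Z" for a x X
  using subgrp_diff[OF Z fs_frag_of_Z[of "a * x" X] fs_frag_of_Z[of x "ac a X"]]
  by(simp add:fs_diff ac_mult mult.commute[of x a])
 show "gens<={u. fs u:Z}"
 proof
  fix u assume "u:gens"
  thus "u:{u. fs u:Z}" by(cases rule:gens_cases) (use 1 2 3 in blast)+
 qed
qed (rule gens_carrier[unfolded tensor_free_def])

lemma frag_of_rr: "frag_of (ups a, dl X) - frag_of (ups 1, dl (ac a X)):rr" using rr_I(3)[of a 1 X] by simp

lemma Z_rr: assumes "X:Z" shows "frag_of (ups 1, dl X):rr"
proof -
 obtain Y where Y: "X=ac a0 Y" using assms by(auto simp:Z_def)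
 have "ups a0=ups 0" by(simp add:V_eq)
 hence 1: "frag_of (ups 0, dl Y) - frag_of (ups 1, dl X):rr" using frag_of_rr[of a0 Y] Y by simp
 have "- frag_of (ups 0, dl Y):rr" using rr_I(1)[of 0 0 Y] by simp
 from subgrp_minus[OF rr subgrp_add[OF rr this 1]] show ?thesis by simp
qed

lemma canonical: "u:carrier G ==> u - frag_of (ups 1, dl (fs u)):rr" unfolding carrier_G
proof(induction u rule:frag_induction)
 case zero
 show ?case using Z_rr[of 0] subgrp_0[OF Z] subgrp_minus[OF rr] by(simp add:fs_0)
next
 case (one x)
 then obtain v X where x: "x=(v, dl X)" "v:carrier V" by(auto simp:W)
 show ?case using frag_of_rr[of "val v" X] x by(simp add:val fs_frag_of W_inj)
next
 case (diff a b)
 have "frag_of (ups 1, dl (fs a)) - frag_of (ups 1, dl (fs (a - b))) - frag_of (ups 1, dl (fs b)):rr"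
  using rr_I(2)[of 1 "fs (a - b)" "fs b"] by(simp add:fs_diff)
 from subgrp_add[OF rr subgrp_diff[OF rr diff] this] show ?case by(simp add:algebra_simps)
qed

definition ta :: "'k=>('v \<times> 'w \<Rightarrow>\<^sub>0 int) set" where "ta X=tensor_class R V W (frag_of (ups 1, dl X))"

lemma class_eq: "tensor_class R V W u={x. x - u:rr}" unfolding tensor_class_def r_coset_def tensor_free_def
 by(auto intro:bexI[of _ "_ - u"])

lemma class_eq_iff: "tensor_class R V W u=tensor_class R V W u' <-> u - u':rr"
proof
 assume "tensor_class R V W u=tensor_class R V W u'"
 moreover have "u:tensor_class R V W u" using subgrp_0[OF rr] by(simp add:class_eq)
 ultimately show "u - u':rr" by(simp add:class_eq)
next
 assume *: "u - u':rr"
 show "tensor_class R V W u=tensor_class R V W u'"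
  unfolding class_eq using subgrp_diff_cong[OF rr, of x x u u' for x] * subgrp_0[OF rr] by auto
qed

lemma tensor_class_eq_ta: "u:carrier G ==> tensor_class R V W u=ta (fs u)"
 unfolding ta_def class_eq_iff by(rule canonical)

lemma ta_eq_iff: "ta X=ta Y <-> X - Y:Z"
proof
 assume "ta X=ta Y"
 hence "fs (frag_of (ups 1, dl X) - frag_of (ups 1, dl Y)):Z" unfolding ta_def class_eq_iff using fs_rr by blast
 from subgrp_add[OF Z subgrp_diff[OF Z this fs_frag_of_Z[of 1 X]] fs_frag_of_Z[of 1 Y]]
 show "X - Y:Z" using subgrp_minus[OF Z, of "Y - X"] by(simp add:fs_diff ac_1)
next
 assume "X - Y:Z"
 hence "frag_of (ups 1, dl (X - Y)):rr" by(rule Z_rr)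
 from subgrp_add[OF rr this rr_I(2)[of 1 "X - Y" Y]] show "ta X=ta Y" by(simp add:ta_def class_eq_iff)
qed

lemma frag_of_carrier: "frag_of (ups a, dl X):carrier G" by(simp add:carrier_G V W)

lemma carrier_tensor: "carrier (tensor_product R V W)=range ta"
proof(intro equalityI subsetI)
 fix C assume "C:carrier (tensor_product R V W)"
 then obtain u where "u:carrier G" "C=tensor_class R V W u" by(auto simp:tensor_product_def)
 thus "C:range ta" by(simp add:tensor_class_eq_ta)
next
 fix C assume "C:range ta"
 then obtain X where "C=tensor_class R V W (frag_of (ups 1, dl X))" by(auto simp:ta_def)
 thus "C:carrier (tensor_product R V W)" by(simp add:tensor_product_def frag_of_carrier)
qed

lemma carrier_G_diff: "u:carrier G ==> u':carrier G ==> u - u':carrier G"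
 unfolding carrier_G by(rule keys_diff_subset)

lemma mem_ta: "u:ta X <-> u:carrier G & fs u - X:Z"
proof
 assume u: "u:ta X"
 hence r: "u - frag_of (ups 1, dl X):rr" by(simp add:ta_def class_eq)
 hence "u - frag_of (ups 1, dl X):carrier G" using rr_carrier by blast
 from carrier_G_diff[OF this carrier_G_diff[OF _ frag_of_carrier[of 1 X], of 0]]
 have uG: "u:carrier G" by(simp add:carrier_G)
 have "ta (fs u)=ta X" unfolding tensor_class_eq_ta[OF uG, symmetric] using r by(simp add:ta_def class_eq_iff)
 thus "u:carrier G & fs u - X:Z" using uG by(simp add:ta_eq_iff)
next
 assume *: "u:carrier G & fs u - X:Z"
 hence "tensor_class R V W u=ta X" using tensor_class_eq_ta ta_eq_iff by metis
 moreover have "u:tensor_class R V W u" using subgrp_0[OF rr] by(simp add:class_eq)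
 ultimately show "u:ta X" by simp
qed

lemma presented_tensor: "presented (tensor_product R V W) ta (%s. ac (inv_into UNIV ga s)) UNIV (carrier R)"
proof
 show "subgrp (UNIV::'k set)" by(simp add:subgrp_def)
 show "carrier (tensor_product R V W)=ta ` UNIV" by(rule carrier_tensor)
 show "\<zero>\<^bsub>tensor_product R V W\<^esub>=ta 0"
  using tensor_class_eq_ta[of 0] by(simp add:tensor_product_def fs_0 carrier_G)
next
 fix X Y :: 'k
 have "ta X <#>\<^bsub>G\<^esub> ta Y=ta (X + Y)"
 proof(intro equalityI subsetI)
  fix u assume "u:ta X <#>\<^bsub>G\<^esub> ta Y"
  then obtain a b where ab: "a:ta X" "b:ta Y" "u=a + b" by(auto simp:set_mult_def tensor_free_def)
  have "a + b:carrier G" using ab keys_add[of a b] by(auto simp:mem_ta carrier_G)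
  thus "u:ta (X + Y)" using ab subgrp_add[OF Z, of "fs a - X" "fs b - Y"] by(simp add:mem_ta fs_add algebra_simps)
 next
  fix u assume u: "u:ta (X + Y)"
  let ?b = "frag_of (ups 1, dl Y)"
  have b: "?b:ta Y" by(simp add:ta_def class_eq subgrp_0[OF rr])
  hence "u - ?b:ta X" using u carrier_G_diff subgrp_diff[OF Z, of "fs u - (X + Y)" "fs ?b - Y"]
   by(simp add:mem_ta fs_diff algebra_simps)
  hence "(u - ?b) \<otimes>\<^bsub>G\<^esub> ?b:ta X <#>\<^bsub>G\<^esub> ta Y" using b by(auto simp:set_mult_def)
  thus "u:ta X <#>\<^bsub>G\<^esub> ta Y" by(simp add:tensor_free_def)
 qed
 thus "ta X \<oplus>\<^bsub>tensor_product R V W\<^esub> ta Y=ta (X + Y)" by(simp add:tensor_product_def)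
next
 fix k X assume "k:carrier R"
 define a where "a=inv_into UNIV ga k"
 have k: "k=ga a" using `k : carrier R` by(simp add:a_def R f_inv_into_f)
 let ?s = "frag_extend (%(v, w). frag_of (k \<odot>\<^bsub>V\<^esub> v, w))"
 have s: "?s u:carrier G & fs (?s u) - ac a (fs u):Z" if "u:carrier G" for u using that unfolding carrier_G
 proof(induction u rule:frag_induction)
  case zero
  show ?case using subgrp_0[OF Z] by(simp add:fs_0 ac_0)
 next
  case (one x)
  then obtain v X where x: "x=(v, dl X)" "v:carrier V" by(auto simp:W)
  have v: "v=ups (val v)" using x val by simp
  have "k \<odot>\<^bsub>V\<^esub> v=ups (a * val v)" by(subst v) (simp add:k V)
  thus ?case using fs_frag_of_Z[of "a * val v" X] x by(simp add:fs_frag_of[of v] W_inj ac_mult V W)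
 next
  case (diff u w)
  hence "fs (?s (u - w)) - ac a (fs (u - w)):Z"
   using subgrp_diff[OF Z, of "fs (?s u) - ac a (fs u)" "fs (?s w) - ac a (fs w)"]
   by(simp add:frag_extend_diff fs_diff ac_diff algebra_simps)
  thus ?case using diff keys_diff[of "?s u" "?s w"] by(auto simp:frag_extend_diff)
 qed
 have "tensor_class R V W (?s u)=ta (ac a X)" if "u:ta X" for u
 proof -
  have "fs (?s u) - ac a X:Z"
   using subgrp_add[OF Z, of "fs (?s u) - ac a (fs u)" "ac a (fs u - X)"] s[of u] that Z_ac[of "fs u - X" a]
   by(simp add:mem_ta ac_diff)
  thus ?thesis using tensor_class_eq_ta[of "?s u"] s[of u] that by(simp add:mem_ta ta_eq_iff)
 qed
 moreover have "frag_of (ups 1, dl X):ta X" by(simp add:ta_def class_eq subgrp_0[OF rr])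
 ultimately have "(UN u:ta X. tensor_class R V W (?s u))=ta (ac a X)" by blast
 thus "k \<odot>\<^bsub>tensor_product R V W\<^esub> ta X=ta (ac (inv_into UNIV ga k) X)"
  by(simp add:tensor_product_def a_def)
qed simp

end

subsection \<open>The stalks in coordinates\<close>

text \<open>\<open>ga\<close> transports the ring \<open>R\<close> on a carrier set to a type of
  class \<open>comm_ring_1\<close>, where the algebra takes place. \<open>log_I\<close> describes
  the logarithmic fields by their values on the coordinates.\<close>

locale log_model = germ_family R \<kappa> I tt n + log_frame z pd rho cst m eps i0 t
 for R :: "'s ring" (structure) and \<kappa> I tt n
  and z :: "'d::finite=>'r::comm_ring_1" and pd rho :: "'d=>'r=>'r" and cst :: "complex=>'r" and m eps i0 t +
 fixes ga :: "'r=>'s" assumes inj_ga: "inj ga" and carrier_R: "carrier R=range ga"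
  and mult_ga: "ga x \<otimes> ga y=ga (x * y)" and add_ga: "ga x \<oplus> ga y=ga (x + y)"
  and one_ga: "\<one>=ga 1" and zero_ga: "\<zero>=ga 0" and \<kappa>_ga: "\<kappa> c=ga (cst c)" and tt_ga: "tt=ga t"
  and I_carrier: "I<=range ga"
  and log_I: "derivation th ==> (ALL x. ga x:I --> ga (th x):I) <-> (ALL i. m i dvd th (z i))"
  and card_d: "CARD('d)=n + 1"
begin

definition gi :: "'s=>'r" where "gi=inv_into UNIV ga"

lemma gi_ga [simp]: "gi (ga x)=x" by(simp add:gi_def inj_ga)
lemma ga_gi: "s:carrier R ==> ga (gi s) = s" by(auto simp:carrier_R)
lemma ga_eq [simp]: "ga x=ga y <-> x=y" using inj_ga by(auto dest:injD)
lemma ga_carrier [simp]: "ga x:carrier R" by(simp add:carrier_R)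

lemma cring_R: "cring R"
proof(rule cringI)
 show "abelian_group R"
 proof(rule abelian_groupI)
  fix x assume "x:carrier R"
  then obtain a where "x=ga a" by(auto simp:carrier_R)
  thus "EX y:carrier R. y \<oplus> x=\<zero>" by(intro bexI[of _ "ga (- a)"]) (auto simp:add_ga zero_ga)
 qed (auto simp:carrier_R add_ga zero_ga add_ac)
 show "comm_monoid R" by(rule comm_monoidI) (auto simp:carrier_R mult_ga one_ga mult_ac)
qed (auto simp:carrier_R mult_ga add_ga algebra_simps)

sublocale R: cring R by(rule cring_R)

lemma a_inv_ga: "\<ominus> ga x=ga (- x)" by(rule R.minus_equality) (auto simp:add_ga zero_ga)
lemma minus_ga: "ga x \<ominus> ga y=ga (x - y)" by(simp add:a_minus_def a_inv_ga add_ga)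
lemma pow_ga: "ga x [^] (k::nat)=ga (x ^ k)" by(induction k) (simp_all add:one_ga mult_ga mult.commute)
lemma sign_ga: "sign i=ga ((-1) ^ i)" by(simp add:sign_def one_ga a_inv_ga pow_ga)

lemma finsum_ga: "finite A ==> (!!i. i:A ==> f i=ga (g i)) ==> (\<Oplus>i\<in>A. f i)=ga (sum g A)"
proof(induction A rule:finite_induct)
 case (insert x A)
 thus ?case by(simp add:Pi_def add_ga)
qed (simp add:zero_ga)

definition up :: "('r=>'r)=>'s=>'s" where "up th=(\<lambda>s\<in>carrier R. ga (th (gi s)))"
definition dn :: "('s=>'s)=>'r=>'r" where "dn P=(%x. gi (P (ga x)))"

lemma up_apply [simp]: "up th (ga x)=ga (th x)" by(simp add:up_def)
lemma dn_up [simp]: "dn (up th)=th" by(simp add:dn_def)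
lemma up_eq [simp]: "up th=up et <-> th=et" using dn_up by metis
lemma up_mem: "up th:carrier R \<rightarrow>\<^sub>E carrier R" by(auto simp:up_def)

lemma up_eqI: assumes "P:extensional (carrier R)" "!!x. P (ga x)=ga (th x)" shows "P=up th"
proof
 fix s show "P s=up th s" using assms by(cases "s:carrier R") (auto simp:carrier_R extensional_def up_def)
qed

lemma up_dn: assumes "P:carrier R \<rightarrow>\<^sub>E carrier R" shows "up (dn P)=P"
proof(rule up_eqI[symmetric])
 show "P:extensional (carrier R)" using assms by(simp add:PiE_def)
 fix x
 have "P (ga x):carrier R" using assms ga_carrier by(rule PiE_mem)
 thus "P (ga x)=ga (dn P x)" by(simp add:dn_def ga_gi)
qed

lemma op_add_up: "op_add (up P) (up Q)=up (fadd P Q)" by(rule up_eqI) (auto simp:op_add_def add_ga fadd_def)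

lemma op_smult_up: "op_smult (ga a) (up P)=up (fscale a P)"
 by(rule up_eqI) (auto simp:op_smult_def mult_ga fscale_def)

lemma op_comp_up: "op_comp (up P) (up Q)=up (%x. P (Q x))" by(rule up_eqI) (auto simp:op_comp_def compose_def)

lemma bracket_up: "bracket (up P) (up Q)=up (fbracket P Q)"
 by(rule up_eqI) (auto simp:bracket_def minus_ga fbracket_def)

lemma up_vector_field: "up th:vector_fields <-> derivation th" using up_mem[of th]
 by(auto simp:vector_fields_def derivation_def carrier_R add_ga mult_ga \<kappa>_ga zero_ga)

lemma vector_fields_eq: "vector_fields=up ` Collect derivation"
proof(intro equalityI subsetI)
 fix P assume P: "P:vector_fields"
 hence "up (dn P)=P" by(intro up_dn) (auto simp:vector_fields_def)
 thus "P:up ` Collect derivation" using P up_vector_field[of "dn P"] by(intro image_eqI[of _ _ "dn P"]) auto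
qed (auto simp:up_vector_field)

lemma log_vector_fields_eq: "log_vector_fields=up ` LV"
proof -
 have "up th ` I<=I <-> (ALL x. ga x:I --> ga (th x):I)" for th
  using I_carrier by(auto simp:image_subset_iff subset_iff)
 thus ?thesis unfolding log_vector_fields_def vector_fields_eq LV_def using log_I by auto
qed

lemma up_LV: "up th:log_vector_fields <-> th:LV" by(auto simp:log_vector_fields_eq)

lemma log_lists_eq: "log_lists p=map up ` LL p"
proof(intro equalityI subsetI)
 fix xs assume xs: "xs:log_lists p"
 hence "map up (map dn xs)=xs" by(auto simp:log_lists_def log_vector_fields_eq intro!:map_idI)
 moreover have "map dn xs:LL p" using xs by(auto simp:log_lists_def log_vector_fields_eq LL_def)
 ultimately show "xs:map up ` LL p" by(intro image_eqI[of _ _ "map dn xs"]) auto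
qed (auto simp:log_lists_def LL_def up_LV subset_iff)

lemma map_up_log_lists [simp]: "map up xs:log_lists p <-> xs:LL p"
 by(auto simp:log_lists_eq image_iff inj_map_eq_map[of up] inj_def)

lemma map_dn_up [simp]: "map dn (map up xs)=xs" by(simp add:map_idI)

definition dl :: "('d, 'r) ops=>'s=>'s" where "dl X=up (ev X)"

lemma inj_dl: "inj dl" by(rule injI) (auto simp:dl_def intro!:ev_eqI)
lemma dl_add: "op_add (dl X) (dl Y)=dl (X + Y)" by(simp add:dl_def op_add_up) (simp add:fadd_def ev_add fun_eq_iff)

lemma dl_act: "op_smult (ga a) (dl X)=dl (act a X)"
 by(simp add:dl_def op_smult_up) (simp add:fscale_def ev_act fun_eq_iff)

lemma dl_vf: "derivation th ==> op_comp (up th) (dl X)=dl (vf th X)"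
 by(simp add:dl_def op_comp_up) (simp add:ev_vf fun_eq_iff)

lemma vf_filt: assumes "X:filt k" shows "vf th X:filt (k + 1)" unfolding vf_def
proof(rule filt_sum)
 fix i
 show "act (th (z i)) (der i X):filt (k + 1)" using assms
  by(induction rule:filt_induct) (auto simp:filt_0 der_0 act_0 der_add act_add filt_add intro!:filt_add filt_single)
qed

lemma act_filt: "X:filt k ==> act a X:filt k"
 by(induction rule:filt_induct) (auto simp:filt_0 act_0 act_add filt_add filt_single)

lemma diff_op_mono: "diff_op l P ==> l<=l' ==> diff_op l' P"
proof(induction arbitrary: l' rule:diff_op.induct)
 case (comp th l P)
 then obtain k where "l'=Suc k" "l<=k" by(cases l') auto
 thus ?case using comp diff_op.comp by simp
qed (auto intro:diff_op.intros)

lemma mult_dl: "(\<lambda>x\<in>carrier R. ga a \<otimes> x)=dl (mono1 (%_. 0) a)"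
 unfolding dl_def by(rule up_eqI) (auto simp:mult_ga)

lemma diff_op_dl: "diff_op l P ==> P:dl ` filt (int l)"
proof(induction rule:diff_op.induct)
 case (mult a l)
 then obtain b where "a=ga b" by(auto simp:carrier_R)
 thus ?case by(auto simp:mult_dl intro!:imageI filt_single)
next
 case (comp th l P)
 then obtain th' X where "th=up th'" "derivation th'" "P=dl X" "X:filt (int l)" by(auto simp:vector_fields_eq)
 thus ?case using vf_filt[of X "int l" th'] by(auto simp:dl_vf add.commute)
next
 case (add l P Q)
 thus ?case by(auto simp:dl_add intro!:imageI filt_add)
qed

text \<open>\<open>diff_op\<close> composes with vector fields on the left, so a function in front
  is absorbed into the leftmost field.\<close>

lemma diff_op_smult: "diff_op l P ==> diff_op l (op_smult (ga a) P)"
proof(induction rule:diff_op.induct)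
 case (mult b l)
 then obtain c where "b=ga c" by(auto simp:carrier_R)
 hence *: "op_smult (ga a) (\<lambda>x\<in>carrier R. b \<otimes> x)=(\<lambda>x\<in>carrier R. ga (a * c) \<otimes> x)"
  by(simp add:mult_dl dl_act)
 show ?case unfolding * by(rule diff_op.mult) (rule ga_carrier)
next
 case (comp th l P)
 then obtain th' X where *: "th=up th'" "derivation th'" "P=dl X"
  using diff_op_dl[OF comp(2)] by(auto simp:vector_fields_eq)
 have "op_smult (ga a) (op_comp th P) = op_comp (up (fscale a th')) P"
  by(simp add:* dl_def op_comp_up op_smult_up) (simp add:fscale_def)
 moreover have "derivation (fscale a th')" using * by(auto simp:derivation_def fscale_def algebra_simps)
 ultimately show ?case using comp diff_op.comp up_vector_field by simp
next
 case (add l P Q)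
 then obtain X Y where *: "P=dl X" "Q=dl Y" using diff_op_dl[OF add(1)] diff_op_dl[OF add(2)] by blast
 have "op_smult (ga a) (op_add P Q) = op_add (op_smult (ga a) P) (op_smult (ga a) Q)"
  by(simp add:* dl_add dl_act act_add)
 thus ?case using add diff_op.add by simp
qed

lemma derivation_pd: "derivation (pd i)" by(simp add:derivation_def pd_add pd_mult pd_cst)
lemma vf_pd: "vf (pd i) X=der i X" by(rule ev_eqI) (simp add:ev_vf derivation_pd ev_der)

lemma diff_op_single: "order_of b<=l ==> diff_op l (dl (mono1 b a))"
proof -
 have "diff_op (order_of b) (dl (mono1 b 1))"
 proof(induction b rule:inc_induct)
  case zero
  show ?case using mult_dl[of 1] diff_op.mult[of "ga 1"] by simp
 next
  case (inc i b)
  have "dl (mono1 (inc i b) 1) = op_comp (up (pd i)) (dl (mono1 b 1))" by(simp add:dl_vf derivation_pd vf_pd pd_1)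
  thus ?case using diff_op.comp[OF _ inc, of "up (pd i)"] by(simp add:up_vector_field derivation_pd)
 qed
 from diff_op_smult[OF this, of a]
 have "diff_op (order_of b) (dl (mono1 b a))" by(simp add:dl_act)
 thus "order_of b<=l ==> ?thesis" by(rule diff_op_mono)
qed

lemma diff_op_eq: "{P. diff_op l P}=dl ` filt (int l)"
proof(intro equalityI subsetI)
 fix P assume "P:dl ` filt (int l)"
 then obtain X where X: "X:filt (int l)" "P=dl X" by auto
 have "diff_op l (dl X)" using X(1)
 proof(induction rule:filt_induct)
  case zero
  show ?case using diff_op_single[of "%_. 0" l 0] by simp
 next
  case (add X Y)
  thus ?case using diff_op.add by(simp add:dl_add[symmetric])
 qed (simp add:diff_op_single)
 thus "P:{P. diff_op l P}" using X by simp
qed (use diff_op_dl in auto)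

lemma carrier_D: "carrier D=range dl"
proof -
 have "carrier D=(\<Union>l. {P. diff_op l P})" by(auto simp:D_def)
 thus ?thesis using filt_exhaustive by(fastforce simp:diff_op_eq)
qed

lemma F_D_eq: "F_D l=dl ` filt l"
proof(cases "l < 0")
 case True
 have "\<zero>\<^bsub>D\<^esub>=dl 0" unfolding dl_def by(rule up_eqI) (auto simp:D_def zero_ga ev_0)
 moreover have "filt l={0}" using True by(auto simp:filt_def)
 ultimately show ?thesis using True by(simp add:F_D_def)
next
 case False
 thus ?thesis by(simp add:F_D_def diff_op_eq)
qed

end

lemma additive_span_eq:
 assumes "abelian_group V" "additive_subgroup H V" "S<=H" "H<=insert \<zero>\<^bsub>V\<^esub> S"
 shows "additive_span V S=H"
proof
 interpret V: abelian_group V by fact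
 show "additive_span V S<=H" unfolding additive_span_def
  by(rule V.add.generate_subgroup_incl[OF assms(3)]) (insert assms(2), simp add:additive_subgroup_def)
 show "H<=additive_span V S" using assms(4) generate.incl[of _ S "add_monoid V"] generate.one[of "add_monoid V" S]
  by(auto simp:additive_span_def)
qed

section \<open>Relative logarithmic forms of top degree, and their tensor products with
  \<open>D\<close>\<close>

context log_model
begin

lemma dn_comp_up [simp]: "dn \<circ> up=id" by(simp add:fun_eq_iff)

definition upf :: "nat=>(('r=>'r) list=>'r)=>('s=>'s) list=>'s" where
 "upf p om=(\<lambda>xs\<in>log_lists p. ga (om (map dn xs)))"

lemma upf_apply: "xs:LL p ==> upf p om (map up xs)=ga (om xs)" by(simp add:upf_def del:map_map)

lemma upf_eqI: assumes "F:extensional (log_lists p)" "!!xs. xs:LL p ==> F (map up xs)=ga (om xs)" shows "F=upf p om"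
proof
 fix xs show "F xs=upf p om xs"
 proof(cases "xs:log_lists p")
  case True
  then obtain ys where "xs=map up ys" "ys:LL p" by(auto simp:log_lists_eq)
  thus ?thesis using assms(2) upf_apply by simp
 next
  case False
  thus ?thesis using assms(1) by(simp add:upf_def extensional_def)
 qed
qed

lemma upf_cong: "(!!xs. xs:LL p ==> om xs = om' xs) ==> upf p om=upf p om'"
 by(rule upf_eqI) (auto simp:upf_apply upf_def)

lemma upf_eq_iff: "upf p om=upf p om' <-> (ALL xs:LL p. om xs = om' xs)"
proof
 assume eq: "upf p om=upf p om'"
 show "ALL xs:LL p. om xs = om' xs" using upf_apply[of _ p om] upf_apply[of _ p om'] eq by simp
qed (blast intro:upf_cong)

lemma log_form_upf: assumes "aform p om" shows "log_form p (upf p om)" unfolding log_form_def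
proof(intro conjI allI impI ballI)
 show "upf p om:log_lists p \<rightarrow>\<^sub>E carrier R" by(auto simp:upf_def)
next
 fix xs th et ys assume *: "xs @ th # ys:log_lists p & et:log_vector_fields"
 hence "xs @ th # ys:map up ` LL p" by(simp add:log_lists_eq)
 then obtain xs' th' ys' where e: "xs=map up xs'" "th=up th'" "ys=map up ys'" "xs' @ th' # ys':LL p"
  by(auto simp:append_eq_map_conv Cons_eq_map_conv)
 obtain et' where et: "et=up et'" "et':LV" using * by(auto simp:log_vector_fields_eq)
 have L: "xs' @ fadd th' et' # ys':LL p" "xs' @ et' # ys':LL p" using e(4) et LV_fadd by(auto simp:LL_def)
 show "upf p om (xs @ op_add th et # ys)=upf p om (xs @ th # ys) \<oplus> upf p om (xs @ et # ys)"
  using upf_apply[OF e(4)] upf_apply[OF L(1)] upf_apply[OF L(2)] aform_fadd[OF assms e(4) et(2)]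
  by(simp add:e et op_add_up add_ga)
next
 fix xs th ys a assume *: "a:carrier R" "xs @ th # ys:log_lists p"
 hence "xs @ th # ys:map up ` LL p" by(simp add:log_lists_eq)
 then obtain xs' th' ys' where e: "xs=map up xs'" "th=up th'" "ys=map up ys'" "xs' @ th' # ys':LL p"
  by(auto simp:append_eq_map_conv Cons_eq_map_conv)
 obtain b where b: "a=ga b" using * by(auto simp:carrier_R)
 have L: "xs' @ fscale b th' # ys':LL p" using e(4) LV_fscale by(auto simp:LL_def)
 show "upf p om (xs @ op_smult a th # ys)=a \<otimes> upf p om (xs @ th # ys)"
  using upf_apply[OF e(4)] upf_apply[OF L(1)] aform_fscale[OF assms e(4)] by(simp add:e b op_smult_up mult_ga)
next
 fix xs assume "xs:log_lists p" "\<not> distinct xs"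
 then obtain ys where "xs=map up ys" "ys:LL p" "\<not> distinct ys" by(auto simp:log_lists_eq distinct_map inj_on_def)
 thus "upf p om xs=\<zero>" using aform_not_distinct[OF assms] upf_apply by(simp add:zero_ga)
qed

lemma log_formE: assumes "log_form p F" obtains om where "aform p om" "F=upf p om"
proof -
 define om where "om=(%xs. gi (F (map up xs)))"
 have F: "F:log_lists p \<rightarrow>\<^sub>E carrier R"
  and add:"!!xs th et ys. xs @ th # ys:log_lists p & et:log_vector_fields ==> F (xs @ op_add th et # ys)=F (xs @ th #
   ys) \<oplus> F (xs @ et # ys)"
  and scale: "!!xs th ys a. a:carrier R ==> xs @ th # ys:log_lists p ==> F (xs @ op_smult a th # ys)=a \<otimes> F
   (xs @ th # ys)"
  and alt: "!!xs. xs:log_lists p ==> \<not> distinct xs ==> F xs=\<zero>" using assms unfolding log_form_def by blast+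
 have om: "F (map up xs)=ga (om xs)" if "xs:LL p" for xs
  using that PiE_mem[OF F, of "map up xs"] by(simp add:om_def ga_gi)
 have "F=upf p om" by(rule upf_eqI) (insert F om, auto simp:PiE_def)
 moreover have "aform p om"
 proof(rule aformI)
  fix xs th ys et assume *: "xs @ th # ys:LL p" "et:LV"
  hence L: "xs @ fadd th et # ys:LL p" "xs @ et # ys:LL p" using LV_fadd by(auto simp:LL_def)
  have "map up xs @ up th # map up ys:log_lists p" using map_up_log_lists[of "xs @ th # ys"] *(1) by simp
  hence "ga (om (xs @ fadd th et # ys))=ga (om (xs @ th # ys)) \<oplus> ga (om (xs @ et # ys))"
   using add[of "map up xs" "up th" "map up ys" "up et"] * om[OF *(1)] om[OF L(1)] om[OF L(2)]
   by(simp add:op_add_up up_LV)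
  thus "om (xs @ fadd th et # ys) = om (xs @ th # ys) + om (xs @ et # ys)" by(simp add:add_ga)
 next
  fix xs th ys a assume *: "xs @ th # ys:LL p"
  hence L: "xs @ fscale a th # ys:LL p" using LV_fscale by(auto simp:LL_def)
  have "map up xs @ up th # map up ys:log_lists p" using map_up_log_lists[of "xs @ th # ys"] * by simp
  hence "ga (om (xs @ fscale a th # ys))=ga a \<otimes> ga (om (xs @ th # ys))"
   using scale[of "ga a" "map up xs" "up th" "map up ys"] om[OF *(1)] om[OF L(1)] by(simp add:op_smult_up)
  thus "om (xs @ fscale a th # ys)=a * om (xs @ th # ys)" by(simp add:mult_ga)
 next
  fix xs assume *: "xs:LL p" "\<not> distinct xs"
  hence "F (map up xs)=\<zero>" by(intro alt) (auto simp:distinct_map)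
  thus "om xs=0" by(simp add:om_def zero_ga)
 qed
 ultimately show ?thesis using that by blast
qed

lemma carrier_\<Omega>: "carrier (\<Omega> p)=upf p ` Collect (aform p)"
 using log_form_upf by(auto simp:\<Omega>_def elim:log_formE)

lemma \<Omega>_add: "upf p om \<oplus>\<^bsub>\<Omega> p\<^esub> upf p om'=upf p (%xs. om xs + om' xs)"
 by(rule upf_eqI) (auto simp:\<Omega>_def upf_apply add_ga)

lemma \<Omega>_smult: "ga a \<odot>\<^bsub>\<Omega> p\<^esub> upf p om=upf p (%xs. a * om xs)"
 by(rule upf_eqI) (auto simp:\<Omega>_def upf_apply mult_ga)

lemma \<Omega>_zero: "\<zero>\<^bsub>\<Omega> p\<^esub>=upf p (%xs. 0)"
 by(rule upf_eqI) (auto simp:\<Omega>_def zero_ga)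

lemma plus_fun: "om + om'=(%x. om x + om' x)" for om om' :: "'b=>'r" by(simp add:plus_fun_def)
lemma minus_fun: "om - om'=(%x. om x - om' x)" for om om' :: "'b=>'r" by(simp add:fun_diff_def)
lemma zero_fun: "(0::'b=>'r)=(%x. 0)" by(simp add:zero_fun_def)

lemma subgroup_aform: "subgrp (Collect (aform p))"
 by(rule subgrpI) (auto simp:zero_fun minus_fun aform_zero aform_diff)

lemma presented_\<Omega>: "presented (\<Omega> p) (upf p) (%s om xs. gi s * om xs) (Collect (aform p)) (carrier R)"
proof
 fix s and om :: "('r=>'r) list=>'r" assume "s:carrier R"
 thus "s \<odot>\<^bsub>\<Omega> p\<^esub> upf p om=upf p (%xs. gi s * om xs)"
  using \<Omega>_smult[where a = "gi s" and p = p and om = om] by(simp add:ga_gi)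
qed (auto simp:subgroup_aform aform_scale carrier_\<Omega> \<Omega>_add \<Omega>_zero plus_fun zero_fun)

lemma delete_nth_eq: "delete_nth=del_at" by(simp add:fun_eq_iff delete_nth_def del_at_def)
lemma del_at_map: "del_at i (map f xs)=map f (del_at i xs)" by(simp add:del_at_def take_map drop_map)

lemma del_at_LL: "xs:LL (Suc p) ==> i <= p ==> del_at i xs:LL p"
 using length_del_at[of i xs] set_del_at[of i xs] by(auto simp:LL_def)

lemma nth_LV: "xs:LL p ==> i < p ==> xs ! i:LV" by(auto simp:LL_def)

lemma wedge_upf: "wedge p (upf 1 xi) (upf p om)=upf (Suc p) (%xs. ww xs (%th. xi [th]) om)"
proof(rule upf_eqI)
 fix xs assume xs: "xs:LL (Suc p)"
 have "upf 1 xi [map up xs ! i]=ga (xi [xs ! i])" if "i <= p" for i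
  using upf_apply[of "[xs ! i]" 1 xi] nth_LV[OF xs, of i] that xs by(simp add:LL_def)
 thus "wedge p (upf 1 xi) (upf p om) (map up xs)=ga (ww xs (%th. xi [th]) om)" unfolding wedge_def ww_sum[OF xs]
  by(simp add:xs delete_nth_eq del_at_map upf_apply del_at_LL sign_ga mult_ga)
   (rule finsum_ga, simp_all add:xs del_at_LL upf_apply mult_ga)
qed (auto simp:wedge_def)

lemma ext_deriv_upf: assumes "aform p bt" shows "ext_deriv p (upf p bt)=upf (Suc p) (%xs. dd xs bt)"
proof(rule upf_eqI)
 fix xs assume xs: "xs:LL (Suc p)"
 let ?P = "{(i, j). i < j & j <= p}"
 have 1: "(\<Oplus>i\<in>{..p}. sign i \<otimes> (map up xs ! i) (upf p bt (delete_nth i (map up xs))))=ga (SUM i<=p.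
  (-1) ^ i * (xs ! i) (bt (del_at i xs)))"
 proof(rule finsum_ga)
  fix i assume "i:{..p}"
  hence "upf p bt (map up (del_at i xs))=ga (bt (del_at i xs))" "map up xs ! i=up (xs ! i)"
   using xs upf_apply[OF del_at_LL[OF xs]] by(auto simp:LL_def)
  thus "sign i \<otimes> (map up xs ! i) (upf p bt (delete_nth i (map up xs)))=ga ((-1) ^ i * (xs ! i) (bt (del_at i xs)))"
   by(simp add:delete_nth_eq del_at_map sign_ga mult_ga)
 qed simp
 have L: "fbracket (xs ! i) (xs ! j) # del_at i (del_at j xs):LL p" if ij: "i < j" "j <= p" for i j
 proof -
  obtain q where p: "p=Suc q" using ij by(cases p) auto
  show ?thesis
   using del_at_LL[of "del_at j xs" q i] del_at_LL[OF xs, of j] ij LV_fbracket nth_LV[OF xs] by(simp add:p)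
 qed
 have 2: "(\<Oplus>ij\<in>?P. sign (fst ij + snd ij) \<otimes> upf p bt (bracket (map up xs ! fst ij) (map up xs !
  snd ij) # delete_nth (fst ij) (delete_nth (snd ij) (map up xs))))=ga (SUM (i, j):?P. (-1) ^ (i + j) * bt (fbracket
  (xs ! i) (xs ! j) # del_at i (del_at j xs)))"
 proof(rule finsum_ga[OF finite_pairs])
  fix ij assume "ij:?P"
  then obtain i j where ij: "ij=(i, j)" "i < j" "j <= p" by auto
  have "upf p bt (bracket (map up xs ! i) (map up xs ! j) # delete_nth i (delete_nth j (map up xs)))=ga (bt (fbracket
   (xs ! i) (xs ! j) # del_at i (del_at j xs)))"
   using upf_apply[OF L[OF ij(2,3)], of bt] xs ij by(simp add:LL_def bracket_up delete_nth_eq del_at_map)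
  thus "sign (fst ij + snd ij) \<otimes> upf p bt (bracket (map up xs ! fst ij) (map up xs ! snd ij) # delete_nth
   (fst ij) (delete_nth (snd ij) (map up xs)))=ga (case ij of (i, j)=>(-1) ^ (i + j) * bt (fbracket (xs ! i) (xs ! j)
   # del_at i (del_at j xs)))"
   by(simp add:ij sign_ga mult_ga)
 qed
 show "ext_deriv p (upf p bt) (map up xs)=ga (dd xs bt)"
  unfolding ext_deriv_def dd_sum[OF assms xs] add_ga[symmetric] 1[symmetric] 2[symmetric] by(simp add:xs)
qed (auto simp:ext_deriv_def)

lemma LL_1E: assumes "xs:LL 1" obtains th where "xs=[th]" "th:LV" using assms by(cases xs) (auto simp:LL_def)

lemma dlog_t_eq: "dlog_t=upf 1 (%xs. eta i0 (hd xs))"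
proof(rule upf_eqI)
 fix xs assume xs: "xs:LL 1"
 then obtain th where th: "xs=[th]" "th:LV" by(rule LL_1E)
 have "(THE a. a:carrier R & a \<otimes> tt=up th tt)=ga (eta i0 th)"
 proof(rule the_equality)
  show "ga (eta i0 th):carrier R & ga (eta i0 th) \<otimes> tt=up th tt" using th by(simp add:tt_ga mult_ga LV_t)
  fix a assume "a:carrier R & a \<otimes> tt=up th tt"
  thus "a=ga (eta i0 th)" using th t_cancel by(auto simp:tt_ga mult_ga LV_t carrier_R mult.commute[of _ t])
 qed
 thus "dlog_t (map up xs)=ga (eta i0 (hd xs))" using map_up_log_lists[of "[th]" 1] th by(simp add:dlog_t_def LL_def)
qed (auto simp:dlog_t_def)

lemma differential_eq: "differential (ga a)=upf 1 (%xs. hd xs a)"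
proof(rule upf_eqI)
 fix xs assume xs: "xs:LL 1"
 then obtain th where th: "xs=[th]" "th:LV" by(rule LL_1E)
 thus "differential (ga a) (map up xs)=ga (hd xs a)"
  using map_up_log_lists[of "[th]" 1] by(simp add:differential_def LL_def)
qed (auto simp:differential_def)

lemma aform_1: "linear_form xi ==> aform 1 (%xs. xi (hd xs))" by(auto simp:linear_form_def)

lemma wedge_dlog_t: "wedge p dlog_t (upf p om)=upf (Suc p) (%xs. ww xs (eta i0) om)"
 using wedge_upf[of p "%xs. eta i0 (hd xs)" om] by(simp add:dlog_t_eq)

lemma length_rest: "length rest=n" using length_FL card_d by simp

text \<open>Evaluation on the relative frame identifies the relative \<open>n\<close>-forms with the
  ring, and their restriction to \<open>Y\<close> with the ring modulo \<open>t\<close>. The kernels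
  are \<open>van_forms\<close> and \<open>mult_forms\<close>.\<close>

definition van_forms :: "(('r=>'r) list=>'r) set" where
 "van_forms={bt. aform n bt & bt (map fr rest)=0}"

definition mult_forms :: "(('r=>'r) list=>'r) set" where
 "mult_forms={bt. aform n bt & t dvd bt (map fr rest)}"

abbreviation "form_scale == %s om xs. gi s * om xs"

lemma subgroup_vanishing: "subgrp van_forms"
 by(rule subgrpI) (auto simp:van_forms_def zero_fun minus_fun aform_zero aform_diff)

lemma subgroup_multiple: "subgrp mult_forms"
 by(rule subgrpI) (auto simp:mult_forms_def zero_fun minus_fun aform_zero aform_diff)

lemma dlog_t_multiples_eq: "dlog_t_multiples n=upf n ` van_forms" unfolding dlog_t_multiples_def
proof(rule additive_span_eq)
 interpret P: presented "\<Omega> n" "upf n" form_scale "Collect (aform n)" "carrier R" by(rule presented_\<Omega>)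
 show "abelian_group (\<Omega> n)" by(rule P.group)
 show "additive_subgroup (upf n ` van_forms) (\<Omega> n)"
  by(rule P.additive_subgroup_image[OF subgroup_vanishing]) (auto simp:van_forms_def)
 have ww: "(%xs. ww xs (eta i0) om):van_forms" if "Suc q=n" "aform q om" for q om
 proof -
  have "ww (map fr rest) (eta i0) om=0" by(rule ww_vanishing) (auto simp:eta_fr rest split:if_splits)
  thus ?thesis using aform_ww[OF linear_form_eta[of i0] that(2)] that(1) by(simp add:van_forms_def del:aform.simps(2))
 qed
 thus "{wedge q dlog_t ga |q ga. Suc q=n & ga:carrier (\<Omega> q)}<=upf n ` van_forms"
  by(auto simp:carrier_\<Omega> wedge_dlog_t)
 show "upf n ` van_forms<=insert \<zero>\<^bsub>\<Omega> n\<^esub> {wedge q dlog_t ga |q ga. Suc q=n & ga:carrier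
  (\<Omega> q)}"
 proof
  fix F assume "F:upf n ` van_forms"
  then obtain bt where bt: "F=upf n bt" "aform n bt" "bt (map fr rest)=0" by(auto simp:van_forms_def)
  show "F:insert \<zero>\<^bsub>\<Omega> n\<^esub> {wedge q dlog_t ga |q ga. Suc q=n & ga:carrier (\<Omega> q)}"
  proof(cases n)
   \<comment> \<open>No \<open>q\<close> satisfies \<open>Suc q = n\<close> here, so the span is
     that of the empty set; and a form of degree 0 is its value on the empty list.\<close>
   case 0
   hence "rest=[]" using length_rest by simp
   hence "F=\<zero>\<^bsub>\<Omega> n\<^esub>" unfolding \<Omega>_zero bt(1) using bt(3) 0 by(intro upf_cong) simp
   thus ?thesis by simp
  next
   case (Suc q)
   let ?om = "%ys. bt (fr i0 # ys)"
   have "F=wedge q dlog_t (upf q ?om)" unfolding bt(1) wedge_dlog_t Suc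
    by(rule upf_cong, rule form_vanishing_on_rest) (use bt Suc length_rest in auto)
   moreover have "upf q ?om:carrier (\<Omega> q)"
    using aform_SucD(1)[OF bt(2)[unfolded Suc] fr_LV] by(simp add:carrier_\<Omega>)
   ultimately show ?thesis using Suc by blast
  qed
 qed
qed

definition rel_class where "rel_class = presented.coset (upf n) (Collect (aform n)) van_forms"

lemma presented_rel: "presented (\<Omega>_rel n) rel_class form_scale (Collect (aform n)) (carrier R)"
proof -
 interpret P: presented "\<Omega> n" "upf n" form_scale "Collect (aform n)" "carrier R" by(rule presented_\<Omega>)
 have k: "P.ker <= van_forms" using length_rest by(auto simp:P.ker_def van_forms_def upf_eq_iff zero_fun)
 have "presented (quotient_module (\<Omega> n\<lparr>carrier := upf n ` Collect (aform n)\<rparr>) (upf n `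
  van_forms)) (P.coset van_forms) form_scale (Collect (aform n)) (carrier R)"
  by(rule P.quotient) (use subgroup_aform subgroup_vanishing k in
   \<open>auto simp:van_forms_def aform_scale minus_fun right_diff_distrib\<close>)
 thus ?thesis unfolding carrier_\<Omega>[symmetric] by(simp add:\<Omega>_rel_def dlog_t_multiples_eq rel_class_def)
qed

lemma rel_class_eq_iff:
 assumes "aform n bt" "aform n bt'" shows "rel_class bt=rel_class bt' <-> bt (map fr rest)=bt' (map fr rest)"
proof -
 interpret P: presented "\<Omega> n" "upf n" form_scale "Collect (aform n)" "carrier R" by(rule presented_\<Omega>)
 have k: "P.ker <= van_forms" using length_rest by(auto simp:P.ker_def van_forms_def upf_eq_iff zero_fun)
 have "rel_class bt=rel_class bt' <-> bt - bt':van_forms" unfolding rel_class_def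
  by(rule P.coset_eq_iff[OF subgroup_vanishing k]) (insert assms, auto simp:van_forms_def)
 thus ?thesis using assms by(auto simp:van_forms_def minus_fun aform_diff)
qed

abbreviation vol1 :: "('r=>'r) list=>'r" where "vol1 == vol rest"

lemma vol1: "aform n vol1" "vol1 (map fr rest)=1" using aform_vol[OF length_rest] vol_eq_1 rest by auto

lemma t_multiples_eq: "t_multiples n=rel_class ` mult_forms"
proof -
 interpret Q: presented "\<Omega>_rel n" rel_class form_scale "Collect (aform n)" "carrier R" by(rule presented_rel)
 have s: "tt \<odot>\<^bsub>\<Omega>_rel n\<^esub> rel_class bt=rel_class (%xs. t * bt xs)" if "aform n bt" for bt
  using Q.smult[of tt bt] that by(simp add:tt_ga)
 show ?thesis
 proof(intro equalityI subsetI)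
  fix C assume "C:t_multiples n"
  thus "C:rel_class ` mult_forms" by(auto simp:t_multiples_def Q.carrier s mult_forms_def aform_scale intro!:imageI)
 next
  fix C assume "C:rel_class ` mult_forms"
  then obtain bt c where bt: "C=rel_class bt" "aform n bt" "bt (map fr rest)=t * c" by(auto simp:mult_forms_def)
  let ?om = "%xs. c * vol1 xs"
  have "C=tt \<odot>\<^bsub>\<Omega>_rel n\<^esub> rel_class ?om"
   using bt by(simp add:s aform_scale vol1 rel_class_eq_iff)
  thus "C:t_multiples n" using aform_scale[OF vol1(1), of c] by(auto simp:t_multiples_def Q.carrier)
 qed
qed

definition rel_Y_class where "rel_Y_class = presented.coset rel_class (Collect (aform n)) mult_forms"

lemma rel_ker: "presented.ker rel_class (Collect (aform n))<=mult_forms"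
proof -
 interpret Q: presented "\<Omega>_rel n" rel_class form_scale "Collect (aform n)" "carrier R" by(rule presented_rel)
 show ?thesis using rel_class_eq_iff[OF _ aform_zero] by(auto simp:Q.ker_def mult_forms_def zero_fun)
qed

lemma presented_rel_Y: "presented (\<Omega>_rel_Y n) rel_Y_class form_scale (Collect (aform n)) (carrier R)"
proof -
 interpret Q: presented "\<Omega>_rel n" rel_class form_scale "Collect (aform n)" "carrier R" by(rule presented_rel)
 have "presented (quotient_module (\<Omega>_rel n\<lparr>carrier := rel_class ` Collect (aform n)\<rparr>) (rel_class
  ` mult_forms)) (Q.coset mult_forms) form_scale (Collect (aform n)) (carrier R)"
  by(rule Q.quotient) (use subgroup_aform subgroup_multiple rel_ker in
   \<open>auto simp:mult_forms_def aform_scale minus_fun right_diff_distrib\<close>)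
 thus ?thesis unfolding Q.carrier[symmetric] by(simp add:\<Omega>_rel_Y_def t_multiples_eq rel_Y_class_def)
qed

lemma rel_Y_class_eq_iff: assumes "aform n bt" "aform n bt'"
 shows "rel_Y_class bt=rel_Y_class bt' <-> t dvd bt (map fr rest) - bt' (map fr rest)"
proof -
 interpret Q: presented "\<Omega>_rel n" rel_class form_scale "Collect (aform n)" "carrier R" by(rule presented_rel)
 have "rel_Y_class bt=rel_Y_class bt' <-> bt - bt':mult_forms" unfolding rel_Y_class_def
  by(rule Q.coset_eq_iff[OF subgroup_multiple rel_ker]) (insert assms, auto simp:mult_forms_def)
 thus ?thesis using assms by(auto simp:mult_forms_def minus_fun aform_diff)
qed

lemma form_class_upf: assumes "aform n bt" shows "form_class n (upf n bt)=rel_Y_class bt"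
proof -
 interpret P: presented "\<Omega> n" "upf n" form_scale "Collect (aform n)" "carrier R" by(rule presented_\<Omega>)
 interpret Q: presented "\<Omega>_rel n" rel_class form_scale "Collect (aform n)" "carrier R" by(rule presented_rel)
 have "dlog_t_multiples n +>\<^bsub>\<Omega> n\<^esub> upf n bt=rel_class bt"
  unfolding dlog_t_multiples_eq rel_class_def
  by(rule P.a_r_coset_image) (insert assms subgroup_vanishing, auto simp:van_forms_def)
 moreover have "t_multiples n +>\<^bsub>\<Omega>_rel n\<^esub> rel_class bt=rel_Y_class bt"
  unfolding t_multiples_eq rel_Y_class_def
  by(rule Q.a_r_coset_image) (insert assms subgroup_multiple, auto simp:mult_forms_def)
 ultimately show ?thesis by(simp add:form_class_def)
qed

definition upsY where "upsY a=rel_Y_class (%xs. a * vol1 xs)"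

lemma rel_Y_class_eq: "aform n bt ==> rel_Y_class bt=upsY (bt (map fr rest))"
 by(simp add:upsY_def rel_Y_class_eq_iff aform_scale vol1)

lemma form_class_eq: "aform n bt ==> form_class n (upf n bt)=upsY (bt (map fr rest))"
 by(simp add:form_class_upf rel_Y_class_eq)

definition upstop where "upstop a=upf (n + 1) (%xs. a * vol FL xs)"

lemma vol_FL: "aform (n + 1) (vol FL)" "vol FL (map fr FL)=1"
 using aform_vol[of FL "n + 1"] length_rest vol_eq_1[of FL] rest by(simp_all del:aform.simps(2) vol.simps)

lemma upstop_eq: assumes "aform (n + 1) bt" shows "upf (n + 1) bt=upstop (bt (map fr FL))" unfolding upstop_def
proof(rule upf_cong)
 fix xs assume "xs:LL (n + 1)"
 moreover have "aform (n + 1) (%xs. bt xs - bt (map fr FL) * vol FL xs)" by(intro aform_diff aform_scale assms vol_FL)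
 ultimately have "bt xs - bt (map fr FL) * vol FL xs=0"
  using top_form_eq_0[of "%xs. bt xs - bt (map fr FL) * vol FL xs" xs] vol_FL(2) unfolding card_d by simp
 thus "bt xs=bt (map fr FL) * vol FL xs" by simp
qed

lemma upstop_eq_iff: "upstop a=upstop b <-> a=b"
proof
 assume "upstop a=upstop b"
 moreover have "map fr FL:LL (n + 1)" using length_rest by(simp add:fr_LV)
 ultimately have "a * vol FL (map fr FL)=b * vol FL (map fr FL)" unfolding upstop_def upf_eq_iff by blast
 thus "a=b" unfolding vol_FL by simp
qed simp

text \<open>With \<open>a0 = t\<close>: the term of degree 0 in the relative complex is the ring of
  operators modulo left multiples of \<open>t\<close>.\<close>

sublocale Y: cyclic_tensor R ga "\<Omega>_rel_Y n" upsY D dl act t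
proof
 interpret Q: presented "\<Omega>_rel_Y n" rel_Y_class form_scale "Collect (aform n)" "carrier R" by(rule presented_rel_Y)
 show "carrier R=range ga" by(rule carrier_R)
 have v: "aform n (%xs. a * vol1 xs)" for a by(simp add:aform_scale vol1)
 show "carrier (\<Omega>_rel_Y n)=range upsY"
 proof(intro equalityI subsetI)
  fix C assume "C:range upsY"
  then obtain a where "C=rel_Y_class (%xs. a * vol1 xs)" by(auto simp:upsY_def)
  thus "C:carrier (\<Omega>_rel_Y n)" using v[of a] by(simp add:Q.carrier)
 qed (auto simp:Q.carrier rel_Y_class_eq)
 fix a x y
 show "upsY x \<oplus>\<^bsub>\<Omega>_rel_Y n\<^esub> upsY y=upsY (x + y)"
  using v by(simp add:upsY_def Q.add plus_fun distrib_right)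
 show "ga a \<odot>\<^bsub>\<Omega>_rel_Y n\<^esub> upsY x=upsY (a * x)"
  using v by(simp add:upsY_def Q.smult mult.assoc)
 show "upsY x=upsY y <-> t dvd x - y" using v by(simp add:upsY_def rel_Y_class_eq_iff vol1)
next
 fix a and X Y :: "('d, 'r) ops"
 show "dl X \<oplus>\<^bsub>D\<^esub> dl Y=dl (X + Y)" "ga a \<odot>\<^bsub>D\<^esub> dl X=dl (act a X)"
  using dl_add[of X Y] dl_act[of a X] by(simp_all add:D_def)
qed (simp_all add:carrier_D inj_dl act_add act_add_left act_act)

text \<open>With \<open>a0 = 0\<close>: forms of degree \<open>n + 1\<close> are free of rank one,
  so the tensor product in which \<open>R_M\<close> is defined is the ring of operators
  itself.\<close>

sublocale T: cyclic_tensor R ga "\<Omega> (n + 1)" upstop D dl act 0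
proof
 show "carrier R=range ga" by(rule carrier_R)
 have v: "aform (n + 1) (%xs. a * vol FL xs)" for a by(intro aform_scale vol_FL)
 show "carrier (\<Omega> (n + 1))=range upstop"
 proof(intro equalityI subsetI)
  fix C assume "C:carrier (\<Omega> (n + 1))"
  then obtain bt where "C=upf (n + 1) bt" "aform (n + 1) bt" unfolding carrier_\<Omega> by blast
  thus "C:range upstop" using upstop_eq by blast
 next
  fix C assume "C:range upstop"
  thus "C:carrier (\<Omega> (n + 1))" unfolding carrier_\<Omega> upstop_def using v by blast
 qed
 fix a x y
 show "upstop x \<oplus>\<^bsub>\<Omega> (n + 1)\<^esub> upstop y=upstop (x + y)"
  by(simp add:upstop_def \<Omega>_add distrib_right)
 show "ga a \<odot>\<^bsub>\<Omega> (n + 1)\<^esub> upstop x=upstop (a * x)"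
  by(simp add:upstop_def \<Omega>_smult mult.assoc)
 show "upstop x=upstop y <-> 0 dvd x - y" by(simp add:upstop_eq_iff)
qed (insert Y.W, simp_all add:inj_dl act_add act_add_left act_act)

end

section \<open>The image of the last differential\<close>

context log_model
begin

text \<open>One computation for two uses: the relative differential, whose values are known modulo
  \<open>t\<close>, and the absolute one, whose values are known exactly. \<open>h\<close> turns
  tensors into operators, up to the ambiguity \<open>Zs\<close>.\<close>

lemma nabla_value:
 fixes h :: "((('s=>'s) list=>'s) \<times> ('s=>'s) \<Rightarrow>\<^sub>0 int)=>('d, 'r) ops"
 assumes h: "!!u u'. h (u + u')=h u + h u'" and Zs: "subgrp Zs"
  and val: "!!bt Y. aform (Suc q) bt ==> h (frag_of (upf (Suc q) bt, dl Y)) - act (bt (map fr is)) Y:Zs"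
  and l: "length is=Suc q" and bt: "aform q bt"
  and xi: "!!j. j:J ==> xi j=upf 1 (%xs. xi' j (hd xs)) & linear_form (xi' j)"
  and E: "!!j. j:J ==> E j=up (E' j) & derivation (E' j)"
  and frame: "!!i x. i:set is ==> fr i x=(SUM j:J. xi' j (fr i) * E' j x)"
 shows "h (nabla J xi E q (upf q bt, dl X)) - (SUM k<=q. act ((-1) ^ k) (vf (fr (is ! k)) (act (bt (del_at k (map fr
  is))) X))):Zs"
proof -
 have eq: "nabla J xi E q (upf q bt, dl X)=frag_of (upf (Suc q) (%xs. dd xs bt), dl X) + (SUM j:J. frag_of (upf (Suc
  q) (%xs. ww xs (xi' j) bt), dl (vf (E' j) X)))"
  unfolding nabla_def prod.case ext_deriv_upf[OF bt] using wedge_upf[of q "%xs. xi' _ (hd xs)" bt] xi E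
  by(intro arg_cong2[where f = "(+)"] refl sum.cong) (simp add:dl_vf)
 let ?a = "h (frag_of (upf (Suc q) (%xs. dd xs bt), dl X)) - act (dd (map fr is) bt) X"
 let ?b = "%j. h (frag_of (upf (Suc q) (%xs. ww xs (xi' j) bt), dl (vf (E' j) X))) - act (ww (map fr is) (xi' j) bt)
  (vf (E' j) X)"
 have "?a:Zs" by(rule val[OF aform_dd[OF bt]])
 moreover have "(SUM j:J. ?b j):Zs" by(rule subgrp_sum[OF Zs]) (rule val[OF aform_ww[OF _ bt]], use xi in blast)
 ultimately have "?a + (SUM j:J. ?b j):Zs" by(rule subgrp_add[OF Zs])
 moreover have "act (dd (map fr is) bt) X + (SUM j:J. act (ww (map fr is) (xi' j) bt) (vf (E' j) X))=(SUM k<=q. act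
  ((-1) ^ k) (vf (fr (is ! k)) (act (bt (del_at k (map fr is))) X)))"
  by(rule conn_frame[OF bt l]) (rule frame)
 hence "h (nabla J xi E q (upf q bt, dl X)) - (SUM k<=q. act ((-1) ^ k) (vf (fr (is ! k)) (act (bt (del_at k (map fr
  is))) X)))=?a + (SUM j:J. ?b j)"
  unfolding eq h additive_sum[of h, OF h] by(simp add:sum_subtractf algebra_simps)
 ultimately show ?thesis by simp
qed

definition JZ :: "('d, 'r) ops set" where
 "JZ={act t Q + (SUM i:UNIV - {i0}. vf (fr i) (F i)) | Q F. True}"

lemma JZ: "subgrp JZ"
proof(rule subgrpI)
 show "0:JZ" unfolding JZ_def by(rule CollectI, rule exI[of _ 0], rule exI[of _ "%_. 0"]) (simp add:act_0 vf_0)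
 fix X Y assume "X:JZ" "Y:JZ"
 then obtain Q F Q' F' where e: "X=act t Q + (SUM i:UNIV - {i0}. vf (fr i) (F i))"
   "Y=act t Q' + (SUM i:UNIV - {i0}. vf (fr i) (F' i))" by(auto simp:JZ_def)
 show "X - Y:JZ" unfolding JZ_def by(rule CollectI, rule exI[of _ "Q - Q'"], rule exI[of _ "%i. F i - F' i"])
   (simp add:e act_diff vf_diff sum_subtractf)
qed

lemma Y_Z_JZ: "Y.Z<=JZ"
proof
 fix X assume "X:Y.Z"
 then obtain Q where "X=act t Q" by(auto simp:Y.Z_def)
 thus "X:JZ" unfolding JZ_def by(intro CollectI exI[of _ Q] exI[of _ "%_. 0"]) (simp add:vf_0)
qed

lemma vf_fr_JZ: assumes "i~=i0" shows "vf (fr i) X:JZ"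
proof -
 have "(SUM k:UNIV - {i0}. vf (fr k) (if k=i then X else 0))=(SUM k:UNIV - {i0}. if k=i then vf (fr i) X else 0)"
  by(rule sum.cong) (auto simp:vf_0)
 also have "... = vf (fr i) X" using assms by simp
 finally show ?thesis
  unfolding JZ_def by(intro CollectI exI[of _ 0] exI[of _ "%k. if k=i then X else 0"]) (simp add:act_0)
qed

lemma act_sign_JZ: "X:JZ ==> act ((-1) ^ k) X:JZ"
 by(cases "even k") (auto simp:act_minus_left intro:subgrp_minus[OF JZ])

lemma vf_i0_Z: "X:Y.Z ==> vf (fr i0) X:Y.Z" by(auto simp:Y.Z_def vf_act derivation_fr fr_t act_add[symmetric])

text \<open>\<open>fr i0\<close> commutes with the other frame fields, and with \<open>t\<close> up
  to a left multiple of \<open>t\<close>. So left multiplication by it descends to the quotient by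
  \<open>JZ\<close>.\<close>

lemma vf_i0_JZ: assumes "X:JZ" shows "vf (fr i0) X:JZ"
proof -
 obtain Q F where e: "X=act t Q + (SUM i:UNIV - {i0}. vf (fr i) (F i))" using assms by(auto simp:JZ_def)
 have "vf (fr i0) X=act t (vf (fr i0) Q + Q) + (SUM i:UNIV - {i0}. vf (fr i) (vf (fr i0) (F i)))"
  by(simp add:e vf_add vf_act derivation_fr fr_t act_add vf_sum vf_fr_commute[of i0])
 thus ?thesis unfolding JZ_def by(intro CollectI exI[of _ "vf (fr i0) Q + Q"] exI[of _ "%i. vf (fr i0) (F i)"]) simp
qed

definition fY :: "((('s=>'s) list=>'s) \<times> ('s=>'s) \<Rightarrow>\<^sub>0 int)=>('d, 'r) ops" where
 "fY u=Y.fs (frag_extend (%(bt, P). frag_of (form_class n bt, P)) u)"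

lemma fY_add: "fY (u + u')=fY u + fY u'" by(simp add:fY_def frag_extend_add Y.fs_add)

lemmas fY_diff = additive_diff[of fY, OF fY_add]
lemmas fY_0 = additive_zero[of fY, OF fY_add]

lemma fY_frag_of: assumes "aform n bt" shows "fY (frag_of (upf n bt, dl X)) - act (bt (map fr rest)) X:Y.Z"
 using Y.fs_frag_of_Z[of "bt (map fr rest)" X] by(simp add:fY_def form_class_eq[OF assms])

lemma form_class_carrier:
 "supp u <= carrier (\<Omega> n) \<times> carrier D ==> frag_extend (%(bt, P). frag_of (form_class n bt, P)) u:carrier Y.G"
 unfolding Y.carrier_G by(rule keys_frag_extend_subset) (auto simp:carrier_\<Omega> form_class_eq Y.V)

lemma rel_tensor_class_eq: "supp u <= carrier (\<Omega> n) \<times> carrier D ==> rel_tensor_class u=Y.ta (fY u)"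
 unfolding rel_tensor_class_def fY_def by(rule Y.tensor_class_eq_ta) (rule form_class_carrier)

lemma keys_nabla:
 assumes "bt:carrier (\<Omega> q)" "P:carrier D" "!!j. j:J ==> xi j:carrier (\<Omega> 1)" "!!j. j:J ==> E j:vector_fields"
 shows "supp (nabla J xi E q (bt, P)) <= carrier (\<Omega> (Suc q)) \<times> carrier D"
proof -
 obtain bt' X where bt: "bt=upf q bt'" "aform q bt'" "P=dl X" using assms by(auto simp:carrier_\<Omega> carrier_D)
 have 1: "(ext_deriv q bt, P):carrier (\<Omega> (Suc q)) \<times> carrier D"
  unfolding bt(1) ext_deriv_upf[OF bt(2)] using aform_dd[OF bt(2)] assms(2) unfolding carrier_\<Omega> by blast
 have 2: "(wedge q (xi j) bt, op_comp (E j) P):carrier (\<Omega> (Suc q)) \<times> carrier D" if j: "j:J" for j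
 proof -
  obtain xi' where xi': "xi j=upf 1 xi'" "aform 1 xi'" using assms(3)[OF j] unfolding carrier_\<Omega> by blast
  have "linear_form (%th. xi' [th])" using xi'(2) by(simp add:linear_form_def)
  hence "aform (Suc q) (%xs. ww xs (%th. xi' [th]) bt')" by(rule aform_ww) (rule bt(2))
  hence "wedge q (xi j) bt:carrier (\<Omega> (Suc q))" unfolding xi' bt(1) wedge_upf carrier_\<Omega> by blast
  moreover obtain th where "E j=up th" "derivation th" using assms(4)[OF j] by(auto simp:vector_fields_eq)
  ultimately show ?thesis by(simp add:bt(3) dl_vf carrier_D)
 qed
 have "supp (SUM j:J. frag_of (wedge q (xi j) bt, op_comp (E j) P)) <= carrier (\<Omega> (Suc q)) \<times> carrier D"
  using keys_sum[of "%j. frag_of (wedge q (xi j) bt, op_comp (E j) P)" J] 2 by fastforce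
 thus ?thesis unfolding nabla_def prod.case using 1 keys_add by fastforce
qed

lemma sum_rest: "(SUM j<n. f (rest ! j))=(SUM i:UNIV - {i0}. f i)"
 using sum.reindex_bij_betw[OF bij_betw_nth[OF rest(2) refl refl], of f] by(simp add:length_rest rest)

lemma sum_FL: "(SUM j<=n. f (FL ! j))=(SUM i:UNIV. f i)"
proof -
 have "distinct FL" "set FL=UNIV" using rest by auto
 thus ?thesis
  using sum.reindex_bij_betw[OF bij_betw_nth[of FL _ UNIV], of "{..n}" f] length_rest by(simp add:lessThan_Suc_atMost)
qed

lemma up_rel_log: "up th:rel_log_vector_fields <-> th:LV & th t=0"
 unfolding rel_log_vector_fields_def mem_Collect_eq up_LV by(simp add:tt_ga zero_ga)

lemma rel_log_vector_fieldsE: assumes "th:rel_log_vector_fields" obtains et where "th=up et" "et:LV" "et t=0"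
proof -
 have "th:log_vector_fields" using assms by(simp add:rel_log_vector_fields_def)
 then obtain et where "th=up et" unfolding log_vector_fields_eq by blast
 thus ?thesis using assms that up_rel_log by blast
qed

lemma relative_frame_value: assumes n: "Suc q=n" and F: "relative_frame xi E" and bt: "aform q bt"
 shows "fY (nabla {..<n} xi E q (upf q bt, dl X)) - (SUM k<=q. act ((-1) ^ k) (vf (fr (rest ! k)) (act (bt (del_at k
  (map fr rest))) X))):Y.Z"
proof -
 define xi' where "xi'=(%j. SOME om. xi j=upf 1 om & aform 1 om)"
 have xi': "xi j=upf 1 (xi' j)" "aform 1 (xi' j)" if "j < n" for j
 proof -
  have "xi j:carrier (\<Omega> 1)" using F that by(simp add:relative_frame_def)
  hence "EX om. xi j=upf 1 om & aform 1 om" unfolding carrier_\<Omega> by blast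
  from someI_ex[OF this] show "xi j=upf 1 (xi' j)" "aform 1 (xi' j)" by(auto simp:xi'_def)
 qed
 define E' where "E'=(%j. dn (E j))"
 have E': "E j=up (E' j)" "derivation (E' j)" if "j < n" for j
 proof -
  have "E j:vector_fields"
   using F that by(simp add:relative_frame_def rel_log_vector_fields_def log_vector_fields_def)
  thus "E j=up (E' j)" "derivation (E' j)" by(auto simp:vector_fields_eq E'_def)
 qed
 show ?thesis
 proof(rule nabla_value[of fY Y.Z q rest bt "{..<n}" xi "%j th. xi' j [th]" E E'])
  show "fY (u + u')=fY u + fY u'" for u u' by(rule fY_add)
  show "subgrp Y.Z" by(rule Y.Z)
  show "fY (frag_of (upf (Suc q) bt, dl Y)) - act (bt (map fr rest)) Y:Y.Z" if "aform (Suc q) bt" for bt Y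
   using fY_frag_of that by(simp only:n)
  show "length rest=Suc q" using length_rest n by simp
  fix j assume j: "j:{..<n}"
  have "upf 1 (xi' j)=upf 1 (%xs. xi' j [hd xs])" by(rule upf_cong, erule LL_1E) simp
  thus "xi j=upf 1 (%xs. xi' j [hd xs]) & linear_form (%th. xi' j [th])"
   using xi'[of j] j by(simp add:linear_form_def)
  show "E j=up (E' j) & derivation (E' j)" using E' j by simp
 next
  fix i x assume "i:set rest"
  hence rel: "up (fr i):rel_log_vector_fields" by(simp add:up_rel_log fr_LV fr_t rest)
  have "(\<Oplus>j\<in>{..<n}. xi j [up (fr i)] \<otimes> E j (ga x))=ga (SUM j<n. xi' j [fr i] * E' j x)"
   by(rule finsum_ga) (use upf_apply[of "[fr i]" 1] xi' E' fr_LV in \<open>auto simp:mult_ga\<close>)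
  moreover have "!!th x. th:rel_log_vector_fields ==> x:carrier R ==> th x=(\<Oplus>j\<in>{..<n}. xi j [th] \<otimes> E j x)"
   using F unfolding relative_frame_def by blast
  ultimately have "up (fr i) (ga x)=ga (SUM j<n. xi' j [fr i] * E' j x)" using rel by simp
  thus "fr i x=(SUM j:{..<n}. xi' j [fr i] * E' j x)" by simp
 qed (rule bt)
qed

lemma standard_relative_frame: "relative_frame (%j. upf 1 (%xs. eta (rest ! j) (hd xs))) (%j. up (fr (rest ! j)))"
proof -
 have i: "rest ! j~=i0" if "j < n" for j using that rest nth_mem[of j rest] length_rest by auto
 have v: "upf 1 (%xs. eta (rest ! j) (hd xs)) [up th]=ga (eta (rest ! j) th)" if "th:LV" for j th
  using upf_apply[of "[th]" 1] that by simp
 have sum: "th x=(\<Oplus>j\<in>{..<n}. upf 1 (%xs. eta (rest ! j) (hd xs)) [th] \<otimes> up (fr (rest ! j)) x)"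
  if th: "th:rel_log_vector_fields" and x: "x:carrier R" for th x
 proof -
  obtain th' where e: "th=up th'" "th':LV" "th' t=0" using th by(rule rel_log_vector_fieldsE)
  obtain y where y: "x=ga y" using x by(auto simp:carrier_R)
  have "eta i0 th'=0" using LV_t[OF e(2)] e(3) t_regular[of "eta i0 th'"] by(simp add:mult.commute)
  hence "th' y=(SUM j<n. eta (rest ! j) th' * fr (rest ! j) y)"
   by(simp add:LV_expansion[OF e(2)] sum_rest[of "%i. eta i th' * fr i y"] sum_remove_i0)
  moreover have "(\<Oplus>j\<in>{..<n}. upf 1 (%xs. eta (rest ! j) (hd xs)) [th] \<otimes> up (fr (rest ! j)) x)=ga
   (SUM j<n. eta (rest ! j) th' * fr (rest ! j) y)"
   by(rule finsum_ga) (simp_all add:e(1) y v[OF e(2), simplified] mult_ga)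
  ultimately show ?thesis by(simp add:e y)
 qed
 have "upf 1 (%xs. eta (rest ! j) (hd xs)):carrier (\<Omega> 1)" for j
  unfolding carrier_\<Omega> using aform_1[OF linear_form_eta[of "rest ! j"]] by blast
 moreover have "up (fr (rest ! j)):rel_log_vector_fields" if "j < n" for j
  using i[OF that] by(simp add:up_rel_log fr_LV fr_t)
 moreover have "upf 1 (%xs. eta (rest ! k) (hd xs)) [up (fr (rest ! j))]=(if k=j then \<one> else \<zero>)" if "k <
  n" "j < n" for k j
  using that rest length_rest v[OF fr_LV, of k "rest ! j"] by(simp add:eta_fr nth_eq_iff_index_eq one_ga zero_ga)
 ultimately show ?thesis using sum unfolding relative_frame_def by blast
qed

lemma boundaries_eq: "boundaries=Y.ta ` JZ"
proof -
 interpret P: presented rel_tensor Y.ta "%s. act (inv_into UNIV ga s)" UNIV "carrier R"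
  unfolding rel_tensor_def by(rule Y.presented_tensor)
 let ?S = "{rel_tensor_class (nabla {..<n} xi E q (bt, P)) | xi E q bt P. Suc q=n & relative_frame xi E & bt:carrier
  (\<Omega> q) & P:carrier D}"
 have nabla: "rel_tensor_class (nabla {..<n} xi E q (upf q bt, dl X))=Y.ta (SUM k<=q. act ((-1) ^ k) (vf (fr (rest !
  k)) (act (bt (del_at k (map fr rest))) X)))"
  if *: "Suc q=n" "relative_frame xi E" "aform q bt" for xi E q bt X
 proof -
  have "supp (nabla {..<n} xi E q (upf q bt, dl X)) <= carrier (\<Omega> (Suc q)) \<times> carrier D"
   by(rule keys_nabla) (insert *, auto simp:carrier_\<Omega> carrier_D relative_frame_def rel_log_vector_fields_def
    log_vector_fields_def)
  thus ?thesis using rel_tensor_class_eq relative_frame_value[OF *, of X] unfolding *(1) by(simp add:Y.ta_eq_iff)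
 qed
 have gen: "additive_span rel_tensor ?S=generate (add_monoid rel_tensor) ?S" by(simp add:additive_span_def)
 show ?thesis unfolding boundaries_def
 proof(intro equalityI)
  have "?S<=Y.ta ` JZ"
  proof
   fix C assume "C:?S"
   then obtain xi E q bt X where C: "C=rel_tensor_class (nabla {..<n} xi E q (upf q bt, dl X))"
    "Suc q=n" "relative_frame xi E" "aform q bt" by(auto simp:carrier_\<Omega> carrier_D)
   have "(SUM k<=q. act ((-1) ^ k) (vf (fr (rest ! k)) (act (bt (del_at k (map fr rest))) X))):JZ"
   proof(rule subgrp_sum[OF JZ], rule act_sign_JZ, rule vf_fr_JZ)
    fix k assume "k:{..q}"
    thus "rest ! k~=i0" using rest nth_mem[of k rest] length_rest C(2) by auto
   qed
   thus "C:Y.ta ` JZ" unfolding C(1) nabla[OF C(2-4)] by blast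
  qed
  moreover have "additive_subgroup (Y.ta ` JZ) rel_tensor" by(rule P.additive_subgroup_image[OF JZ]) simp
  ultimately show "additive_span rel_tensor ?S<=Y.ta ` JZ"
   unfolding gen by(intro P.V.add.generate_subgroup_incl) (simp_all add:additive_subgroup_def)
 next
  have S: "?S <= carrier rel_tensor"
  proof
   fix C assume "C:?S"
   then obtain xi E q bt X where C: "C=rel_tensor_class (nabla {..<n} xi E q (upf q bt, dl X))"
    "Suc q=n" "relative_frame xi E" "aform q bt" by(auto simp:carrier_\<Omega> carrier_D)
   thus "C:carrier rel_tensor" by(simp add:nabla P.carrier)
  qed
  let ?B = "{X. Y.ta X:additive_span rel_tensor ?S}"
  have sub: "subgroup (additive_span rel_tensor ?S) (add_monoid rel_tensor)"
   unfolding gen using P.V.add.generate_is_subgroup S by simp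
  have B: "subgrp ?B"
  proof(rule subgrpI)
   show "0:?B" using subgroup.one_closed[OF sub] by(simp add:P.zero)
   fix X Y assume *: "X:?B" "Y:?B"
   have "Y.ta (- Y):additive_span rel_tensor ?S"
    using subgroup.m_inv_closed[OF sub, of "Y.ta Y"] * P.minus[of Y] by(simp add:a_inv_def)
   hence "Y.ta X \<oplus>\<^bsub>rel_tensor\<^esub> Y.ta (- Y):additive_span rel_tensor ?S"
    using subgroup.m_closed[OF sub] * by simp
   thus "X - Y:?B" by(simp add:P.add)
  qed
  have fr: "vf (fr i) X:?B" if "i~=i0" for i X
  proof -
   have "i:set rest" using that rest by simp
   then obtain k where k: "k < n" "rest ! k=i" using length_rest by(auto simp:in_set_conv_nth)
   obtain q where q: "Suc q=n" using k by(cases n) auto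
   \<comment> \<open>The contraction of the volume form with \<open>fr i\<close> vanishes on every
     list from which a field other than \<open>fr i\<close> is deleted. Its sign makes up for moving
     \<open>fr i\<close> to the place \<open>k\<close>; the sign of the differential is compensated
     by passing from \<open>X\<close> to \<open>(-1)^k X\<close>.\<close>
   let ?bt = "%ys. (-1) ^ k * vol1 (fr i # ys)"
   have D: "aform q (%ys. vol1 (fr i # ys))" by(rule aform_SucD(1)) (use vol1 q fr_LV in auto)
   have bt: "aform q ?bt" by(rule aform_scale[OF D])
   have L: "del_at j (map fr rest):LL q" if "j<=q" for j by(rule del_at_LL) (use that q length_rest in auto)
   have del:"?bt (del_at j (map fr rest))=(if j=k then 1 else 0)" if j: "j<=q" for j
   proof(cases "j=k")
    case True
    have "take k rest @ i # drop (Suc k) rest=rest" using k length_rest id_take_nth_drop[of k rest] by simp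
    hence e: "map fr (take k rest) @ fr i # map fr (drop (Suc k) rest)=map fr rest" by(metis list.simps(9) map_append)
    have "vol1 (map fr (take k rest) @ fr i # map fr (drop (Suc k) rest))=(-1) ^ k * vol1 (fr i # map fr (take k
     rest) @ map fr (drop (Suc k) rest))"
     using aform_front[of q vol1 "fr i" "map fr (take k rest)" "map fr (drop (Suc k) rest)"] vol1(1) q k length_rest
     by(simp add:fr_LV map_append[symmetric] del:map_append)
    thus ?thesis using True vol1(2) by(simp add:e del_at_def take_map drop_map)
   next
    case False
    have "rest ! k:set (del_at j rest)"
    proof(cases "k < j")
     case True
     thus ?thesis using k length_rest by(auto simp:del_at_def in_set_conv_nth intro!:disjI1 exI[of _ k])
    next
     case False
     hence "rest ! k:set (drop (Suc j) rest)"
      using `j ~= k` k length_rest unfolding in_set_conv_nth by(intro exI[of _ "k - Suc j"]) auto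
     thus ?thesis by(simp add:del_at_def)
    qed
    hence "fr i:set (del_at j (map fr rest))" using k by(auto simp:del_at_map)
    hence "vol1 (fr i # del_at j (map fr rest))=0"
     using aform_not_distinct[OF vol1(1), of "fr i # del_at j (map fr rest)"] L[OF j] q fr_LV by auto
    thus ?thesis using False by simp
   qed
   have "(SUM j<=q. act ((-1) ^ j) (vf (fr (rest ! j)) (act (?bt (del_at j (map fr rest))) (act ((-1) ^ k) X))))=(SUM
    j<=q. if j=k then vf (fr i) X else 0)"
   proof(rule sum.cong)
    fix j assume "j:{..q}"
    hence j: "j<=q" by simp
    show "act ((-1) ^ j) (vf (fr (rest ! j)) (act (?bt (del_at j (map fr rest))) (act ((-1) ^ k) X)))=(if j=k then vf
     (fr i) X else 0)"
     unfolding del[OF j] using k by(cases "even k") (auto simp:act_0 vf_0 act_minus_left vf_minus)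
   qed simp
   also have "... = vf (fr i) X" using k q by auto
   finally have "Y.ta (vf (fr i) X):?S"
    using nabla[OF q standard_relative_frame bt, of "act ((-1) ^ k) X"] q standard_relative_frame bt
    by(auto simp:carrier_\<Omega> carrier_D) (metis (no_types, lifting) imageI mem_Collect_eq rangeI)
   hence "Y.ta (vf (fr i) X):generate (add_monoid rel_tensor) ?S" by(rule generate.incl)
   thus ?thesis unfolding gen by simp
  qed
  have Z: "act t Q:?B" for Q
  proof -
   have "Y.ta (act t Q)=Y.ta 0" unfolding Y.ta_eq_iff by(auto simp:Y.Z_def)
   thus ?thesis using subgrp_0[OF B] by simp
  qed
  have "JZ<=?B"
  proof
   fix X assume "X:JZ"
   then obtain Q F where X: "X=act t Q + (SUM i:UNIV - {i0}. vf (fr i) (F i))" by(auto simp:JZ_def)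
   show "X:?B" unfolding X by(rule subgrp_add[OF B Z subgrp_sum[OF B]]) (rule fr, simp)
  qed
  thus "Y.ta ` JZ<=additive_span rel_tensor ?S" by auto
 qed
qed

end

section \<open>\<open>M\<close>, its filtration and \<open>R\<close> in terms of operators\<close>

context log_model
begin

text \<open>This is the class of the relative volume form \<open>vol1\<close> tensored with the
  operator.\<close>

definition ps where "ps = presented.coset Y.ta UNIV JZ"

lemma presented_restrict: "presented (restrict_scalars \<kappa> rel_tensor) Y.ta (%c. act (cst c)) UNIV UNIV"
proof -
 interpret P: presented rel_tensor Y.ta "%s. act (inv_into UNIV ga s)" UNIV "carrier R"
  unfolding rel_tensor_def by(rule Y.presented_tensor)
 show ?thesis
 proof
  show "subgrp (UNIV::('d, 'r) ops set)" by(simp add:subgrp_def)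
  fix c :: complex and X
  have "\<kappa> c:carrier R" "inv_into UNIV ga (\<kappa> c) = cst c" using inj_ga \<kappa>_ga[of c] by simp_all
  hence "\<kappa> c \<odot>\<^bsub>rel_tensor\<^esub> Y.ta X=Y.ta (act (cst c) X)" using P.smult by simp
  thus "c \<odot>\<^bsub>restrict_scalars \<kappa> rel_tensor\<^esub> Y.ta X=Y.ta (act (cst c) X)"
   by(simp add:restrict_scalars_def)
 qed (auto simp:restrict_scalars_def P.carrier P.add P.zero)
qed

lemma cst_JZ: assumes "X:JZ" shows "act (cst c) X:JZ"
proof -
 obtain Q F where e: "X=act t Q + (SUM i:UNIV - {i0}. vf (fr i) (F i))" using assms by(auto simp:JZ_def)
 have "fr i (cst c)=0" for i using derivation_cst[OF derivation_fr] .
 hence "act (cst c) X=act t (act (cst c) Q) + (SUM i:UNIV - {i0}. vf (fr i) (act (cst c) (F i)))"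
  by(simp add:e act_add act_sum vf_act derivation_fr act_commute[of "cst c"])
 thus ?thesis unfolding JZ_def by(intro CollectI exI[of _ "act (cst c) Q"] exI[of _ "%i. act (cst c) (F i)"]) simp
qed

lemma restrict_ker: "presented.ker Y.ta UNIV<=JZ"
proof -
 interpret P: presented "restrict_scalars \<kappa> rel_tensor" Y.ta "%c. act (cst c)" UNIV UNIV by(rule presented_restrict)
 show ?thesis using Y_Z_JZ by(auto simp:P.ker_def Y.ta_eq_iff)
qed

lemma presented_M: "presented M ps (%c. act (cst c)) UNIV UNIV"
proof -
 interpret P: presented "restrict_scalars \<kappa> rel_tensor" Y.ta "%c. act (cst c)" UNIV UNIV by(rule presented_restrict)
 have "presented (quotient_module (restrict_scalars \<kappa> rel_tensor\<lparr>carrier := Y.ta ` UNIV\<rparr>) (Y.ta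
  ` JZ)) (P.coset JZ) (%c. act (cst c)) UNIV UNIV"
  by(rule P.quotient[OF _ _ _ JZ restrict_ker]) (auto simp:P.A cst_JZ act_diff)
 thus ?thesis unfolding P.carrier[symmetric] by(simp add:M_def boundaries_eq ps_def)
qed

lemma ps_eq_iff: "ps X = ps Y <-> X - Y:JZ"
proof -
 interpret P: presented "restrict_scalars \<kappa> rel_tensor" Y.ta "%c. act (cst c)" UNIV UNIV by(rule presented_restrict)
 show ?thesis unfolding ps_def by(rule P.coset_eq_iff[OF JZ restrict_ker]) auto
qed

lemma M_class_eq: assumes "supp u <= carrier (\<Omega> n) \<times> carrier D" shows "M_class u = ps (fY u)"
proof -
 interpret P: presented rel_tensor Y.ta "%s. act (inv_into UNIV ga s)" UNIV "carrier R"
  unfolding rel_tensor_def by(rule Y.presented_tensor)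
 show ?thesis unfolding M_class_def boundaries_eq rel_tensor_class_eq[OF assms] ps_def
  by(rule P.a_r_coset_image[OF JZ]) auto
qed

lemma M_class_frag_of: assumes "aform n bt" shows "M_class (frag_of (upf n bt, dl X)) = ps (act (bt (map fr rest)) X)"
proof -
 have "M_class (frag_of (upf n bt, dl X)) = ps (fY (frag_of (upf n bt, dl X)))"
  by(rule M_class_eq) (insert assms, auto simp:carrier_\<Omega> carrier_D)
 thus ?thesis using fY_frag_of[OF assms, of X] Y_Z_JZ by(auto simp:ps_eq_iff)
qed

lemma F_M_eq: "F_M l = ps ` filt (l + int n)" unfolding F_M_def
proof(rule additive_span_eq)
 interpret P: presented M ps "%c. act (cst c)" UNIV UNIV by(rule presented_M)
 let ?S = "{M_class (frag_of (bt, P)) |bt P. bt:carrier (\<Omega> n) & P:F_D (l + int n)}"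
 show "abelian_group M" by(rule P.group)
 show "additive_subgroup (ps ` filt (l + int n)) M"
  by(rule P.additive_subgroup_image) (auto intro:subgrpI filt_0 filt_diff)
 show "?S <= ps ` filt (l + int n)" by(auto simp:carrier_\<Omega> F_D_eq M_class_frag_of act_filt intro!:imageI)
 have "ps X:?S" if "X:filt (l + int n)" for X using M_class_frag_of[OF vol1(1), of X] vol1 that
  by(intro CollectI exI[of _ "upf n vol1"] exI[of _ "dl X"]) (auto simp:carrier_\<Omega> F_D_eq)
 thus "ps ` filt (l + int n)<=insert \<zero>\<^bsub>M\<^esub> ?S" by blast
qed

definition fT where "fT E z' u=T.fs (frag_extend (nabla {..n} (%i. differential (z' i)) E n) u)"

lemma T_Z: "T.Z={0}" by(auto simp:T.Z_def)

lemma T_fs_frag_of: "aform (Suc n) bt ==> T.fs (frag_of (upf (Suc n) bt, dl X))=act (bt (map fr FL)) X"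
 using T.fs_frag_of_Z[of "bt (map fr FL)" X] upstop_eq[of bt] by(simp add:T_Z del:aform.simps)

lemma coordinate_frameE: assumes "coordinate_frame z' E"
 obtains ze ep where "!!i. i<=n ==> z' i=ga (ze i)" "!!i. i<=n ==> E i=up (ep i)" "!!i. i<=n ==> derivation (ep i)"
  "!!th x. derivation th ==> th x=(SUM i<=n. th (ze i) * ep i x)"
proof -
 have 1: "z' i=ga (gi (z' i))" "E i=up (dn (E i))" "derivation (dn (E i))" if "i<=n" for i
 proof -
  have "E i:vector_fields" "z' i:carrier R" using assms that by(simp_all add:coordinate_frame_def)
  thus "z' i=ga (gi (z' i))" "E i=up (dn (E i))" "derivation (dn (E i))" by(auto simp:vector_fields_eq ga_gi)
 qed
 have "th x=(SUM i<=n. th (gi (z' i)) * dn (E i) x)" if "derivation th" for th x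
 proof -
  have "up th (ga x)=(\<Oplus>i\<in>{..n}. up th (z' i) \<otimes> E i (ga x))"
   using assms that up_vector_field[of th] unfolding coordinate_frame_def by(metis ga_carrier)
  also have "... = ga (SUM i<=n. th (gi (z' i)) * dn (E i) x)"
  proof(rule finsum_ga)
   fix i assume "i:{..n}"
   hence "up th (z' i)=ga (th (gi (z' i)))" "E i (ga x)=ga (dn (E i) x)"
    using 1[of i] up_apply[of th "gi (z' i)"] up_apply[of "dn (E i)" x] by simp_all
   thus "up th (z' i) \<otimes> E i (ga x)=ga (th (gi (z' i)) * dn (E i) x)" by(simp add:mult_ga)
  qed simp
  finally show ?thesis by simp
 qed
 with 1 show ?thesis by(rule that[of "%i. gi (z' i)" "%i. dn (E i)"])
qed

lemma fT_frag_of: assumes F: "coordinate_frame z' E" and bt: "aform n bt"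
 shows "fT E z' (frag_of (upf n bt, dl X))=(SUM k<=n. act ((-1) ^ k) (vf (fr (FL ! k)) (act (bt (del_at k (map fr FL))) X)))"
proof -
 obtain ze ep where C: "!!i. i<=n ==> z' i=ga (ze i)" "!!i. i<=n ==> E i=up (ep i)" "!!i. i<=n ==> derivation (ep i)"
  "!!th x. derivation th ==> th x=(SUM i<=n. th (ze i) * ep i x)" using F by(rule coordinate_frameE) blast
 have "T.fs (nabla {..n} (%i. differential (z' i)) E n (upf n bt, dl X)) - (SUM k<=n. act ((-1) ^ k) (vf (fr (FL !
  k)) (act (bt (del_at k (map fr FL))) X))):T.Z"
 proof(rule nabla_value[of T.fs T.Z n FL bt "{..n}" "%i. differential (z' i)" "%i th. th (ze i)" E ep])
  show "T.fs (frag_of (upf (Suc n) bt, dl Y)) - act (bt (map fr FL)) Y:T.Z" if "aform (Suc n) bt" for bt Y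
   using T_fs_frag_of[OF that] by(simp add:T_Z)
  show "differential (z' j)=upf 1 (%xs. hd xs (ze j)) & linear_form (%th. th (ze j))" if "j:{..n}" for j
   using that C by(simp add:differential_eq linear_form_def fadd_def fscale_def)
  show "E j=up (ep j) & derivation (ep j)" if "j:{..n}" for j using that C by simp
  show "fr i x=(SUM j:{..n}. fr i (ze j) * ep j x)" for i x by(rule C(4)) (rule derivation_fr)
 qed (insert length_rest bt T.Z, simp_all add:T.fs_add)
 thus ?thesis by(simp add:fT_def T_Z)
qed

text \<open>Of the \<open>n + 1\<close> terms of the absolute differential in the frame, the one at
  \<open>fr i0\<close> is \<open>fr i0\<close> times the operator of \<open>u\<close>; the others
  begin with a relative field and lie in \<open>JZ\<close>.\<close>

lemma fT_value: assumes F: "coordinate_frame z' E" and u: "supp u <= carrier (\<Omega> n) \<times> carrier D"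
 shows "fT E z' u - vf (fr i0) (fY u):JZ" using u
proof(induction u rule:frag_induction)
 case zero
 show ?case using subgrp_0[OF JZ] by(simp add:fT_def T.fs_0 fY_0 vf_0)
next
 case (one x)
 then obtain bt X where x: "x=(upf n bt, dl X)" "aform n bt" by(auto simp:carrier_\<Omega> carrier_D)
 have "fT E z' (frag_of x) = vf (fr i0) (act (bt (map fr rest)) X) + (SUM k<n. act ((-1) ^ Suc k) (vf (fr (rest ! k))
  (act (bt (fr i0 # del_at k (map fr rest))) X)))"
  unfolding x fT_frag_of[OF F x(2)] lessThan_Suc_atMost[symmetric] sum.lessThan_Suc_shift by simp
 moreover have "(SUM k<n. act ((-1) ^ Suc k) (vf (fr (rest ! k)) (act (bt (fr i0 # del_at k (map fr rest))) X))):JZ"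
 proof(rule subgrp_sum[OF JZ], rule act_sign_JZ, rule vf_fr_JZ)
  fix k assume "k:{..<n}"
  thus "rest ! k~=i0" using rest nth_mem[of k rest] length_rest by auto
 qed
 moreover have "vf (fr i0) (fY (frag_of x) - act (bt (map fr rest)) X):JZ"
  using vf_i0_Z[OF fY_frag_of[OF x(2), of X]] Y_Z_JZ unfolding x by blast
 ultimately show ?case using subgrp_diff[OF JZ, of "fT E z' (frag_of x) - vf (fr i0) (act (bt (map fr rest)) X)"
    "vf (fr i0) (fY (frag_of x) - act (bt (map fr rest)) X)"] by(simp add:vf_diff algebra_simps)
next
 case (diff a b)
 thus ?case using subgrp_diff[OF JZ diff] by(simp add:fT_def frag_extend_diff T.fs_diff fY_diff vf_diff algebra_simps)
qed

definition wT where "wT v=T.fs (frag_extend (%(ga, Q). frag_of (wedge n dlog_t ga, Q)) v)"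

lemma wT_frag_of: assumes "aform n bt" shows "wT (frag_of (upf n bt, dl X))=act (bt (map fr rest)) X"
proof -
 have "aform (Suc n) (%xs. ww xs (eta i0) bt)" by(rule aform_ww[OF linear_form_eta assms])
 thus ?thesis
  using T_fs_frag_of[of "%xs. ww xs (eta i0) bt" X] ww_eta_fr[of i0 rest bt] rest by(simp add:wT_def wedge_dlog_t)
qed

lemma wT_value: assumes "supp v <= carrier (\<Omega> n) \<times> carrier D" shows "wT v - fY v:JZ" using assms
proof(induction v rule:frag_induction)
 case zero
 show ?case using subgrp_0[OF JZ] by(simp add:wT_def T.fs_0 fY_0)
next
 case (one x)
 then obtain bt X where x: "x=(upf n bt, dl X)" "aform n bt" by(auto simp:carrier_\<Omega> carrier_D)
 thus ?case using subgrp_minus[OF Y.Z fY_frag_of[OF x(2), of X]] Y_Z_JZ by(auto simp:wT_frag_of)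
next
 case (diff a b)
 thus ?case using subgrp_diff[OF JZ diff] by(simp add:wT_def frag_extend_diff T.fs_diff fY_diff algebra_simps)
qed

lemma standard_coordinate_frame: "coordinate_frame (%i. ga (z (FL ! i))) (%i. up (pd (FL ! i)))"
 unfolding coordinate_frame_def
proof(intro conjI allI impI ballI)
 fix i j assume "i<=n" "j<=n"
 moreover have "distinct FL" using rest by auto
 ultimately have "FL ! i=FL ! j <-> i=j" using length_rest by(intro nth_eq_iff_index_eq) auto
 thus "up (pd (FL ! i)) (ga (z (FL ! j)))=(if i=j then \<one> else \<zero>)"
  by(simp only:up_apply pd_z) (simp add:one_ga zero_ga)
next
 fix th x assume "th:vector_fields" "x:carrier R"
 then obtain th' y where e: "th=up th'" "derivation th'" "x=ga y" by(auto simp:vector_fields_eq carrier_R)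
 have "(\<Oplus>i\<in>{..n}. th (ga (z (FL ! i))) \<otimes> up (pd (FL ! i)) x)=ga (SUM i<=n. th' (z (FL ! i)) * pd
  (FL ! i) y)"
  by(rule finsum_ga) (simp_all add:e mult_ga)
 also have "... = th x" unfolding sum_FL[of "%i. th' (z i) * pd i y"] by(simp add:e derivation_eq'[OF e(2), of y])
 finally show "th x=(\<Oplus>i\<in>{..n}. th (ga (z (FL ! i))) \<otimes> up (pd (FL ! i)) x)" by simp
qed (auto simp:up_vector_field derivation_pd)

lemma T_keys:
 "supp v <= carrier (\<Omega> n) \<times> carrier D ==> frag_extend (%(ga, Q). frag_of (wedge n dlog_t ga, Q)) v:carrier T.G"
 "supp u <= carrier (\<Omega> n) \<times> carrier D ==> coordinate_frame z' E ==> frag_extend (nabla {..n} (%i.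
  differential (z' i)) E n) u:carrier T.G"
proof -
 show "frag_extend (%(ga, Q). frag_of (wedge n dlog_t ga, Q)) v:carrier T.G"
  if v: "supp v <= carrier (\<Omega> n) \<times> carrier D" unfolding T.carrier_G
 proof(rule keys_frag_extend_subset[OF v])
  fix x assume "x:carrier (\<Omega> n) \<times> carrier D"
  then obtain bt X where x: "x=(upf n bt, dl X)" "aform n bt" by(auto simp:carrier_\<Omega> carrier_D)
  have "upf (n + 1) (%xs. ww xs (eta i0) bt):carrier (\<Omega> (n + 1))"
   unfolding carrier_\<Omega> using aform_ww[OF linear_form_eta[of i0] x(2)] by simp
  thus "supp (case x of (ga, Q)=>frag_of (wedge n dlog_t ga, Q)) <= carrier (\<Omega> (n + 1)) \<times> carrier D"
   by(simp add:x wedge_dlog_t carrier_D)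
 qed
 show "frag_extend (nabla {..n} (%i. differential (z' i)) E n) u:carrier T.G"
  if u: "supp u <= carrier (\<Omega> n) \<times> carrier D" and F: "coordinate_frame z' E" unfolding T.carrier_G
 proof(rule keys_frag_extend_subset[OF u])
  fix x assume "x:carrier (\<Omega> n) \<times> carrier D"
  then obtain bt P where x: "x=(bt, P)" "bt:carrier (\<Omega> n)" "P:carrier D" by auto
  have d: "differential (z' j):carrier (\<Omega> 1)" if j: "j<=n" for j
  proof -
   obtain a where a: "z' j=ga a" using F j by(auto simp:coordinate_frame_def carrier_R)
   have "linear_form (%th. th a)" by(simp add:linear_form_def fadd_def fscale_def)
   from aform_1[OF this] show ?thesis unfolding a differential_eq carrier_\<Omega> by blast
  qed
  have "supp (nabla {..n} (%i. differential (z' i)) E n (bt, P)) <= carrier (\<Omega> (Suc n)) \<times> carrier D"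
   by(rule keys_nabla[OF x(2,3)]) (insert d F, auto simp:coordinate_frame_def)
  thus "supp (nabla {..n} (%i. differential (z' i)) E n x) <= carrier (\<Omega> (n + 1)) \<times> carrier D"
   by(simp add:x)
 qed
qed

lemma T_class_eq_iff:
 assumes "supp u <= carrier (\<Omega> n) \<times> carrier D" "supp v <= carrier (\<Omega> n) \<times> carrier D"
  "coordinate_frame z' E"
 shows "tensor_class R (\<Omega> (n + 1)) D (frag_extend (%(ga, Q). frag_of (wedge n dlog_t ga, Q)) v)=tensor_class R
  (\<Omega> (n + 1)) D (frag_extend (nabla {..n} (%i. differential (z' i)) E n) u) <-> wT v=fT E z' u"
 unfolding T.tensor_class_eq_ta[OF T_keys(1)[OF assms(2)]] T.tensor_class_eq_ta[OF T_keys(2)[OF assms(1,3)]]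
  T.ta_eq_iff T_Z wT_def fT_def by simp

text \<open>Modulo \<open>JZ\<close>, wedging with dt/t takes \<open>v\<close> to its own operator,
  and the differential takes \<open>u\<close> to \<open>fr i0\<close> times its operator. This
  forces the class of \<open>v\<close>, whatever \<open>u\<close>, \<open>v\<close> and the
  coordinates are.\<close>

lemma R_M_ps: "R_M (ps X) = ps (vf (fr i0) X)" unfolding R_M_def
proof(rule the_equality)
 let ?P = "%m'. EX u v z' E. u:carrier (tensor_free (\<Omega> n) D) & v:carrier (tensor_free (\<Omega> n) D) &
  coordinate_frame z' E & ps X=M_class u & m'=M_class v & tensor_class R (\<Omega> (n + 1)) D (frag_extend (%(ga, Q).
  frag_of (wedge n dlog_t ga, Q)) v)=tensor_class R (\<Omega> (n + 1)) D (frag_extend (nabla {..n} (%i. differential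
  (z' i)) E n) u)"
 let ?K = "carrier (\<Omega> n) \<times> carrier D"
 let ?z = "%i. ga (z (FL ! i))" and ?E = "%i. up (pd (FL ! i))"
 have k: "supp (frag_of (upf n vol1, dl Y))<=?K" for Y using vol1 by(auto simp:carrier_\<Omega> carrier_D)
 let ?u = "frag_of (upf n vol1, dl X)"
 \<comment> \<open>Since dt/t wedged with \<open>vol1\<close> has value 1 on the frame, tensoring
   \<open>vol1\<close> with the operator of the differential of \<open>?u\<close> solves the
   equation exactly, not only modulo \<open>JZ\<close>.\<close>
 let ?v = "frag_of (upf n vol1, dl (fT ?E ?z ?u))"
 have "fY ?u - X:Y.Z" "fY ?v - fT ?E ?z ?u:Y.Z" using fY_frag_of[OF vol1(1)] vol1(2) by(metis act_1)+
 hence J: "fY ?u - X:JZ" "fY ?v - fT ?E ?z ?u:JZ" using Y_Z_JZ by auto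
 have "ps X=M_class ?u" unfolding M_class_eq[OF k] ps_eq_iff using subgrp_minus[OF JZ J(1)] by simp
 moreover have "ps (vf (fr i0) X)=M_class ?v"
 proof -
  have "fY ?v - vf (fr i0) X:JZ"
   using subgrp_add[OF JZ J(2) subgrp_add[OF JZ fT_value[OF standard_coordinate_frame k[of X]] vf_i0_JZ[OF J(1)]]]
   by(simp add:vf_diff)
  thus ?thesis unfolding M_class_eq[OF k] ps_eq_iff using subgrp_minus[OF JZ] by fastforce
 qed
 moreover have "wT ?v=fT ?E ?z ?u" using wT_frag_of[OF vol1(1)] vol1(2) by simp
 ultimately show "?P (ps (vf (fr i0) X))"
  using k standard_coordinate_frame T_class_eq_iff[OF k k standard_coordinate_frame]
  by(intro exI[of _ ?u] exI[of _ ?v] exI[of _ ?z] exI[of _ ?E]) (simp add:tensor_free_def)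
 fix m' assume "?P m'"
 then obtain u v z' E where
  u: "supp u <= carrier (\<Omega> n) \<times> carrier D" and v: "supp v <= carrier (\<Omega> n) \<times> carrier D"
  and F: "coordinate_frame z' E" and m: "ps X=M_class u" "m'=M_class v"
  and eq: "tensor_class R (\<Omega> (n + 1)) D (frag_extend (%(ga, Q). frag_of (wedge n dlog_t ga, Q))
   v)=tensor_class R (\<Omega> (n + 1)) D (frag_extend (nabla {..n} (%i. differential (z' i)) E n) u)"
  by(elim exE conjE) (simp add:tensor_free_def)
 have "wT v=fT E z' u" using eq T_class_eq_iff[OF u v F] by blast
 moreover have "X - fY u:JZ" using m(1) unfolding M_class_eq[OF u] ps_eq_iff .
 ultimately have "fY v - vf (fr i0) X:JZ"
  using subgrp_diff[OF JZ subgrp_diff[OF JZ fT_value[OF F u] wT_value[OF v]] vf_i0_JZ[of "X - fY u"]]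
  by(simp add:vf_diff)
 thus "m' = ps (vf (fr i0) X)" unfolding m(2) M_class_eq[OF v] ps_eq_iff .
qed

end

section \<open>The stalks off \<open>Y\<close> and at a crossing\<close>

locale coords_model = germ_family R \<kappa> I tt n + coords z pd rho cst
 for R :: "'s ring" (structure) and \<kappa> I tt n
  and z :: "'d::finite=>'r::comm_ring_1" and pd rho :: "'d=>'r=>'r" and cst :: "complex=>'r" +
 fixes ga :: "'r=>'s" assumes inj_ga: "inj ga" and carrier_R: "carrier R=range ga"
  and mult_ga: "ga x \<otimes> ga y=ga (x * y)" and add_ga: "ga x \<oplus> ga y=ga (x + y)"
  and one_ga: "\<one>=ga 1" and zero_ga: "\<zero>=ga 0"
  and \<kappa>_ga: "\<kappa> c=ga (cst c)" and card_d: "CARD('d)=n + 1"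
begin

lemma ga_eq_iff: "ga x=ga y <-> x=y" using inj_ga by(auto dest:injD)

lemma smooth_decomposition: assumes t: "t = cst c + z i0" "t * u=1" and tt: "tt=ga t" and I: "I=range ga"
 shows "graded_decomp al"
proof -
 \<comment> \<open>As \<open>t\<close> is \<open>z i0\<close> plus a constant, the field
   \<open>t \<partial>_{i0}\<close> sends \<open>t\<close> to \<open>t\<close>, as the frame
   requires.\<close>
 define m eps where "m=(%i. if i=i0 then t else 1)" and "eps=(%i. if i=i0 then 1 else 0::'r)"
 have t_reg: "x=0" if "t * x=0" for x
 proof -
  have "u * (t * x)=0" using that by simp
  thus ?thesis using t(2) by(simp add:mult.assoc[symmetric] mult.commute[of u])
 qed
 interpret log_model R \<kappa> I tt n z pd rho cst m eps i0 t ga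
 proof unfold_locales
  fix i j :: 'd
  show "j~=i ==> pd j (m i)=0" by(auto simp:m_def t pd_add pd_cst pd_z pd_1)
  show "m i * x=0 ==> x=0" for x by(auto simp:m_def t_reg split:if_splits)
  show "m i * pd i t=eps i * t" by(auto simp:m_def eps_def t(1) pd_add pd_cst pd_z)
  show "eps i=0 | eps i=1" "eps i0=1" by(auto simp:eps_def)
 next
  fix th :: "'r=>'r"
  have "m i dvd x" for i x
  proof(cases "i=i0")
   case True
   have "x=t * (u * x)" using t(2) by(simp add:mult.assoc[symmetric])
   thus ?thesis using True by(simp add:m_def) (metis dvd_triv_left)
  qed (simp add:m_def)
  thus "(ALL x. ga x:I --> ga (th x):I) <-> (ALL i. m i dvd th (z i))" by(simp add:I)
 qed (use t_reg inj_ga carrier_R mult_ga add_ga one_ga zero_ga \<kappa>_ga card_d tt I in auto)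
 have "X:JZ" for X
 proof -
  have "X=act t (act u X)" using t(2) by(simp add:act_act)
  hence "X:Y.Z" by(auto simp:Y.Z_def)
  thus ?thesis using Y_Z_JZ by blast
 qed
 hence ps: "ps X = ps 0" for X by(simp add:ps_eq_iff)
 interpret P: presented M ps "%c. act (cst c)" UNIV UNIV by(rule presented_M)
 show ?thesis
 proof(rule trivial_decomposition)
  show "presented M (%_::complex. ps 0) (*) UNIV UNIV"
  proof
   show "carrier M=(%_::complex. ps 0) ` UNIV" unfolding P.carrier using ps by auto
   show "ps 0 \<oplus>\<^bsub>M\<^esub> ps 0 = ps 0" by(simp add:P.add)
   show "\<zero>\<^bsub>M\<^esub> = ps 0" by(rule P.zero)
   show "k \<odot>\<^bsub>M\<^esub> ps 0 = ps 0" for k using P.smult[of k 0] by(simp add:act_0)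
  qed (auto simp:subgrp_def)
  show "R_M (ps 0) = ps 0" using R_M_ps[of 0] ps by simp
  show "F_M l={ps 0}" for l unfolding F_M_eq using ps filt_0 by auto
 qed
qed

lemma crossing_decomposition: assumes K: "K~={}" and e: "!!i. i:K ==> 0 < e i"
  and tt: "tt=ga (mon (%i. if i:K then e i else 0))"
  and I: "I=ga ` {x. mon (%i. if i:K then 1 else 0) dvd x}" and al: "0<=al" "al < 1" shows "graded_decomp al"
proof -
 obtain i0 where i0: "i0:K" using K by auto
 define t where "t=mon (%i. if i:K then e i else 0)"
 define P where "P=mon (%i. if i:K then 1 else 0)"
 define m eps where "m=(%i. if i:K then cst (1 / of_nat (e i)) * z i else 1)" and "eps=(%i. if i:K then 1 else 0::'r)"
 have c: "cst (of_nat (e i)) * cst (1 / of_nat (e i))=1" if "i:K" for i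
  using e[OF that] by(simp add:cst_mult[symmetric] cst_1)
 have zP: "pd i P=0" if "i ~: K" for i
  using z_pd_mon[of i "%i. if i:K then 1 else 0"] z_regular[of i "pd i P"] that by(simp add:P_def)
 have zPK: "z i * pd i P=P" if "i:K" for i using z_pd_mon[of i "%i. if i:K then 1 else 0"] that by(simp add:P_def)
 have zt: "pd i t=0" if "i ~: K" for i
  using z_pd_mon[of i "%i. if i:K then e i else 0"] z_regular[of i "pd i t"] that by(simp add:t_def)
 have zdvd: "z i dvd x" if "rho i x=0" for i x using rho_split[of x i] that by auto
 have rhoP: "rho i P=0" if "i:K" for i using that by(simp add:P_def rho_mon)
 interpret log_frame z pd rho cst m eps i0 t
 proof unfold_locales
  fix i j :: 'd
  show "j~=i ==> pd j (m i)=0" by(auto simp:m_def pd_mult pd_cst pd_z pd_1)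
  show "m i * x=0 ==> x=0" for x
  proof(cases "i:K")
   case True
   assume "m i * x=0"
   hence "cst (1 / of_nat (e i)) * (z i * x)=0" using True by(simp add:m_def mult.assoc)
   hence "z i * x=0" using cst_unit[of "1 / of_nat (e i)"] e[OF True] by simp
   thus ?thesis by(rule z_regular)
  qed (simp add:m_def)
  show "m i * pd i t=eps i * t"
  proof(cases "i:K")
   case True
   have "m i * pd i t = cst (1 / of_nat (e i)) * (z i * pd i t)" using True by(simp add:m_def mult.assoc)
   also have "... = (cst (of_nat (e i)) * cst (1 / of_nat (e i))) * t"
    using True by(simp add:t_def z_pd_mon cst_of_nat mult_ac)
   finally show ?thesis using True by(simp add:c eps_def)
  qed (simp add:m_def eps_def zt)
  show "eps i=0 | eps i=1" "eps i0=1" using i0 by(auto simp:eps_def)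
  show "t * x=0 ==> x=0" for x unfolding t_def by(rule mon_regular)
 qed
 interpret log_model R \<kappa> I tt n z pd rho cst m eps i0 t ga
 proof unfold_locales
  fix th :: "'r=>'r"
  assume d: "derivation th"
  have th: "th (x + y)=th x + th y" "th (x * y)=x * th y + y * th x" "th (cst a)=0" for x y a
   using d by(simp_all add:derivation_def)
  have thP: "th x=(SUM j:UNIV. th (z j) * pd j x)" for x by(rule derivation_eq) (auto simp:th)
  have mz: "m i dvd x <-> (i:K --> z i dvd x)" for i x
  proof(cases "i:K")
   case True
   have "z i = cst (of_nat (e i)) * m i" using c[OF True] True by(simp add:m_def mult.assoc[symmetric])
   hence "m i dvd z i" by(metis dvd_triv_right)
   moreover have "z i dvd m i" using True by(simp add:m_def)
   ultimately show ?thesis using True dvd_trans by blast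
  qed (simp add:m_def)
  have I_iff: "ga x:I <-> P dvd x" for x by(auto simp:I P_def ga_eq_iff)
  show "(ALL x. ga x:I --> ga (th x):I) <-> (ALL i. m i dvd th (z i))"
  proof
   assume *: "ALL x. ga x:I --> ga (th x):I"
   \<comment> \<open>\<open>P\<close> divides \<open>th P\<close>. Setting \<open>z i\<close> to 0
     leaves the single term \<open>th (z i) * pd i P\<close>, whose second factor becomes a monomial
     in the other variables and can be cancelled; so \<open>th (z i)\<close> vanishes where
     \<open>z i\<close> does.\<close>
   show "ALL i. m i dvd th (z i)" unfolding mz
   proof(intro allI impI)
    fix i assume i: "i:K"
    have "P dvd th P" using * I_iff by simp
    hence "rho i (th P)=0" using rhoP[OF i] by(auto simp:rho_mult elim!:dvdE)
    moreover have "rho i (th P)=(SUM j:UNIV. rho i (th (z j) * pd j P))"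
     unfolding thP[of P] by(rule additive_sum) (rule rho_add)
    moreover have "... = (SUM j:UNIV. if j=i then rho i (th (z i)) * rho i (pd i P) else 0)"
    proof(rule sum.cong)
     fix j
     have "rho i (pd j P)=0" if "j~=i"
     proof(cases "j:K")
      case True
      have "z j * rho i (pd j P)=rho i (z j * pd j P)" using that by(simp add:rho_mult rho_z)
      hence "z j * rho i (pd j P)=0" using zPK[OF True] rhoP[OF i] by simp
      thus ?thesis by(rule z_regular)
     qed (simp add:zP rho_0)
     thus "rho i (th (z j) * pd j P)=(if j=i then rho i (th (z i)) * rho i (pd i P) else 0)" by(simp add:rho_mult)
    qed simp
    ultimately have "rho i (pd i P) * rho i (th (z i))=0" by(simp add:mult.commute)
    moreover have "rho i (pd i P)=mon (%j. if j:K - {i} then 1 else 0)"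
    proof -
     have "inc i (%j. if j:K - {i} then 1 else 0)=(%j. if j:K then 1 else 0)" using i by(auto simp:inc_def)
     hence "P=z i * mon (%j. if j:K - {i} then 1 else 0)" unfolding P_def by(metis mon_inc)
     hence "z i * (pd i P - mon (%j. if j:K - {i} then 1 else 0))=0" using zPK[OF i] by(simp add:right_diff_distrib)
     hence "pd i P=mon (%j. if j:K - {i} then 1 else 0)" using z_regular by fastforce
     thus ?thesis by(simp add:rho_mon)
    qed
    ultimately have "rho i (th (z i))=0" using mon_regular by simp
    thus "z i dvd th (z i)" by(rule zdvd)
   qed
  next
   assume *: "ALL i. m i dvd th (z i)"
   have "P dvd th P" unfolding thP[of P]
   proof(rule dvd_sum)
    fix j
    show "P dvd th (z j) * pd j P"
    proof(cases "j:K")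
     case True
     then obtain q where "th (z j)=z j * q" using * mz by(auto elim!:dvdE)
     hence "th (z j) * pd j P=P * q" using zPK[OF True] by(simp add:mult_ac)
     thus ?thesis by simp
    qed (simp add:zP)
   qed
   thus "ALL x. ga x:I --> ga (th x):I" unfolding I_iff by(auto simp:th elim!:dvdE[of P])
  qed
 qed (insert inj_ga carrier_R mult_ga add_ga one_ga zero_ga \<kappa>_ga card_d tt I, auto simp:t_def)
 interpret C: crossing z pd rho cst K e i0 by unfold_locales (use i0 e in auto)
 have f: "fr i x=m i * pd i x - (if i=i0 then 0 else eps i * (m i0 * pd i0 x))" for i x by(simp add:fr_def)
 have vf0: "vf (fr i0) X=C.euler (%_. 0) i0 X" for X
 proof(rule ev_eqI)
  show "ev (vf (fr i0) X) x=ev (C.euler (%_. 0) i0 X) x" for x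
   unfolding ev_vf[OF derivation_fr] f using i0 by(simp add:C.euler_def ev_add ev_act ev_der m_def cst_0)
 qed
 have vfi: "vf (fr i) X=C.rel (%_. 0) i X" if "i~=i0" for i X
 proof(rule ev_eqI)
  show "ev (vf (fr i) X) x=ev (C.rel (%_. 0) i X) x" for x unfolding ev_vf[OF derivation_fr] f using i0 that
   by(simp add:C.rel_def C.euler_def ev_add ev_diff ev_act ev_der m_def eps_def cst_0)
 qed
 have reli0: "C.rel (%_. 0) i0 X=0" for X using i0 by(simp add:C.rel_def)
 interpret G: germ_crossing R \<kappa> I tt n z pd rho cst K e i0 ps
 proof(intro germ_crossing.intro germ_crossing_axioms.intro C.crossing_axioms)
  show "presented M ps (%c. act (cst c)) UNIV UNIV" by(rule presented_M)
  show "F_M l = ps ` filt (l + int n)" for l by(rule F_M_eq)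
  show "R_M (ps X) = ps (C.euler (%_. 0) i0 X)" for X by(simp add:R_M_ps vf0)
  fix X
  have s: "(SUM i:UNIV. C.rel (%_. 0) i (F i))=(SUM i:UNIV - {i0}. vf (fr i) (F i))" for F
   unfolding sum_remove_i0 reli0 by(simp add:vfi)
  show "ps X = ps 0 <-> (EX Q. X - act (mon (%i. if i:K then e i else 0)) Q:C.rels (%_. 0))"
   unfolding ps_eq_iff JZ_def C.rels_def t_def[symmetric] s by(auto simp:diff_eq_eq algebra_simps image_iff)
 qed
 show ?thesis using al by(rule G.graded_decomp)
qed

end

subsection \<open>Holomorphic functions of several variables\<close>

abbreviation fd :: "(complex ^ 'd::finite=>complex)=>complex ^ 'd=>complex ^ 'd=>complex" where
 "fd g z == frechet_derivative g (at z)"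

lemma norm_cscale: "norm (c *s h) = cmod c * norm h" for h :: "complex ^ 'd::finite"
 by(simp add:norm_vec_def norm_mult L2_set_right_distrib)

lemma bounded_linear_cscale: "bounded_linear (%c. c *s h)" for h :: "complex ^ 'd::finite"
 by(rule bounded_linear_intro[where K = "norm h"]) (auto simp:vec_eq_iff algebra_simps norm_cscale)

lemma bounded_linear_axis: "bounded_linear (axis j::complex=>complex ^ 'd::finite)"
 unfolding linear_conv_bounded_linear[symmetric] by(rule linearI) (auto simp:vec_eq_iff axis_def)

lemma sum_axis: "x=(SUM j:UNIV. axis j (x $ j))" for x :: "complex ^ 'd::finite"
 by(simp add:vec_eq_iff axis_def if_distrib[of "%y. _ * y"] cong: if_cong)

lemma has_derivative_cvec:
 fixes f :: "'b::real_normed_vector=>complex ^ 'd::finite"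
 assumes "!!j. ((%x. f x $ j) has_derivative (%h. f' h $ j)) F" shows "(f has_derivative f') F"
proof -
 have "((%x. SUM j:UNIV. axis j (f x $ j)) has_derivative (%h. SUM j:UNIV. axis j (f' h $ j))) F"
  by(intro has_derivative_sum bounded_linear.has_derivative[OF bounded_linear_axis] assms)
 thus ?thesis by(simp only:sum_axis[symmetric])
qed

lemma bounded_linear_nth: "bounded_linear (%x. x $ j)" for x :: "complex ^ 'd::finite" by(rule bounded_linear_vec_nth)

lemma holoD: assumes "holomorphic_map S g" "z:S"
 shows "(g has_derivative fd g z) (at z)" "fd g z (c *s v) = c * fd g z v"
proof -
 obtain L where L: "(g has_derivative L) (at z)" "!!c v. L (c *s v) = c * L v"
  using assms by(auto simp:holomorphic_map_def)
 have "L=fd g z" using L(1) by(rule frechet_derivative_at)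
 with L show "(g has_derivative fd g z) (at z)" "fd g z (c *s v) = c * fd g z v" by auto
qed

lemma holoI: assumes "!!z. z:S ==> (g has_derivative L z) (at z)" "!!z c v. z:S ==> L z (c *s v) = c * L z v"
 shows "holomorphic_map S g" using assms unfolding holomorphic_map_def by blast

lemma holo_subset: "holomorphic_map S g ==> T<=S ==> holomorphic_map T g" by(auto simp:holomorphic_map_def)

lemma holo_continuous: "holomorphic_map S g ==> continuous_on S g"
 by(intro continuous_at_imp_continuous_on ballI) (rule has_derivative_continuous[OF holoD(1)])

lemma fd_linear: "holomorphic_map S g ==> z:S ==> bounded_linear (fd g z)"
 by(rule has_derivative_bounded_linear[OF holoD(1)])

lemma holo_cong: assumes "holomorphic_map S g" "open S" "!!z. z:S ==> h z=g z" shows "holomorphic_map S h"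
proof(rule holoI[of S h "fd g"])
 show "(h has_derivative fd g z) (at z)" if "z:S" for z
  by(rule has_derivative_transform_within_open[OF holoD(1)[OF assms(1) that] assms(2) that]) (simp add:assms(3))
qed (rule holoD[OF assms(1)])

lemma holo_const: "holomorphic_map S (%_. c)" by(rule holoI) (auto intro:derivative_eq_intros)

lemma holo_nth: "holomorphic_map S (%z. z $ j)"
 by(rule holoI[of _ _ "%_ h. h $ j"]) (auto intro:bounded_linear_imp_has_derivative bounded_linear_nth)

lemma holo_add: "holomorphic_map S g ==> holomorphic_map S h ==> holomorphic_map S (%z. g z + h z)"
 by(rule holoI[of _ _ "%z v. fd g z v + fd h z v"])
  (auto intro!:has_derivative_add holoD(1) simp:holoD(2) distrib_left)

lemma holo_mult: "holomorphic_map S g ==> holomorphic_map S h ==> holomorphic_map S (%z. g z * h z)"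
 by(rule holoI[of _ _ "%z v. g z * fd h z v + fd g z v * h z"])
  (rule has_derivative_mult[OF holoD(1) holoD(1)], assumption+, simp add:holoD(2) algebra_simps)

lemma holo_minus: "holomorphic_map S g ==> holomorphic_map S (%z. - g z)"
 using holo_mult[OF holo_const[of S "-1"], of g] by simp

lemma holo_compose:
 fixes p :: "complex ^ 'e::finite=>complex ^ 'd::finite"
 assumes p: "!!j. holomorphic_map T (%z. p z $ j)" and g: "holomorphic_map S g" and pT: "p ` T<=S"
 shows "holomorphic_map T (%z. g (p z))" "z:T ==> fd (%z. g (p z)) z v=fd g (p z) (\<chi> j. fd (%z. p z $ j) z v)"
proof -
 let ?P = "%z v. \<chi> j. fd (%z. p z $ j) z v"
 have P: "(p has_derivative ?P z) (at z)" if "z:T" for z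
  by(rule has_derivative_cvec) (use holoD(1)[OF p that] in simp)
 have D: "((%z. g (p z)) has_derivative (%v. fd g (p z) (?P z v))) (at z)" if "z:T" for z
  by(rule has_derivative_compose[OF P[OF that]]) (insert that pT, auto intro!:holoD(1)[OF g])
 have c: "?P z (c *s v) = c *s ?P z v" if "z:T" for z c v using holoD(2)[OF p that] by(simp add:vec_eq_iff)
 show "holomorphic_map T (%z. g (p z))" by(rule holoI[OF D]) (insert c holoD(2)[OF g] pT, auto simp:image_subset_iff)
 show "z:T ==> fd (%z. g (p z)) z v=fd g (p z) (?P z v)" using frechet_derivative_at[OF D] by metis
qed

lemma holo_compose1: assumes "holomorphic_map S g" "F holomorphic_on T" "open T" "g ` S<=T"
 shows "holomorphic_map S (%z. F (g z))" "z:S ==> fd (%z. F (g z)) z v=deriv F (g z) * fd g z v"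
proof -
 have D: "((%z. F (g z)) has_derivative (%v. deriv F (g z) * fd g z v)) (at z)" if "z:S" for z
 proof(rule has_derivative_compose[OF holoD(1)[OF assms(1) that]])
  show "(F has_derivative (*) (deriv F (g z))) (at (g z))"
   using holomorphic_derivI[OF assms(2,3), of "g z"] that assms(4) by(auto simp:has_field_derivative_def)
 qed
 show "holomorphic_map S (%z. F (g z))" by(rule holoI[OF D]) (auto simp:holoD(2)[OF assms(1)])
 show "z:S ==> fd (%z. F (g z)) z v=deriv F (g z) * fd g z v" using frechet_derivative_at[OF D] by metis
qed

lemma line_derivative: assumes "holomorphic_map S g" "z + c *s h:S"
 shows "((%c. g (z + c *s h)) has_field_derivative fd g (z + c *s h) h) (at c)"
proof -
 have "((%c. z + c *s h) has_derivative (%c. c *s h)) (at c)"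
  using bounded_linear.has_derivative[OF bounded_linear_cscale has_derivative_ident, of h]
  by(auto intro!:derivative_eq_intros)
 from has_derivative_compose[OF this holoD(1)[OF assms]]
 show ?thesis by(simp add:has_field_derivative_def holoD(2)[OF assms] mult_commute_abs)
qed

lemma line_holomorphic:
 assumes "holomorphic_map S g" "!!c. c:T ==> z + c *s h:S" shows "(%c. g (z + c *s h)) holomorphic_on T"
 by(rule holomorphic_onI, rule field_differentiable_at_within)
  (use line_derivative[OF assms(1) assms(2)] in \<open>unfold field_differentiable_def, blast\<close>)

text \<open>By definition a holomorphic map is merely differentiable, so continuity of the
  derivative comes from Cauchy's estimate on lines: the difference of \<open>g (z + c *s h)\<close>
  and \<open>g (z0 + c *s h)\<close> is uniformly small for \<open>c\<close> in a disc, hence so is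
  its derivative at 0. The Leibniz rule below depends on this.\<close>

lemma fd_continuous:
 fixes g :: "complex ^ 'd::finite=>complex"
 assumes g: "holomorphic_map S g" and S: "open S" shows "continuous_on S (%z. fd g z h)"
proof(cases "h=0")
 case True
 have "fd g z h=0" if "z:S" for z using True fd_linear[OF g that] by(simp add:linear_simps)
 thus ?thesis using continuous_on_cong[OF refl, of S "%z. fd g z h" "%_. 0"] by simp
next
 case False
 show ?thesis unfolding continuous_on_iff
 proof(intro ballI allI impI)
  fix z0 and ep :: real assume z0: "z0:S" and ep: "ep > 0"
  obtain ro where ro: "ro > 0" "cball z0 (2 * ro)<=S"
  proof -
   obtain e where "e > 0" "cball z0 e<=S" using S z0 open_contains_cball by blast
   thus ?thesis by(intro that[of "e / 2"]) auto
  qed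
  define r where "r=ro / norm h"
  have r: "r > 0" using ro False by(simp add:r_def)
  have "uniformly_continuous_on (cball z0 (2 * ro)) g"
   by(rule compact_uniformly_continuous) (use holo_continuous[OF g] ro continuous_on_subset in auto)
  then obtain dl where dl: "dl > 0" "!!x y. x:cball z0 (2 * ro) ==> y:cball z0 (2 * ro) ==> dist y x < dl ==> dist (g
   y) (g x) < ep / 2 * r"
  proof -
   have e: "0 < ep / 2 * r" using ep r by simp
   assume "uniformly_continuous_on (cball z0 (2 * ro)) g"
   from this[unfolded uniformly_continuous_on_def, rule_format, OF e] show ?thesis using that by blast
  qed
  show "EX d>0. ALL z:S. dist z z0 < d --> dist (fd g z h) (fd g z0 h) < ep"
  proof(intro exI[of _ "min dl ro"] conjI ballI impI)
   fix z assume z: "z:S" "dist z z0 < min dl ro"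
   have m: "z + c *s h:cball z0 (2 * ro)" "z0 + c *s h:cball z0 (2 * ro)" if "norm c<=r" for c
   proof -
    have "norm (c *s h)<=ro" using mult_right_mono[OF that norm_ge_zero[of h]] False by(simp add:norm_cscale r_def)
    moreover have "norm (z - z0 + c *s h)<=norm (z - z0) + norm (c *s h)" by(rule norm_triangle_ineq)
    ultimately show "z + c *s h:cball z0 (2 * ro)" "z0 + c *s h:cball z0 (2 * ro)"
     using z ro by(auto simp:dist_norm norm_minus_commute algebra_simps)
   qed
   define ph where "ph=(%c. g (z + c *s h) - g (z0 + c *s h))"
   have hol: "ph holomorphic_on cball 0 r"
    unfolding ph_def by(intro holomorphic_on_diff line_holomorphic[OF g]) (use m ro in auto)
   have "((%c. g (z + c *s h) - g (z0 + c *s h)) has_field_derivative (fd g z h - fd g z0 h)) (at 0)"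
    using DERIV_diff[OF line_derivative[OF g, of z 0 h] line_derivative[OF g, of z0 0 h]] z z0 by simp
   hence d: "deriv ph 0=fd g z h - fd g z0 h" unfolding ph_def by(rule DERIV_imp_deriv)
   have "norm ((deriv ^^ 1) ph 0)<=fact 1 * (ep / 2 * r) / r ^ 1"
   proof(rule Cauchy_inequality)
    fix c :: complex assume "norm (0 - c)=r"
    thus "norm (ph c)<=ep / 2 * r"
     using m[of c] dl(2)[of "z0 + c *s h" "z + c *s h"] z by(simp add:ph_def dist_norm less_imp_le)
   qed (insert hol r, auto intro:holomorphic_on_subset holomorphic_on_imp_continuous_on)
   hence "norm (fd g z h - fd g z0 h)<=ep / 2" using r d by simp
   thus "dist (fd g z h) (fd g z0 h) < ep" using ep by(simp add:dist_norm)
  qed (use dl ro in auto)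
 qed
qed

lemma continuous_on_section:
 assumes "continuous_on (U \<times> T) (%(z, s). k z s)" "z:U" shows "continuous_on T (k z)"
proof -
 have "continuous_on T (Pair z)" by(rule continuous_on_Pair[OF continuous_on_const continuous_on_id])
 thus ?thesis using continuous_on_compose2[OF assms(1), of T "Pair z"] assms(2) by auto
qed

text \<open>Differentiation under the integral sign, for points \<open>p z s\<close> whose
  derivative in \<open>z\<close> does not depend on \<open>z\<close>. It is applied to the circles
  of Cauchy's formula and to the segments in the division by a coordinate.\<close>

lemma holo_integral:
 fixes p :: "complex ^ 'd::finite=>real=>complex ^ 'd"
 assumes g: "holomorphic_map S g" and S: "open S" and U: "open U" "convex U"
  and pS: "!!z s. z:U ==> s:{0..1} ==> p z s:S" and pc: "continuous_on (U \<times> {0..1}) (%(z, s). p z s)"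
  and pd: "!!z s. z:U ==> s:{0..1} ==> ((%z. p z s) has_derivative A s) (at z)"
  and Ac: "!!h. continuous_on {0..1} (%s. A s h)" and Al: "!!s c h. s:{0..1} ==> A s (c *s h) = c *s A s h"
  and c: "continuous_on {0..1} c" shows "holomorphic_map U (%z. integral {0..1} (%s. c s * g (p z s)))"
proof(cases "U={}")
 case True thus ?thesis by(simp add:holomorphic_map_def)
next
 case False
 then obtain u where u: "u:U" by auto
 have Ab: "bounded_linear (A s)" if "s:{0..1}" for s using pd[OF u that] by(rule has_derivative_bounded_linear)
 define G where "G=(%z. Blinfun (fd g z))"
 define B where "B=(%s. Blinfun (A s))"
 have G: "blinfun_apply (G z)=fd g z" if "z:S" for z
  unfolding G_def by(rule bounded_linear_Blinfun_apply) (rule fd_linear[OF g that])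
 have B: "blinfun_apply (B s)=A s" if "s:{0..1}" for s
  unfolding B_def by(rule bounded_linear_Blinfun_apply) (rule Ab[OF that])
 have Gc: "continuous_on S G"
  by(intro continuous_on_blinfun_componentwise) (rule continuous_on_eq[OF fd_continuous[OF g S]], simp add:G)
 have Bc: "continuous_on {0..1} B"
  by(intro continuous_on_blinfun_componentwise) (rule continuous_on_eq[OF Ac], simp add:B)
 define fx where "fx=(%z s. blinfun_mult_right (c s) o\<^sub>L (G (p z s) o\<^sub>L B s))"
 have fx: "blinfun_apply (fx z s) h = c s * fd g (p z s) (A s h)" if "z:U" "s:{0..1}" for z s h
  using that by(simp add:fx_def G pS B)
 have pz: "continuous_on {0..1} (p z)" if "z:U" for z using continuous_on_section[OF pc that] .
 have fxc: "continuous_on (U \<times> {0..1}) (%(z, s). fx z s)"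
 proof -
  have 1: "continuous_on (U \<times> {0..1}) (%x. G (p (fst x) (snd x)))"
   by(rule continuous_on_compose2[OF Gc]) (insert pc pS, auto simp:case_prod_unfold)
  have 2: "continuous_on (U \<times> {0..1}) (%x. B (snd x))"
   by(rule continuous_on_compose2[OF Bc]) (auto intro!:continuous_intros)
  have 3: "continuous_on (U \<times> {0..1}) (%x. blinfun_mult_right (c (snd x)))"
   by(intro bounded_linear.continuous_on[OF bounded_linear_blinfun_mult_right] continuous_on_compose2[OF c])
    (auto intro!:continuous_intros)
  show ?thesis unfolding fx_def case_prod_unfold
   by(intro bounded_bilinear.continuous_on[OF bounded_bilinear_blinfun_compose] 1 2 3)
 qed
 have D: "((%z. integral {0..1} (%s. c s * g (p z s))) has_derivative integral {0..1} (fx z)) (at z)" if z: "z:U" for z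
 proof -
  have "((%z. integral (cbox 0 1) (%s. c s * g (p z s))) has_derivative integral (cbox 0 1) (fx z)) (at z within U)"
  proof(rule leibniz_rule[OF _ _ _ z U(2)])
   fix x :: "complex ^ 'd" and s :: real assume x: "x:U" "s:cbox 0 1"
   hence s: "s:{0..1}" by simp
   have "((%x. c s * g (p x s)) has_derivative (%h. c s * fd g (p x s) (A s h))) (at x)"
    by(intro has_derivative_mult_right has_derivative_compose[OF pd[OF x(1) s]] holoD(1)[OF g] pS x s)
   moreover have "blinfun_apply (fx x s)=(%h. c s * fd g (p x s) (A s h))" using fx[OF x(1) s] by auto
   ultimately show "((%x. c s * g (p x s)) has_derivative blinfun_apply (fx x s)) (at x within U)"
    by(simp add:has_derivative_at_withinI)
  next
   fix x assume x: "x:U"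
   show "(%s. c s * g (p x s)) integrable_on cbox 0 1" by(rule integrable_continuous)
     (auto intro!:continuous_intros c continuous_on_compose2[OF holo_continuous[OF g] pz[OF x]] pS[OF x])
  qed (use fxc in simp)
  thus ?thesis using at_within_open[OF z U(1)] by simp
 qed
 show ?thesis
 proof(rule holoI[OF D])
  fix z a v assume z: "z:U"
  have i: "fx z integrable_on {0..1}" by(rule integrable_continuous_real) (rule continuous_on_section[OF fxc z])
  have e: "blinfun_apply (integral {0..1} (fx z)) h=integral {0..1} (%s. blinfun_apply (fx z s) h)" for h
   using integral_linear[OF i blinfun.bounded_linear_left[of h]] by(simp add:o_def)
  have "integral {0..1} (%s. blinfun_apply (fx z s) (a *s v))=integral {0..1} (%s. a * blinfun_apply (fx z s) v)"
  proof(rule integral_cong)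
   fix s :: real assume s: "s:{0..1}"
   thus "blinfun_apply (fx z s) (a *s v)=a * blinfun_apply (fx z s) v"
    using z by(simp add:fx Al holoD(2)[OF g pS[OF z s]])
  qed
  thus "blinfun_apply (integral {0..1} (fx z)) (a *s v)=a * blinfun_apply (integral {0..1} (fx z)) v" by(simp add:e)
 qed
qed

lemma holo_local: assumes "!!z. z:S ==> EX U. z:U & holomorphic_map U g" shows "holomorphic_map S g"
 using assms by(force simp:holomorphic_map_def)

text \<open>Cauchy's formula on the line in direction \<open>h\<close>. The derivative of the circle
  path is \<open>2 pi i\<close> times the path, which explains the path in the numerator.\<close>

lemma fd_integral:
 fixes g :: "complex ^ 'd::finite=>complex"
 assumes g: "holomorphic_map S g" and r: "r > 0" and zS: "!!c. norm c<=r ==> z + c *s h:S"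
 shows "fd g z h=integral {0..1} (%s. circlepath 0 r s / (circlepath 0 r s)\<^sup>2 * g (z + circlepath 0 r s *s h))"
proof -
 define ph where "ph=(%c. g (z + c *s h))"
 have hol: "ph holomorphic_on cball 0 r" unfolding ph_def by(rule line_holomorphic[OF g]) (use zS in auto)
 have "deriv ph 0=fd g z h"
  unfolding ph_def by(rule DERIV_imp_deriv) (use line_derivative[OF g, of z 0 h] zS[of 0] r in simp)
 moreover have "((%u. ph u / (u - 0) ^ Suc 1) has_contour_integral (2 * pi * \<i>) / fact 1 * (deriv ^^ 1) ph 0)
  (circlepath 0 r)"
  by(rule Cauchy_has_contour_integral_higher_derivative_circlepath)
   (insert hol r, auto intro:holomorphic_on_subset holomorphic_on_imp_continuous_on)
 ultimately have "((%s. ph (circlepath 0 r s) / (circlepath 0 r s)\<^sup>2 * vector_derivative (circlepath 0 r) (at s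
  within {0..1})) has_integral 2 * pi * \<i> * fd g z h) {0..1}"
  by(simp add:has_contour_integral_def power2_eq_square)
 from has_integral_mult_right[OF this, of "1 / (2 * pi * \<i>)"]
 have "((%s. 1 / (2 * pi * \<i>) * (ph (circlepath 0 r s) / (circlepath 0 r s)\<^sup>2 * vector_derivative
  (circlepath 0 r) (at s within {0..1}))) has_integral fd g z h) {0..1}" by simp
 moreover have "vector_derivative (circlepath 0 r) (at s within {0..1})=2 * pi * \<i> * circlepath 0 r s" if "s:{0..1}" for s
  using that vector_derivative_circlepath01[of s 0 r] by(simp add:circlepath)
 ultimately have "((%s. circlepath 0 r s / (circlepath 0 r s)\<^sup>2 * g (z + circlepath 0 r s *s h)) has_integral
  fd g z h) {0..1}"
  by(elim has_integral_eq[rotated]) (simp add:ph_def mult_ac)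
 thus ?thesis by(simp add:integral_unique)
qed

lemma holo_fd:
 fixes g :: "complex ^ 'd::finite=>complex"
 assumes g: "holomorphic_map S g" and S: "open S" shows "holomorphic_map S (%z. fd g z h)"
proof(cases "h=0")
 case True
 have "fd g z h=0" if "z:S" for z using True fd_linear[OF g that] by(simp add:linear_simps)
 thus ?thesis using holo_cong[OF holo_const S] by metis
next
 case False
 show ?thesis
 proof(rule holo_local)
  fix z0 assume z0: "z0:S"
  obtain ro where ro: "ro > 0" "cball z0 (2 * ro)<=S"
  proof -
   obtain e where "e > 0" "cball z0 e<=S" using S z0 open_contains_cball by blast
   thus ?thesis by(intro that[of "e / 2"]) auto
  qed
  define r where "r=ro / norm h"
  have r: "r > 0" using ro False by(simp add:r_def)
  have m: "z + c *s h:S" if "z:ball z0 ro" "norm c<=r" for c z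
  proof -
   have "norm (c *s h)<=ro" using mult_right_mono[OF that(2) norm_ge_zero[of h]] False by(simp add:norm_cscale r_def)
   moreover have "norm (z - z0 + c *s h)<=norm (z - z0) + norm (c *s h)" by(rule norm_triangle_ineq)
   ultimately have "z + c *s h:cball z0 (2 * ro)" using that by(auto simp:dist_norm norm_minus_commute algebra_simps)
   thus ?thesis using ro by blast
  qed
  let ?ga = "circlepath 0 r"
  have n: "norm (?ga s)<=r" "?ga s~=0" for s using r by(simp_all add:circlepath norm_mult)
  have c: "continuous_on T ?ga" for T unfolding circlepath by(intro continuous_intros)
  have "holomorphic_map (ball z0 ro) (%z. integral {0..1} (%s. ?ga s / (?ga s)\<^sup>2 * g (z + ?ga s *s h)))"
  proof(rule holo_integral[OF g S, where A = "%s h. h"])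
   show "z + ?ga s *s h:S" if "z:ball z0 ro" for z s by(rule m[OF that n(1)])
   show "continuous_on (ball z0 ro \<times> {0..1}) (%(z, s). z + ?ga s *s h)" unfolding case_prod_unfold
    by(intro continuous_intros bounded_linear.continuous_on[OF bounded_linear_cscale] continuous_on_compose2[OF c[of
     UNIV]]) auto
   show "continuous_on {0..1} (%s. ?ga s / (?ga s)\<^sup>2)" using n by(intro continuous_intros c) auto
  qed (auto intro!:derivative_eq_intros)
  hence "holomorphic_map (ball z0 ro) (%z. fd g z h)" by(rule holo_cong) (use fd_integral[OF g r] m in auto)
  thus "EX U. z0:U & holomorphic_map U (%z. fd g z h)" using ro by(intro exI[of _ "ball z0 ro"]) auto
 qed
qed

text \<open>For \<open>s = 0\<close> this is the projection to a coordinate hyperplane; real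
  \<open>s\<close> between 0 and 1 give the segment from there to \<open>z\<close>.\<close>

definition scl :: "'d=>complex=>complex ^ 'd::finite=>complex ^ 'd" where
 "scl i s z=(\<chi> j. if j=i then s * z $ j else z $ j)"

lemma scl_nth [simp]: "scl i s z $ j=(if j=i then s * z $ j else z $ j)" by(simp add:scl_def)
lemma scl_1: "scl i 1 z=z" by(simp add:vec_eq_iff)

lemma bounded_linear_scl: "bounded_linear (scl i s)"
 unfolding linear_conv_bounded_linear[symmetric] by(rule linearI) (auto simp:vec_eq_iff algebra_simps)

lemma norm_scl: "norm s<=1 ==> norm (scl i s z)<=norm z"
 by(rule norm_le_componentwise_cart) (auto simp:norm_mult mult_left_le_one_le)

lemma scl_line: "scl i s z = scl i 0 z + s *s axis i (z $ i)" by(auto simp:vec_eq_iff axis_def)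

text \<open>The quotient is \<open>\<integral> \<partial>\<^sub>i g\<close> along the segment from the projection of a point to the point.\<close>

lemma holomorphic_division:
 fixes g :: "complex ^ 'd::finite=>complex" assumes g: "holomorphic_map (ball 0 ro) g"
 shows "EX q. holomorphic_map (ball 0 ro) q & (ALL z:ball 0 ro. g z=g (scl i 0 z) + z $ i * q z)"
proof(intro exI conjI ballI)
 let ?q = "%z. integral {0..1} (%s::real. 1 * fd g (scl i (of_real s) z) (axis i 1))"
 have b: "scl i (of_real s) z:ball 0 ro" if "z:ball 0 ro" "s:{0..1}" for z and s :: real
  using norm_scl[of "of_real s" i z] that by simp
 show "holomorphic_map (ball 0 ro) ?q"
 proof(rule holo_integral[where p = "%z s. scl i (of_real s) z" and A = "%s. scl i (of_real s)"])
  show "continuous_on (ball 0 ro \<times> {0..1}) (%(z, s). scl i (of_real s) z)"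
  proof -
   have "continuous_on T (%x. if j=i then complex_of_real (snd x) * fst x $ j else fst x $ j)"
    for T :: "((complex ^ 'd) \<times> real) set" and j by(cases "j=i") (auto intro!:continuous_intros)
   thus ?thesis unfolding case_prod_unfold scl_def by(intro continuous_on_vec_lambda)
  qed
  show "continuous_on {0..1} (%s. scl i (of_real s) h)" for h :: "complex ^ 'd" unfolding scl_line[of i "of_real _"]
   by(intro continuous_intros bounded_linear.continuous_on[OF bounded_linear_cscale])
  show "((%z. scl i (of_real s) z) has_derivative scl i (of_real s)) (at z)" for s :: real and z
   by(rule bounded_linear_imp_has_derivative[OF bounded_linear_scl])
  show "holomorphic_map (ball 0 ro) (%z. fd g z (axis i 1))" by(rule holo_fd[OF g open_ball])
 qed (insert b, auto simp:vec_eq_iff)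
 fix z :: "complex ^ 'd" assume z: "z:ball 0 ro"
 have "((%s. fd g (scl i (of_real s) z) (axis i (z $ i))) has_integral (g (scl i (of_real 1) z) - g (scl i (of_real
  0) z))) {0..1::real}"
 proof(rule fundamental_theorem_of_calculus)
  fix s :: real assume s: "s:{0..1}"
  have "((%c. g (scl i 0 z + c *s axis i (z $ i))) has_field_derivative fd g (scl i (of_real s) z) (axis i (z $ i)))
   (at (of_real s))"
   using line_derivative[OF g, of "scl i 0 z" "of_real s"] b[OF z s] scl_line[of i "of_real s" z] by simp
  from has_vector_derivative_real_field[OF this]
  show "((%s. g (scl i (of_real s) z)) has_vector_derivative fd g (scl i (of_real s) z) (axis i (z $ i))) (at s
   within {0..1})"
   by(subst scl_line)
 qed simp
 hence "integral {0..1} (%s::real. fd g (scl i (of_real s) z) (axis i (z $ i)))=g z - g (scl i 0 z)"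
  using scl_1[of i z] by(simp add:integral_unique)
 moreover have "integral {0..1} (%s::real. fd g (scl i (of_real s) z) (axis i (z $ i)))=integral {0..1} (%s::real. z
  $ i * fd g (scl i (of_real s) z) (axis i 1))"
 proof(rule integral_cong)
  fix s :: real assume s: "s:{0..1}"
  have "axis i (z $ i)=z $ i *s axis i 1" by(simp add:vec_eq_iff axis_def)
  thus "fd g (scl i (of_real s) z) (axis i (z $ i))=z $ i * fd g (scl i (of_real s) z) (axis i 1)"
   using holoD(2)[OF g b[OF z s]] by simp
 qed
 ultimately show "g z=g (scl i 0 z) + z $ i * ?q z" by simp
qed

subsection \<open>Germs of holomorphic functions\<close>

definition hol :: "(complex ^ 'd::finite=>complex)=>bool" where
 "hol g <-> (EX ro>0. holomorphic_map (ball 0 ro) g)"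

lemma holI: "ro > 0 ==> holomorphic_map (ball 0 ro) g ==> hol g" by(auto simp:hol_def)

lemma hol_common: assumes "hol g" "hol h" "\<forall>\<^sub>F z in nhds 0. P z"
 obtains ro where "ro > 0" "holomorphic_map (ball 0 ro) g" "holomorphic_map (ball 0 ro) h" "!!z. z:ball 0 ro ==> P z"
proof -
 obtain a b c where "a > 0" "b > 0" "c > 0" "holomorphic_map (ball 0 a) g" "holomorphic_map (ball 0 b) h"
  "ALL z. dist z 0 < c --> P z" using assms unfolding hol_def eventually_nhds_metric by blast
 thus ?thesis by(intro that[of "min a (min b c)"]) (auto intro:holo_subset simp:dist_commute)
qed

lemma holE: assumes "hol g" obtains ro where "ro > 0" "holomorphic_map (ball 0 ro) g"
 using assms by(auto simp:hol_def)

lemma hol_simps [simp]: "hol (%z. c)" "hol (%z. z $ i)"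
 "hol g ==> hol h ==> hol (%z. g z + h z)" "hol g ==> hol h ==> hol (%z. g z * h z)"
 "hol g ==> hol (%z. - g z)" "hol g ==> hol h ==> hol (%z. g z - h z)"
proof -
 show add:"hol (%z. g z + h z)" if "hol g" "hol h" for g h :: "complex ^ 'd=>complex"
  by(rule hol_common[OF that, of "%_. True"]) (auto intro:holI holo_add)
 show "hol (%z. g z * h z)" if "hol g" "hol h" for g h :: "complex ^ 'd=>complex"
  by(rule hol_common[OF that, of "%_. True"]) (auto intro:holI holo_mult)
 show m: "hol (%z. - g z)" if "hol g" for g :: "complex ^ 'd=>complex" using that holo_minus by(auto simp:hol_def)
 show "hol (%z. g z - h z)" if "hol g" "hol h" for g h :: "complex ^ 'd=>complex"
  using add[OF that(1) m[OF that(2)]] by simp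
 show "hol (%z. c)" "hol (%z. z $ i)" by(rule holI[of 1], simp, rule holo_const, rule holI[of 1], simp, rule holo_nth)
qed

lemma holo_scl: assumes g: "holomorphic_map (ball 0 ro) g" shows "holomorphic_map (ball 0 ro) (%z. g (scl i 0 z))"
  "z:ball 0 ro ==> fd (%z. g (scl i 0 z)) z v=fd g (scl i 0 z) (scl i 0 v)"
proof -
 have b: "scl i 0 z:ball 0 ro" if "z:ball 0 ro" for z using norm_scl[of 0 i z] that by simp
 have D: "((%z. g (scl i 0 z)) has_derivative (%v. fd g (scl i 0 z) (scl i 0 v))) (at z)" if "z:ball 0 ro" for z
  using has_derivative_compose[OF bounded_linear_imp_has_derivative[OF bounded_linear_scl] holoD(1)[OF g b[OF that]]] .
 have c: "scl i 0 (c *s v) = c *s scl i 0 v" for c v by(simp add:vec_eq_iff)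
 show "holomorphic_map (ball 0 ro) (%z. g (scl i 0 z))" by(rule holoI[OF D]) (simp_all add:c holoD(2)[OF g b])
 show "z:ball 0 ro ==> fd (%z. g (scl i 0 z)) z v=fd g (scl i 0 z) (scl i 0 v)"
  using frechet_derivative_at[OF D] by metis
qed

lemma hol_fd [simp]: "hol g ==> hol (%z. fd g z h)" by(elim holE) (rule holI[OF _ holo_fd[OF _ open_ball]])
lemma hol_scl [simp]: "hol g ==> hol (%z. g (scl i 0 z))" by(elim holE) (rule holI[OF _ holo_scl(1)])

lemma fd_cong: assumes "holomorphic_map S g" "open S" "z:S" "!!z. z:S ==> h z=g z" shows "fd h z=fd g z"
proof -
 have "(h has_derivative fd g z) (at z)"
  by(rule has_derivative_transform_within_open[OF holoD(1)[OF assms(1,3)] assms(2,3)]) (simp add:assms(4))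
 thus ?thesis by(rule frechet_derivative_at[symmetric])
qed

text \<open>Germs at 0 form a type that depends only on the dimension, so that it can be an instance
  of \<open>comm_ring_1\<close>. The stalks on \<open>X\<close> are identified with it by
  coordinates.\<close>

typedef (overloaded) ('d::finite) hgerm =
 "{G::(complex ^ 'd=>complex) set. EX g. hol g & G={h. \<forall>\<^sub>F z in nhds 0. h z=g z}}"
 using hol_simps(1) by blast

definition gm :: "(complex ^ 'd::finite=>complex)=>'d hgerm" where
 "gm g=Abs_hgerm {h. \<forall>\<^sub>F z in nhds 0. h z=g z}"

definition rp :: "'d::finite hgerm=>complex ^ 'd=>complex" where
 "rp G=(SOME g. hol g & gm g=G)"

lemma rp [simp]: "hol (rp G)" "gm (rp G)=G"
proof -
 have "EX g. hol g & gm g=G" using Rep_hgerm[of G] Rep_hgerm_inverse[of G] by(auto simp:gm_def)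
 from someI_ex[OF this] show "hol (rp G)" "gm (rp G)=G" by(auto simp:rp_def)
qed

lemma gm_eqI: "\<forall>\<^sub>F z in nhds 0. g z=h z ==> gm g=gm h"
proof -
 assume *: "\<forall>\<^sub>F z in nhds 0. g z=h z"
 have "(\<forall>\<^sub>F z in nhds 0. k z=g z) <-> (\<forall>\<^sub>F z in nhds 0. k z=h z)" for k
  using eventually_elim2[OF *] by(auto elim:eventually_elim2[OF *])
 thus ?thesis by(simp add:gm_def)
qed

lemma gm_eq_iff: assumes "hol g" "hol h" shows "gm g=gm h <-> (\<forall>\<^sub>F z in nhds 0. g z=h z)"
proof
 assume "gm g=gm h"
 hence "{k. \<forall>\<^sub>F z in nhds 0. k z=g z}={k. \<forall>\<^sub>F z in nhds 0. k z=h z}"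
  unfolding gm_def using assms by(subst (asm) Abs_hgerm_inject) auto
 hence "g:{k. \<forall>\<^sub>F z in nhds 0. k z=h z}" by auto
 thus "\<forall>\<^sub>F z in nhds 0. g z=h z" by simp
qed (rule gm_eqI)

lemma rp_gm: "hol g ==> \<forall>\<^sub>F z in nhds 0. rp (gm g) z=g z" using gm_eq_iff[of "rp (gm g)" g] by simp

lemma gm_ballI: "ro > 0 ==> (!!z. z:ball 0 ro ==> g z=h z) ==> gm g=gm h"
 by(rule gm_eqI) (auto simp:eventually_nhds_metric dist_commute)

lemma hgerm_cases [case_names gm]: obtains g where "hol g" "G=gm g" using rp[of G] by metis

instantiation hgerm :: (finite) comm_ring_1
begin

definition "0=gm (%_. 0)"
definition "1=gm (%_. 1)"
definition "G + H=gm (%z. rp G z + rp H z)"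
definition "G * H=gm (%z. rp G z * rp H z)"
definition "- G=gm (%z. - rp G z)" for G :: "'a hgerm"
definition "G - H=gm (%z. rp G z - rp H z)"

lemma gm_plus: assumes "hol g" "hol h" shows "gm g + gm h=gm (%z. g z + h z)"
 unfolding plus_hgerm_def by(rule gm_eqI) (use rp_gm[OF assms(1)] rp_gm[OF assms(2)] in \<open>eventually_elim, simp\<close>)

lemma gm_times: assumes "hol g" "hol h" shows "gm g * gm h=gm (%z. g z * h z)"
 unfolding times_hgerm_def by(rule gm_eqI) (use rp_gm[OF assms(1)] rp_gm[OF assms(2)] in \<open>eventually_elim,
  simp\<close>)

lemma gm_uminus: assumes "hol g" shows "- gm g=gm (%z. - g z)"
 unfolding uminus_hgerm_def by(rule gm_eqI) (use rp_gm[OF assms] in \<open>eventually_elim, simp\<close>)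

lemma gm_minus: assumes "hol g" "hol h" shows "gm g - gm h=gm (%z. g z - h z)"
 unfolding minus_hgerm_def by(rule gm_eqI) (use rp_gm[OF assms(1)] rp_gm[OF assms(2)] in \<open>eventually_elim,
  simp\<close>)

lemmas gm_simps = gm_plus gm_times gm_uminus gm_minus zero_hgerm_def one_hgerm_def

instance
proof
 fix a b c :: "'a hgerm"
 obtain f g h where gm: "hol f" "a=gm f" "hol g" "b=gm g" "hol h" "c=gm h"
  by(rule hgerm_cases[of a], rule hgerm_cases[of b], rule hgerm_cases[of c]) blast
 show "a + b + c=a + (b + c)" "a + b=b + a" "0 + a=a" "- a + a=0" "a - b=a + - b"
  "a * b * c=a * (b * c)" "a * b=b * a" "1 * a=a" "(a + b) * c=a * c + b * c"
  by(simp_all add:gm gm_simps algebra_simps)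
 show "(0::'a hgerm)~=1" using eventually_nhds_x_imp_x[of "%_. False" "0::complex ^ 'a"]
  by(auto simp:zero_hgerm_def one_hgerm_def gm_eq_iff)
qed

end

definition hz :: "'d=>'d::finite hgerm" where "hz i=gm (%z. z $ i)"
definition hcst :: "complex=>'d::finite hgerm" where "hcst c=gm (%_. c)"
definition hpd :: "'d=>'d::finite hgerm=>'d hgerm" where "hpd i G=gm (%z. fd (rp G) z (axis i 1))"
definition hrho :: "'d=>'d::finite hgerm=>'d hgerm" where "hrho i G=gm (%z. rp G (scl i 0 z))"

lemma gm_pd: assumes "hol g" shows "hpd i (gm g)=gm (%z. fd g z (axis i 1))"
proof -
 obtain ro where ro: "ro > 0" "holomorphic_map (ball 0 ro) g" "!!z. z:ball 0 ro ==> rp (gm g) z=g z"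
  by(rule hol_common[OF assms assms rp_gm[OF assms]]) blast
 show ?thesis unfolding hpd_def by(rule gm_ballI[OF ro(1)]) (simp only:fd_cong[OF ro(2) open_ball _ ro(3)])
qed

lemma gm_rho: assumes "hol g" shows "hrho i (gm g)=gm (%z. g (scl i 0 z))"
proof -
 obtain ro where ro: "ro > 0" "!!z. z:ball 0 ro ==> rp (gm g) z=g z"
  by(rule hol_common[OF assms assms rp_gm[OF assms]]) blast
 show ?thesis unfolding hrho_def
 proof(rule gm_ballI[OF ro(1)], rule ro(2))
  fix z :: "complex ^ 'a" assume "z:ball 0 ro"
  thus "scl i 0 z:ball 0 ro" using norm_scl[of 0 i z] by simp
 qed
qed

lemma hrho_split: "EX q. x=hrho i x + hz i * q"
proof(cases x rule:hgerm_cases)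
 case (gm g)
 obtain ro where ro: "ro > 0" "holomorphic_map (ball 0 ro) g" using gm(1) by(rule holE)
 obtain q where q: "holomorphic_map (ball 0 ro) q" "ALL z:ball 0 ro. g z=g (scl i 0 z) + z $ i * q z"
  using holomorphic_division[OF ro(2), of i] by blast
 have "hol q" using ro q by(auto simp:hol_def)
 hence "x=hrho i x + hz i * gm q" using gm q(2) by(simp add:hz_def gm_rho gm_simps) (rule gm_ballI[OF ro(1)], simp)
 thus ?thesis by blast
qed

text \<open>\<open>g\<close> vanishes where the \<open>i\<close>-th coordinate is nonzero, and the
  hyperplane is reached by continuity along the \<open>i\<close>-th axis.\<close>

lemma hz_regular: assumes "hz i * x=0" shows "x=0"
proof(cases x rule:hgerm_cases)
 case (gm g)
 have "\<forall>\<^sub>F z in nhds 0. z $ i * g z=0" using assms gm by(simp add:hz_def gm_simps gm_eq_iff)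
 then obtain ro where ro: "ro > 0" "holomorphic_map (ball 0 ro) g" "!!z. z:ball 0 ro ==> z $ i * g z=0"
  by(rule hol_common[OF gm(1) gm(1)]) blast
 have "g z=0" if z: "z:ball 0 ro" for z
 proof(rule ccontr)
  assume n: "g z~=0"
  hence zi: "z $ i=0" using ro(3)[OF z] by simp
  have "continuous (at 0) (%c. g (z + c *s axis i 1))"
   using DERIV_isCont[OF line_derivative[OF ro(2), of z 0 "axis i 1"]] z by simp
  hence "((%c. g (z + c *s axis i 1)) \<longlongrightarrow> g z) (at 0)" by(simp add:continuous_at)
  hence 1: "\<forall>\<^sub>F c in at 0. g (z + c *s axis i 1)~=0" using n by(rule tendsto_imp_eventually_ne)
  have "continuous (at 0) (%c. z + c *s axis i 1)"
   by(intro continuous_intros bounded_linear.continuous[OF bounded_linear_cscale])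
  hence "((%c. z + c *s axis i 1) \<longlongrightarrow> z) (at 0)" by(simp add:continuous_at)
  hence 2: "\<forall>\<^sub>F c in at 0. z + c *s axis i 1:ball 0 ro" using topological_tendstoD[OF _ open_ball z] by blast
  have "\<forall>\<^sub>F c::complex in at 0. False" using 1 2 eventually_neq_at_within[of 0 0 UNIV]
  proof eventually_elim
   case (elim c)
   thus ?case using ro(3)[of "z + c *s axis i 1"] zi by(simp add:axis_def)
  qed
  thus False by simp
 qed
 thus ?thesis unfolding gm zero_hgerm_def by(intro gm_ballI[OF ro(1)])
qed

lemma hpd_axioms: "hpd i (x + y)=hpd i x + hpd i y" "hpd i (x * y)=x * hpd i y + y * hpd i x"
 "hpd i (hcst c)=0" "hpd i (hz j)=(if i=j then 1 else 0)"
 "hpd i (hrho i x)=0" "i~=j ==> hpd i (hrho j x)=hrho j (hpd i x)"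
proof -
 obtain g h where gm: "hol g" "x=gm g" "hol h" "y=gm h" by(rule hgerm_cases[of x], rule hgerm_cases[of y]) blast
 obtain ro where ro: "ro > 0" "holomorphic_map (ball 0 ro) g" "holomorphic_map (ball 0 ro) h"
  using hol_common[OF gm(1,3), of "%_. True"] by auto
 note D = holoD(1)[OF ro(2)] holoD(1)[OF ro(3)]
 have "fd (%z. g z + h z) z=(%v. fd g z v + fd h z v)" if "z:ball 0 ro" for z
  using frechet_derivative_at[OF has_derivative_add[OF D(1)[OF that] D(2)[OF that]]] by simp
 thus "hpd i (x + y)=hpd i x + hpd i y" by(simp add:gm gm_simps gm_pd) (rule gm_ballI[OF ro(1)], simp)
 have "fd (%z. g z * h z) z=(%v. g z * fd h z v + fd g z v * h z)" if "z:ball 0 ro" for z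
  using frechet_derivative_at[OF has_derivative_mult[OF D(1)[OF that] D(2)[OF that]]] by simp
 thus "hpd i (x * y)=x * hpd i y + y * hpd i x"
  by(simp add:gm gm_simps gm_pd) (rule gm_ballI[OF ro(1)], simp add:mult.commute)
 show "hpd i (hcst c)=0" by(simp add:hcst_def gm_pd gm_simps)
 have "fd (%z. z $ j) z=(%v. v $ j)" for z :: "complex ^ 'a"
  by(rule frechet_derivative_at[symmetric], rule bounded_linear_imp_has_derivative, rule bounded_linear_nth)
 thus "hpd i (hz j)=(if i=j then 1 else 0)" by(simp add:hz_def gm_pd gm_simps axis_def)
 show "hpd i (hrho i x)=0" unfolding gm gm_rho[OF gm(1)] gm_pd[OF hol_scl[OF gm(1)]] zero_hgerm_def
 proof(rule gm_ballI[OF ro(1)])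
  fix z :: "complex ^ 'a" assume z: "z:ball 0 ro"
  have "scl i 0 (axis i 1)=0" "scl i 0 z:ball 0 ro" using norm_scl[of 0 i z] z by(auto simp:vec_eq_iff axis_def)
  thus "fd (%z. g (scl i 0 z)) z (axis i 1)=0"
   using holo_scl(2)[OF ro(2) z, of i] fd_linear[OF ro(2), of "scl i 0 z"] by(simp add:linear_simps)
 qed
 assume ij: "i~=j"
 show "hpd i (hrho j x)=hrho j (hpd i x)"
  unfolding gm gm_rho[OF gm(1)] gm_pd[OF hol_scl[OF gm(1)]] gm_pd[OF gm(1)] gm_rho[OF hol_fd[OF gm(1)]]
 proof(rule gm_ballI[OF ro(1)])
  fix z :: "complex ^ 'a" assume z: "z:ball 0 ro"
  have "scl j 0 (axis i 1)=axis i 1" using ij by(auto simp:vec_eq_iff axis_def)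
  thus "fd (%z. g (scl j 0 z)) z (axis i 1)=fd g (scl j 0 z) (axis i 1)" using holo_scl(2)[OF ro(2) z, of j] by simp
 qed
qed

lemma hrho_axioms: "hrho i (x + y)=hrho i x + hrho i y" "hrho i (x * y)=hrho i x * hrho i y" "hrho i (hcst c)=hcst c"
 "hrho i (hz j)=(if i=j then 0 else hz j)" "hrho i (hrho j x)=hrho j (hrho i x)" "hrho i (hrho i x)=hrho i x"
proof -
 obtain g h where gm: "hol g" "x=gm g" "hol h" "y=gm h" by(rule hgerm_cases[of x], rule hgerm_cases[of y]) blast
 have s: "scl i 0 (scl j 0 z) = scl j 0 (scl i 0 z)" "scl i 0 (scl i 0 z) = scl i 0 z" for z :: "complex ^ 'a"
  by(auto simp:vec_eq_iff)
 show "hrho i (x + y)=hrho i x + hrho i y" "hrho i (x * y)=hrho i x * hrho i y" "hrho i (hcst c)=hcst c"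
  "hrho i (hz j)=(if i=j then 0 else hz j)" "hrho i (hrho j x)=hrho j (hrho i x)" "hrho i (hrho i x)=hrho i x"
  by(auto simp:gm gm_simps gm_rho hcst_def hz_def s)
qed

lemma hcst_axioms: "hcst (a + b)=hcst a + hcst b" "hcst (a * b)=hcst a * hcst b" "hcst 1=1"
 by(auto simp:hcst_def gm_simps)

text \<open>Vanishing to order \<open>k\<close> at 0, expressed as a growth condition.\<close>

definition small :: "nat=>'d::finite hgerm=>bool" where
 "small k x <-> (EX C. \<forall>\<^sub>F z in nhds 0. cmod (rp x z)<=C * norm z ^ k)"

lemma small_gm: assumes "hol g" shows "small k (gm g) <-> (EX C. \<forall>\<^sub>F z in nhds 0. cmod (g z)<=C * norm z ^ k)"
proof -
 have "(\<forall>\<^sub>F z in nhds 0. cmod (rp (gm g) z)<=C * norm z ^ k) <-> (\<forall>\<^sub>F z in nhds 0. cmod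
  (g z)<=C * norm z ^ k)" for C
  by(rule eventually_subst) (use rp_gm[OF assms] in eventually_elim, simp)
 thus ?thesis by(simp add:small_def)
qed

lemma small_0: "small 0 x"
proof(cases x rule:hgerm_cases)
 case (gm g)
 obtain ro where ro: "ro > 0" "holomorphic_map (ball 0 ro) g" using gm(1) by(rule holE)
 have "isCont g 0" using has_derivative_continuous[OF holoD(1)[OF ro(2), of 0]] ro(1) by simp
 hence "(g \<longlongrightarrow> g 0) (nhds 0)" by(simp add:isCont_def tendsto_nhds_iff)
 hence "\<forall>\<^sub>F z in nhds 0. dist (g z) (g 0) < 1" by(rule tendstoD) simp
 hence "\<forall>\<^sub>F z in nhds 0. cmod (g z)<=(cmod (g 0) + 1) * norm z ^ 0"
 proof eventually_elim
  case (elim z)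
  thus ?case using norm_triangle_sub[of "g z" "g 0"] by(simp add:dist_norm)
 qed
 thus ?thesis unfolding gm(2) small_gm[OF gm(1)] by blast
qed

lemma small_add: assumes "small k x" "small k y" shows "small k (x + y)"
proof -
 obtain g h where gm: "hol g" "x=gm g" "hol h" "y=gm h" by(rule hgerm_cases[of x], rule hgerm_cases[of y]) blast
 obtain B C where "\<forall>\<^sub>F z in nhds 0. cmod (g z)<=B * norm z ^ k" "\<forall>\<^sub>F z in nhds 0. cmod (h
  z)<=C * norm z ^ k"
  using assms gm by(auto simp:small_gm)
 hence "\<forall>\<^sub>F z in nhds 0. cmod (g z + h z)<=(B + C) * norm z ^ k"
 proof eventually_elim
  case (elim z)
  thus ?case using norm_triangle_ineq[of "g z" "h z"] by(simp add:algebra_simps)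
 qed
 thus ?thesis using gm by(auto simp:gm_simps small_gm)
qed

lemma small_hz: assumes "small k x" shows "small (Suc k) (hz i * x)"
proof(cases x rule:hgerm_cases)
 case (gm g)
 obtain C where "\<forall>\<^sub>F z in nhds 0. cmod (g z)<=C * norm z ^ k" using assms gm by(auto simp:small_gm)
 hence "\<forall>\<^sub>F z in nhds 0. cmod (z $ i * g z)<=C * norm z ^ Suc k"
 proof eventually_elim
  case (elim z)
  have "cmod (z $ i) * cmod (g z)<=norm z * (C * norm z ^ k)"
   by(rule mult_mono[OF Finite_Cartesian_Product.norm_nth_le elim]) auto
  thus ?case by(simp add:norm_mult mult_ac)
 qed
 thus ?thesis using gm by(auto simp:hz_def gm_simps small_gm)
qed

text \<open>On every complex line through the origin such a germ vanishes to infinite order.\<close>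

lemma small_imp_0:
 fixes x :: "'d::finite hgerm" assumes "!!k. small k x" shows "x=0"
proof(cases x rule:hgerm_cases)
 case (gm g)
 obtain ro where ro: "ro > 0" "holomorphic_map (ball 0 ro) g" using gm(1) by(rule holE)
 have bound: "EX C. \<forall>\<^sub>F z in nhds 0. cmod (g z)<=C * norm z ^ k" for k
  using assms[of k] gm by(simp add:small_gm)
 have g0: "g 0=0" using bound[of 1] by(auto dest:eventually_nhds_x_imp_x)
 have "g v=0" if v: "v:ball 0 ro" for v
 proof(rule ccontr)
  assume n: "g v~=0"
  hence v0: "v~=0" using g0 by auto
  define S :: "complex set" where "S=ball 0 (ro / norm v)"
  have vS: "0 + c *s v:ball 0 ro" if "c:S" for c using that v0 by(simp add:S_def norm_cscale field_simps)
  obtain k n r where knr: "0 < k" "0 < r" "ball 0 r<=S"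
   "!!c. c:ball 0 r ==> k * norm (c - 0) ^ n<=norm (g (0 + c *s v) - g (0 + 0 *s v))"
   by(rule holomorphic_lower_bound_difference[OF line_holomorphic[OF ro(2), of S 0 v], of 0 1])
    (insert vS v v0 n g0 ro, auto simp:S_def field_simps)
  obtain C where C: "\<forall>\<^sub>F z in nhds 0. cmod (g z)<=C * norm z ^ Suc n" using bound by blast
  have "((%c::complex. c *s v) \<longlongrightarrow> 0 *s v) (at 0)"
   by(intro bounded_linear.tendsto[OF bounded_linear_cscale] tendsto_ident_at)
  hence "filterlim (%c::complex. c *s v) (nhds 0) (at 0)" by simp
  from eventually_compose_filterlim[OF C this]
  have 1: "\<forall>\<^sub>F c::complex in at 0. cmod (g (c *s v))<=C * (cmod c * norm v) ^ Suc n" by(simp add:norm_cscale)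
  have 2: "\<forall>\<^sub>F c::complex in at 0. c:ball 0 r" using knr(2) eventually_at_ball[of r "0::complex" UNIV] by simp
  have 3: "\<forall>\<^sub>F c::complex in at 0. cmod c * (\<bar>C\<bar> * norm v ^ Suc n) < k"
  proof(rule order_tendstoD)
   show "((%c. cmod c * (\<bar>C\<bar> * norm v ^ Suc n)) \<longlongrightarrow> cmod 0 * (\<bar>C\<bar> * norm v ^
    Suc n)) (at 0)"
    by(intro tendsto_intros)
  qed (use knr in simp)
  have "\<forall>\<^sub>F c::complex in at 0. False" using 1 2 3 eventually_neq_at_within[of 0 0 UNIV]
  proof eventually_elim
   case (elim c)
   have "k * cmod c ^ n<=C * (cmod c * norm v) ^ Suc n" using knr(4)[OF elim(2)] elim(1) g0 by simp
   also have "... <= \<bar>C\<bar> * (cmod c * norm v) ^ Suc n" by(intro mult_right_mono) auto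
   also have "... = (cmod c * (\<bar>C\<bar> * norm v ^ Suc n)) * cmod c ^ n" by(simp add:power_mult_distrib)
   also have "... < k * cmod c ^ n" using elim by(intro mult_strict_right_mono) auto
   finally show ?case by simp
  qed
  thus False by simp
 qed
 thus ?thesis unfolding gm(2) zero_hgerm_def by(intro gm_ballI[OF ro(1)])
qed

lemma hgerm_const: assumes "!!i. hpd i x=0" shows "EX c. x=hcst c"
proof(cases x rule:hgerm_cases)
 case (gm g)
 have "\<forall>\<^sub>F z in nhds 0. fd g z (axis i 1)=0" for i
  using assms[of i] gm by(simp add:gm_pd gm_simps gm_eq_iff)
 hence "\<forall>\<^sub>F z in nhds 0. ALL i. fd g z (axis i 1)=0" by(simp add:eventually_all_finite)
 then obtain ro where ro: "ro > 0" "holomorphic_map (ball 0 ro) g" "!!z. z:ball 0 ro ==> ALL i. fd g z (axis i 1)=0"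
  by(rule hol_common[OF gm(1) gm(1)]) blast
 have "(g has_derivative (%h. 0)) (at z within ball 0 ro)" if z: "z:ball 0 ro" for z
 proof -
  interpret L: bounded_linear "fd g z" by(rule fd_linear[OF ro(2) z])
  have "fd g z v=0" for v
  proof -
   have "v=(SUM i:UNIV. v $ i *s axis i 1)" by(simp add:vec_eq_iff axis_def if_distrib[of "%y. _ * y"] cong: if_cong)
   hence "fd g z v=(SUM i:UNIV. fd g z (v $ i *s axis i 1))" by(metis L.sum)
   thus ?thesis using ro(3)[OF z] by(simp add:holoD(2)[OF ro(2) z])
  qed
  hence "fd g z=(%h. 0)" by auto
  thus ?thesis using has_derivative_at_withinI[OF holoD(1)[OF ro(2) z], of "ball 0 ro"] by simp
 qed
 from has_derivative_zero_constant[OF convex_ball this]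
 obtain c where "!!z. z:ball 0 ro ==> g z = c" by blast
 hence "x=hcst c" unfolding gm hcst_def by(rule gm_ballI[OF ro(1)])
 thus ?thesis by blast
qed

text \<open>Division by one coordinate after the other leaves a germ independent of all of them,
  hence a constant.\<close>

lemma hgerm_expansion: "EX c q. x=hcst c + (SUM i:UNIV. hz i * q i)"
proof -
 have "EX y q. x=y + (SUM i:A. hz i * q i) & (ALL i:A. hrho i y=y)" if "finite A" for A using that
 proof(induction A rule:finite_induct)
  case (insert i A)
  then obtain y q where y: "x=y + (SUM i:A. hz i * q i)" "ALL i:A. hrho i y=y" by blast
  obtain p where p: "y=hrho i y + hz i * p" using hrho_split by blast
  have "(SUM j:A. hz j * (q(i := p)) j)=(SUM j:A. hz j * q j)" using insert by(intro sum.cong) auto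
  hence "x=hrho i y + (SUM j:insert i A. hz j * (q(i := p)) j)" using insert y(1) p by(simp add:add.assoc[symmetric])
  moreover have "ALL j:insert i A. hrho j (hrho i y)=hrho i y"
   using y(2) hrho_axioms(5)[of _ i y] by(auto simp:hrho_axioms(6))
  ultimately show ?case by blast
 qed auto
 from this[of UNIV] obtain y q where y: "x=y + (SUM i:UNIV. hz i * q i)" "!!i. hrho i y=y" by auto
 have "hpd i y=0" for i using hpd_axioms(5)[of i y] y(2) by simp
 then obtain c where "y=hcst c" using hgerm_const by blast
 thus ?thesis using y(1) by blast
qed

text \<open>The difference of the two sides is a derivation that kills constants and coordinates. By
  \<open>hgerm_expansion\<close> each of its values is a combination of the \<open>hz i\<close> with
  further values of it as coefficients, so it is small of every order.\<close>

lemma hgerm_derivation_eq: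
 fixes th :: "'d::finite hgerm=>'d hgerm"
 assumes th: "!!x y. th (x + y)=th x + th y" "!!x y. th (x * y)=x * th y + y * th x" "!!c. th (hcst c)=0"
 shows "th x=(SUM i:UNIV. th (hz i) * hpd i x)"
proof -
 define dl where "dl=(%x. th x - (SUM i:UNIV. th (hz i) * hpd i x))"
 have add:"dl (x + y)=dl x + dl y" for x y by(simp add:dl_def th hpd_axioms sum.distrib algebra_simps)
 have dl: "dl (x * y)=x * dl y + y * dl x" "dl (hcst c)=0" "dl (hz i)=0" for x y c i
  by(simp_all add:dl_def th hpd_axioms sum.distrib sum_distrib_left algebra_simps if_distrib[of "%y. _ * y"] cong: if_cong)
 have "small k (dl x)" for k x
 proof(induction k arbitrary: x)
  case (Suc k)
  obtain c q where "x=hcst c + (SUM i:UNIV. hz i * q i)" using hgerm_expansion by blast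
  hence "dl x=(SUM i:UNIV. hz i * dl (q i))" by(simp add:add additive_sum[of dl, OF add] dl)
  moreover have "small (Suc k) (SUM i:A. hz i * dl (q i))" if "finite A" for A using that
  proof(induction A rule:finite_induct)
   case empty
   have "small (Suc k) (hz undefined * 0::'d hgerm)"
    by(rule small_hz) (auto simp:small_gm zero_hgerm_def intro!:exI[of _ 0])
   thus ?case by simp
  qed (simp add:small_add small_hz Suc)
  ultimately show ?case by simp
 qed (rule small_0)
 hence "dl x=0" by(rule small_imp_0)
 thus ?thesis by(simp add:dl_def)
qed

interpretation hg: coords hz hpd hrho hcst
 by unfold_locales
  (fact hcst_axioms hpd_axioms hrho_axioms hrho_split hz_regular hgerm_derivation_eq | rule hgerm_derivation_eq; assumption)+

subsection \<open>Charts\<close>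

text \<open>The real inverse function theorem applies; the inverse is holomorphic because the
  inverse of a complex linear derivative is complex linear. As a single coordinate is replaced, a
  nonzero \<open>i\<close>-th partial derivative of \<open>H\<close> makes the derivative
  injective.\<close>

lemma coordinate_change:
 fixes a :: "complex ^ 'd::finite"
 assumes S: "open S" "a:S" and H: "holomorphic_map S H" "H a=0" "fd H a (axis i 1)~=0"
 defines "Ps == %z. \<chi> j. if j=i then H z else z $ j - a $ j"
 obtains U V Ph where "open U" "a:U" "open V" "homeomorphism U V Ps Ph"
  "!!j. holomorphic_map U (%z. Ps z $ j)" "!!j. holomorphic_map V (%z. Ph z $ j)"
proof -
 define L where "L=(%z v. \<chi> j. if j=i then fd H z v else v $ j)"
 have comp: "((%z. Ps z $ j) has_derivative (%v. L z v $ j)) (at z)" if "z:S" for z j using holoD(1)[OF H(1) that]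
  by(cases "j=i") (auto simp:Ps_def L_def intro!:derivative_eq_intros bounded_linear_imp_has_derivative bounded_linear_nth)
 have D: "(Ps has_derivative L z) (at z)" if "z:S" for z by(rule has_derivative_cvec) (rule comp[OF that])
 have Lc: "L z (c *s v) = c *s L z v" if "z:S" for z c v by(auto simp:vec_eq_iff L_def holoD(2)[OF H(1) that])
 have Lb: "bounded_linear (L z)" if "z:S" for z using D[OF that] by(rule has_derivative_bounded_linear)
 define f' where "f'=(%z. Blinfun (L z))"
 have f': "blinfun_apply (f' z)=L z" if "z:S" for z unfolding f'_def by(rule bounded_linear_Blinfun_apply[OF Lb[OF that]])
 have cf: "continuous_on S f'"
 proof(rule continuous_on_blinfun_componentwise)
  fix b :: "complex ^ 'd"
  have "continuous_on S (%z. if j=i then fd H z b else b $ j)" for j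
   using fd_continuous[OF H(1) S(1)] by(cases "j=i") auto
  hence "continuous_on S (%z. L z b)" unfolding L_def by(intro continuous_on_vec_lambda)
  thus "continuous_on S (%z. blinfun_apply (f' z) b)" by(rule continuous_on_eq) (simp add:f')
 qed
 interpret La: bounded_linear "L a" by(rule Lb[OF S(2)])
 have "v=0" if v: "L a v=0" for v
 proof -
  have j: "v $ j=0" if "j~=i" for j using arg_cong[OF v, of "%x. x $ j"] that by(simp add:L_def)
  have "v = v $ i *s axis i 1" using j by(auto simp:vec_eq_iff axis_def)
  moreover have "fd H a v=0" using arg_cong[OF v, of "%x. x $ i"] by(simp add:L_def)
  ultimately have "v $ i * fd H a (axis i 1)=0" using holoD(2)[OF H(1) S(2)] by metis
  thus ?thesis using j H(3) by(metis (no_types) mult_eq_0_iff vec_eq_iff zero_index)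
 qed
 hence "inj (L a)" by(simp add:La.linear linear_inj_iff_eq_0)
 then obtain G where G: "linear G" "G \<circ> L a=id" using linear_injective_left_inverse[OF La.linear] by blast
 have Gb: "blinfun_apply (Blinfun G)=G"
  using G(1) by(intro bounded_linear_Blinfun_apply) (simp add:linear_conv_bounded_linear)
 have id: "Blinfun G o\<^sub>L f' a=id_blinfun" by(rule blinfun_eqI) (insert G(2), simp add:Gb f' S fun_eq_iff)
 have D': "(Ps has_derivative blinfun_apply (f' z)) (at z)" if "z:S" for z using D[OF that] f'[OF that] by simp
 obtain U V Ph Ph' where U: "open U" "U<=S" "a:U" "open V" "Ps a:V" "homeomorphism U V Ps Ph"
  "!!y. y:V ==> (Ph has_derivative Ph' y) (at y)" "!!y. y:V ==> Ph' y=inv_into UNIV (blinfun_apply (f' (Ph y)))"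
  "!!y. y:V ==> bij (blinfun_apply (f' (Ph y)))"
  by(rule inverse_function_theorem[OF S(1) D' cf S(2) id]) (assumption | rule that)+
 have Phc: "Ph' y (c *s v) = c *s Ph' y v" if y: "y:V" for y c v
 proof -
  have s: "Ph y:S" using U(2,6) y by(auto simp:homeomorphism_def)
  have b: "bij (L (Ph y))" and e: "Ph' y=inv_into UNIV (L (Ph y))" using U(8,9)[OF y] f'[OF s] by auto
  have "L (Ph y) (Ph' y (c *s v))=L (Ph y) (c *s Ph' y v)" using b by(simp add:e Lc[OF s] surj_f_inv_f bij_is_surj)
  thus ?thesis using b by(simp add:bij_is_inj inj_eq)
 qed
 show ?thesis
 proof
  show "holomorphic_map U (%z. Ps z $ j)" for j by(rule holoI[OF comp]) (insert U(2), auto simp:Lc)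
  show "holomorphic_map V (%z. Ph z $ j)" for j by(rule holoI[of _ _ "%y v. Ph' y v $ j"])
    (auto simp:Phc intro!:bounded_linear.has_derivative[OF bounded_linear_nth] U(7))
 qed (use U in auto)
qed

lemma chart_facts: assumes "is_chart X (U, ph)" shows "openin X U" "open (ph ` U)" "inj_on ph U" "U<=topspace X"
  "open S ==> openin X {x:U. ph x:S}" "openin X V ==> V<=U ==> open (ph ` V)"
proof -
 have h: "homeomorphic_map (subtopology X U) (top_of_set (ph ` U)) ph" and o: "openin X U" "open (ph ` U)"
  using assms by(auto simp:is_chart_def)
 show "openin X U" "open (ph ` U)" by(fact o)+
 show U: "U<=topspace X" by(rule openin_subset[OF o(1)])
 hence t: "topspace (subtopology X U)=U" by auto
 show "inj_on ph U" using homeomorphic_imp_injective_map[OF h] t by simp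
 show "openin X {x:U. ph x:S}" if "open S"
 proof -
  have "openin (subtopology X U) {x:topspace (subtopology X U). ph x:ph ` U Int S}"
   using openin_continuous_map_preimage[OF homeomorphic_imp_continuous_map[OF h]] that by blast
  moreover have "{x:topspace (subtopology X U). ph x:ph ` U Int S}={x:U. ph x:S}" unfolding t by auto
  ultimately show ?thesis using openin_trans_full o(1) by metis
 qed
 show "open (ph ` V)" if "openin X V" "V<=U"
 proof -
  have "openin (subtopology X U) V" using that by(metis openin_subtopology_Int2 inf.absorb_iff2
   openin_subset_topspace_eq openin_open_subtopology o(1))
  hence "openin (top_of_set (ph ` U)) (ph ` V)" using homeomorphic_imp_open_map[OF h] by(simp add:open_map_def)
  thus ?thesis using o(2) openin_open_trans by blast
 qed
qed

lemma (in coords) mon_dvd: assumes "finite K" "!!k. k:K ==> rho k x=0" shows "mon (%i. if i:K then 1 else 0) dvd x"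
 using assms
proof(induction K arbitrary: x rule:finite_induct)
 case (insert k K)
 obtain q where q: "x=z k * q" using rho_split[of x k] insert.prems by auto
 have "rho l q=0" if "l:K" for l
 proof -
  have "z k * rho l q=rho l x" using that insert.hyps by(auto simp:q rho_mult rho_z)
  hence "z k * rho l q=0" using insert.prems that by simp
  thus ?thesis by(rule z_regular)
 qed
 hence "mon (%i. if i:K then 1 else 0) dvd q" by(rule insert.IH)
 moreover have "(%i. if i:insert k K then 1 else 0)=inc k (%i. if i:K then 1 else 0)"
  using insert.hyps by(auto simp:inc_def)
 ultimately show ?case by(simp only:mon_inc q) (rule mult_dvd_mono, simp)
qed simp

lemma gm_prod: assumes "finite A" "!!i. i:A ==> hol (g i)"
 shows "hol (%z. PROD i:A. g i z) & (PROD i:A. gm (g i))=gm (%z. PROD i:A. g i z)"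
 using assms by(induction A rule:finite_induct) (auto simp:gm_simps)

lemma gm_power: "hol g ==> hol (%z. g z ^ k) & gm g ^ k=gm (%z. g z ^ k)" by(induction k) (auto simp:gm_simps)

interpretation hg: coords hz hpd hrho hcst
 by unfold_locales
  (fact hcst_axioms hpd_axioms hrho_axioms hrho_split hz_regular hgerm_derivation_eq | rule hgerm_derivation_eq; assumption)+

lemma mon_gm: "hol (%z. PROD k:K. z $ k ^ e k)" "hg.mon (%i. if i:K then e i else 0)=gm (%z. PROD k:K. z $ k ^ e k)"
 for K :: "'d::finite set"
proof -
 have "(PROD i:UNIV. hz i ^ (if i:K then e i else 0))=(PROD k:K. gm (%z. z $ k ^ e k))"
  by(rule prod.mono_neutral_cong_right) (auto simp:hz_def gm_power)
 thus "hol (%z. PROD k:K. z $ k ^ e k)" "hg.mon (%i. if i:K then e i else 0)=gm (%z. PROD k:K. z $ k ^ e k)"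
  using gm_prod[of K "%k z. z $ k ^ e k"] gm_power[OF hol_simps(2)] by(auto simp:hg.mon_def)
qed

lemma eventually_ballE: "\<forall>\<^sub>F z in nhds (0::complex ^ 'd::finite). P z ==> EX ro>0. ALL z:ball 0 ro. P z"
 by(auto simp:eventually_nhds_metric dist_commute)

lemma holomorphic_fun_subset: "holomorphic_fun X A V f ==> openin X V' ==> V'<=V ==> holomorphic_fun X A V' f"
 unfolding holomorphic_fun_def by(blast intro:holo_subset)

text \<open>Coordinates centered at \<open>p\<close> as far as germs are concerned: \<open>w\<close>
  is a total function restricted only near \<open>p\<close>. \<open>pull\<close> and
  \<open>push\<close> say that holomorphic germs at \<open>p\<close> are germs at 0 composed with
  \<open>w\<close>, and \<open>w_open\<close> makes this identification injective.\<close>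

locale local_coords =
 fixes X :: "'a topology" and A :: "('a, 'd::finite) chart set" and p :: 'a and w :: "'a=>complex ^ 'd"
 assumes w0: "w p=0" and p_top: "p:topspace X" and w_cont: "open N ==> 0:N ==> EX V. openin X V & p:V & w ` V<=N"
  and w_open: "openin X V ==> p:V ==> EX ro>0. ball 0 ro<=w ` V"
  and pull: "hol g ==> EX V. p:V & holomorphic_fun X A V (%x. g (w x))"
  and push: "holomorphic_fun X A V f ==> p:V ==> EX g V'. hol g & openin X V' & p:V' & V'<=V & (ALL x:V'. f x=g (w x))"
begin

lemma germ_eq_iff: "germ X p f=germ X p g <-> (EX V. openin X V & p:V & (ALL x:V. f x=g x))"
proof
 assume eq: "germ X p f=germ X p g"
 have "f:germ X p f" using p_top by(auto simp:germ_def intro:exI[of _ "topspace X"])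
 thus "EX V. openin X V & p:V & (ALL x:V. f x=g x)" unfolding eq by(simp add:germ_def)
next
 assume "EX V. openin X V & p:V & (ALL x:V. f x=g x)"
 then obtain V where V: "openin X V" "p:V" "ALL x:V. f x=g x" by blast
 have "h:germ X p f <-> h:germ X p g" for h unfolding germ_def mem_Collect_eq
  by(rule iffI; elim exE conjE; rule_tac x = "U Int V" in exI; use V in auto)
 thus "germ X p f=germ X p g" by blast
qed

definition ga :: "'d hgerm=>('a=>complex) set" where "ga G=germ X p (%x. rp G (w x))"

lemma nhds_pull: assumes "\<forall>\<^sub>F z in nhds 0. P z" shows "EX V. openin X V & p:V & (ALL x:V. P (w x))"
proof -
 obtain ro where ro: "ro > 0" "ALL z:ball 0 ro. P z" using eventually_ballE[OF assms] by blast
 show ?thesis using w_cont[of "ball 0 ro"] ro by fastforce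
qed

lemma ga_gm: "hol g ==> ga (gm g)=germ X p (%x. g (w x))" unfolding ga_def germ_eq_iff by(rule nhds_pull) (rule rp_gm)

lemma inj_ga: "inj ga"
proof(rule injI)
 fix G H assume eq: "ga G=ga H"
 obtain g h where gm: "hol g" "G=gm g" "hol h" "H=gm h" by(rule hgerm_cases[of G], rule hgerm_cases[of H]) blast
 obtain V where V: "openin X V" "p:V" "ALL x:V. g (w x)=h (w x)" using eq gm by(auto simp:ga_gm germ_eq_iff)
 obtain ro where "ro > 0" "ball 0 ro<=w ` V" using w_open V by blast
 thus "G=H" unfolding gm using V(3) by(intro gm_ballI) auto
qed

lemma germ_times: "(UN g:germ X p a. UN h:germ X p b. germ X p (%x. F (g x) (h x)))=germ X p (%x. F (a x) (b x))"
proof -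
 have "germ X p (%x. F (g x) (h x))=germ X p (%x. F (a x) (b x))" if gh: "g:germ X p a" "h:germ X p b" for g h
 proof -
  obtain U V where "openin X U" "p:U" "ALL x:U. g x=a x" "openin X V" "p:V" "ALL x:V. h x=b x"
   using gh by(auto simp:germ_def)
  thus ?thesis unfolding germ_eq_iff by(intro exI[of _ "U Int V"]) auto
 qed
 moreover have "a:germ X p a" "b:germ X p b" using p_top by(auto simp:germ_def intro:exI[of _ "topspace X"])
 ultimately show ?thesis by blast
qed

lemma ga_ops:
 "ga x \<otimes>\<^bsub>germ_ring X A p\<^esub> ga y=ga (x * y)" "ga x \<oplus>\<^bsub>germ_ring X A p\<^esub> ga
  y=ga (x + y)"
 "\<one>\<^bsub>germ_ring X A p\<^esub>=ga 1" "\<zero>\<^bsub>germ_ring X A p\<^esub>=ga 0" "germ X p (%_. c)=ga (hcst c)"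
proof -
 obtain g h where gm: "hol g" "x=gm g" "hol h" "y=gm h" by(rule hgerm_cases[of x], rule hgerm_cases[of y]) blast
 show "ga x \<otimes>\<^bsub>germ_ring X A p\<^esub> ga y=ga (x * y)" "ga x \<oplus>\<^bsub>germ_ring X A p\<^esub>
  ga y=ga (x + y)"
  "\<one>\<^bsub>germ_ring X A p\<^esub>=ga 1" "\<zero>\<^bsub>germ_ring X A p\<^esub>=ga 0" "germ X p (%_. c)=ga (hcst c)"
  using germ_times[where a = "%x. g (w x)" and b = "%x. h (w x)" and F = "(*)"] germ_times[where a = "%x. g (w x)"
   and b = "%x. h (w x)" and F = "(+)"]
  by(simp_all add:gm gm_simps ga_gm germ_ring_def hcst_def)
qed

lemma ga_carrier: "{germ X p g | g U. p:U & holomorphic_fun X A U g}=range ga"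
proof(intro equalityI subsetI)
 fix a assume "a:{germ X p g | g U. p:U & holomorphic_fun X A U g}"
 then obtain f U where f: "a=germ X p f" "p:U" "holomorphic_fun X A U f" by blast
 obtain g V' where "hol g" "openin X V'" "p:V'" "V'<=U" "ALL x:V'. f x=g (w x)" using push[OF f(3,2)] by blast
 hence "a=ga (gm g)" unfolding f by(simp add:ga_gm germ_eq_iff) blast
 thus "a:range ga" by blast
next
 fix a assume "a:range ga"
 then obtain G where "a=ga G" by blast
 thus "a:{germ X p g | g U. p:U & holomorphic_fun X A U g}" using pull[of "rp G"] unfolding ga_def by auto
qed

lemma coords_model: assumes "CARD('d)=n + 1"
 shows "coords_model (germ_ring X A p) (%c. germ X p (%_. c)) n hz hpd hrho hcst ga"
 by unfold_locales (insert assms ga_carrier ga_ops inj_ga, simp_all add:germ_ring_def)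

text \<open>A germ vanishing on the zero set of \<open>f\<close> vanishes on each hyperplane of
  \<open>K\<close>, so \<open>mon_dvd\<close> applies; the exponents 1 reflect that the zero set is
  taken reduced.\<close>

lemma zero_ideal_crossing: assumes V: "openin X V" "p:V" "!!x. x:V ==> f x=0 <-> (EX k:K. w x $ k=0)"
 shows "zero_ideal X A f p=ga ` {x. hg.mon (%i. if i:K then 1 else 0) dvd x}"
proof(intro equalityI subsetI)
 fix a assume "a:zero_ideal X A f p"
 then obtain h U where h: "a=germ X p h" "p:U" "holomorphic_fun X A U h" "ALL x:U. f x=0 --> h x=0"
  by(auto simp:zero_ideal_def)
 obtain g V' where g: "hol g" "openin X V'" "p:V'" "V'<=U" "ALL x:V'. h x=g (w x)" using push[OF h(3,2)] by blast
 have a: "a=ga (gm g)" unfolding h using g by(simp add:ga_gm germ_eq_iff) blast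
 obtain ro where ro: "ro > 0" "ball 0 ro<=w ` (V Int V')" using w_open[of "V Int V'"] V g by blast
 have "hrho k (gm g)=0" if k: "k:K" for k unfolding gm_rho[OF g(1)] zero_hgerm_def
 proof(rule gm_ballI[OF ro(1)])
  fix z :: "complex ^ 'd" assume "z:ball 0 ro"
  hence "scl k 0 z:ball 0 ro" using norm_scl[of 0 k z] by simp
  then obtain x where x: "x:V" "x:V'" "scl k 0 z=w x" using ro by blast
  have "w x $ k=0" unfolding x(3)[symmetric] by simp
  hence "h x=0" using V(3) x h(4) g(4) k by blast
  thus "g (scl k 0 z)=0" using x g(5) by simp
 qed
 hence "hg.mon (%i. if i:K then 1 else 0) dvd gm g" by(intro hg.mon_dvd) auto
 thus "a:ga ` {x. hg.mon (%i. if i:K then 1 else 0) dvd x}" unfolding a by blast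
next
 fix a assume "a:ga ` {x. hg.mon (%i. if i:K then 1 else 0) dvd x}"
 then obtain y where y: "a=ga (hg.mon (%i. if i:K then 1 else 0) * y)" by(auto elim!:dvdE)
 obtain g where g: "hol g" "y=gm g" by(rule hgerm_cases)
 let ?g = "%z. (PROD k:K. z $ k ^ 1) * g z"
 have h: "hol ?g" using mon_gm(1)[where K = K and e = "%_. 1"] g(1) by simp
 have a: "a=germ X p (%x. ?g (w x))"
  unfolding y g mon_gm(2)[where K = K and e = "%_. 1"] using mon_gm(1)[where K = K and e = "%_. 1"] g(1) h by(simp
   add:gm_times ga_gm)
 obtain U where U: "p:U" "holomorphic_fun X A U (%x. ?g (w x))" using pull[OF h] by blast
 have "openin X U" using U(2) by(simp add:holomorphic_fun_def)
 hence "holomorphic_fun X A (U Int V) (%x. ?g (w x))" "p:U Int V"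
  using holomorphic_fun_subset[OF U(2), of "U Int V"] V(1,2) U(1) by auto
 moreover have "ALL x:U Int V. f x=0 --> ?g (w x)=0" using V(3) by(auto simp:prod_zero_iff)
 ultimately show "a:zero_ideal X A f p" unfolding a zero_ideal_def by blast
qed

theorem crossing_germ: assumes "CARD('d)=n + 1" and V: "openin X V" "p:V" "!!x. x:V ==> f x=(PROD k:K. w x $ k ^ e k)"
  and K: "K~={}" "!!k. k:K ==> 0 < e k" and al: "0<=al" "al < 1"
 shows "germ_family.graded_decomp (germ_ring X A p) (%c. germ X p (%_. c)) (zero_ideal X A f p) (germ X p f) n al"
proof -
 interpret coords_model "germ_ring X A p" "%c. germ X p (%_. c)" "zero_ideal X A f p" "germ X p f" n hz hpd hrho hcst ga
  by(rule coords_model) fact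
 show ?thesis
 proof(rule crossing_decomposition[OF K])
  show "germ X p f=ga (hg.mon (%i. if i:K then e i else 0))"
   unfolding mon_gm ga_gm[OF mon_gm(1)] germ_eq_iff using V by blast
  show "zero_ideal X A f p=ga ` {x. hg.mon (%i. if i:K then 1 else 0) dvd x}"
   by(rule zero_ideal_crossing[OF V(1,2)]) (insert V(3) K(2), auto simp:prod_zero_iff)
 qed (use al in auto)
qed

theorem smooth_germ: assumes "CARD('d)=n + 1" and V: "openin X V" "p:V" "!!x. x:V ==> f x = c + w x $ i" and c: "c~=0"
 shows "germ_family.graded_decomp (germ_ring X A p) (%c. germ X p (%_. c)) (zero_ideal X A f p) (germ X p f) n al"
proof -
 interpret coords_model "germ_ring X A p" "%c. germ X p (%_. c)" "zero_ideal X A f p" "germ X p f" n hz hpd hrho hcst ga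
  by(rule coords_model) fact
 have ne: "c + z $ i~=0" if "z:ball 0 (cmod c)" for z :: "complex ^ 'd"
 proof
  assume "c + z $ i=0"
  hence "cmod (z $ i) = cmod c" by(metis add_eq_0_iff norm_minus_cancel)
  thus False using that Finite_Cartesian_Product.norm_nth_le[of z i] by simp
 qed
 have inv: "hol (%z. inverse (c + z $ i))"
 proof(rule holI[of "cmod c"])
  show "holomorphic_map (ball 0 (cmod c)) (%z. inverse (c + z $ i))" by(rule holo_compose1(1)[of _ _ inverse "- {0}"])
    (auto intro!:holo_add holo_const holo_nth holomorphic_intros dest:ne)
 qed (use c in simp)
 show ?thesis
 proof(rule smooth_decomposition[of "hcst c + hz i" c i "gm (%z. inverse (c + z $ i))"])
  show "(hcst c + hz i) * gm (%z. inverse (c + z $ i))=1"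
   using inv c ne by(simp add:hcst_def hz_def gm_simps) (rule gm_ballI[of "cmod c"], auto)
  show "germ X p f=ga (hcst c + hz i)" using V by(simp add:hcst_def hz_def gm_simps ga_gm germ_eq_iff) blast
  \<comment> \<open>With no components the monomial is 1, and the ideal is the whole ring.\<close>
  have "zero_ideal X A f p=ga ` {x. hg.mon (%j. if j:{} then 1 else 0) dvd x}"
  proof -
   obtain V' where V': "openin X V'" "p:V'" "w ` V'<=ball 0 (cmod c)" using w_cont[of "ball 0 (cmod c)"] c by auto
   show ?thesis by(rule zero_ideal_crossing[of "V Int V'"]) (insert V V' ne, auto simp:image_subset_iff)
  qed
  thus "zero_ideal X A f p=range ga" by simp
 qed simp
qed

end

section \<open>Coordinates at the points of \<open>X\<close>\<close>

lemma holo_transition: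
 assumes "compatible c c'" shows "holomorphic_map (snd c ` (fst c Int fst c')) (%z. transition c c' z $ j)"
  "holomorphic_map (snd c' ` (fst c Int fst c')) (%z. transition c' c z $ j)" using assms by(auto simp:compatible_def)

text \<open>A chart followed by a biholomorphic map \<open>Ps\<close> near the image of
  \<open>p\<close>. The chart \<open>(U, ph)\<close> need not belong to \<open>A\<close>, whereas
  \<open>holomorphic_fun\<close> refers to the charts of \<open>A\<close>; the transition maps
  mediate.\<close>

lemma chart_local_coords:
 fixes A :: "('a, 'd::finite) chart set" and Ps Ph :: "complex ^ 'd=>complex ^ 'd"
 assumes M: "complex_manifold X A" and c: "holomorphic_chart X A (U, ph)" "p:U"
  and S: "open S" "ph p:S" "open T" "homeomorphism S T Ps Ph" "Ps (ph p)=0"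
  and Ps: "!!j. holomorphic_map S (%z. Ps z $ j)" and Ph: "!!j. holomorphic_map T (%z. Ph z $ j)"
 shows "local_coords X A p (%x. Ps (ph x))"
proof
 have U: "is_chart X (U, ph)" and comp: "!!c'. c':A ==> compatible (U, ph) c'"
  using c by(auto simp:holomorphic_chart_def)
 note F = chart_facts[OF U]
 have hom: "continuous_on S Ps" "continuous_on T Ph" "!!y. y:S ==> Ph (Ps y)=y" "!!y. y:T ==> Ps (Ph y)=y"
  "!!y. y:S ==> Ps y:T" "!!y. y:T ==> Ph y:S" using S(4) by(auto simp:homeomorphism_def)
 have T0: "0:T" and Ph0: "Ph 0 = ph p" using hom S(2,5) by force+
 show "Ps (ph p)=0" by fact
 show p: "p:topspace X" using F(4) c(2) by blast
 have pre: "openin X {x:U. ph x:S & Ps (ph x):N}" "open {y:S. Ps y:N}" if "open N" for N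
 proof -
  have "open (S Int Ps -` N)" by(rule continuous_open_preimage[OF hom(1) S(1) that])
  moreover have "S Int Ps -` N={y:S. Ps y:N}" by auto
  ultimately show o: "open {y:S. Ps y:N}" by simp
  show "openin X {x:U. ph x:S & Ps (ph x):N}" using F(5)[OF o] by simp
 qed
 show "EX V. openin X V & p:V & (%x. Ps (ph x)) ` V<=N" if "open N" "0:N" for N
  using pre(1)[OF that(1)] that S c by(intro exI[of _ "{x:U. ph x:S & Ps (ph x):N}"]) auto
 have preT: "EX ro>0. ball 0 ro<={y:T. Ph y:N}" if "open N" "ph p:N" for N
 proof -
  have "open (T Int Ph -` N)" by(rule continuous_open_preimage[OF hom(2) S(3) that(1)])
  moreover have "T Int Ph -` N={y:T. Ph y:N}" by auto
  ultimately have "open {y:T. Ph y:N}" by simp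
  thus ?thesis using T0 Ph0 that(2) by(auto elim!:openE)
 qed
 show "EX ro>0. ball 0 ro<=(%x. Ps (ph x)) ` V" if V: "openin X V" "p:V" for V
 proof -
  have "open (ph ` (V Int U))" by(rule F(6)) (use V F(1) in auto)
  then obtain ro where ro: "ro > 0" "ball 0 ro<={y:T. Ph y:ph ` (V Int U)}" using preT[of "ph ` (V Int U)"] V c by blast
  have "z:(%x. Ps (ph x)) ` V" if "z:ball 0 ro" for z
  proof -
   obtain x where "x:V" "Ph z = ph x" "z:T" using ro `z : ball 0 ro` by blast
   thus ?thesis using hom(4)[of z] by(intro image_eqI[of _ _ x]) auto
  qed
  thus ?thesis using ro(1) by blast
 qed
 show "EX V. p:V & holomorphic_fun X A V (%x. g (Ps (ph x)))" if g: "hol g" for g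
 proof -
  obtain ro where ro: "ro > 0" "holomorphic_map (ball 0 ro) g" using g by(rule holE)
  let ?S = "{y:S. Ps y:ball 0 ro}" and ?V = "{x:U. ph x:S & Ps (ph x):ball 0 ro}"
  have gPs: "holomorphic_map ?S (%y. g (Ps y))" by(rule holo_compose(1)[OF _ ro(2)]) (auto intro:holo_subset[OF Ps])
  have "holomorphic_map (ph' ` (?V Int V')) ((%x. g (Ps (ph x))) \<circ> inv_into V' ph')" if c': "(V', ph'):A" for V' ph'
  proof -
   have c'': "is_chart X (V', ph')" using M c' by(auto simp:complex_manifold_def)
   note F' = chart_facts[OF c'']
   have inv: "inv_into V' ph' (ph' x)=x" if "x:V'" for x using F'(3) that by simp
   have "holomorphic_map (ph' ` (?V Int V')) (%z. g (Ps (transition (V', ph') (U, ph) z)))"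
   proof(rule holo_compose(1)[OF _ gPs])
    show "holomorphic_map (ph' ` (?V Int V')) (%z. transition (V', ph') (U, ph) z $ j)" for j
     by(rule holo_subset[OF holo_transition(2)[OF comp[OF c']]]) auto
   qed (auto simp:transition_def inv)
   thus ?thesis by(simp add:transition_def o_def)
  qed
  hence "holomorphic_fun X A ?V (%x. g (Ps (ph x)))" unfolding holomorphic_fun_def using pre(1)[OF open_ball] by blast
  moreover have "p:?V" using c S ro by simp
  ultimately show ?thesis by(intro exI[of _ ?V] conjI)
 qed
 show "EX g V'. hol g & openin X V' & p:V' & V'<=V & (ALL x:V'. f x=g (Ps (ph x)))"
  if f: "holomorphic_fun X A V f" "p:V" for f V
 proof -
  obtain V' ph' where c': "(V', ph'):A" "p:V'" using M p by(fastforce simp:complex_manifold_def)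
  have c'': "is_chart X (V', ph')" using M c' by(auto simp:complex_manifold_def)
  note F' = chart_facts[OF c'']
  have V: "openin X V" and fh: "holomorphic_map (ph' ` (V Int V')) (f \<circ> inv_into V' ph')"
   using f c' by(auto simp:holomorphic_fun_def)
  have o: "open (ph ` (U Int V' Int V))" by(rule F(6)) (use V F(1) F'(1) in auto)
  obtain ro where ro: "ro > 0" "ball 0 ro<={y:T. Ph y:ph ` (U Int V' Int V)}" using preT[OF o] c c' f by blast
  let ?g = "%y. (f \<circ> inv_into V' ph') (transition (U, ph) (V', ph') (Ph y))"
  have inv: "inv_into U ph (ph x)=x" if "x:U" for x using F(3) that by simp
  have 1: "holomorphic_map (ph ` (U Int V' Int V)) (%z. (f \<circ> inv_into V' ph') (transition (U, ph) (V', ph') z))"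
  proof(rule holo_compose(1)[OF _ fh])
   show "holomorphic_map (ph ` (U Int V' Int V)) (%z. transition (U, ph) (V', ph') z $ j)" for j
    by(rule holo_subset[OF holo_transition(1)[OF comp[OF c'(1)]]]) auto
  qed (auto simp:transition_def inv)
  have "holomorphic_map (ball 0 ro) ?g" by(rule holo_compose(1)[OF _ 1]) (insert ro, auto intro!:holo_subset[OF Ph])
  hence "hol ?g" by(rule holI[OF ro(1)])
  moreover have "f x=?g (Ps (ph x))" if "x:U" "x:V'" "ph x:S" for x
   using that F'(3) by(simp add:hom transition_def inv)
  moreover have "openin X ({x:U. ph x:S} Int V' Int V)" using F(5)[OF S(1)] F'(1) V by auto
  ultimately show ?thesis using c c' f S(2) by(intro exI[of _ ?g] exI[of _ "{x:U. ph x:S} Int V' Int V"]) auto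
 qed
qed

text \<open>Some partial derivative of \<open>f\<close> in a chart is nonzero at \<open>p\<close>,
  so \<open>f\<close> minus its value at \<open>p\<close> can be taken as a coordinate.\<close>

lemma smooth_point:
 fixes A :: "('a, 'd::finite) chart set"
 assumes n: "CARD('d)=n + 1" and M: "complex_manifold X A" and f: "holomorphic_fun X A (topspace X) f"
  and sm: "smooth_away_from_0 A f" and p: "p:topspace X" "f p~=0"
 shows "germ_family.graded_decomp (germ_ring X A p) (%c. germ X p (%_. c)) (zero_ideal X A f p) (germ X p f) n al"
proof -
 obtain U ph where c: "(U, ph):A" "p:U" using M p by(fastforce simp:complex_manifold_def)
 have ch: "holomorphic_chart X A (U, ph)" using M c by(auto simp:complex_manifold_def holomorphic_chart_def)
 hence "is_chart X (U, ph)" by(simp add:holomorphic_chart_def)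
 note F = chart_facts[OF this]
 define g where "g=f \<circ> inv_into U ph"
 have inv: "g (ph x)=f x" if "x:U" for x using F(3) that by(simp add:g_def)
 have "topspace X Int U=U" using F(4) by auto
 hence g: "holomorphic_map (ph ` U) g" using f c(1) unfolding holomorphic_fun_def g_def by force
 have pS: "ph p:ph ` U" using c(2) by simp
 interpret L: bounded_linear "fd g (ph p)" by(rule fd_linear[OF g pS])
 obtain v where v: "fd g (ph p) v~=0" using sm c p(2) by(fastforce simp:smooth_away_from_0_def g_def)
 obtain i where i: "fd g (ph p) (axis i 1)~=0"
 proof -
  have "v=(SUM i:UNIV. v $ i *s axis i 1)" by(simp add:vec_eq_iff axis_def if_distrib[of "%y. _ * y"] cong: if_cong)
  hence "fd g (ph p) v=fd g (ph p) (SUM i:UNIV. v $ i *s axis i 1)" by(rule arg_cong)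
  hence s: "fd g (ph p) v=(SUM i:UNIV. v $ i * fd g (ph p) (axis i 1))" by(simp only:L.sum holoD(2)[OF g pS])
  have "EX i. fd g (ph p) (axis i 1)~=0"
  proof(rule ccontr)
   assume "\<nexists>i. fd g (ph p) (axis i 1)~=0"
   thus False using v s by simp
  qed
  thus ?thesis using that by blast
 qed
 define H where "H=(%z. g z + - f p)"
 have H: "holomorphic_map (ph ` U) H" unfolding H_def by(intro holo_add holo_const g)
 have "(H has_derivative fd g (ph p)) (at (ph p))"
  unfolding H_def using has_derivative_add_const[OF holoD(1)[OF g pS]] .
 hence "fd H (ph p)=fd g (ph p)" by(rule frechet_derivative_at[symmetric])
 hence Hi: "fd H (ph p) (axis i 1)~=0" using i by simp
 have H0: "H (ph p)=0" using inv[OF c(2)] by(simp add:H_def)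
 obtain S T Ph where S: "open S" "ph p:S" "open T"
  "homeomorphism S T (%z. \<chi> j. if j=i then H z else z $ j - ph p $ j) Ph"
  "!!j. holomorphic_map S (%z. (\<chi> j. if j=i then H z else z $ j - ph p $ j) $ j)"
  "!!j. holomorphic_map T (%z. Ph z $ j)" by(rule coordinate_change[OF F(2) pS H H0 Hi]) (assumption | rule that)+
 interpret local_coords X A p "%x. \<chi> j. if j=i then H (ph x) else ph x $ j - ph p $ j"
  by(rule chart_local_coords[OF M ch c(2) S(1-4)]) (insert S H0, auto simp:vec_eq_iff)
 show ?thesis by(rule smooth_germ[OF n F(1) c(2), of _ "f p" i]) (insert p(2), simp_all add:H_def inv)
qed

text \<open>A unit near a simple point of a coordinate hyperplane is absorbed into the coordinate by an
  \<open>e\<close>-th root.\<close>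

lemma crossing_point:
 fixes A :: "('a, 'd::finite) chart set"
 assumes n: "CARD('d)=n + 1" and M: "complex_manifold X A" and ch: "holomorphic_chart X A (U, ph)" "p:U"
  and J: "finite J" "J~={}" "inj_on si J" "!!k. k:J ==> ph p $ si k=0" "!!k. k:J ==> 0 < (e k::nat)"
  and u: "holomorphic_fun X A U u" "u p~=0"
  and f: "!!x. x:U ==> f x=u x * (PROD k:J. (ph x $ si k) ^ e k)" and al: "0<=al" "al < 1"
 shows "germ_family.graded_decomp (germ_ring X A p) (%c. germ X p (%_. c)) (zero_ideal X A f p) (germ X p f) n al"
proof -
 define a where "a = ph p"
 \<comment> \<open>A preliminary translated coordinate system, in order to write the unit
   \<open>u\<close> as a function \<open>g\<close> of coordinates near 0.\<close>
 interpret tr: local_coords X A p "%x. ph x - a"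
 proof(rule chart_local_coords[OF M ch, of UNIV UNIV "%z. z - a" "%z. z + a"])
  show "homeomorphism UNIV UNIV (%z. z - a) (%z. z + a)" by(auto simp:homeomorphism_def intro!:continuous_intros)
  show "holomorphic_map UNIV (%z. (z - a) $ j)" "holomorphic_map UNIV (%z. (z + a) $ j)" for j
   using holo_add[OF holo_nth holo_const, of UNIV j "- (a $ j)"]
    holo_add[OF holo_nth holo_const, of UNIV j "a $ j"] by simp_all
 qed (auto simp:a_def)
 obtain g V where g: "hol g" "openin X V" "p:V" "V<=U" "ALL x:V. u x=g (ph x - a)"
  using tr.push[OF u(1) ch(2)] by blast
 have g0: "g 0~=0" using g(3,5) u(2) by(simp add:a_def)
 obtain ro0 where ro0: "ro0 > 0" "holomorphic_map (ball 0 ro0) g" using g(1) by(rule holE)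
 have "isCont g 0" using has_derivative_continuous[OF holoD(1)[OF ro0(2), of 0]] ro0(1) by simp
 hence "(g \<longlongrightarrow> g 0) (nhds 0)" by(simp add:isCont_def tendsto_nhds_iff)
 hence "\<forall>\<^sub>F z in nhds 0. dist (g z) (g 0) < cmod (g 0)" by(rule tendstoD) (use g0 in simp)
 then obtain ro where ro: "ro > 0" "holomorphic_map (ball 0 ro) g" "!!z. z:ball 0 ro ==> dist (g z) (g 0) < cmod (g 0)"
  by(rule hol_common[OF g(1) g(1)]) blast
 obtain k1 where k1: "k1:J" using J(2) by blast
 define i where "i = si k1"
 define d :: complex where "d = of_nat (e k1)"
 have d: "d~=0" using J(5)[OF k1] by(simp add:d_def)
 \<comment> \<open>A root of \<open>g\<close> of order \<open>e k1\<close>. Division by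
   \<open>g 0\<close> brings the argument of \<open>Ln\<close> into the disc of radius 1 about 1,
   off the branch cut; the last factor restores the constant.\<close>
 define rt where "rt=(%z. exp (Ln (1 / g 0 * g z) / d) * exp (Ln (g 0) / d))"
 have np: "1 / g 0 * g z ~: \<real>\<^sub>\<le>\<^sub>0" if "z:ball 0 ro" for z
 proof
  assume "1 / g 0 * g z:\<real>\<^sub>\<le>\<^sub>0"
  then obtain r where r: "1 / g 0 * g z = complex_of_real r" "r<=0" by(auto elim!:nonpos_Reals_cases)
  hence "g z - g 0 = complex_of_real (r - 1) * g 0" using g0 by(simp add:field_simps)
  hence "dist (g z) (g 0)=\<bar>r - 1\<bar> * cmod (g 0)" by(simp only:dist_norm norm_mult norm_of_real)
  thus False using ro(3)[OF that] r(2) g0 by(simp add:mult_less_cancel_right1)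
 qed
 have rt_hol: "holomorphic_map (ball 0 ro) rt" unfolding rt_def
 proof(intro holo_mult holo_const)
  show "holomorphic_map (ball 0 ro) (%z. exp (Ln (1 / g 0 * g z) / d))"
  proof(rule holo_compose1(1)[of _ "%z. 1 / g 0 * g z" "%y. exp (Ln y / d)" "- \<real>\<^sub>\<le>\<^sub>0"])
   show "holomorphic_map (ball 0 ro) (%z. 1 / g 0 * g z)" by(intro holo_mult holo_const ro(2))
   show "(%y. exp (Ln y / d)) holomorphic_on - \<real>\<^sub>\<le>\<^sub>0" using d by(intro holomorphic_intros) auto
  qed (use np in auto)
 qed
 have rt_pow: "rt z ^ e k1=g z" if "z:ball 0 ro" for z
 proof -
  have p: "exp (y / d) ^ e k1=exp y" for y using d by(simp add:exp_of_nat_mult[symmetric] d_def)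
  have "g z~=0" using ro(3)[OF that] by auto
  thus ?thesis using g0 by(simp add:rt_def power_mult_distrib p)
 qed
 have rt0: "rt 0~=0" by(simp add:rt_def)
 \<comment> \<open>The new \<open>i\<close>-th coordinate. As \<open>a $ i = 0\<close>, its
   derivative at \<open>a\<close> in the \<open>i\<close>-th direction is \<open>rt 0\<close>, which
   is nonzero.\<close>
 define H where "H=(%z. z $ i * rt (z - a))"
 have rta: "holomorphic_map (ball a ro) (%z. rt (z - a))"
 proof(rule holo_compose(1)[OF _ rt_hol])
  show "holomorphic_map (ball a ro) (%z. (z - a) $ j)" for j
   using holo_add[OF holo_nth holo_const, of _ j "- (a $ j)"] by simp
 qed (auto simp:dist_norm norm_minus_commute)
 have ai: "a $ i=0" using J(4)[OF k1] by(simp add:a_def i_def)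
 have H: "holomorphic_map (ball a ro) H" unfolding H_def by(intro holo_mult holo_nth rta)
 have aS: "a:ball a ro" using ro(1) by simp
 have "(H has_derivative (%v. a $ i * fd (%z. rt (z - a)) a v + v $ i * rt (a - a))) (at a)" unfolding H_def
  by(rule has_derivative_mult[OF bounded_linear_imp_has_derivative[OF bounded_linear_nth] holoD(1)[OF rta aS]])
 hence "(%v. a $ i * fd (%z. rt (z - a)) a v + v $ i * rt (a - a))=fd H a" by(rule frechet_derivative_at)
 from fun_cong[OF this, of "axis i 1"]
 have Hi: "fd H a (axis i 1)~=0" using rt0 ai by simp
 have H0: "H a=0" by(simp add:H_def ai)
 obtain S T Ph where S: "open S" "a:S" "open T"
  "homeomorphism S T (%z. \<chi> j. if j=i then H z else z $ j - a $ j) Ph"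
  "!!j. holomorphic_map S (%z. (\<chi> j. if j=i then H z else z $ j - a $ j) $ j)"
  "!!j. holomorphic_map T (%z. Ph z $ j)"
  by(rule coordinate_change[OF open_ball aS H H0 Hi]) (assumption | rule that)+
 interpret local_coords X A p "%x. \<chi> j. if j=i then H (ph x) else ph x $ j - a $ j"
  by(rule chart_local_coords[OF M ch S(1) _ S(3,4)]) (insert S H0, auto simp:vec_eq_iff a_def)
 have "openin X {x:U. ph x:ball a ro}"
  by(rule chart_facts(5)[OF _ open_ball]) (insert ch(1), simp add:holomorphic_chart_def)
 hence W: "openin X ({x:U. ph x:ball a ro} Int V)" using g(2) by blast
 show ?thesis
 proof(rule crossing_germ[OF n W, where K = "si ` J" and e = "%k. e (inv_into J si k)"])
  fix x assume "x:{x:U. ph x:ball a ro} Int V"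
  hence x: "x:U" "ph x - a:ball 0 ro" "x:V" by(auto simp:dist_norm norm_minus_commute)
  let ?w = "\<chi> j. if j=i then H (ph x) else ph x $ j - a $ j"
  have "(PROD k:si ` J. ?w $ k ^ e (inv_into J si k))=(PROD k:J. ?w $ si k ^ e k)"
   using J(3) by(simp add:prod.reindex)
  also have "... = (PROD k:J. (if k=k1 then g (ph x - a) else 1) * (ph x $ si k) ^ e k)"
  proof(rule prod.cong)
   fix k assume k: "k:J"
   have "si k=i <-> k=k1" using J(3) k k1 by(auto simp:i_def inj_on_def)
   moreover have "a $ si k=0" using J(4)[OF k] by(simp add:a_def)
   ultimately show "?w $ si k ^ e k=(if k=k1 then g (ph x - a) else 1) * (ph x $ si k) ^ e k"
    using rt_pow[OF x(2)] by(auto simp:H_def power_mult_distrib)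
  qed simp
  also have "... = u x * (PROD k:J. (ph x $ si k) ^ e k)" using k1 J(1) g(5) x(3) by(simp add:prod.distrib prod.delta)
  finally show "f x=(PROD k:si ` J. ?w $ k ^ e (inv_into J si k))" using f[OF x(1)] by simp
 next
  show "0 < e (inv_into J si k)" if "k:si ` J" for k using that by(intro J(5)) (rule inv_into_into)
 qed (insert ch(2) g(3) ro(1) J(2) al, auto simp:a_def)
qed

theorem corollary7p8:
  fixes X :: "'a topology" and A :: "('a, 'd::finite) chart set"
    and f :: "'a \<Rightarrow> complex" and n :: nat and \<alpha> :: real
  assumes "CARD('d) = n + 1"
    and "kaehler_manifold X A"
    and "holomorphic_fun X A (topspace X) f"
    and "f ` topspace X = ball 0 1"
    and "proper_map X (top_of_set (ball 0 1)) f"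
    and "smooth_away_from_0 A f"
    and "snc_central_fiber X A f"
    and "0 \<le> \<alpha>" and "\<alpha> < 1" and "\<alpha> \<in> \<rat>"
  shows "\<forall>p\<in>topspace X.
    let V = M_stalk X A f n \<alpha> p; F = F_stalk X A f n \<alpha> p;
        N = R_stalk X A f n \<alpha> p; W = W_stalk X A f n \<alpha> p
    in (\<forall>(r::nat) (l::int). gr_pow V N W (int r) r \<in>
          iso ((add_monoid (gr V W (int r)))\<lparr>carrier := F_gr V F W l (int r)\<rparr>)
              ((add_monoid (gr V W (- int r)))\<lparr>carrier := F_gr V F W (l + int r) (- int r)\<rparr>)) \<and>
       (\<forall>(r::int) (m::int).
          internal_direct_sum (gr V W r) {l::nat. - real_of_int r / 2 \<le> real l}
            (lefschetz_summand V N F W m r) (F_gr V F W m r))"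
proof -
 have M: "complex_manifold X A" using assms(2) by(simp add:kaehler_manifold_def)
 obtain I Y e where snc: "finite (I::nat set)" "ALL i:I. closedin X (Y i) & connectedin X (Y i) & Y i~={} & 0 < (e i::nat)"
  "ALL p:topspace X. EX U ph si u. holomorphic_chart X A (U, ph) & p:U & inj_on si {i:I. p:Y i} & (ALL i:I. U Int Y
   i=(if p:Y i then {x:U. ph x $ si i=0} else {})) & holomorphic_fun X A U u & (ALL x:U. u x~=0) & (ALL x:U. f x=u x
   * (PROD i:{i:I. p:Y i}. (ph x $ si i) ^ e i))"
  using assms(7) unfolding snc_central_fiber_def by(elim exE conjE) (rule that)
 have "germ_family.graded_decomp (germ_ring X A p) (%c. germ X p (%_. c)) (zero_ideal X A f p) (germ X p f) n \<alpha>"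
  if p: "p:topspace X" for p
 proof -
  let ?J = "{i:I. p:Y i}"
  obtain U ph si u where c: "holomorphic_chart X A (U, ph)" "p:U" "inj_on si ?J"
   "ALL i:I. U Int Y i=(if p:Y i then {x:U. ph x $ si i=0} else {})" "holomorphic_fun X A U u" "ALL x:U. u x~=0"
   "ALL x:U. f x=u x * (PROD i:?J. (ph x $ si i) ^ e i)" using bspec[OF snc(3) p] by(elim exE conjE) (rule that)
  show ?thesis
  \<comment> \<open>If no component passes through \<open>p\<close>, the product is empty and
    \<open>f p\<close> is the value of the unit \<open>u\<close>.\<close>
  proof(cases "?J={}")
   case True
   have "f p=u p * (PROD i:?J. (ph p $ si i) ^ e i)" using c(2,7) by blast
   hence "f p~=0" using c(2,6) unfolding True by simp
   thus ?thesis by(rule smooth_point[OF assms(1) M assms(3,6) p])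
  next
   case False
   show ?thesis
   proof(rule crossing_point[OF assms(1) M c(1,2) _ False c(3) _ _ c(5)])
    show "ph p $ si i=0" if "i:?J" for i using bspec[OF c(4), of i] that c(2) by auto
    show "f x=u x * (PROD i:?J. (ph x $ si i) ^ e i)" if "x:U" for x using c(7) that by blast
   qed (use snc(1,2) c(2,6) assms(8,9) in auto)
  qed
 qed
 thus ?thesis by(simp add:germ_family.graded_decomp_def Let_def M_stalk_def F_stalk_def R_stalk_def W_stalk_def)
qed

end
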